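(* Let $H$ be a translation-invariant measurable real-valued function defined on all finite $\mathcal{X}^*\subset\mathbb{R}^d\times\mathcal{M}$. Suppose that either (i) $H$ has finite range interactions and $h_{H(\mathcal{Z}_n^* )}<\infty$ for some $n\in\mathbb{N}$, or (ii) for some $\kappa\in\mathbb{N}$, $H=H^{(\xi)}$ is induced by a translation-invariant functional $\xi(\mathbf{x};\mathcal{X}^* )$ which depends only on the $\kappa$ nearest neighbours, and $h_{H(\mathcal{Z}_n^* )}<\infty$ for some $n\in\mathbb{N}$ with $n>\kappa$. Suppose also that $H_n(\mathcal{X}_n^* )$ and $H(\mathcal{U}_{n,K}^* )$ are integrable for all $n\in\mathbb{N}$ and $K>0$. Finally suppose that, for some $\sigma\in[0,\infty)$, $n^{-1/2}(H_n(\mathcal{X}_n^* )-\mathbb{E}H_n(\mathcal{X}_n^* ))$ converges in distribution to $\mathcal{N}(0,\sigma^2)$ as $n\to\infty$. Then $\sigma>0$ and $h(H)<\infty$, and for any $b\in(0,\infty)$ with $h(H)\,|\,b$, $$\sup_{u\in\mathbb{R}}\left|n^{1/2}P[H_n(\mathcal{X}_n^* )\in[u,u+b)]-\sigma^{-1}b\,\phi\!\left(\frac{u-\mathbb{E}H_n(\mathcal{X}_n^* )}{n^{1/2}\sigma}\right)\right|\to0\quad\text{as }n\to\infty.$$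
   Context: Spans: a real random variable $X$ is lattice if there exists $h>0$ with $(X-a)/h\in\mathbb{Z}$ almost surely for some $a\in\mathbb{R}$. The span $h_X$ is the largest such $h$ if $X$ is lattice and non-degenerate, $h_X:=0$ if $X$ is non-lattice, and $h_X:=+\infty$ if $\mathrm{Var}[X]=0$. For $a\ge0,b>0$ real, $a\,|\,b$ means that $b$ is an integer multiple of $a$ or $a=0$; $+\infty\,|\,b$ does not hold for $b<\infty$. Marked points: $\mathcal{M}$ is an arbitrary measurable space (mark space) and $\mathbb{P}_{\mathcal{M}}$ a probability distribution on $\mathcal{M}$. For $\mathbf{x}=(x,t)\in\mathbb{R}^d\times\mathcal{M}$, $y\in\mathbb{R}^d$, $a\in\mathbb{R}$: $y+\mathbf{x}:=(y+x,t)$ and $a\mathbf{x}:=(ax,t)$; for $\mathcal{X}^*\subset\mathbb{R}^d\times\mathcal{M}$, $y+a\mathcal{X}^*:=\{y+a\mathbf{x}:\mathbf{x}\in\mathcal{X}^*\}$. $B(x;r)$ is the closed Euclidean ball, $B(r):=B(0;r)$, $B^*(x;r):=B(x;r)\times\mathcal{M}$. For nonempty $\mathcal{X}^*,\mathcal{Y}^*$, $D(\mathcal{X}^*,\mathcal{Y}^* ):=\inf\{|x-y|:(x,t)\in\mathcal{X}^*,(y,u)\in\mathcal{Y}^*\text{ for some }t,u\in\mathcal{M}\}$. Functionals: $H$ is translation invariant if $H(y+\mathcal{X}^* )=H(\mathcal{X}^* )$ for all $y\in\mathbb{R}^d$ and all $\mathcal{X}^*$. $H$ has finite range interactions if there is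 $\tau\in(0,\infty)$ with $H(\mathcal{X}^*\cup\mathcal{Y}^* )=H(\mathcal{X}^* )+H(\mathcal{Y}^* )$ whenever $D(\mathcal{X}^*,\mathcal{Y}^* )>\tau$. A translation-invariant functional $\xi$ is a measurable real-valued function $\xi(\mathbf{x};\mathcal{X}^* )$ defined for finite $\mathcal{X}^*\subset\mathbb{R}^d\times\mathcal{M}$ and $\mathbf{x}\in\mathcal{X}^*$, with $\xi(y+\mathbf{x};y+\mathcal{X}^* )=\xi(\mathbf{x};\mathcal{X}^* )$ for all $y\in\mathbb{R}^d$; it induces $H^{(\xi)}(\mathcal{X}^* ):=\sum_{\mathbf{x}\in\mathcal{X}^*}\xi(\mathbf{x};\mathcal{X}^* )$. For $\mathbf{x}=(x,t)\in\mathcal{X}^*$, $R_\kappa(\mathbf{x};\mathcal{X}^* )$ is the smallest $r\ge0$ such that $\mathcal{X}^*\cap B^*(x;r)$ has at least $\kappa$ elements other than $\mathbf{x}$, and is $\infty$ if $\mathcal{X}^*$ has $\kappa$ or fewer elements. $\xi$ depends only on the $\kappa$ nearest neighbours if $\xi(\mathbf{x};\mathcal{X}^* )=\xi(\mathbf{x};\mathcal{X}^*\cap B^*(x;R_\kappa(\mathbf{x};\mathcal{X}^* )))$ for all $\mathbf{x}=(x,t)$ and $\mathcal{X}^*$. Point processes: $X_1,X_2,\ldots$ are i.i.d. random vectors in $\mathbb{R}^d$ with common density $f$, where $\sup f<\infty$ and $f$ is Lebesgue-almost everywhere continuous. $T_1,T_2,\ldots$ are independent with distribution $\mathbb{P}_{\mathcal{M}}$,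 independent of everything else. $\mathcal{X}_n^*:=\{(X_1,T_1),\ldots,(X_n,T_n)\}$. $(r_n)_{n\ge1}$ is a sequence of positive constants such that $\rho:=\lim_{n\to\infty}nr_n^d$ exists with $0<\rho<\infty$, and $H_n(\mathcal{X}^* ):=H(r_n^{-1}\mathcal{X}^* )$. $\mathcal{U}_{n,K}^*:=\{(U_{1,K},T_1),\ldots,(U_{n,K},T_n)\}$ with $U_{i,K}$ independent uniform in $B(K)$; $\mathcal{Z}_n^*:=\{(Z_1,T_1),\ldots,(Z_n,T_n)\}$ with $Z_i$ independent standard $d$-dimensional normal. The limiting span is $h(H):=\liminf_{n\to\infty}h_{H(\mathcal{Z}_n^* )}$. $\phi(x)=(2\pi)^{-1/2}e^{-x^2/2}$. *)

theory Defs
  imports "HOL-Probability.Probability"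
begin

definition has_lattice_span :: "'w measure \<Rightarrow> ('w \<Rightarrow> real) \<Rightarrow> real \<Rightarrow> bool" where
  "has_lattice_span P Y h \<longleftrightarrow> h > 0 \<and> (\<exists>a::real. AE \<omega> in P. (Y \<omega> - a) / h \<in> \<int>)"

definition lattice_rv :: "'w measure \<Rightarrow> ('w \<Rightarrow> real) \<Rightarrow> bool" where
  "lattice_rv P Y \<longleftrightarrow> (\<exists>h. has_lattice_span P Y h)"

text \<open>Zero variance is rendered as almost sure constancy: \<open>Y\<close> need not be
  integrable, and the library's variance of a non-integrable variable carries no information.\<close>

definition degenerate_rv :: "'w measure \<Rightarrow> ('w \<Rightarrow> real) \<Rightarrow> bool" where
  "degenerate_rv P Y \<longleftrightarrow> (\<exists>c::real. AE \<omega> in P. Y \<omega> = c)"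

text \<open>For a non-degenerate lattice variable the set of admissible \<open>h\<close> has a greatest
  element, so \<open>Greatest\<close> is meaningful here.\<close>

definition rv_span :: "'w measure \<Rightarrow> ('w \<Rightarrow> real) \<Rightarrow> ereal" where
  "rv_span P Y =
     (if degenerate_rv P Y then \<infinity>
      else if lattice_rv P Y then ereal (GREATEST h. has_lattice_span P Y h)
      else 0)"

definition span_dvd :: "ereal \<Rightarrow> real \<Rightarrow> bool" where
  "span_dvd a b \<longleftrightarrow> a = 0 \<or> (\<exists>a'. a = ereal a' \<and> (\<exists>k::int. b = of_int k * a'))"

text \<open>The measurable space of finite subsets of a measurable space \<open>E\<close>, with the \<open>\<sigma>\<close>-algebra
  generated by the counting maps \<open>X \<mapsto> card (X \<inter> A)\<close>, \<open>A\<close> measurable.\<close>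

definition finite_subsets :: "'e measure \<Rightarrow> 'e set set" where
  "finite_subsets E = {X. finite X \<and> X \<subseteq> space E}"

definition finite_config :: "'e measure \<Rightarrow> 'e set measure" where
  "finite_config E = sigma (finite_subsets E)
     {{X \<in> finite_subsets E. card (X \<inter> A) = k} | A k. A \<in> sets E}"

text \<open>Throughout, the mark space is the measurable space underlying the mark distribution \<open>Q\<close>.\<close>

abbreviation marked_space :: "'m measure \<Rightarrow> ((real^'d) \<times> 'm) measure" where
  "marked_space Q \<equiv> borel \<Otimes>\<^sub>M Q"

abbreviation configs :: "'m measure \<Rightarrow> ((real^'d) \<times> 'm) set set" where
  "configs Q \<equiv> finite_subsets (marked_space Q)"

definition translate_pt :: "real^'d \<Rightarrow> (real^'d) \<times> 'm \<Rightarrow> (real^'d) \<times> 'm" where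
  "translate_pt y p = (y + fst p, snd p)"

definition scale_pt :: "real \<Rightarrow> (real^'d) \<times> 'm \<Rightarrow> (real^'d) \<times> 'm" where
  "scale_pt a p = (a *\<^sub>R fst p, snd p)"

definition marked_ball :: "'m measure \<Rightarrow> real^'d \<Rightarrow> ereal \<Rightarrow> ((real^'d) \<times> 'm) set" where
  "marked_ball Q x r = {y. ereal (dist x y) \<le> r} \<times> space Q"

definition marked_dist :: "((real^'d) \<times> 'm) set \<Rightarrow> ((real^'d) \<times> 'm) set \<Rightarrow> real" where
  "marked_dist X Y = setdist (fst ` X) (fst ` Y)"

definition translation_invariant ::
    "'m measure \<Rightarrow> (((real^'d) \<times> 'm) set \<Rightarrow> real) \<Rightarrow> bool" where
  "translation_invariant Q H \<longleftrightarrow>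
     (\<forall>y. \<forall>X \<in> configs Q. H (translate_pt y ` X) = H X)"

definition finite_range_interactions ::
    "'m measure \<Rightarrow> (((real^'d) \<times> 'm) set \<Rightarrow> real) \<Rightarrow> bool" where
  "finite_range_interactions Q H \<longleftrightarrow>
     (\<exists>\<tau>>0. \<forall>X \<in> configs Q. \<forall>Y \<in> configs Q.
        X \<noteq> {} \<and> Y \<noteq> {} \<and> marked_dist X Y > \<tau> \<longrightarrow> H (X \<union> Y) = H X + H Y)"

definition translation_invariant_functional ::
    "'m measure \<Rightarrow> ((real^'d) \<times> 'm \<Rightarrow> ((real^'d) \<times> 'm) set \<Rightarrow> real) \<Rightarrow> bool" where
  "translation_invariant_functional Q \<xi> \<longleftrightarrow>
     (\<lambda>(p, X). \<xi> p X) \<in> borel_measurable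
        (restrict_space (marked_space Q \<Otimes>\<^sub>M finite_config (marked_space Q)) {(p, X). p \<in> X}) \<and>
     (\<forall>y. \<forall>X \<in> configs Q. \<forall>p \<in> X. \<xi> (translate_pt y p) (translate_pt y ` X) = \<xi> p X)"

definition induced_functional ::
    "((real^'d) \<times> 'm \<Rightarrow> ((real^'d) \<times> 'm) set \<Rightarrow> real) \<Rightarrow> ((real^'d) \<times> 'm) set \<Rightarrow> real" where
  "induced_functional \<xi> X = (\<Sum>p\<in>X. \<xi> p X)"

definition nn_radius ::
    "'m measure \<Rightarrow> nat \<Rightarrow> (real^'d) \<times> 'm \<Rightarrow> ((real^'d) \<times> 'm) set \<Rightarrow> ereal" where
  "nn_radius Q \<kappa> p X =
     (if card X \<le> \<kappa> then \<infinity>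
      else ereal (LEAST r. 0 \<le> r \<and> \<kappa> \<le> card ((X \<inter> marked_ball Q (fst p) (ereal r)) - {p})))"

definition depends_on_nearest_neighbours ::
    "'m measure \<Rightarrow> nat \<Rightarrow> ((real^'d) \<times> 'm \<Rightarrow> ((real^'d) \<times> 'm) set \<Rightarrow> real) \<Rightarrow> bool" where
  "depends_on_nearest_neighbours Q \<kappa> \<xi> \<longleftrightarrow>
     (\<forall>X \<in> configs Q. \<forall>p \<in> X.
        \<xi> p X = \<xi> p (X \<inter> marked_ball Q (fst p) (nn_radius Q \<kappa> p X)))"

definition marked_sample ::
    "(nat \<Rightarrow> 'w \<Rightarrow> real^'d) \<Rightarrow> (nat \<Rightarrow> 'w \<Rightarrow> 'm) \<Rightarrow> nat \<Rightarrow> 'w \<Rightarrow> ((real^'d) \<times> 'm) set" where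
  "marked_sample X T n \<omega> = (\<lambda>i. (X i \<omega>, T i \<omega>)) ` {1..n}"

text \<open>The locations \<open>X\<^sub>1, X\<^sub>2, \<dots>\<close> have law \<open>\<mu>\<close>, the marks \<open>T\<^sub>1, T\<^sub>2, \<dots>\<close> have law \<open>Q\<close>, and all of
  these variables are mutually independent; this is expressed by saying that the pairs are
  independent with law \<open>\<mu> \<Otimes>\<^sub>M Q\<close>.\<close>

definition iid_marked ::
    "'w measure \<Rightarrow> (real^'d) measure \<Rightarrow> 'm measure \<Rightarrow>
     (nat \<Rightarrow> 'w \<Rightarrow> real^'d) \<Rightarrow> (nat \<Rightarrow> 'w \<Rightarrow> 'm) \<Rightarrow> bool" where
  "iid_marked P \<mu> Q X T \<longleftrightarrow>
     prob_space.indep_vars P (\<lambda>_. marked_space Q) (\<lambda>i \<omega>. (X i \<omega>, T i \<omega>)) {1..} \<and>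
     (\<forall>i\<ge>1. distr P (marked_space Q) (\<lambda>\<omega>. (X i \<omega>, T i \<omega>)) = \<mu> \<Otimes>\<^sub>M Q)"

definition std_normal_vec :: "(real^'d) measure" where
  "std_normal_vec = density lborel (\<lambda>z. ennreal (\<Prod>i\<in>UNIV. std_normal_density (z $ i)))"

text \<open>The normal law with mean \<open>0\<close> and standard deviation \<open>\<sigma> \<ge> 0\<close>, including the
  degenerate case \<open>\<sigma> = 0\<close>, which \<open>normal_density\<close> does not cover.\<close>

definition centred_normal :: "real \<Rightarrow> real measure" where
  "centred_normal \<sigma> =
     (if \<sigma> = 0 then return borel 0 else density lborel (\<lambda>x. ennreal (normal_density 0 \<sigma> x)))"

definition limiting_span ::
    "'w measure \<Rightarrow> (((real^'d) \<times> 'm) set \<Rightarrow> real) \<Rightarrow>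
     (nat \<Rightarrow> 'w \<Rightarrow> real^'d) \<Rightarrow> (nat \<Rightarrow> 'w \<Rightarrow> 'm) \<Rightarrow> ereal" where
  "limiting_span P H Z T = liminf (\<lambda>n. rv_span P (\<lambda>\<omega>. H (marked_sample Z T n \<omega>)))"

definition rescaled ::
    "(nat \<Rightarrow> real) \<Rightarrow> (((real^'d) \<times> 'm) set \<Rightarrow> real) \<Rightarrow> nat \<Rightarrow> ((real^'d) \<times> 'm) set \<Rightarrow> real" where
  "rescaled r H n X = H (scale_pt (inverse (r n)) ` X)"

end

theory Submission
  imports Defs "HOL-Real_Asymp.Real_Asymp"
begin

text \<open>
  The functional of a large sample contains many independent random contributions that do not
  interact with the rest of the sample, and these alone force the characteristic function to be
  small away from the origin. Combined with the assumed central limit theorem, which controls the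
  characteristic function near the origin, Fourier inversion gives the local limit theorem.

  \<^bold>\<open>Isolated boxes.\<close> Rescale the sample so that there are of order one points per unit volume. A
  continuity point of \<open>f\<close> with \<open>f > 0\<close> has a neighbourhood which, after rescaling, contains of order
  \<open>n\<close> well separated centres \<open>y\<close>. Call the box around \<open>y\<close> good if exactly \<open>m\<close> points lie within distance
  \<open>K\<close> of \<open>y\<close> and the only other points within distance \<open>A\<close> are guards near prescribed positions
  \<open>y + g\<close>. For a functional of finite range no guards are needed, only an empty shell. For
  \<open>\<kappa>\<close> nearest neighbours, rays of \<open>\<kappa> + 1\<close> guards in a finite net of directions ensure that no outside
  point looks into the box, while \<open>m > \<kappa>\<close> ensures that no inside point looks out of it. In both cases
  (\<open>finite_range_isolation\<close>, \<open>nearest_neighbour_isolation\<close>) \<open>H\<close> of the sample is \<open>H\<close> of the block in the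
  box plus \<open>H\<close> of the rest.

  \<^bold>\<open>Decay of the characteristic function.\<close> Condition on the discrete information of which points fall
  into which regions (\<open>char_bound_good_boxes\<close>). The blocks of the good boxes are then independent, and
  each contributes a factor at most \<open>exp (- c \<theta>\<^sup>2)\<close> as long as \<open>H\<close> of a block of \<open>m\<close> points has no span
  of the form \<open>2 \<pi> / t\<close> with \<open>0 < t \<le> \<bar>\<theta>\<bar>\<close> (\<open>separated_pairs_lower_bound\<close>, \<open>block_char_bound\<close>); Gaussian
  points serve as reference law for a block. Each box is good with probability bounded below, and
  by a bounded-difference variance estimate the number of good boxes is of order \<open>n\<close> outside an event
  of probability \<open>O(1/n)\<close>. Hence (\<open>sample_char_bound\<close>) the characteristic function is at most
  \<open>B/n + exp (- c n \<theta>\<^sup>2)\<close> for \<open>\<bar>\<theta>\<bar> \<le> T\<close>. The error \<open>B/n\<close> is harmless, since it is integrated over a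
  range of length of order \<open>sqrt n\<close>.

  \<^bold>\<open>Spans.\<close> If \<open>h\<close> is a span for \<open>n\<close> Gaussian points, then conditioning on the positions of all but \<open>k\<close>
  points makes it a span for \<open>k\<close> points conditioned to lie in a fixed ball (\<open>span_transfer\<close>). Therefore
  all large \<open>n\<close> have spans dividing one common number \<open>d \<noteq> 0\<close>, so that the spans lie in \<open>0\<close> together
  with the values \<open>\<bar>d\<bar>/k\<close>. Thus the limiting span is finite, and it is either attained by
  some large \<open>m\<close>, or zero with arbitrarily small spans for suitable \<open>m\<close>; that \<open>m\<close> is the block size.

  \<^bold>\<open>Conclusion.\<close> Evaluating the bound at \<open>\<theta> = 1 / sqrt n\<close> shows that the Gaussian limit is not
  degenerate, so \<open>\<sigma> > 0\<close>. If the limiting span is \<open>0\<close>, the bound holds for every \<open>T\<close>, and smoothing with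
  the Fejer kernel gives the result (\<open>nonlattice_llt\<close>). If it is \<open>a > 0\<close>, the sample itself need not be
  a lattice variable. Then the bound is applied not to characters but to \<open>exp (i s \<lfloor>(x - u) / a\<rfloor>)\<close>, which
  still splits off block contributions lying in a coset of \<open>a \<int>\<close>, and the probability that the
  floor vanishes is recovered by inversion over \<open>\<bar>s\<bar> \<le> \<pi>\<close> (\<open>lattice_llt\<close>).
\<close>

section \<open>Local limit theorems from bounds on characteristic functions\<close>

text \<open>The common end of both inversion arguments. The integrands \<open>D n\<close> live on windows that grow like
  \<open>sqrt n\<close>. A dominated part is handled by dominated convergence, and the part \<open>q n\<close> that decays in \<open>n\<close>
  only costs \<open>q n\<close> times the length of the window.\<close>

lemma local_error_vanishes:
  fixes D :: "nat \<Rightarrow> real \<Rightarrow> real" and E :: "real \<Rightarrow> real" and q :: "nat \<Rightarrow> real"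
  assumes meas[measurable]: "\<And>n. D n \<in> borel_measurable borel"
    and nonneg: "\<And>n w. 0 \<le> D n w"
    and lim: "\<And>w. (\<lambda>n. D n w) \<longlonglongrightarrow> 0"
    and bound: "\<forall>\<^sub>F n in sequentially. \<forall>w. \<bar>w\<bar> \<le> T * sqrt (real n) \<longrightarrow> D n w \<le> q n + E w"
    and E: "integrable lborel E" "\<And>w. 0 \<le> E w"
    and q: "(\<lambda>n. sqrt (real n) * q n) \<longlonglongrightarrow> 0" "\<And>n. 0 \<le> q n"
    and T: "0 \<le> T"
  shows "(\<lambda>n. \<integral>w. indicator {-(T * sqrt (real n))..T * sqrt (real n)} w * D n w \<partial>lborel) \<longlonglongrightarrow> 0"
proof -
  define I where "I n = {-(T * sqrt (real n))..T * sqrt (real n)}" for n :: nat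
  have I[measurable]: "I n \<in> sets borel" for n by (simp add: I_def)
  define R where "R n w = indicator (I n) w * max 0 (D n w - q n)" for n w
  have Rm[measurable]: "R n \<in> borel_measurable borel" for n unfolding R_def by measurable
  have Rlim: "(\<lambda>n. R n w) \<longlonglongrightarrow> 0" for w
  proof (rule tendsto_sandwich[OF _ _ tendsto_const lim])
    show "\<forall>\<^sub>F n in sequentially. 0 \<le> R n w" by (auto simp: R_def)
    show "\<forall>\<^sub>F n in sequentially. R n w \<le> D n w"
      using q(2) nonneg by (intro always_eventually) (auto simp: R_def indicator_def max_def)
  qed
  obtain N where N: "\<And>n w. N \<le> n \<Longrightarrow> \<bar>w\<bar> \<le> T * sqrt (real n) \<Longrightarrow> D n w \<le> q n + E w"
    using bound by (auto simp: eventually_sequentially)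
  have Rb: "norm (R n w) \<le> E w" if "N \<le> n" for n w
  proof (cases "w \<in> I n")
    case True
    then have "\<bar>w\<bar> \<le> T * sqrt (real n)" by (auto simp: I_def)
    from N[OF that this] True E(2)[of w] show ?thesis by (simp add: R_def)
  qed (use E(2) in \<open>simp add: R_def\<close>)
  have "(\<lambda>n. \<integral>w. R (n + N) w \<partial>lborel) \<longlonglongrightarrow> (\<integral>w. 0 \<partial>(lborel :: real measure))"
    by (rule integral_dominated_convergence[where w=E])
       (use Rb E in \<open>auto intro!: LIMSEQ_ignore_initial_segment Rlim\<close>)
  then have L1: "(\<lambda>n. \<integral>w. R n w \<partial>lborel) \<longlonglongrightarrow> (\<integral>w. 0 \<partial>(lborel :: real measure))"
    by (rule LIMSEQ_offset)
  have Rint: "\<forall>\<^sub>F n in sequentially. integrable lborel (R n)"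
    by (intro eventually_sequentiallyI[of N] Bochner_Integration.integrable_bound[OF E(1)])
       (use Rb E in \<open>auto intro: order_trans\<close>)
  have up: "\<forall>\<^sub>F n in sequentially. (\<integral>w. indicator (I n) w * D n w \<partial>lborel)
      \<le> 2 * T * (sqrt (real n) * q n) + (\<integral>w. R n w \<partial>lborel)"
    using Rint
  proof eventually_elim
    case (elim n)
    have i1: "integrable lborel (\<lambda>w. indicator (I n) w * q n)"
      unfolding I_def
      by (intro integrable_mult_left integrable_real_indicator) (auto simp: emeasure_lborel_Icc_eq)
    have m: "measure lborel (I n) = 2 * (T * sqrt (real n))"
      unfolding I_def using T by (subst measure_lborel_Icc) auto
    have "(\<integral>w. indicator (I n) w * D n w \<partial>lborel) \<le> (\<integral>w. indicator (I n) w * q n + R n w \<partial>lborel)"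
      by (rule integral_mono'[OF Bochner_Integration.integrable_add[OF i1 elim]])
         (auto simp: R_def nonneg q indicator_def)
    also have "\<dots> = 2 * T * (sqrt (real n) * q n) + (\<integral>w. R n w \<partial>lborel)"
      by (subst Bochner_Integration.integral_add[OF i1 elim]) (simp add: m)
    finally show ?case .
  qed
  have lim2: "(\<lambda>n. 2 * T * (sqrt (real n) * q n) + (\<integral>w. R n w \<partial>lborel)) \<longlonglongrightarrow> 2 * T * 0 + (\<integral>w. 0 \<partial>(lborel :: real measure))"
    by (intro tendsto_intros q L1)
  show ?thesis
    unfolding I_def[symmetric]
    by (rule tendsto_sandwich[OF _ up tendsto_const])
       (use lim2 in \<open>auto intro!: always_eventually Bochner_Integration.integral_nonneg simp: nonneg\<close>)
qed

lemma gaussian_fourier: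
  assumes "0 < (\<sigma>::real)"
  shows "integrable lborel (\<lambda>w. exp (- (\<sigma> * w)\<^sup>2 / 2))"
    and "(\<integral>w. cos (w * x) * exp (- (\<sigma> * w)\<^sup>2 / 2) \<partial>lborel) = 2 * pi / \<sigma> * std_normal_density (x / \<sigma>)"
proof -
  have e: "std_normal_density w = 1 / sqrt (2*pi) * exp (- w\<^sup>2 / 2)" for w
    by (simp add: std_normal_density_def)
  have i0: "integrable lborel (\<lambda>w. sqrt (2*pi) * std_normal_density w)" by simp
  then have i0: "integrable lborel (\<lambda>w::real. exp (- w\<^sup>2 / 2))" by (simp add: e)
  from lborel_integrable_real_affine[OF this, of \<sigma> 0] assms
  show "integrable lborel (\<lambda>w. exp (- (\<sigma> * w)\<^sup>2 / 2))" by simp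
  have c: "(\<integral>u. std_normal_density u * cos (t * u) \<partial>lborel) = exp (- t\<^sup>2 / 2)" for t
  proof -
    have int: "integrable lborel (\<lambda>u. std_normal_density u *\<^sub>R iexp (t * u))"
      by (rule Bochner_Integration.integrable_bound[OF integrable_normal_density[of 1 0]]) auto
    have "char std_normal_distribution t = (CLINT u|lborel. std_normal_density u *\<^sub>R iexp (t * u))"
      unfolding char_def by (subst integral_density) auto
    then have "(CLINT u|lborel. std_normal_density u *\<^sub>R iexp (t * u)) = complex_of_real (exp (- t\<^sup>2 / 2))"
      unfolding char_std_normal_distribution by (rule sym)
    then have "Re (CLINT u|lborel. std_normal_density u *\<^sub>R iexp (t * u)) = exp (- t\<^sup>2 / 2)"
      by (metis Re_complex_of_real)
    then show ?thesis
      by (subst (asm) integral_Re[OF int, symmetric]) (simp add: Re_exp)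
  qed
  have "(\<integral>w. cos (w * x) * exp (- (\<sigma> * w)\<^sup>2 / 2) \<partial>lborel)
      = (1/\<sigma>) * (\<integral>u. cos (u / \<sigma> * x) * exp (- u\<^sup>2 / 2) \<partial>lborel)"
    by (subst lborel_integral_real_affine[where c="1/\<sigma>" and t=0]) (use assms in simp_all)
  also have "(\<integral>u. cos (u / \<sigma> * x) * exp (- u\<^sup>2 / 2) \<partial>lborel)
     = (\<integral>u. sqrt (2*pi) * (std_normal_density u * cos ((x/\<sigma>) * u)) \<partial>lborel)"
    by (intro Bochner_Integration.integral_cong) (auto simp: e field_simps)
  also have "\<dots> = sqrt (2*pi) * exp (- (x/\<sigma>)\<^sup>2 / 2)"
    unfolding Bochner_Integration.integral_mult_right_zero c by (rule refl)
  also have "\<dots> = 2 * pi * std_normal_density (x/\<sigma>)"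
    by (simp add: e field_simps)
  finally show "(\<integral>w. cos (w * x) * exp (- (\<sigma> * w)\<^sup>2 / 2) \<partial>lborel) = 2 * pi / \<sigma> * std_normal_density (x / \<sigma>)"
    by simp
qed

lemma std_normal_density_le: "std_normal_density x \<le> 1"
proof -
  have "exp (- x\<^sup>2 / 2) \<le> 1" by simp
  moreover have "1 \<le> sqrt (2 * pi)" using pi_gt3 by (subst real_le_rsqrt) auto
  ultimately have "exp (- x\<^sup>2 / 2) \<le> sqrt (2 * pi)" by linarith
  then show ?thesis by (simp add: std_normal_density_def field_simps)
qed

lemma std_normal_density_lipschitz: "\<bar>std_normal_density x - std_normal_density y\<bar> \<le> \<bar>x - y\<bar>"
proof -
  have D: "(std_normal_density has_field_derivative (- t * std_normal_density t)) (at t within UNIV)" for t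
    unfolding std_normal_density_def
    by (rule derivative_eq_intros refl | simp)+
  have b: "norm (- t * std_normal_density t) \<le> 1" for t
  proof -
    have "\<bar>t\<bar> \<le> 1 + t\<^sup>2 / 2"
    proof -
      have "0 \<le> (\<bar>t\<bar> - 1)\<^sup>2" by simp
      then show ?thesis by (simp add: power2_eq_square algebra_simps)
    qed
    also have "\<dots> \<le> exp (t\<^sup>2/2)" by (rule exp_ge_add_one_self)
    finally have "\<bar>t\<bar> * exp (- t\<^sup>2/2) \<le> 1" by (simp add: exp_minus field_simps)
    moreover have "1 \<le> sqrt (2 * pi)" using pi_gt3 by (subst real_le_rsqrt) auto
    ultimately have "\<bar>t\<bar> * exp (- t\<^sup>2/2) \<le> sqrt (2 * pi)" by linarith
    then show ?thesis by (simp add: std_normal_density_def abs_mult field_simps)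
  qed
  from field_differentiable_bound[OF convex_UNIV D b, of x y]
  show ?thesis by simp
qed

text \<open>The information supplied by a central limit theorem, in the form in which Fourier inversion uses
  it: pointwise convergence of the characteristic functions of the normalised variables.\<close>

locale gaussian_fluctuations = prob_space P for P :: "'w measure" +
  fixes Z :: "nat \<Rightarrow> 'w \<Rightarrow> real" and m :: "nat \<Rightarrow> real" and \<sigma> :: real
  assumes Z_measurable[measurable]: "\<And>n. Z n \<in> borel_measurable P"
    and sigma_pos: "0 < \<sigma>"
    and char_limit: "\<And>w. (\<lambda>n. CLINT \<omega>|P. iexp (w * ((Z n \<omega> - m n) / sqrt (real n))))
        \<longlonglongrightarrow> complex_of_real (exp (- (\<sigma> * w)\<^sup>2 / 2))"
begin

definition norm_char :: "nat \<Rightarrow> real \<Rightarrow> complex" where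
  "norm_char n w = (CLINT \<omega>|P. iexp (w * ((Z n \<omega> - m n) / sqrt (real n))))"

lemma norm_char_measurable[measurable]: "norm_char n \<in> borel_measurable borel"
proof -
  interpret D: real_distribution "distr P borel (\<lambda>\<omega>. (Z n \<omega> - m n) / sqrt (real n))"
    by (intro real_distribution_distr) auto
  have "norm_char n = char (distr P borel (\<lambda>\<omega>. (Z n \<omega> - m n) / sqrt (real n)))"
    by (rule ext) (simp add: norm_char_def char_def integral_distr)
  then show ?thesis by simp
qed

lemma norm_iexp_integral_le: "cmod (CLINT \<omega>|P. iexp (Y \<omega>)) \<le> 1"
proof (cases "integrable P (\<lambda>\<omega>. iexp (Y \<omega>))")
  case True
  have "cmod (CLINT \<omega>|P. iexp (Y \<omega>)) \<le> (\<integral>\<omega>. cmod (iexp (Y \<omega>)) \<partial>P)"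
    by (rule integral_norm_bound)
  then show ?thesis by (simp add: prob_space)
qed (simp add: not_integrable_integral_eq)

lemma integrable_bounded:
  fixes Y :: "'w \<Rightarrow> 'b :: {banach, second_countable_topology}"
  assumes "Y \<in> borel_measurable P" "\<And>\<omega>. norm (Y \<omega>) \<le> c"
  shows "integrable P Y"
  by (rule integrable_const_bound[of _ c]) (use assms in auto)

lemma integrable_fst_factor:
  fixes f :: "real \<Rightarrow> real"
  assumes f: "integrable lborel f"
  shows "integrable (lborel \<Otimes>\<^sub>M P) (\<lambda>(x, \<omega>). f x)"
proof -
  interpret pair_sigma_finite lborel P ..
  have [measurable]: "f \<in> borel_measurable borel" using f by auto
  show ?thesis
    by (rule Fubini_integrable) (use f in \<open>auto simp: prob_space\<close>)
qed

text \<open>The integer \<open>L = \<lfloor>(Z n - u) / h\<rfloor>\<close> vanishes exactly when \<open>Z n \<in> {u..<u + h}\<close>, and its distribution is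
  recovered by Fourier inversion over \<open>\<bar>s\<bar> \<le> \<pi>\<close>. After the substitution \<open>s = w / sqrt n\<close> the difference
  between \<open>L\<close> and \<open>(Z n - u) / h\<close> changes the integrand by at most \<open>\<bar>w\<bar> / sqrt n\<close>, so its limit is the
  Gaussian one uniformly in \<open>u\<close>; \<open>Z n\<close> itself need not live on a lattice.\<close>

lemma lattice_llt:
  assumes h: "0 < h" and c: "0 < c"
    and p: "(\<lambda>n. sqrt (real n) * p n) \<longlonglongrightarrow> 0" "\<And>n. 0 \<le> p n"
    and bound: "\<forall>\<^sub>F n in sequentially. \<forall>u s. \<bar>s\<bar> \<le> pi \<longrightarrow>
      cmod (CLINT \<omega>|P. iexp (s * of_int \<lfloor>(Z n \<omega> - u) / h\<rfloor>)) \<le> p n + exp (- c * real n * s\<^sup>2)"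
    and e: "0 < e"
  shows "\<forall>\<^sub>F n in sequentially. \<forall>u. \<bar>sqrt (real n) * measure P {\<omega> \<in> space P. Z n \<omega> \<in> {u..<u + h}}
      - h / \<sigma> * std_normal_density ((u - m n) / (sqrt (real n) * \<sigma>))\<bar> < e"
proof -
  define \<tau> where "\<tau> = \<sigma> / h"
  have tau: "0 < \<tau>" using sigma_pos h by (simp add: \<tau>_def)
  define G where "G w = exp (- (\<tau> * w)\<^sup>2 / 2)" for w
  have Gint: "integrable lborel G" unfolding G_def by (rule gaussian_fourier[OF tau])
  have Gm[measurable]: "G \<in> borel_measurable borel" unfolding G_def by measurable
  \<comment> \<open>The first bound gives pointwise convergence, the second one the domination required by \<open>local_error_vanishes\<close>.\<close>
  define D where "D n w = min (\<bar>w\<bar> / sqrt (real n) + cmod (norm_char n (w / h) - G w))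
     (p n + exp (- c * w\<^sup>2) + G w)" for n w
  have Dm[measurable]: "D n \<in> borel_measurable borel" for n unfolding D_def by measurable
  have D0: "0 \<le> D n w" for n w using p(2)[of n] by (simp add: D_def G_def add_nonneg_nonneg)
  have Dlim: "(\<lambda>n. D n w) \<longlonglongrightarrow> 0" for w
  proof (rule tendsto_sandwich[OF _ _ tendsto_const])
    show "\<forall>\<^sub>F n in sequentially. 0 \<le> D n w" by (simp add: D0)
    show "\<forall>\<^sub>F n in sequentially. D n w \<le> \<bar>w\<bar> / sqrt (real n) + cmod (norm_char n (w / h) - G w)"
      by (simp add: D_def)
    have "G w = exp (- (\<sigma> * (w/h))\<^sup>2 / 2)" by (simp add: G_def \<tau>_def)
    then have "(\<lambda>n. cmod (norm_char n (w / h) - G w)) \<longlonglongrightarrow> cmod (complex_of_real (G w) - complex_of_real (G w))"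
      using char_limit[of "w/h"] unfolding norm_char_def[symmetric]
      by (intro tendsto_norm tendsto_diff tendsto_const) (simp only:)
    moreover have "(\<lambda>n. \<bar>w\<bar> / sqrt (real n)) \<longlonglongrightarrow> 0" by real_asymp
    ultimately show "(\<lambda>n. \<bar>w\<bar> / sqrt (real n) + cmod (norm_char n (w / h) - G w)) \<longlonglongrightarrow> 0"
      using tendsto_add by fastforce
  qed
  define W where "W n = {-(pi * sqrt (real n))..pi * sqrt (real n)}" for n
  have Wm[measurable]: "W n \<in> sets borel" for n by (simp add: W_def)
  define E where "E w = exp (- c * w\<^sup>2) + G w" for w
  have gc: "integrable lborel (\<lambda>w. exp (- c * w\<^sup>2))"
    using gaussian_fourier(1)[of "sqrt (2*c)"] c by (simp add: power_mult_distrib)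
  have Eint: "integrable lborel E" unfolding E_def
    by (intro Bochner_Integration.integrable_add Gint gc)
  have lim1: "(\<lambda>n. \<integral>w. indicator (W n) w * D n w \<partial>lborel) \<longlonglongrightarrow> 0"
    unfolding W_def
    by (rule local_error_vanishes[where q=p and E=E, OF Dm D0 Dlim _ Eint _ p])
       (auto simp: D_def E_def G_def intro!: always_eventually)
  have lim2: "(\<lambda>n. \<integral>w. indicator (- W n) w * G w \<partial>lborel) \<longlonglongrightarrow> (\<integral>w. 0 \<partial>(lborel :: real measure))"
  proof (rule integral_dominated_convergence[where w=G])
    show "AE w in lborel. (\<lambda>n. indicator (- W n) w * G w) \<longlonglongrightarrow> 0"
    proof (rule AE_I2)
      fix w :: real
      have "\<forall>\<^sub>F n in sequentially. \<bar>w\<bar> \<le> pi * sqrt (real n)" by real_asymp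
      then have "\<forall>\<^sub>F n in sequentially. indicator (- W n) w * G w = 0"
        by eventually_elim (auto simp: W_def indicator_def)
      then show "(\<lambda>n. indicator (- W n) w * G w) \<longlonglongrightarrow> 0" by (rule tendsto_eventually)
    qed
  qed (use Gint in \<open>auto simp: indicator_def G_def\<close>)
  have lim: "(\<lambda>n. ((\<integral>w. indicator (W n) w * D n w \<partial>lborel) + (\<integral>w. indicator (- W n) w * G w \<partial>lborel)) / (2 * pi)) \<longlonglongrightarrow> (0 + (\<integral>w. 0 \<partial>(lborel :: real measure))) / (2*pi)"
    by (intro tendsto_intros lim1 lim2) simp
  then have "\<forall>\<^sub>F n in sequentially. ((\<integral>w. indicator (W n) w * D n w \<partial>lborel) + (\<integral>w. indicator (- W n) w * G w \<partial>lborel)) / (2 * pi) < e"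
    by (rule order_tendstoD(2)) (use e in simp)
  then show ?thesis using bound eventually_gt_at_top[of 0]
  proof eventually_elim
    case (elim n)
    show ?case
    proof
      fix u
      define L where "L \<omega> = \<lfloor>(Z n \<omega> - u) / h\<rfloor>" for \<omega>
      have Lm[measurable]: "L \<in> measurable P (count_space UNIV)"
        unfolding L_def by measurable
      define r where "r = sqrt (real n)"
      have r: "0 < r" using elim by (simp add: r_def)
      define \<phi> where "\<phi> w = (CLINT \<omega>|P. iexp (w / r * of_int (L \<omega>)))" for w
      have Rephi: "Re (\<phi> w) = (\<integral>\<omega>. cos (w / r * of_int (L \<omega>)) \<partial>P)" for w
        unfolding \<phi>_def
        by (subst integral_Re[symmetric]) (auto intro!: integrable_bounded[of _ 1] simp: Re_exp)
      define x where "x = (u - m n) / (h * r)"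
      define I where "I = W n"
      have Wint: "integrable lborel (indicator (W n) :: real \<Rightarrow> real)"
        unfolding W_def by (intro integrable_real_indicator) (auto simp: emeasure_lborel_Icc_eq)
      have prob0: "measure P {\<omega> \<in> space P. Z n \<omega> \<in> {u..<u + h}} = (\<integral>\<omega>. indicator {0} (L \<omega>) \<partial>P)"
      proof -
        have "{\<omega> \<in> space P. Z n \<omega> \<in> {u..<u + h}} = {\<omega> \<in> space P. L \<omega> = 0}"
          using h by (auto simp: L_def floor_eq_iff field_simps)
        moreover have "(\<integral>\<omega>. indicator {0} (L \<omega>) \<partial>P) = ((\<integral>\<omega>. indicator {\<omega> \<in> space P. L \<omega> = 0} \<omega> \<partial>P) :: real)"
          by (intro Bochner_Integration.integral_cong) (auto simp: indicator_def)
        ultimately show ?thesis by (simp add: Int_absorb2)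
      qed
      have ind: "r * indicator {0} l = (1 / (2*pi)) * (\<integral>w. indicator (W n) w * cos (w / r * of_int l) \<partial>lborel)" for l :: int
      proof (cases "l = 0")
        case True
        have "(\<integral>w. indicator (W n) w \<partial>(lborel::real measure)) = 2 * pi * r"
          unfolding W_def r_def by simp
        with True show ?thesis by simp
      next
        case False
        let ?F = "\<lambda>w. sin (w / r * of_int l) * (r / of_int l)"
        have "((\<lambda>w. cos (w / r * of_int l)) has_integral (?F (pi * r) - ?F (- (pi * r)))) {- (pi * r)..pi * r}"
          using r False
          by (intro fundamental_theorem_of_calculus)
             (auto intro!: derivative_eq_intros simp flip: has_real_derivative_iff_has_vector_derivative)
        moreover have "sin (pi * of_int l) = 0" by (simp add: sin_zero_iff_int2) 
        ultimately have hi: "((\<lambda>w. cos (w / r * of_int l)) has_integral 0) {- (pi * r)..pi * r}"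
          using r by (simp add: mult.commute)
        have "set_integrable lborel {- (pi * r)..pi * r} (\<lambda>w. cos (w / r * of_int l))"
          by (intro borel_integrable_atLeastAtMost' continuous_intros) (use r in auto)
        from set_borel_integral_eq_integral(2)[OF this] integral_unique[OF hi]
        have "(LBINT w:{- (pi * r)..pi * r}. cos (w / r * of_int l)) = 0" by simp
        then show ?thesis using False by (simp add: set_lebesgue_integral_def W_def r_def)
      qed
      have "r * measure P {\<omega> \<in> space P. Z n \<omega> \<in> {u..<u + h}} = (\<integral>\<omega>. r * indicator {0} (L \<omega>) \<partial>P)"
        unfolding prob0 by simp
      also have "\<dots> = (1 / (2*pi)) * (\<integral>\<omega>. (\<integral>w. indicator (W n) w * cos (w / r * of_int (L \<omega>)) \<partial>lborel) \<partial>P)"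
        unfolding ind by simp
      also have "(\<integral>\<omega>. (\<integral>w. indicator (W n) w * cos (w / r * of_int (L \<omega>)) \<partial>lborel) \<partial>P)
          = (\<integral>w. (\<integral>\<omega>. indicator (W n) w * cos (w / r * of_int (L \<omega>)) \<partial>P) \<partial>lborel)"
      proof -
        interpret pair_sigma_finite lborel P ..
        have "integrable (lborel \<Otimes>\<^sub>M P) (\<lambda>(w, \<omega>). indicator (W n) w * cos (w / r * of_int (L \<omega>)))"
        proof (rule Bochner_Integration.integrable_bound[where f="\<lambda>(w,\<omega>). indicator (W n) w * (1::real)"])
          show "integrable (lborel \<Otimes>\<^sub>M P) (\<lambda>(w,\<omega>). indicator (W n) w * (1::real))"
            by (rule integrable_fst_factor) (auto intro: Wint)
        qed (auto simp: abs_mult indicator_def)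
        from Fubini_integral[OF this] show ?thesis by simp
      qed
      also have "\<dots> = (\<integral>w. indicator (W n) w * Re (\<phi> w) \<partial>lborel)"
        by (simp add: Rephi)
      finally have A: "2 * pi * (r * measure P {\<omega> \<in> space P. Z n \<omega> \<in> {u..<u + h}}) = (\<integral>w. indicator (W n) w * Re (\<phi> w) \<partial>lborel)"
        by simp
      have B: "2 * pi * (h / \<sigma> * std_normal_density ((u - m n) / (r * \<sigma>))) = (\<integral>w. cos (w * x) * G w \<partial>lborel)"
        using gaussian_fourier(2)[OF tau, of x] h sigma_pos r
        by (simp add: G_def \<tau>_def x_def mult.commute)
      have near: "\<bar>Re (\<phi> w) - cos (w * x) * G w\<bar> \<le> D n w" if w: "w \<in> W n" for w
      proof -
        have "\<bar>w / r\<bar> \<le> pi" using w r by (auto simp: W_def r_def field_simps abs_le_iff)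
        with elim have "cmod (\<phi> w) \<le> p n + exp (- c * real n * (w/r)\<^sup>2)"
          unfolding \<phi>_def L_def by blast
        also have "real n * (w/r)\<^sup>2 = w\<^sup>2" using elim r by (simp add: r_def power_divide)
        then have "exp (- c * real n * (w/r)\<^sup>2) = exp (- c * w\<^sup>2)" by (simp add: mult.assoc)
        finally have b1: "\<bar>Re (\<phi> w)\<bar> \<le> p n + exp (- c * w\<^sup>2)"
          using abs_Re_le_cmod[of "\<phi> w"] by linarith
        have "\<bar>cos (w * x) * G w\<bar> \<le> G w" by (auto simp: abs_mult G_def)
        with b1 have b2: "\<bar>Re (\<phi> w) - cos (w * x) * G w\<bar> \<le> p n + exp (- c * w\<^sup>2) + G w" by linarith
        have "cmod (\<phi> w - iexp (- (w * x)) * norm_char n (w / h))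
           = cmod (CLINT \<omega>|P. iexp (w / r * of_int (L \<omega>)) - iexp (- (w*x)) * iexp (w / h * ((Z n \<omega> - m n) / r)))"
          unfolding \<phi>_def norm_char_def r_def[symmetric]
          by (subst Bochner_Integration.integral_diff)
             (auto intro!: integrable_bounded[of _ 1] simp: norm_mult)
        also have "\<dots> \<le> (\<integral>\<omega>. cmod (iexp (w / r * of_int (L \<omega>)) - iexp (- (w*x)) * iexp (w / h * ((Z n \<omega> - m n) / r))) \<partial>P)"
          by (rule integral_norm_bound)
        also have "\<dots> \<le> (\<integral>\<omega>. \<bar>w\<bar> / r \<partial>P)"
        proof (rule integral_mono')
          fix \<omega>
          have *: "iexp (- (w*x)) * iexp (w / h * ((Z n \<omega> - m n) / r)) = iexp (w / r * ((Z n \<omega> - u) / h))"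
            unfolding exp_add[symmetric] of_real_add[symmetric] distrib_left[symmetric]
            using h r by (simp add: x_def field_simps)
          have "cmod (iexp (w / r * of_int (L \<omega>)) - iexp (w / r * ((Z n \<omega> - u) / h)))
             \<le> \<bar>w / r * of_int (L \<omega>) - w / r * ((Z n \<omega> - u) / h)\<bar>"
          proof -
            have "cmod (iexp a - iexp b) \<le> \<bar>a - b\<bar>" for a b :: real
            proof -
              have "iexp a - iexp b = iexp b * (iexp (a - b) - 1)"
                by (simp add: algebra_simps flip: exp_add)
              then have "cmod (iexp a - iexp b) = cmod (iexp (a - b) - 1)" by (simp add: norm_mult)
              also have "\<dots> \<le> \<bar>a - b\<bar>" using iexp_approx1[of "a - b" 0] by simp
              finally show ?thesis .
            qed
            then show ?thesis .
          qed
          also have "\<dots> = \<bar>w / r\<bar> * \<bar>of_int (L \<omega>) - (Z n \<omega> - u) / h\<bar>"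
            by (simp only: abs_mult right_diff_distrib[symmetric])
          also have "\<dots> \<le> \<bar>w / r\<bar> * 1"
            by (intro mult_left_mono) (auto simp: L_def abs_le_iff, linarith+)
          finally show "cmod (iexp (w / r * of_int (L \<omega>)) - iexp (- (w*x)) * iexp (w / h * ((Z n \<omega> - m n) / r))) \<le> \<bar>w\<bar> / r"
            unfolding * using r by simp
        qed (use r in auto)
        finally have c1: "cmod (\<phi> w - iexp (- (w * x)) * norm_char n (w / h)) \<le> \<bar>w\<bar> / r"
          by (simp add: prob_space)
        have "cmod (iexp (- (w * x)) * norm_char n (w / h) - iexp (- (w * x)) * G w) = cmod (norm_char n (w / h) - G w)"
          by (simp add: norm_mult flip: right_diff_distrib)
        with c1 have "cmod (\<phi> w - iexp (- (w * x)) * G w) \<le> \<bar>w\<bar> / r + cmod (norm_char n (w / h) - G w)"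
          using norm_triangle_ineq[of "\<phi> w - iexp (- (w * x)) * norm_char n (w / h)" "iexp (- (w * x)) * norm_char n (w / h) - iexp (- (w * x)) * G w"]
          by simp
        moreover have "Re (\<phi> w - iexp (- (w * x)) * G w) = Re (\<phi> w) - cos (w * x) * G w"
          by (simp add: Re_exp)
        ultimately have "\<bar>Re (\<phi> w) - cos (w * x) * G w\<bar> \<le> \<bar>w\<bar> / r + cmod (norm_char n (w / h) - G w)"
          using abs_Re_le_cmod[of "\<phi> w - iexp (- (w * x)) * G w"] by linarith
        with b2 show ?thesis by (simp add: D_def r_def)
      qed
      have \<phi>m[measurable]: "(\<lambda>w. Re (\<phi> w)) \<in> borel_measurable borel"
        unfolding Rephi by measurable
      have phi1: "\<bar>Re (\<phi> w)\<bar> \<le> 1" for w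
        using abs_Re_le_cmod[of "\<phi> w"] norm_iexp_integral_le[of "\<lambda>\<omega>. w / r * of_int (L \<omega>)"]
        unfolding \<phi>_def by linarith
      have i1: "integrable lborel (\<lambda>w. indicator (W n) w * Re (\<phi> w))"
        by (rule Bochner_Integration.integrable_bound[OF Wint])
           (auto simp: abs_mult phi1 indicator_def)
      have i2: "integrable lborel (\<lambda>w. cos (w * x) * G w)"
        by (rule Bochner_Integration.integrable_bound[OF Gint]) (auto simp: abs_mult G_def)
      have i3: "integrable lborel (\<lambda>w. indicator (W n) w * D n w)"
      proof (rule Bochner_Integration.integrable_bound)
        show "integrable lborel (\<lambda>w. indicator (W n) w * p n + E w)"
          by (intro Bochner_Integration.integrable_add Eint integrable_mult_left Wint)
        show "AE w in lborel. norm (indicator (W n) w * D n w) \<le> norm (indicator (W n) w * p n + E w)"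
          using p(2)[of n] D0 by (intro AE_I2) (auto simp: indicator_def D_def E_def G_def abs_mult)
      qed measurable
      have i4: "integrable lborel (\<lambda>w. indicator (- W n) w * G w)"
        by (rule Bochner_Integration.integrable_bound[OF Gint]) (auto simp: G_def indicator_def)
      have "\<bar>(\<integral>w. indicator (W n) w * Re (\<phi> w) \<partial>lborel) - (\<integral>w. cos (w * x) * G w \<partial>lborel)\<bar>
         = \<bar>\<integral>w. indicator (W n) w * Re (\<phi> w) - cos (w * x) * G w \<partial>lborel\<bar>"
        by (subst Bochner_Integration.integral_diff[OF i1 i2]) simp
      also have "\<dots> \<le> (\<integral>w. \<bar>indicator (W n) w * Re (\<phi> w) - cos (w * x) * G w\<bar> \<partial>lborel)"
        by (rule integral_abs_bound)
      also have "\<dots> \<le> (\<integral>w. indicator (W n) w * D n w + indicator (- W n) w * G w \<partial>lborel)"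
      proof (rule integral_mono)
        fix w
        show "\<bar>indicator (W n) w * Re (\<phi> w) - cos (w * x) * G w\<bar> \<le> indicator (W n) w * D n w + indicator (- W n) w * G w"
          using near[of w] by (cases "w \<in> W n") (auto simp: abs_mult G_def)
      qed (intro integrable_abs Bochner_Integration.integrable_diff Bochner_Integration.integrable_add i1 i2 i3 i4)+
      also have "\<dots> = (\<integral>w. indicator (W n) w * D n w \<partial>lborel) + (\<integral>w. indicator (- W n) w * G w \<partial>lborel)"
        by (rule Bochner_Integration.integral_add[OF i3 i4])
      also have "\<dots> < e * (2 * pi)" using elim(1) by (simp add: field_simps)
      finally have "\<bar>2 * pi * (r * measure P {\<omega> \<in> space P. Z n \<omega> \<in> {u..<u + h}})
          - 2 * pi * (h / \<sigma> * std_normal_density ((u - m n) / (r * \<sigma>)))\<bar> < e * (2 * pi)"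
        unfolding A B .
      then have "2 * pi * \<bar>(r * measure P {\<omega> \<in> space P. Z n \<omega> \<in> {u..<u + h}})
          - (h / \<sigma> * std_normal_density ((u - m n) / (r * \<sigma>)))\<bar> < 2 * pi * e"
        unfolding right_diff_distrib[symmetric] abs_mult by (simp add: mult.commute)
      then show "\<bar>sqrt (real n) * measure P {\<omega> \<in> space P. Z n \<omega> \<in> {u..<u + h}}
      - h / \<sigma> * std_normal_density ((u - m n) / (sqrt (real n) * \<sigma>))\<bar> < e"
        by (simp add: r_def)
    qed
  qed
qed

end

text \<open>The Fejer kernel: a probability density concentrating at the origin as \<open>d\<close> grows, whose Fourier
  transform is the triangle function supported on \<open>{-d..d}\<close>. Smoothing with it makes inversion depend
  on the characteristic function in a compact range only.\<close>

definition fejer :: "real \<Rightarrow> real \<Rightarrow> real" where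
  "fejer d x = d / (2 * pi) * (sinc (d * x / 2))\<^sup>2"

lemma fejer_measurable[measurable]: "fejer d \<in> borel_measurable borel"
  unfolding fejer_def by measurable

lemma fejer_nonneg: "0 \<le> d \<Longrightarrow> 0 \<le> fejer d x"
  by (simp add: fejer_def)

lemma fejer_scale: "fejer d x = d * fejer 1 (d * x)"
  by (simp add: fejer_def)

lemma fejer_eq: "x \<noteq> 0 \<Longrightarrow> 0 < d \<Longrightarrow> fejer d x = (1 - cos (d * x)) / (pi * d * x\<^sup>2)"
proof -
  assume "x \<noteq> 0" "0 < d"
  moreover have "1 - cos (d * x) = 2 * (sin (d * x / 2))\<^sup>2"
    using cos_double_sin[of "d * x / 2"] by simp
  ultimately show ?thesis
    by (simp add: fejer_def power_divide field_simps power2_eq_square)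
qed

text \<open>The antiderivative is explicit: integrating by parts turns the squared sine into the sine
  integral, whose limit is known.\<close>

lemma fejer_integral: "has_bochner_integral lborel (fejer 1) 1"
proof -
  define F where "F x = (Si x - x / 2 * (sinc (x / 2))\<^sup>2) / pi" for x
  have D: "(F has_real_derivative fejer 1 x) (at x)" if "0 \<le> x" for x
  proof (cases "x = 0")
    case True
    have "((\<lambda>x. x / 2 * (sinc (x / 2))\<^sup>2) has_real_derivative 1/2) (at 0)"
    proof -
      have "isCont (\<lambda>x. (sinc (x / 2))\<^sup>2 / 2) 0"
        by (intro continuous_intros continuous_within_compose3[OF isCont_sinc]) auto
      then have "((\<lambda>x. (sinc (x / 2))\<^sup>2 / 2) \<longlongrightarrow> 1/2) (at 0)" by (simp add: isCont_def)
      then show ?thesis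
        unfolding has_field_derivative_iff
        by (rule Lim_transform_eventually)
           (auto simp: eventually_at_filter field_simps)
    qed
    with DERIV_Si[of 0] have "((\<lambda>x. (Si x - x / 2 * (sinc (x / 2))\<^sup>2) / pi) has_real_derivative (sinc 0 - 1/2) / pi) (at 0)"
      by (intro DERIV_cdivide DERIV_diff) auto
    then show ?thesis unfolding F_def True by (simp add: fejer_def)
  next
    case False
    then have x: "0 < x" using that by simp
    have "((\<lambda>x. (Si x - (1 - cos x) / x) / pi) has_real_derivative fejer 1 x) (at x)"
      using x
      by (auto intro!: derivative_eq_intros DERIV_Si simp: fejer_eq field_simps power2_eq_square)
    then show ?thesis
    proof (rule has_field_derivative_transform_within_open[of _ _ _ "{0<..}"])
      fix t :: real assume t: "t \<in> {0<..}"
      have "1 - cos t = 2 * (sin (t / 2))\<^sup>2"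
        using cos_double_sin[of "t / 2"] by simp
      then show "(Si t - (1 - cos t) / t) / pi = F t"
        using t by (simp add: F_def power_divide field_simps power2_eq_square)
    qed (use x in auto)
  qed
  have L: "(F \<longlongrightarrow> 1/2) at_top"
  proof -
    have "((\<lambda>x. (Si x - (1 - cos x) / x) / pi) \<longlongrightarrow> (pi / 2 - 0) / pi) at_top"
    proof (intro tendsto_intros Si_at_top)
      show "((\<lambda>x::real. (1 - cos x) / x) \<longlongrightarrow> 0) at_top"
      proof (rule Lim_null_comparison)
        show "\<forall>\<^sub>F x::real in at_top. norm ((1 - cos x) / x) \<le> 2 / x"
          using eventually_gt_at_top[of 0]
        proof eventually_elim
          case (elim x)
          have "\<bar>1 - cos x\<bar> \<le> 2" using cos_ge_minus_one[of x] cos_le_one[of x] by linarith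
          with elim show ?case by (simp add: divide_right_mono)
        qed
        show "((\<lambda>x::real. 2 / x) \<longlongrightarrow> 0) at_top" by real_asymp
      qed
    qed simp
    then have "((\<lambda>x. (Si x - (1 - cos x) / x) / pi) \<longlongrightarrow> 1/2) at_top" by simp
    then show ?thesis
    proof (rule Lim_transform_eventually)
      show "\<forall>\<^sub>F t in at_top. (Si t - (1 - cos t) / t) / pi = F t"
        using eventually_gt_at_top[of 0]
      proof eventually_elim
        case (elim t)
        have "1 - cos t = 2 * (sin (t / 2))\<^sup>2"
          using cos_double_sin[of "t / 2"] by simp
        then show ?case
          using elim by (simp add: F_def power_divide field_simps power2_eq_square)
      qed
    qed
  qed
  have "has_bochner_integral lborel (\<lambda>x. indicator {0..} x *\<^sub>R fejer 1 x) (1/2 - F 0)"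
  proof (rule has_bochner_integral_nn_integral)
    have "(\<integral>\<^sup>+x. ennreal (fejer 1 x) * indicator {0..} x \<partial>lborel) = ennreal (1/2 - F 0)"
      by (rule nn_integral_FTC_atLeast[OF fejer_measurable D _ L]) (auto simp: fejer_nonneg)
    moreover have "(\<integral>\<^sup>+x. ennreal (indicator {0..} x *\<^sub>R fejer 1 x) \<partial>lborel)
        = (\<integral>\<^sup>+x. ennreal (fejer 1 x) * indicator {0..} x \<partial>lborel)"
      by (intro nn_integral_cong) (auto simp: indicator_def)
    ultimately show "(\<integral>\<^sup>+x. ennreal (indicator {0..} x *\<^sub>R fejer 1 x) \<partial>lborel) = ennreal (1/2 - F 0)"
      by simp
  qed (auto simp: fejer_nonneg F_def Si_def zero_ereal_def[symmetric])
  moreover have "F 0 = 0" by (simp add: F_def Si_def zero_ereal_def[symmetric])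
  ultimately have "has_bochner_integral lborel (fejer 1) (2 *\<^sub>R (1/2))"
    by (intro has_bochner_integral_even_function) (auto simp: fejer_def)
  then show ?thesis by simp
qed

lemma fejer_scaled_integral: "0 < d \<Longrightarrow> has_bochner_integral lborel (fejer d) 1"
  using lborel_has_bochner_integral_real_affine_iff[of d "fejer 1" 1 0] fejer_integral
    has_bochner_integral_mult_right[of d lborel "\<lambda>x. fejer 1 (d * x)" "1/d"]
  by (subst fejer_scale[abs_def]) (simp add: field_simps)

lemma fejer_concentrates:
  assumes "0 < e" "0 < \<eta>"
  shows "\<exists>d>0. (\<integral>x. indicator {-\<eta>..\<eta>} x * fejer d x \<partial>lborel) \<ge> 1 - e"
proof -
  have i: "integrable lborel (fejer 1)" and i1: "(\<integral>x. fejer 1 x \<partial>lborel) = 1"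
    using fejer_integral by (auto simp: has_bochner_integral_iff)
  have "(\<lambda>n. \<integral>x. indicator {- (real n * \<eta>)..real n * \<eta>} x * fejer 1 x \<partial>lborel) \<longlonglongrightarrow> (\<integral>x. fejer 1 x \<partial>lborel)"
  proof (rule integral_dominated_convergence[where w="fejer 1"])
    show "AE x in lborel. (\<lambda>n. indicator {- (real n * \<eta>)..real n * \<eta>} x * fejer 1 x) \<longlonglongrightarrow> fejer 1 x"
    proof (rule AE_I2)
      fix x :: real
      have "\<forall>\<^sub>F n in sequentially. \<bar>x\<bar> \<le> real n * \<eta>" using assms by real_asymp
      then have "\<forall>\<^sub>F n in sequentially. indicator {- (real n * \<eta>)..real n * \<eta>} x * fejer 1 x = fejer 1 x"
        by eventually_elim (auto simp: indicator_def)
      then show "(\<lambda>n. indicator {- (real n * \<eta>)..real n * \<eta>} x * fejer 1 x) \<longlonglongrightarrow> fejer 1 x"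
        by (rule tendsto_eventually)
    qed
  qed (use i in \<open>auto simp: indicator_def fejer_nonneg\<close>)
  then have "\<forall>\<^sub>F n in sequentially. 1 - e < (\<integral>x. indicator {- (real n * \<eta>)..real n * \<eta>} x * fejer 1 x \<partial>lborel)"
    using assms unfolding i1 by (intro order_tendstoD(1)) auto
  with eventually_gt_at_top[of 0] have "\<forall>\<^sub>F n in sequentially. 0 < n \<and> 1 - e < (\<integral>x. indicator {- (real n * \<eta>)..real n * \<eta>} x * fejer 1 x \<partial>lborel)"
    by eventually_elim simp
  then obtain n where n: "0 < n" "1 - e < (\<integral>x. indicator {- (real n * \<eta>)..real n * \<eta>} x * fejer 1 x \<partial>lborel)"
    by (auto simp: eventually_sequentially)
  have "indicator {- (real n * \<eta>)..real n * \<eta>} (real n * x) = (indicator {-\<eta>..\<eta>} x :: real)" for x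
    using n mult_le_cancel_left_pos[of "real n" "-\<eta>" x] mult_le_cancel_left_pos[of "real n" x \<eta>]
    by (auto simp: indicator_def)
  then have "(\<integral>x. indicator {- (real n * \<eta>)..real n * \<eta>} x * fejer 1 x \<partial>lborel)
    = (\<integral>x. indicator {-\<eta>..\<eta>} x * fejer (real n) x \<partial>lborel)"
    by (subst lborel_integral_real_affine[where c="real n" and t=0])
       (use n in \<open>auto simp: fejer_scale[of "real n"] mult_ac simp flip: Bochner_Integration.integral_mult_right_zero\<close>)
  with n show ?thesis by (intro exI[of _ "real n"]) auto
qed

lemma fejer_fourier:
  assumes d: "0 < d"
  shows "2 * pi * fejer d x = (\<integral>t. indicator {-d..d} t * ((1 - \<bar>t\<bar> / d) * cos (t * x)) \<partial>lborel)"
proof -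
  let ?f = "\<lambda>t. (1 - \<bar>t\<bar> / d) * cos (t * x)"
  have half: "((\<lambda>t. (1 - t / d) * cos (t * x)) has_integral (pi * fejer d x)) {0..d}"
  proof (cases "x = 0")
    case True
    have "((\<lambda>t. (1 - t / d) * cos (t * x)) has_integral ((d - d\<^sup>2 / (2 * d)) - (0 - 0\<^sup>2 / (2*d)))) {0..d}"
      using d True
      by (intro fundamental_theorem_of_calculus)
         (auto intro!: derivative_eq_intros simp flip: has_real_derivative_iff_has_vector_derivative)
    then show ?thesis using True d by (simp add: fejer_def power2_eq_square field_simps)
  next
    case False
    let ?F = "\<lambda>t. (1 - t / d) * sin (t * x) / x - cos (t * x) / (d * x\<^sup>2)"
    have "((\<lambda>t. (1 - t / d) * cos (t * x)) has_integral (?F d - ?F 0)) {0..d}"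
      using d False
      by (intro fundamental_theorem_of_calculus)
         (auto intro!: derivative_eq_intros simp: field_simps power2_eq_square simp flip: has_real_derivative_iff_has_vector_derivative)
    moreover have "?F d - ?F 0 = pi * fejer d x"
      using False d by (simp add: fejer_eq) (simp add: diff_divide_distrib)
    ultimately show ?thesis by simp
  qed
  have "((\<lambda>t. ?f t) has_integral (pi * fejer d x)) {0..d}"
    by (rule has_integral_eq[OF _ half]) auto
  then have h1: "(?f has_integral (pi * fejer d x)) {0..d}" .
  have h2: "(?f has_integral (pi * fejer d x)) {-d..0}"
    using has_integral_reflect_real[THEN iffD2, OF h1] by simp
  have "(?f has_integral (pi * fejer d x + pi * fejer d x)) {-d..d}"
    by (rule has_integral_combine[OF _ _ h2 h1]) (use d in auto)
  then have hi: "(?f has_integral (2 * pi * fejer d x)) {-d..d}" by (simp add: mult.assoc)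
  have "set_integrable lborel {-d..d} ?f"
    by (intro borel_integrable_atLeastAtMost' continuous_intros) (use d in auto)
  from set_borel_integral_eq_integral(2)[OF this] integral_unique[OF hi]
  show ?thesis by (simp add: set_lebesgue_integral_def)
qed

context gaussian_fluctuations
begin

text \<open>The density of \<open>Z n\<close> smoothed at scale \<open>1/d\<close> is given by inversion over \<open>\<bar>t\<bar> \<le> d\<close>, with the
  triangle function as a weight; the weight tends to \<open>1\<close> on the relevant scale \<open>t = w / sqrt n\<close>.\<close>

lemma smoothed_llt:
  assumes d: "0 < d" and c: "0 < c"
    and p: "(\<lambda>n. sqrt (real n) * p n) \<longlonglongrightarrow> 0" "\<And>n. 0 \<le> p n"
    and bound: "\<forall>\<^sub>F n in sequentially. \<forall>t. \<bar>t\<bar> \<le> d \<longrightarrow>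
      cmod (CLINT \<omega>|P. iexp (t * Z n \<omega>)) \<le> p n + exp (- c * real n * t\<^sup>2)"
    and e: "0 < e"
  shows "\<forall>\<^sub>F n in sequentially. \<forall>y. \<bar>sqrt (real n) * (\<integral>\<omega>. fejer d (y - Z n \<omega>) \<partial>P)
      - 1 / \<sigma> * std_normal_density ((y - m n) / (sqrt (real n) * \<sigma>))\<bar> < e"
proof -
  define G where "G w = exp (- (\<sigma> * w)\<^sup>2 / 2)" for w
  have Gint: "integrable lborel G" unfolding G_def by (rule gaussian_fourier[OF sigma_pos])
  have Gm[measurable]: "G \<in> borel_measurable borel" unfolding G_def by measurable
  define W where "W n = {-(d * sqrt (real n))..d * sqrt (real n)}" for n
  have Wm[measurable]: "W n \<in> sets borel" for n by (simp add: W_def)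
  define tri where "tri n w = 1 - \<bar>w\<bar> / (d * sqrt (real n))" for n w
  have trim[measurable]: "tri n \<in> borel_measurable borel" for n unfolding tri_def by measurable
  have tri01: "0 \<le> tri n w" "tri n w \<le> 1" if "w \<in> W n" for n w
    using that d by (auto simp: tri_def W_def divide_le_eq abs_le_iff)
  define D where "D n w = indicator (W n) w * cmod (tri n w * norm_char n w - G w)" for n w
  have Dm[measurable]: "D n \<in> borel_measurable borel" for n unfolding D_def by measurable
  have D0: "0 \<le> D n w" for n w by (simp add: D_def)
  have Dlim: "(\<lambda>n. D n w) \<longlonglongrightarrow> 0" for w
  proof (rule tendsto_sandwich[OF _ _ tendsto_const])
    show "\<forall>\<^sub>F n in sequentially. 0 \<le> D n w" by (simp add: D0)
    show "\<forall>\<^sub>F n in sequentially. D n w \<le> cmod (tri n w * norm_char n w - G w)"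
      by (simp add: D_def indicator_def)
    have "(\<lambda>n. tri n w) \<longlonglongrightarrow> 1" unfolding tri_def using d by real_asymp
    then have "(\<lambda>n. cmod (tri n w * norm_char n w - G w)) \<longlonglongrightarrow> cmod (complex_of_real 1 * G w - G w)"
      using char_limit[of w] unfolding norm_char_def[symmetric] G_def[symmetric]
      by (intro tendsto_norm tendsto_diff tendsto_const tendsto_mult tendsto_of_real)
    then show "(\<lambda>n. cmod (tri n w * norm_char n w - G w)) \<longlonglongrightarrow> 0" by simp
  qed
  define E where "E w = exp (- c * w\<^sup>2) + G w" for w
  have gc: "integrable lborel (\<lambda>w. exp (- c * w\<^sup>2))"
    using gaussian_fourier(1)[of "sqrt (2*c)"] c by (simp add: power_mult_distrib)
  have Eint: "integrable lborel E" unfolding E_def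
    by (intro Bochner_Integration.integrable_add Gint gc)
  have normbound: "cmod (norm_char n w) \<le> p n + exp (- c * w\<^sup>2)"
    if b: "\<forall>t. \<bar>t\<bar> \<le> d \<longrightarrow> cmod (CLINT \<omega>|P. iexp (t * Z n \<omega>)) \<le> p n + exp (- c * real n * t\<^sup>2)"
      and w: "w \<in> W n" and n: "0 < n" for n w
  proof -
    have "\<bar>w / sqrt (real n)\<bar> \<le> d" using w n by (auto simp: W_def field_simps abs_le_iff)
    with b have "cmod (CLINT \<omega>|P. iexp (w / sqrt (real n) * Z n \<omega>)) \<le> p n + exp (- c * real n * (w / sqrt (real n))\<^sup>2)"
      by blast
    also have "- c * real n * (w / sqrt (real n))\<^sup>2 = - c * w\<^sup>2" using n by (simp add: power_divide)
    also have "(CLINT \<omega>|P. iexp (w / sqrt (real n) * Z n \<omega>)) = 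
        (CLINT \<omega>|P. iexp (w / sqrt (real n) * m n) * iexp (w * ((Z n \<omega> - m n) / sqrt (real n))))"
      unfolding exp_add[symmetric] of_real_add[symmetric] distrib_left[symmetric]
      by (intro Bochner_Integration.integral_cong) (auto simp: diff_divide_distrib algebra_simps)
    also have "\<dots> = iexp (w / sqrt (real n) * m n) * norm_char n w"
      by (simp add: norm_char_def)
    also have "cmod \<dots> = cmod (norm_char n w)" by (simp add: norm_mult)
    finally show ?thesis .
  qed
  have Dbound: "\<forall>\<^sub>F n in sequentially. \<forall>w. \<bar>w\<bar> \<le> d * sqrt (real n) \<longrightarrow> D n w \<le> p n + E w"
    using bound eventually_gt_at_top[of 0]
  proof eventually_elim
    case (elim n)
    show ?case
    proof (intro allI impI)
      fix w assume "\<bar>w\<bar> \<le> d * sqrt (real n)"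
      then have w: "w \<in> W n" by (auto simp: W_def)
      have "cmod (tri n w * norm_char n w - G w) \<le> cmod (tri n w * norm_char n w) + cmod (G w)"
        by (rule norm_triangle_ineq4)
      also have "\<dots> \<le> 1 * cmod (norm_char n w) + G w"
        using tri01[OF w] by (intro add_mono) (auto simp: norm_mult G_def intro!: mult_left_le_one_le)
      also have "\<dots> \<le> p n + E w"
        using normbound[OF elim(1) w elim(2)] by (simp add: E_def)
      finally show "D n w \<le> p n + E w" using w by (simp add: D_def)
    qed
  qed
  have lim1: "(\<lambda>n. \<integral>w. indicator (W n) w * D n w \<partial>lborel) \<longlonglongrightarrow> 0"
    unfolding W_def
    by (rule local_error_vanishes[where q=p and E=E, OF Dm D0 Dlim Dbound Eint _ p])
       (use d in \<open>auto simp: E_def G_def add_nonneg_nonneg\<close>)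
  have lim2: "(\<lambda>n. \<integral>w. indicator (- W n) w * G w \<partial>lborel) \<longlonglongrightarrow> (\<integral>w. 0 \<partial>(lborel :: real measure))"
  proof (rule integral_dominated_convergence[where w=G])
    show "AE w in lborel. (\<lambda>n. indicator (- W n) w * G w) \<longlonglongrightarrow> 0"
    proof (rule AE_I2)
      fix w :: real
      have "\<forall>\<^sub>F n in sequentially. \<bar>w\<bar> \<le> d * sqrt (real n)" using d by real_asymp
      then have "\<forall>\<^sub>F n in sequentially. indicator (- W n) w * G w = 0"
        by eventually_elim (auto simp: W_def indicator_def)
      then show "(\<lambda>n. indicator (- W n) w * G w) \<longlonglongrightarrow> 0" by (rule tendsto_eventually)
    qed
  qed (use Gint in \<open>auto simp: indicator_def G_def\<close>)
  have "(\<lambda>n. ((\<integral>w. indicator (W n) w * D n w \<partial>lborel) + (\<integral>w. indicator (- W n) w * G w \<partial>lborel)) / (2 * pi)) \<longlonglongrightarrow> (0 + (\<integral>w. 0 \<partial>(lborel :: real measure))) / (2*pi)"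
    by (intro tendsto_intros lim1 lim2) simp
  then have "\<forall>\<^sub>F n in sequentially. ((\<integral>w. indicator (W n) w * D n w \<partial>lborel) + (\<integral>w. indicator (- W n) w * G w \<partial>lborel)) / (2 * pi) < e"
    by (rule order_tendstoD(2)) (use e in simp)
  then show ?thesis using bound eventually_gt_at_top[of 0]
  proof eventually_elim
    case (elim n)
    show ?case
    proof
      fix y
      define r where "r = sqrt (real n)"
      have r: "0 < r" using elim by (simp add: r_def)
      define x where "x = (y - m n) / r"
      have Wint: "integrable lborel (indicator (W n) :: real \<Rightarrow> real)"
        unfolding W_def by (intro integrable_real_indicator) (auto simp: emeasure_lborel_Icc_eq)
      define \<phi> where "\<phi> w = iexp (- (w * x)) * norm_char n w" for w
      have \<phi>m[measurable]: "\<phi> \<in> borel_measurable borel" unfolding \<phi>_def by measurable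
      have Rephi: "Re (\<phi> w) = (\<integral>\<omega>. cos (w / r * (y - Z n \<omega>)) \<partial>P)" for w
      proof -
        have "\<phi> w = (CLINT \<omega>|P. iexp (- (w * x)) * iexp (w * ((Z n \<omega> - m n) / r)))"
          by (simp add: \<phi>_def norm_char_def r_def)
        also have "\<dots> = (CLINT \<omega>|P. iexp (w / r * (Z n \<omega> - y)))"
          unfolding exp_add[symmetric] of_real_add[symmetric] distrib_left[symmetric]
          using r by (intro Bochner_Integration.integral_cong) (auto simp: x_def field_simps)
        also have "Re \<dots> = (\<integral>\<omega>. cos (w / r * (Z n \<omega> - y)) \<partial>P)"
          by (subst integral_Re[symmetric]) (auto intro!: integrable_bounded[of _ 1] simp: Re_exp)
        also have "\<dots> = (\<integral>\<omega>. cos (w / r * (y - Z n \<omega>)) \<partial>P)"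
        proof (intro Bochner_Integration.integral_cong refl)
          fix \<omega>
          have "w / r * (Z n \<omega> - y) = - (w / r * (y - Z n \<omega>))" by (simp add: algebra_simps)
          then show "cos (w / r * (Z n \<omega> - y)) = cos (w / r * (y - Z n \<omega>))" by (metis cos_minus)
        qed
        finally show ?thesis .
      qed
      have ind: "2 * pi * (r * fejer d z) = (\<integral>w. indicator (W n) w * (tri n w * cos (w / r * z)) \<partial>lborel)" for z
      proof -
        have i: "indicator (W n) (r * t) = (indicator {-d..d} t :: real)" for t
          using r mult_le_cancel_left_pos[of r "-d" t] mult_le_cancel_left_pos[of r t d]
          by (auto simp: W_def r_def[symmetric] indicator_def mult.commute)
        have "(\<integral>w. indicator (W n) w * (tri n w * cos (w / r * z)) \<partial>lborel)
           = r * (\<integral>t. indicator {-d..d} t * ((1 - \<bar>t\<bar> / d) * cos (t * z)) \<partial>lborel)"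
          using r d by (subst lborel_integral_real_affine[where c=r and t=0])
            (auto simp: i i[unfolded mult.commute[of r]] tri_def r_def[symmetric] abs_mult field_simps)
        with fejer_fourier[OF d, of z] show ?thesis by simp
      qed
      have "2 * pi * (r * (\<integral>\<omega>. fejer d (y - Z n \<omega>) \<partial>P)) = (\<integral>\<omega>. 2 * pi * (r * fejer d (y - Z n \<omega>)) \<partial>P)"
        by simp
      also have "\<dots> = (\<integral>\<omega>. (\<integral>w. indicator (W n) w * (tri n w * cos (w / r * (y - Z n \<omega>))) \<partial>lborel) \<partial>P)"
        unfolding ind ..
      also have "\<dots> = (\<integral>w. (\<integral>\<omega>. indicator (W n) w * (tri n w * cos (w / r * (y - Z n \<omega>))) \<partial>P) \<partial>lborel)"
      proof -
        interpret pair_sigma_finite lborel P ..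
        have "integrable (lborel \<Otimes>\<^sub>M P) (\<lambda>(w, \<omega>). indicator (W n) w * (tri n w * cos (w / r * (y - Z n \<omega>))))"
        proof (rule Bochner_Integration.integrable_bound[where f="\<lambda>(w,\<omega>). indicator (W n) w * (1::real)"])
          show "integrable (lborel \<Otimes>\<^sub>M P) (\<lambda>(w,\<omega>). indicator (W n) w * (1::real))"
            by (rule integrable_fst_factor) (auto intro: Wint)
          have "\<bar>tri n w * cos z\<bar> \<le> 1" if "w \<in> W n" for w z
            using tri01[OF that] by (simp add: abs_mult mult_le_one)
          then show "AE x in lborel \<Otimes>\<^sub>M P. norm (case x of (w, \<omega>) \<Rightarrow> indicator (W n) w * (tri n w * cos (w / r * (y - Z n \<omega>))))
              \<le> norm (case x of (w, \<omega>) \<Rightarrow> indicator (W n) w * (1::real))"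
            by (auto simp: indicator_def)
        qed measurable
        from Fubini_integral[OF this] show ?thesis by simp
      qed
      also have "\<dots> = (\<integral>w. indicator (W n) w * (tri n w * Re (\<phi> w)) \<partial>lborel)"
        by (simp add: Rephi)
      finally have A: "2 * pi * (r * (\<integral>\<omega>. fejer d (y - Z n \<omega>) \<partial>P)) = (\<integral>w. indicator (W n) w * (tri n w * Re (\<phi> w)) \<partial>lborel)" .
      have B: "2 * pi * (1 / \<sigma> * std_normal_density ((y - m n) / (r * \<sigma>))) = (\<integral>w. cos (w * x) * G w \<partial>lborel)"
        using gaussian_fourier(2)[OF sigma_pos, of x] by (simp add: G_def x_def)
      have near: "\<bar>tri n w * Re (\<phi> w) - cos (w * x) * G w\<bar> \<le> D n w" if w: "w \<in> W n" for w
      proof -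
        have "tri n w * Re (\<phi> w) - cos (w * x) * G w = Re (iexp (- (w * x)) * (tri n w * norm_char n w - G w))"
          by (simp add: \<phi>_def Re_exp Im_exp algebra_simps)
        then have "\<bar>tri n w * Re (\<phi> w) - cos (w * x) * G w\<bar> \<le> cmod (iexp (- (w * x)) * (tri n w * norm_char n w - G w))"
          using abs_Re_le_cmod by metis
        then show ?thesis using w by (simp add: D_def norm_mult)
      qed
      have phi1: "\<bar>Re (\<phi> w)\<bar> \<le> 1" for w
        using abs_Re_le_cmod[of "\<phi> w"] norm_iexp_integral_le[of "\<lambda>\<omega>. w * ((Z n \<omega> - m n) / sqrt n)"]
        unfolding \<phi>_def norm_char_def by (simp add: norm_mult)
      have nc1: "cmod (norm_char n w) \<le> 1" for w
        unfolding norm_char_def by (rule norm_iexp_integral_le)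
      have tphi: "\<bar>tri n w * Re (\<phi> w)\<bar> \<le> 1" if "w \<in> W n" for w
        using tri01[OF that] phi1[of w] by (simp add: abs_mult mult_le_one)
      have i1: "integrable lborel (\<lambda>w. indicator (W n) w * (tri n w * Re (\<phi> w)))"
        by (rule Bochner_Integration.integrable_bound[OF Wint])
           (use tphi in \<open>auto simp: indicator_def\<close>)
      have i2: "integrable lborel (\<lambda>w. cos (w * x) * G w)"
        by (rule Bochner_Integration.integrable_bound[OF Gint]) (auto simp: abs_mult G_def)
      have Dle: "D n w \<le> 2" if w: "w \<in> W n" for w
      proof -
        have "cmod (tri n w * norm_char n w - G w) \<le> cmod (tri n w * norm_char n w) + cmod (G w)"
          by (rule norm_triangle_ineq4)
        also have "\<dots> \<le> 1 + 1"
          using tri01[OF w] nc1[of w] by (intro add_mono) (auto simp: norm_mult G_def intro!: mult_le_one)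
        finally show ?thesis using w by (simp add: D_def)
      qed
      have i3: "integrable lborel (\<lambda>w. indicator (W n) w * D n w)"
      proof (rule Bochner_Integration.integrable_bound)
        show "integrable lborel (\<lambda>w. indicator (W n) w * (2::real))"
          by (intro integrable_mult_left Wint)
        show "AE w in lborel. norm (indicator (W n) w * D n w) \<le> norm (indicator (W n) w * (2::real))"
          using Dle D0 by (intro AE_I2) (auto simp: indicator_def)
      qed measurable
      have i4: "integrable lborel (\<lambda>w. indicator (- W n) w * G w)"
        by (rule Bochner_Integration.integrable_bound[OF Gint]) (auto simp: G_def indicator_def)
      have "\<bar>(\<integral>w. indicator (W n) w * (tri n w * Re (\<phi> w)) \<partial>lborel) - (\<integral>w. cos (w * x) * G w \<partial>lborel)\<bar>
         = \<bar>\<integral>w. indicator (W n) w * (tri n w * Re (\<phi> w)) - cos (w * x) * G w \<partial>lborel\<bar>"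
        by (subst Bochner_Integration.integral_diff[OF i1 i2]) simp
      also have "\<dots> \<le> (\<integral>w. \<bar>indicator (W n) w * (tri n w * Re (\<phi> w)) - cos (w * x) * G w\<bar> \<partial>lborel)"
        by (rule integral_abs_bound)
      also have "\<dots> \<le> (\<integral>w. indicator (W n) w * D n w + indicator (- W n) w * G w \<partial>lborel)"
      proof (rule integral_mono)
        fix w
        show "\<bar>indicator (W n) w * (tri n w * Re (\<phi> w)) - cos (w * x) * G w\<bar> \<le> indicator (W n) w * D n w + indicator (- W n) w * G w"
          using near[of w] by (cases "w \<in> W n") (auto simp: abs_mult G_def)
      qed (intro integrable_abs Bochner_Integration.integrable_diff Bochner_Integration.integrable_add i1 i2 i3 i4)+
      also have "\<dots> = (\<integral>w. indicator (W n) w * D n w \<partial>lborel) + (\<integral>w. indicator (- W n) w * G w \<partial>lborel)"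
        by (rule Bochner_Integration.integral_add[OF i3 i4])
      also have "\<dots> < e * (2 * pi)" using elim(1) by (simp add: field_simps)
      finally have "\<bar>2 * pi * (r * (\<integral>\<omega>. fejer d (y - Z n \<omega>) \<partial>P))
          - 2 * pi * (1 / \<sigma> * std_normal_density ((y - m n) / (r * \<sigma>)))\<bar> < e * (2 * pi)"
        unfolding A B .
      then have "2 * pi * \<bar>r * (\<integral>\<omega>. fejer d (y - Z n \<omega>) \<partial>P)
          - (1 / \<sigma> * std_normal_density ((y - m n) / (r * \<sigma>)))\<bar> < 2 * pi * e"
        unfolding right_diff_distrib[symmetric] abs_mult by (simp add: mult.commute)
      then show "\<bar>sqrt (real n) * (\<integral>\<omega>. fejer d (y - Z n \<omega>) \<partial>P)
      - 1 / \<sigma> * std_normal_density ((y - m n) / (sqrt (real n) * \<sigma>))\<bar> < e"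
        by (simp add: r_def)
    qed
  qed
qed

text \<open>Consecutive intervals of length \<open>h\<close> have asymptotically the same probability, because the Gaussian
  density varies by \<open>O(1 / sqrt n)\<close> between them.\<close>

lemma lattice_llt_multiple:
  assumes h: "0 < h" and c: "0 < c" and k: "b = real k * h"
    and p: "(\<lambda>n. sqrt (real n) * p n) \<longlonglongrightarrow> 0" "\<And>n. 0 \<le> p n"
    and bound: "\<forall>\<^sub>F n in sequentially. \<forall>u s. \<bar>s\<bar> \<le> pi \<longrightarrow>
      cmod (CLINT \<omega>|P. iexp (s * of_int \<lfloor>(Z n \<omega> - u) / h\<rfloor>)) \<le> p n + exp (- c * real n * s\<^sup>2)"
    and e: "0 < e"
  shows "\<forall>\<^sub>F n in sequentially. \<forall>u. \<bar>sqrt (real n) * measure P {\<omega> \<in> space P. Z n \<omega> \<in> {u..<u + b}}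
      - b / \<sigma> * std_normal_density ((u - m n) / (sqrt (real n) * \<sigma>))\<bar> < e"
  using e unfolding k
proof (induction k arbitrary: e)
  case (Suc k)
  let ?g = "\<lambda>n u. std_normal_density ((u - m n) / (sqrt (real n) * \<sigma>))"
  have "(\<lambda>n. h / \<sigma> * (real k * h / (sqrt (real n) * \<sigma>))) \<longlonglongrightarrow> 0"
    using sigma_pos by real_asymp
  then have "\<forall>\<^sub>F n in sequentially. h / \<sigma> * (real k * h / (sqrt (real n) * \<sigma>)) < e / 3"
    using Suc.prems by (intro order_tendstoD(2)) auto
  moreover have "\<forall>\<^sub>F n in sequentially. \<forall>u. \<bar>sqrt (real n) * measure P {\<omega> \<in> space P. Z n \<omega> \<in> {u..<u + h}}
      - h / \<sigma> * ?g n u\<bar> < e / 3"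
    by (rule lattice_llt[OF h c p bound]) (use Suc.prems in auto)
  moreover have "\<forall>\<^sub>F n in sequentially. \<forall>u. \<bar>sqrt (real n) * measure P {\<omega> \<in> space P. Z n \<omega> \<in> {u..<u + real k * h}}
      - real k * h / \<sigma> * ?g n u\<bar> < e / 3"
    by (rule Suc.IH) (use Suc.prems in auto)
  ultimately show ?case using eventually_gt_at_top[of 0]
  proof eventually_elim
    case (elim n)
    show ?case
    proof
      fix u
      let ?v = "u + real k * h"
      have kh: "0 \<le> real k * h" using h by simp
      have "{\<omega> \<in> space P. Z n \<omega> \<in> {u..<u + real (Suc k) * h}}
        = {\<omega> \<in> space P. Z n \<omega> \<in> {u..<?v}} \<union> {\<omega> \<in> space P. Z n \<omega> \<in> {?v..<?v + h}}"
        using h kh by (auto simp only: of_nat_Suc distrib_right atLeastLessThan_iff mem_Collect_eq Un_iff)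
      then have M: "measure P {\<omega> \<in> space P. Z n \<omega> \<in> {u..<u + real (Suc k) * h}}
        = measure P {\<omega> \<in> space P. Z n \<omega> \<in> {u..<?v}} + measure P {\<omega> \<in> space P. Z n \<omega> \<in> {?v..<?v + h}}"
        by (simp only:, intro finite_measure_Union) (use h kh in auto)
      have "\<bar>h / \<sigma> * ?g n ?v - h / \<sigma> * ?g n u\<bar> = h / \<sigma> * \<bar>?g n ?v - ?g n u\<bar>"
        unfolding right_diff_distrib[symmetric] abs_mult using h sigma_pos by simp
      also have "\<dots> \<le> h / \<sigma> * \<bar>(?v - m n) / (sqrt (real n) * \<sigma>) - (u - m n) / (sqrt (real n) * \<sigma>)\<bar>"
        using h sigma_pos by (intro mult_left_mono std_normal_density_lipschitz) auto
      also have "\<dots> = h / \<sigma> * (real k * h / (sqrt (real n) * \<sigma>))"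
        using h sigma_pos elim(4) kh by (simp add: abs_mult flip: diff_divide_distrib)
      finally have 1: "\<bar>h / \<sigma> * ?g n ?v - h / \<sigma> * ?g n u\<bar> < e / 3" using elim(1) by linarith
      have 2: "\<bar>sqrt (real n) * measure P {\<omega> \<in> space P. Z n \<omega> \<in> {?v..<?v + h}} - h / \<sigma> * ?g n ?v\<bar> < e / 3"
        using elim(2) by blast
      have 3: "\<bar>sqrt (real n) * measure P {\<omega> \<in> space P. Z n \<omega> \<in> {u..<?v}} - real k * h / \<sigma> * ?g n u\<bar> < e / 3"
        using elim(3) by blast
      have "real (Suc k) * h / \<sigma> * ?g n u = real k * h / \<sigma> * ?g n u + h / \<sigma> * ?g n u"
        by (simp only: of_nat_Suc distrib_right add_divide_distrib mult_1 add.commute)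
      moreover have "\<bar>x + y - s\<bar> < e"
        if "s = t + w" "\<bar>c - w\<bar> < e / 3" "\<bar>y - c\<bar> < e / 3" "\<bar>x - t\<bar> < e / 3" for x y s t w c :: real
        using that by linarith
      ultimately show "\<bar>sqrt (real n) * measure P {\<omega> \<in> space P. Z n \<omega> \<in> {u..<u + real (Suc k) * h}}
          - real (Suc k) * h / \<sigma> * ?g n u\<bar> < e"
        unfolding M distrib_left using 1 2 3 by blast
    qed
  qed
qed auto

text \<open>Fubini's theorem and a translation. This turns the estimate of densities into one of interval
  probabilities averaged over the kernel.\<close>

lemma integral_smoothed_density:
  assumes d: "0 < d" and ab: "a \<le> b"
  shows "set_integrable lborel {a..b} (\<lambda>y. \<integral>\<omega>. fejer d (y - Z n \<omega>) \<partial>P)"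
    and "(LBINT y:{a..b}. (\<integral>\<omega>. fejer d (y - Z n \<omega>) \<partial>P))
       = (\<integral>x. fejer d x * measure P {\<omega> \<in> space P. Z n \<omega> + x \<in> {a..b}} \<partial>lborel)"
    and "integrable lborel (\<lambda>x. fejer d x * measure P {\<omega> \<in> space P. Z n \<omega> + x \<in> {a..b}})"
proof -
  interpret pair_sigma_finite lborel P ..
  have fi: "integrable lborel (fejer d)" using fejer_scaled_integral[OF d] by (simp add: has_bochner_integral_iff)
  have f0: "0 \<le> fejer d x" for x using fejer_nonneg d by simp
  have fb: "fejer d x \<le> d" for x
  proof -
    have "\<bar>sinc t\<bar> \<le> 1" for t :: real
      using abs_sin_le_one[of t] abs_sin_x_le_abs_x[of t] by (auto simp: divide_le_eq)
    then have "(sinc (d * x / 2))\<^sup>2 \<le> 1" by (metis abs_square_le_1)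
    then have "fejer d x \<le> d / (2 * pi) * 1" unfolding fejer_def using d by (intro mult_left_mono) auto
    also have "\<dots> \<le> d" using d pi_gt3 by (simp add: divide_le_eq)
    finally show ?thesis .
  qed
  let ?I = "indicator {a..b} :: real \<Rightarrow> real"
  have Iint: "integrable lborel ?I" by (intro integrable_real_indicator) (auto simp: emeasure_lborel_Icc_eq)
  have pint: "integrable (lborel \<Otimes>\<^sub>M P) (\<lambda>(y, \<omega>). ?I y * fejer d (y - Z n \<omega>))"
  proof (rule Bochner_Integration.integrable_bound[where f="\<lambda>(y,\<omega>). ?I y * d"])
    show "integrable (lborel \<Otimes>\<^sub>M P) (\<lambda>(y,\<omega>). ?I y * d)"
      by (rule integrable_fst_factor) (auto intro: Iint)
    show "AE x in lborel \<Otimes>\<^sub>M P. norm (case x of (y, \<omega>) \<Rightarrow> ?I y * fejer d (y - Z n \<omega>))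
              \<le> norm (case x of (y, \<omega>) \<Rightarrow> ?I y * d)"
      using f0 fb d by (auto simp: indicator_def)
  qed measurable
  have sh: "(\<integral>y. ?I y * fejer d (y - Z n \<omega>) \<partial>lborel) = (\<integral>x. ?I (Z n \<omega> + x) * fejer d x \<partial>lborel)" for \<omega>
    by (subst lborel_integral_real_affine[where c=1 and t="Z n \<omega>"]) auto
  have pint2: "integrable (lborel \<Otimes>\<^sub>M P) (\<lambda>(x, \<omega>). ?I (Z n \<omega> + x) * fejer d x)"
  proof (rule Bochner_Integration.integrable_bound[where f="\<lambda>(x,\<omega>). fejer d x * (1::real)"])
    show "integrable (lborel \<Otimes>\<^sub>M P) (\<lambda>(x,\<omega>). fejer d x * (1::real))"
      by (rule integrable_fst_factor) (auto intro: fi)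
    show "AE x in lborel \<Otimes>\<^sub>M P. norm (case x of (x, \<omega>) \<Rightarrow> ?I (Z n \<omega> + x) * fejer d x)
              \<le> norm (case x of (y, \<omega>) \<Rightarrow> fejer d y * (1::real))"
      using f0 by (auto simp: indicator_def)
  qed measurable
  have "integrable lborel (\<lambda>y. \<integral>\<omega>. ?I y * fejer d (y - Z n \<omega>) \<partial>P)"
    using integrable_fst[OF pint] by simp
  then show "set_integrable lborel {a..b} (\<lambda>y. \<integral>\<omega>. fejer d (y - Z n \<omega>) \<partial>P)"
    by (simp add: set_integrable_def)
  have meas: "(\<integral>\<omega>. ?I (Z n \<omega> + x) * fejer d x \<partial>P) = fejer d x * measure P {\<omega> \<in> space P. Z n \<omega> + x \<in> {a..b}}" for x
  proof -
    have "(\<integral>\<omega>. ?I (Z n \<omega> + x) * fejer d x \<partial>P) = (\<integral>\<omega>. indicator {\<omega> \<in> space P. Z n \<omega> + x \<in> {a..b}} \<omega> * fejer d x \<partial>P)"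
      by (intro Bochner_Integration.integral_cong) (auto simp: indicator_def)
    then show ?thesis by simp
  qed
  have "(LBINT y:{a..b}. (\<integral>\<omega>. fejer d (y - Z n \<omega>) \<partial>P)) = (\<integral>y. (\<integral>\<omega>. ?I y * fejer d (y - Z n \<omega>) \<partial>P) \<partial>lborel)"
    by (simp add: set_lebesgue_integral_def)
  also have "\<dots> = (\<integral>\<omega>. (\<integral>y. ?I y * fejer d (y - Z n \<omega>) \<partial>lborel) \<partial>P)"
    using Fubini_integral[OF pint] by simp
  also have "\<dots> = (\<integral>\<omega>. (\<integral>x. ?I (Z n \<omega> + x) * fejer d x \<partial>lborel) \<partial>P)" unfolding sh ..
  also have "\<dots> = (\<integral>x. (\<integral>\<omega>. ?I (Z n \<omega> + x) * fejer d x \<partial>P) \<partial>lborel)"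
    using Fubini_integral[OF pint2] by simp
  finally show "(LBINT y:{a..b}. (\<integral>\<omega>. fejer d (y - Z n \<omega>) \<partial>P))
       = (\<integral>x. fejer d x * measure P {\<omega> \<in> space P. Z n \<omega> + x \<in> {a..b}} \<partial>lborel)"
    unfolding meas .
  show "integrable lborel (\<lambda>x. fejer d x * measure P {\<omega> \<in> space P. Z n \<omega> + x \<in> {a..b}})"
    unfolding meas[symmetric] using integrable_fst[OF pint2] by simp
qed

lemma smoothed_interval:
  assumes d: "0 < d" and ab: "a \<le> b" and e: "0 < e"
    and llt: "\<forall>\<^sub>F n in sequentially. \<forall>y. \<bar>sqrt (real n) * (\<integral>\<omega>. fejer d (y - Z n \<omega>) \<partial>P)
      - 1 / \<sigma> * std_normal_density ((y - m n) / (sqrt (real n) * \<sigma>))\<bar> < e / (2 * (b - a + 1))"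
  shows "\<forall>\<^sub>F n in sequentially. \<forall>u. \<bar>sqrt (real n) * (\<integral>x. fejer d x * measure P {\<omega> \<in> space P. Z n \<omega> + x \<in> {u + a..u + b}} \<partial>lborel)
      - (b - a) / \<sigma> * std_normal_density ((u - m n) / (sqrt (real n) * \<sigma>))\<bar> < e"
proof -
  define M where "M = max \<bar>a\<bar> \<bar>b\<bar>"
  have "(\<lambda>n. 1 / \<sigma> * (M / (sqrt (real n) * \<sigma>))) \<longlonglongrightarrow> 0"
    using sigma_pos by real_asymp
  then have "\<forall>\<^sub>F n in sequentially. 1 / \<sigma> * (M / (sqrt (real n) * \<sigma>)) < e / (2 * (b - a + 1))"
    using e ab by (intro order_tendstoD(2)) auto
  with llt show ?thesis using eventually_gt_at_top[of 0]
  proof eventually_elim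
    case (elim n)
    show ?case
    proof
      fix u
      let ?g = "\<lambda>u. std_normal_density ((u - m n) / (sqrt (real n) * \<sigma>))"
      let ?p = "\<lambda>y. \<integral>\<omega>. fejer d (y - Z n \<omega>) \<partial>P"
      have ab': "u + a \<le> u + b" using ab by simp
      note I = integral_smoothed_density[OF d ab', of n]
      have i1: "integrable lborel (\<lambda>y. indicator {u+a..u+b} y * (sqrt (real n) * ?p y))"
        using I(1) integrable_mult_right[of "sqrt (real n)" lborel "\<lambda>y. indicator {u+a..u+b} y * ?p y"]
        by (simp add: set_integrable_def mult_ac)
      have i2: "integrable lborel (\<lambda>y. indicator {u+a..u+b} y * k)" for k :: real
        by (intro integrable_mult_left integrable_real_indicator) (auto simp: emeasure_lborel_Icc_eq)
      have pt: "\<bar>sqrt (real n) * ?p y - 1 / \<sigma> * ?g u\<bar> \<le> e / (b - a + 1)" if y: "y \<in> {u+a..u+b}" for y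
      proof -
        have "\<bar>1 / \<sigma> * ?g y - 1 / \<sigma> * ?g u\<bar> = 1 / \<sigma> * \<bar>?g y - ?g u\<bar>"
          unfolding right_diff_distrib[symmetric] abs_mult using sigma_pos by simp
        also have "\<dots> \<le> 1 / \<sigma> * \<bar>(y - m n) / (sqrt (real n) * \<sigma>) - (u - m n) / (sqrt (real n) * \<sigma>)\<bar>"
          using sigma_pos by (intro mult_left_mono std_normal_density_lipschitz) auto
        also have "\<dots> = 1 / \<sigma> * (\<bar>y - u\<bar> / (sqrt (real n) * \<sigma>))"
          using sigma_pos elim(3) by (simp add: abs_mult flip: diff_divide_distrib)
        also have "\<dots> \<le> 1 / \<sigma> * (M / (sqrt (real n) * \<sigma>))"
          using sigma_pos y by (intro mult_left_mono divide_right_mono) (auto simp: M_def)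
        finally have A1: "\<bar>1 / \<sigma> * ?g y - 1 / \<sigma> * ?g u\<bar> < e / (2 * (b - a + 1))"
          using elim(2) by (rule order_le_less_trans)
        have A2: "\<bar>sqrt (real n) * ?p y - 1 / \<sigma> * ?g y\<bar> < e / (2 * (b - a + 1))"
          using elim(1) by blast
        have "e / B = e / (2 * B) + e / (2 * B)" for B :: real by (simp add: divide_simps)
        then have A3: "e / (b - a + 1) = e / (2 * (b - a + 1)) + e / (2 * (b - a + 1))" .
        have "\<bar>s - g'\<bar> \<le> v + v" if "\<bar>g - g'\<bar> < v" "\<bar>s - g\<bar> < v" for s g g' v :: real
          using that by linarith
        from this[OF A1 A2] show ?thesis unfolding A3 .
      qed
      have "sqrt (real n) * (\<integral>x. fejer d x * measure P {\<omega> \<in> space P. Z n \<omega> + x \<in> {u + a..u + b}} \<partial>lborel)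
         = (\<integral>y. indicator {u+a..u+b} y * (sqrt (real n) * ?p y) \<partial>lborel)"
        unfolding I(2)[symmetric] set_lebesgue_integral_def Bochner_Integration.integral_mult_right_zero[symmetric]
        by (intro Bochner_Integration.integral_cong) auto
      moreover have "(b - a) / \<sigma> * ?g u = (\<integral>y. indicator {u+a..u+b} y * (1 / \<sigma> * ?g u) \<partial>lborel)"
        using ab by simp
      ultimately have "\<bar>sqrt (real n) * (\<integral>x. fejer d x * measure P {\<omega> \<in> space P. Z n \<omega> + x \<in> {u + a..u + b}} \<partial>lborel)
         - (b - a) / \<sigma> * ?g u\<bar> = \<bar>\<integral>y. indicator {u+a..u+b} y * (sqrt (real n) * ?p y) - indicator {u+a..u+b} y * (1 / \<sigma> * ?g u) \<partial>lborel\<bar>"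
        by (simp only: Bochner_Integration.integral_diff[OF i1 i2])
      also have "\<dots> \<le> (\<integral>y. \<bar>indicator {u+a..u+b} y * (sqrt (real n) * ?p y) - indicator {u+a..u+b} y * (1 / \<sigma> * ?g u)\<bar> \<partial>lborel)"
        by (rule integral_abs_bound)
      also have "\<dots> \<le> (\<integral>y. indicator {u+a..u+b} y * (e / (b - a + 1)) \<partial>lborel)"
        by (rule integral_mono'[OF i2]) (use pt e ab in \<open>auto simp: indicator_def\<close>)
      also have "\<dots> = (b - a) * (e / (b - a + 1))" using ab by simp
      also have "\<dots> < e" using e ab by (simp add: field_simps)
      finally show "\<bar>sqrt (real n) * (\<integral>x. fejer d x * measure P {\<omega> \<in> space P. Z n \<omega> + x \<in> {u + a..u + b}} \<partial>lborel)
         - (b - a) / \<sigma> * ?g u\<bar> < e" .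
    qed
  qed
qed

text \<open>Removing the smoothing: a shift by at most \<open>\<eta>\<close> keeps the interval inside a slightly longer one and
  contains a slightly shorter one. The kernel mass outside \<open>{-\<eta>..\<eta>}\<close> multiplies probabilities which
  have to be of order \<open>1 / sqrt n\<close> uniformly; this follows from the upper estimate, which is proved
  first.\<close>

lemma nonlattice_llt:
  assumes bound: "\<And>T. 0 < T \<Longrightarrow> \<exists>c>0. \<exists>p. (\<lambda>n. sqrt (real n) * p n) \<longlonglongrightarrow> 0 \<and> (\<forall>n. 0 \<le> p n) \<and>
      (\<forall>\<^sub>F n in sequentially. \<forall>t. \<bar>t\<bar> \<le> T \<longrightarrow> cmod (CLINT \<omega>|P. iexp (t * Z n \<omega>)) \<le> p n + exp (- c * real n * t\<^sup>2))"
    and b: "0 < b" and e: "0 < e"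
  shows "\<forall>\<^sub>F n in sequentially. \<forall>u. \<bar>sqrt (real n) * measure P {\<omega> \<in> space P. Z n \<omega> \<in> {u..<u + b}}
      - b / \<sigma> * std_normal_density ((u - m n) / (sqrt (real n) * \<sigma>))\<bar> < e"
proof -
  define G where "G = 1 / \<sigma>"
  have G: "0 < G" using sigma_pos by (simp add: G_def)
  define K where "K = b * G + 2 * G + 1"
  have K: "0 < K" using b G by (simp add: K_def add_pos_pos)
  \<comment> \<open>Half of \<open>\<eta> (4 K + 6 G + 4)\<close> is the total error in both estimates below, and \<open>3 \<eta> \<le> b\<close> keeps the shrunken interval nonempty.\<close>
  define \<eta> where "\<eta> = min (1/2) (min (b/3) (e / (2 * (4 * K + 6 * G + 4))))"
  have eta: "0 < \<eta>" "\<eta> \<le> 1/2" "\<eta> \<le> b / 3" "\<eta> \<le> e / (2 * (4 * K + 6 * G + 4))"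
    unfolding \<eta>_def min_less_iff_conj min_le_iff_disj using b e K G by auto
  have eta_e: "\<eta> * (4 * K + 6 * G + 4) < e"
  proof -
    have pos: "0 < 4 * K + 6 * G + 4" using K G by linarith
    from eta(4) have "\<eta> * (2 * (4 * K + 6 * G + 4)) \<le> e" using pos by (simp add: le_divide_eq mult.commute)
    moreover have "0 < \<eta> * (4 * K + 6 * G + 4)" using pos eta by simp
    ultimately show ?thesis by linarith
  qed
  obtain d where d: "0 < d" and conc: "(\<integral>x. indicator {-\<eta>..\<eta>} x * fejer d x \<partial>lborel) \<ge> 1 - \<eta>"
    using fejer_concentrates[OF eta(1) eta(1)] by blast
  have fi: "integrable lborel (fejer d)" and f1: "(\<integral>x. fejer d x \<partial>lborel) = 1"
    using fejer_scaled_integral[OF d] by (auto simp: has_bochner_integral_iff)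
  have f0: "0 \<le> fejer d x" for x using fejer_nonneg d by simp
  obtain c p where cp: "0 < c" "(\<lambda>n. sqrt (real n) * p n) \<longlonglongrightarrow> 0" "\<And>n. 0 \<le> p n"
      "\<forall>\<^sub>F n in sequentially. \<forall>t. \<bar>t\<bar> \<le> d \<longrightarrow> cmod (CLINT \<omega>|P. iexp (t * Z n \<omega>)) \<le> p n + exp (- c * real n * t\<^sup>2)"
    using bound[OF d] by blast
  let ?A = "\<lambda>n a b u. sqrt (real n) * (\<integral>x. fejer d x * measure P {\<omega> \<in> space P. Z n \<omega> + x \<in> {u + a..u + b}} \<partial>lborel)"
  let ?g = "\<lambda>n u. std_normal_density ((u - m n) / (sqrt (real n) * \<sigma>))"
  have sm: "\<forall>\<^sub>F n in sequentially. \<forall>u. \<bar>?A n a b u - (b - a) / \<sigma> * ?g n u\<bar> < \<eta>" if "a \<le> b" for a b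
    by (rule smoothed_interval[OF d that eta(1)], rule smoothed_llt[OF d cp]) (use that eta in auto)
  have e1: "\<forall>\<^sub>F n in sequentially. \<forall>u. \<bar>?A n (- \<eta>) (b + \<eta>) u - (b + \<eta> - - \<eta>) / \<sigma> * ?g n u\<bar> < \<eta>"
    by (rule sm) (use b eta in auto)
  have e2: "\<forall>\<^sub>F n in sequentially. \<forall>u. \<bar>?A n \<eta> (b - 2 * \<eta>) u - (b - 2 * \<eta> - \<eta>) / \<sigma> * ?g n u\<bar> < \<eta>"
    by (rule sm) (use b eta in auto)
  from e1 e2 eventually_gt_at_top[of 0] show ?thesis
  proof eventually_elim
    case (elim n)
    define r where "r = sqrt (real n)"
    have r: "0 < r" using elim by (simp add: r_def)
    define p where "p u = measure P {\<omega> \<in> space P. Z n \<omega> \<in> {u..<u + b}}" for u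
    have p01: "0 \<le> p u" "p u \<le> 1" for u by (auto simp: p_def)
    define q where "q a b u x = measure P {\<omega> \<in> space P. Z n \<omega> + x \<in> {u + a..u + b}}" for a b u x
    have qi: "integrable lborel (\<lambda>x. fejer d x * q a b u x)" if "a \<le> b" for a b u
      unfolding q_def by (rule integral_smoothed_density(3)[OF d]) (use that in auto)
    have gb: "0 \<le> ?g n u" "?g n u \<le> 1" for u using std_normal_density_le by auto
    have bu: "(b + \<eta> - - \<eta>) / \<sigma> * ?g n u = b * G * ?g n u + 2 * \<eta> * G * ?g n u"
      "(b - 2 * \<eta> - \<eta>) / \<sigma> * ?g n u = b * G * ?g n u - 3 * \<eta> * G * ?g n u" for u
      using sigma_pos by (auto simp: G_def field_simps)
    have gG: "2 * \<eta> * G * ?g n u \<le> 2 * \<eta> * G" "0 \<le> 2 * \<eta> * G * ?g n u" "3 * \<eta> * G * ?g n u \<le> 3 * \<eta> * G" for u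
      using gb[of u] eta G by (auto intro!: mult_right_le_one_le mult_nonneg_nonneg)
    have eG: "0 \<le> \<eta> * G" using eta G by simp
    have upper: "(1 - \<eta>) * (r * p u) \<le> b * G * ?g n u + 2 * \<eta> * G + \<eta>" for u
    proof -
      have "(1 - \<eta>) * p u \<le> (\<integral>x. indicator {-\<eta>..\<eta>} x * fejer d x \<partial>lborel) * p u"
        using conc p01 by (intro mult_right_mono)
      also have "\<dots> = (\<integral>x. indicator {-\<eta>..\<eta>} x * fejer d x * p u \<partial>lborel)" by simp
      also have "\<dots> \<le> (\<integral>x. fejer d x * q (-\<eta>) (b + \<eta>) u x \<partial>lborel)"
      proof (rule integral_mono')
        show "integrable lborel (\<lambda>x. fejer d x * q (-\<eta>) (b + \<eta>) u x)" by (rule qi) (use b eta in auto)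
        fix x :: real
        have "p u \<le> q (-\<eta>) (b + \<eta>) u x" if "x \<in> {-\<eta>..\<eta>}"
          unfolding p_def q_def using that by (intro finite_measure_mono) auto
        then show "indicator {-\<eta>..\<eta>} x * fejer d x * p u \<le> fejer d x * q (-\<eta>) (b + \<eta>) u x"
          using f0[of x] by (auto simp: indicator_def q_def intro!: mult_left_mono)
        show "0 \<le> fejer d x * q (-\<eta>) (b + \<eta>) u x" using f0 by (simp add: q_def)
      qed
      finally have "(1 - \<eta>) * (r * p u) \<le> ?A n (- \<eta>) (b + \<eta>) u"
        using r by (simp add: q_def r_def mult.left_commute mult_left_mono)
      moreover have "\<bar>?A n (- \<eta>) (b + \<eta>) u - (b + \<eta> - - \<eta>) / \<sigma> * ?g n u\<bar> < \<eta>" using elim(1) by blast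
      ultimately show ?thesis using gG[of u] unfolding bu by linarith
    qed
    \<comment> \<open>The crude uniform bound that controls the tails of the kernel in the lower estimate.\<close>
    have sup: "r * p u \<le> 2 * K" for u
    proof -
      have "1/2 * (r * p u) \<le> (1 - \<eta>) * (r * p u)"
        using eta r p01 by (intro mult_right_mono) auto
      moreover have "b * G * ?g n u \<le> b * G" using gb[of u] b G by (intro mult_right_le_one_le) auto
      moreover have "2 * \<eta> * G \<le> 1 * G" using eta G by (intro mult_right_mono) auto
      ultimately show ?thesis using upper[of u] eta(1,2) G K_def by linarith
    qed
    have up2: "r * p u \<le> b * G * ?g n u + \<eta> * (4 * K + 6 * G + 4) / 2" for u
    proof -
      have "\<eta> * (r * p u) \<le> \<eta> * (2 * K)" using sup eta by (intro mult_left_mono) auto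
      moreover have "r * p u = (1 - \<eta>) * (r * p u) + \<eta> * (r * p u)" by (simp add: algebra_simps)
      moreover have "\<eta> * (4 * K + 6 * G + 4) / 2 = \<eta> * (2 * K) + 3 * \<eta> * G + 2 * \<eta>" by (simp add: algebra_simps)
      ultimately show ?thesis using upper[of u] eta(1) eG by linarith
    qed
    have lo: "b * G * ?g n u - \<eta> * (4 * K + 6 * G + 4) / 2 \<le> r * p u" for u
    proof -
      have qle: "r * q \<eta> (b - 2 * \<eta>) u x \<le> indicator {-\<eta>..\<eta>} x * (r * p u) + indicator (- {-\<eta>..\<eta>}) x * (2 * K)" for x
      proof (cases "x \<in> {-\<eta>..\<eta>}")
        case True
        then have "q \<eta> (b - 2 * \<eta>) u x \<le> p u"
          unfolding p_def q_def 
        proof (intro finite_measure_mono)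
          show "{\<omega> \<in> space P. Z n \<omega> + x \<in> {u + \<eta>..u + (b - 2 * \<eta>)}} \<subseteq> {\<omega> \<in> space P. Z n \<omega> \<in> {u..<u + b}}"
            using True eta by auto
        qed auto
        then show ?thesis using True r by simp
      next
        case False
        have "q \<eta> (b - 2 * \<eta>) u x \<le> p (u + \<eta> - x)"
          unfolding p_def q_def using eta by (intro finite_measure_mono) auto
        then have "r * q \<eta> (b - 2 * \<eta>) u x \<le> r * p (u + \<eta> - x)" using r by simp
        with sup[of "u + \<eta> - x"] False show ?thesis by simp
      qed
      have i1: "integrable lborel (\<lambda>x. indicator {-\<eta>..\<eta>} x * fejer d x)"
        by (rule Bochner_Integration.integrable_bound[OF fi]) (auto simp: indicator_def)
      have i2: "integrable lborel (\<lambda>x. indicator (- {-\<eta>..\<eta>}) x * fejer d x)"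
        by (rule Bochner_Integration.integrable_bound[OF fi]) (auto simp: indicator_def)
      have spl: "(\<integral>x. indicator {-\<eta>..\<eta>} x * fejer d x \<partial>lborel) + (\<integral>x. indicator (- {-\<eta>..\<eta>}) x * fejer d x \<partial>lborel) = 1"
        unfolding f1[symmetric] Bochner_Integration.integral_add[OF i1 i2, symmetric]
        by (intro Bochner_Integration.integral_cong) (auto simp: indicator_def)
      have "?A n \<eta> (b - 2 * \<eta>) u = (\<integral>x. fejer d x * (r * q \<eta> (b - 2 * \<eta>) u x) \<partial>lborel)"
        unfolding q_def r_def Bochner_Integration.integral_mult_right_zero[symmetric]
        by (intro Bochner_Integration.integral_cong) auto
      also have "\<dots> \<le> (\<integral>x. indicator {-\<eta>..\<eta>} x * fejer d x * (r * p u) + indicator (- {-\<eta>..\<eta>}) x * fejer d x * (2 * K) \<partial>lborel)"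
      proof (rule integral_mono')
        show "integrable lborel (\<lambda>x. indicator {-\<eta>..\<eta>} x * fejer d x * (r * p u) + indicator (- {-\<eta>..\<eta>}) x * fejer d x * (2 * K))"
          by (intro Bochner_Integration.integrable_add integrable_mult_left i1 i2)
        fix x
        show "fejer d x * (r * q \<eta> (b - 2 * \<eta>) u x) \<le> indicator {-\<eta>..\<eta>} x * fejer d x * (r * p u) + indicator (- {-\<eta>..\<eta>}) x * fejer d x * (2 * K)"
          using mult_left_mono[OF qle[of x] f0[of x]] by (simp add: algebra_simps)
        show "0 \<le> indicator {-\<eta>..\<eta>} x * fejer d x * (r * p u) + indicator (- {-\<eta>..\<eta>}) x * fejer d x * (2 * K)"
          using f0 r p01 K by (auto simp: indicator_def)
      qed
      also have "\<dots> = (\<integral>x. indicator {-\<eta>..\<eta>} x * fejer d x \<partial>lborel) * (r * p u) + (\<integral>x. indicator (- {-\<eta>..\<eta>}) x * fejer d x \<partial>lborel) * (2 * K)"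
        by (subst Bochner_Integration.integral_add) (auto intro!: integrable_mult_left i1 i2)
      also have "\<dots> \<le> 1 * (r * p u) + \<eta> * (2 * K)"
      proof (intro add_mono mult_right_mono)
        have "0 \<le> (\<integral>x. indicator (- {-\<eta>..\<eta>}) x * fejer d x \<partial>lborel)"
          using f0 by (intro Bochner_Integration.integral_nonneg) auto
        with spl show "(\<integral>x. indicator {-\<eta>..\<eta>} x * fejer d x \<partial>lborel) \<le> 1" by linarith
        show "(\<integral>x. indicator (- {-\<eta>..\<eta>}) x * fejer d x \<partial>lborel) \<le> \<eta>" using spl conc by linarith
      qed (use r p01 K in auto)
      finally have "?A n \<eta> (b - 2 * \<eta>) u \<le> r * p u + \<eta> * (2 * K)" by simp
      moreover have "\<bar>?A n \<eta> (b - 2 * \<eta>) u - (b - 2 * \<eta> - \<eta>) / \<sigma> * ?g n u\<bar> < \<eta>" using elim(2) by blast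
      moreover have "\<eta> * (4 * K + 6 * G + 4) / 2 = \<eta> * (2 * K) + 3 * \<eta> * G + 2 * \<eta>" by (simp add: algebra_simps)
      ultimately show ?thesis using gG[of u] eta(1) eG unfolding bu by linarith
    qed
    show ?case
    proof
      fix u
      have "b / \<sigma> * ?g n u = b * G * ?g n u" by (simp add: G_def)
      then show "\<bar>sqrt (real n) * measure P {\<omega> \<in> space P. Z n \<omega> \<in> {u..<u + b}} - b / \<sigma> * ?g n u\<bar> < e"
        using lo[of u] up2[of u] eta_e
        unfolding p_def[symmetric] r_def[symmetric] by linarith
    qed
  qed
qed

end

section \<open>Isolated groups of points\<close>

lemma configs_finite: "X \<in> configs Q \<Longrightarrow> finite X"
  and configs_snd: "X \<in> configs Q \<Longrightarrow> p \<in> X \<Longrightarrow> snd p \<in> space Q"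
  by (auto simp: finite_subsets_def space_pair_measure)

lemma configs_subset: "X \<in> configs Q \<Longrightarrow> Y \<subseteq> X \<Longrightarrow> Y \<in> configs Q"
  by (auto simp: finite_subsets_def intro: finite_subset)

lemma configs_Un: "X \<in> configs Q \<Longrightarrow> Y \<in> configs Q \<Longrightarrow> X \<union> Y \<in> configs Q"
  by (auto simp: finite_subsets_def)

lemma mem_marked_ball: "X \<in> configs Q \<Longrightarrow> q \<in> X \<Longrightarrow> q \<in> marked_ball Q x (ereal r) \<longleftrightarrow> dist x (fst q) \<le> r"
  using configs_snd[of X Q q] by (cases q) (auto simp: marked_ball_def)

text \<open>The radius in the definition of the nearest neighbours is a minimum: on a finite configuration
  the number of points in a ball only changes at finitely many radii.\<close>

lemma least_nn_radius:
  fixes X :: "((real^'d) \<times> 'm) set"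
  assumes X: "X \<in> configs Q"
    and s: "0 \<le> s" "\<kappa> \<le> card ((X \<inter> marked_ball Q (fst p) (ereal s)) - {p})"
  defines "R \<equiv> \<lambda>r. 0 \<le> r \<and> \<kappa> \<le> card ((X \<inter> marked_ball Q (fst p) (ereal r)) - {p})"
  shows "\<exists>r. R r \<and> (\<forall>t. R t \<longrightarrow> r \<le> t)"
proof -
  define D where "D = insert 0 ((\<lambda>q. dist (fst p) (fst q)) ` X)"
  have D: "finite D" using configs_finite[OF X] by (simp add: D_def)
  have down: "\<exists>r\<in>D. R r \<and> r \<le> t" if t: "R t" for t
  proof (intro bexI conjI)
    let ?S = "{d\<in>D. d \<le> t}"
    have S: "finite ?S" "?S \<noteq> {}" using D t by (auto simp: D_def R_def)
    from Max_in[OF S] show "Max ?S \<in> D" "Max ?S \<le> t" by auto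
    have "X \<inter> marked_ball Q (fst p) (ereal (Max ?S)) = X \<inter> marked_ball Q (fst p) (ereal t)"
    proof (intro set_eqI iffI IntI; elim IntE)
      fix q assume q: "q \<in> X" "q \<in> marked_ball Q (fst p) (ereal t)"
      then have "dist (fst p) (fst q) \<in> ?S" using mem_marked_ball[OF X q(1)] by (auto simp: D_def)
      then show "q \<in> marked_ball Q (fst p) (ereal (Max ?S))"
        using mem_marked_ball[OF X q(1)] S by (auto intro: Max_ge)
    next
      fix q assume q: "q \<in> X" "q \<in> marked_ball Q (fst p) (ereal (Max ?S))"
      then show "q \<in> marked_ball Q (fst p) (ereal t)"
        using mem_marked_ball[OF X q(1)] \<open>Max ?S \<le> t\<close> by auto
    qed
    moreover have "0 \<le> Max ?S" using S t by (intro Max_ge) (auto simp: D_def R_def)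
    ultimately show "R (Max ?S)" using t by (simp add: R_def)
  qed
  let ?F = "{r\<in>D. R r}"
  have F: "finite ?F" using D by auto
  have "R s" using s by (simp add: R_def)
  with down have "?F \<noteq> {}" by blast
  from Min_in[OF F this] have "R (Min ?F)" by auto
  moreover have "Min ?F \<le> t" if t: "R t" for t
  proof -
    from down[OF t] obtain r where "r \<in> ?F" "r \<le> t" by blast
    with Min_le[OF F this(1)] show ?thesis by linarith
  qed
  ultimately show ?thesis by blast
qed

text \<open>If a ball of radius \<open>s\<close> around \<open>p\<close> already contains \<open>\<kappa>\<close> other points of \<open>X'\<close> and no point outside \<open>X'\<close>,
  then \<open>p\<close> has the same nearest neighbour radius, hence the same neighbourhood, in \<open>X\<close> and in \<open>X'\<close>.\<close>

lemma nn_functional_local: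
  fixes X :: "((real^'d) \<times> 'm) set"
  assumes nn: "depends_on_nearest_neighbours Q \<kappa> \<xi>"
    and X: "X \<in> configs Q" and sub: "X' \<subseteq> X" and p: "p \<in> X'" and s: "0 \<le> s"
    and near: "\<kappa> \<le> card {q \<in> X' - {p}. dist (fst p) (fst q) \<le> s}"
    and far: "\<And>q. q \<in> X - X' \<Longrightarrow> s < dist (fst p) (fst q)"
  shows "\<xi> p X = \<xi> p X'"
proof -
  have X': "X' \<in> configs Q" by (rule configs_subset[OF X sub])
  have finX: "finite X" "finite X'" using configs_finite X X' by auto
  have same: "X \<inter> marked_ball Q (fst p) (ereal r) = X' \<inter> marked_ball Q (fst p) (ereal r)" if "r \<le> s" for r
    using far that sub by (force simp: mem_marked_ball[OF X])
  define R where "R Y r \<longleftrightarrow> 0 \<le> r \<and> \<kappa> \<le> card ((Y \<inter> marked_ball Q (fst p) (ereal r)) - {p})" for Y and r :: real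
  have "{q \<in> X' - {p}. dist (fst p) (fst q) \<le> s} = (X' \<inter> marked_ball Q (fst p) (ereal s)) - {p}"
    by (auto simp: mem_marked_ball[OF X'])
  then have R's: "R X' s" using near s by (simp add: R_def)
  then have Rs: "R X s" using same[of s] by (simp add: R_def)
  have ex: "\<exists>r. R Y r \<and> (\<forall>t. R Y t \<longrightarrow> r \<le> t)" if "Y \<in> configs Q" "R Y s" for Y
    using least_nn_radius[OF that(1) s, of \<kappa> p] that(2) unfolding R_def by auto
  from ex[OF X Rs] obtain r where r: "R X r" "\<And>t. R X t \<Longrightarrow> r \<le> t" by blast
  from ex[OF X' R's] obtain r' where r': "R X' r'" "\<And>t. R X' t \<Longrightarrow> r' \<le> t" by blast
  have rs: "r \<le> s" "r' \<le> s" using r(2)[OF Rs] r'(2)[OF R's] by auto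
  have "R X' r" "R X r'" using r(1) r'(1) same[OF rs(1)] same[OF rs(2)] by (auto simp: R_def)
  then have rr: "r' = r" using r(2) r'(2) by (simp add: antisym)
  have card: "\<kappa> < card X'"
  proof -
    have "\<kappa> \<le> card (X' - {p})"
      by (rule order_trans[OF near], rule card_mono) (use finX in auto)
    then show ?thesis using p finX card_Suc_Diff1[of X' p] by simp
  qed
  then have cardX: "\<kappa> < card X" using card_mono[OF finX(1) sub] by simp
  have L: "nn_radius Q \<kappa> p X = ereal r" "nn_radius Q \<kappa> p X' = ereal r"
    using card cardX r r' rr unfolding nn_radius_def R_def
    by (auto intro!: Least_equality)
  have "\<xi> p X = \<xi> p (X \<inter> marked_ball Q (fst p) (ereal r))"
    using nn X subsetD[OF sub p] L unfolding depends_on_nearest_neighbours_def by auto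
  also have "\<dots> = \<xi> p (X' \<inter> marked_ball Q (fst p) (ereal r))" using same[OF rs(1)] by simp
  also have "\<dots> = \<xi> p X'"
    using nn X' p L unfolding depends_on_nearest_neighbours_def by auto
  finally show ?thesis .
qed

text \<open>Every guard position \<open>y + g\<close> is occupied up to \<open>\<epsilon>\<close>, and within distance \<open>A\<close> of \<open>y\<close> there is nothing
  but guards.\<close>

definition guarded :: "real \<Rightarrow> (real^'d) set \<Rightarrow> real \<Rightarrow> real^'d \<Rightarrow> ((real^'d) \<times> 'm) set \<Rightarrow> bool" where
  "guarded A G \<epsilon> y B \<longleftrightarrow>
     (\<forall>g\<in>G. \<exists>p\<in>B. dist (y + g) (fst p) < \<epsilon>) \<and>
     (\<forall>p\<in>B. dist y (fst p) \<le> A \<longrightarrow> (\<exists>g\<in>G. dist (y + g) (fst p) < \<epsilon>))"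

text \<open>A block of \<open>m\<close> points within distance \<open>K\<close> of a centre contributes additively as soon as its
  surroundings are guarded. The block size is fixed because nearest neighbour functionals need more
  than \<open>\<kappa>\<close> points inside; the guard zones lie strictly between the radii \<open>K\<close> and \<open>A\<close>.\<close>

definition isolation :: "'m measure \<Rightarrow> (((real^'d) \<times> 'm) set \<Rightarrow> real) \<Rightarrow> nat \<Rightarrow> real \<Rightarrow>
    real \<Rightarrow> (real^'d) set \<Rightarrow> real \<Rightarrow> bool" where
  "isolation Q H m K A G \<epsilon> \<longleftrightarrow> 0 < \<epsilon> \<and> 0 < K \<and> K < A \<and> finite G \<and>
     (\<forall>g\<in>G. K + \<epsilon> < norm g \<and> norm g + \<epsilon> < A) \<and>
     (\<forall>y. \<forall>V\<in>configs Q. \<forall>B\<in>configs Q. card V = m \<longrightarrow> (\<forall>p\<in>V. dist y (fst p) \<le> K) \<longrightarrow>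
        guarded A G \<epsilon> y B \<longrightarrow> H (V \<union> B) = H V + H B)"

text \<open>With finite range \<open>\<tau>\<close> an empty shell of width \<open>\<tau> + 1\<close> suffices, without guards.\<close>

lemma finite_range_isolation:
  assumes fr: "finite_range_interactions Q H" and H0: "H {} = 0" and K: "0 < K"
  shows "\<exists>A G \<epsilon>. isolation Q H m K A G \<epsilon>"
proof -
  obtain \<tau> where tau: "\<tau> > 0" "\<And>X Y. X \<in> configs Q \<Longrightarrow> Y \<in> configs Q \<Longrightarrow> X \<noteq> {} \<Longrightarrow> Y \<noteq> {} \<Longrightarrow>
      marked_dist X Y > \<tau> \<Longrightarrow> H (X \<union> Y) = H X + H Y"
    using fr unfolding finite_range_interactions_def by blast
  have "H (V \<union> B) = H V + H B"
    if V: "V \<in> configs Q" "\<forall>p\<in>V. dist y (fst p) \<le> K" and B: "B \<in> configs Q" "guarded (K + \<tau> + 1) {} 1 y B"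
    for y V B
  proof (cases "V = {} \<or> B = {}")
    case False
    have "\<tau> + 1 \<le> marked_dist V B" unfolding marked_dist_def
    proof (rule le_setdistI)
      fix x z assume "x \<in> fst ` V" "z \<in> fst ` B"
      then have "dist y x \<le> K" "K + \<tau> + 1 < dist y z"
        using V(2) B(2) by (auto simp: guarded_def not_le)
      then show "\<tau> + 1 \<le> dist x z" using dist_triangle[of y z x] by linarith
    qed (use False in auto)
    then show ?thesis using tau(2)[OF V(1) B(1)] False by auto
  qed (use H0 in auto)
  then have "isolation Q H m K (K + \<tau> + 1) {} 1"
    using K tau by (auto simp: isolation_def)
  then show ?thesis by blast
qed

lemma finite_set_separated:
  fixes G :: "'a::metric_space set"
  assumes "finite G"
  shows "\<exists>\<epsilon>>0. \<epsilon> \<le> 1/2 \<and> (\<forall>g\<in>G. \<forall>g'\<in>G. g \<noteq> g' \<longrightarrow> 2 * \<epsilon> < dist g g')"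
proof -
  define D where "D = insert 1 ((\<lambda>(g, g'). dist g g') ` {(g, g'). g \<in> G \<and> g' \<in> G \<and> g \<noteq> g'})"
  have "{(g, g'). g \<in> G \<and> g' \<in> G \<and> g \<noteq> g'} \<subseteq> G \<times> G" by auto
  then have "finite {(g, g'). g \<in> G \<and> g' \<in> G \<and> g \<noteq> g'}" using assms by (simp add: finite_subset)
  then have D: "finite D" unfolding D_def by simp
  have pos: "0 < Min D" using D by (subst Min_gr_iff) (auto simp: D_def)
  have "Min D \<le> dist g g'" if "g \<in> G" "g' \<in> G" "g \<noteq> g'" for g g'
    using D that by (intro Min_le) (auto simp: D_def)
  moreover have "Min D \<le> 1" using D by (intro Min_le) (auto simp: D_def)
  ultimately show ?thesis using pos by (intro exI[of _ "Min D / 3"]) force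
qed

text \<open>The guards are placed on rays: \<open>\<kappa> + 1\<close> consecutive positions, far from the centre compared with
  \<open>K\<close> and \<open>\<kappa>\<close>, in each direction of a \<open>1/2\<close>-net \<open>N\<close> of the unit sphere. A point \<open>p\<close> at distance
  \<open>D\<close> from the centre finds \<open>\<kappa>\<close> guards other than itself within distance \<open>D - K - 1\<close>, whereas the block
  has distance at least \<open>D - K\<close> from it; so the block is invisible to it. Conversely, the points of the
  block are at mutual distance at most \<open>2 K\<close> and more than \<open>\<kappa>\<close> in number, so that they do not see
  beyond the block.\<close>

lemma nearest_neighbour_isolation:
  fixes H :: "((real^'d) \<times> 'm) set \<Rightarrow> real"
  assumes nn: "depends_on_nearest_neighbours Q \<kappa> \<xi>"
    and H: "\<And>X. X \<in> configs Q \<Longrightarrow> H X = induced_functional \<xi> X"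
    and m: "\<kappa> < m" and K: "0 < K"
  shows "\<exists>A G \<epsilon>. isolation Q H m K A G \<epsilon>"
proof -
  obtain N :: "(real^'d) set"
    where N: "finite N" "N \<subseteq> sphere 0 1" "sphere 0 1 \<subseteq> (\<Union>x\<in>N. ball x (1/2))"
  proof (rule compactE_image[of "sphere 0 1 :: (real^'d) set" "sphere 0 1" "\<lambda>x. ball x (1/2)"])
    show "sphere 0 1 \<subseteq> (\<Union>x\<in>sphere 0 1. ball x (1/2) :: (real^'d) set)" by force
  qed auto
  \<comment> \<open>The radii of the guards on a ray increase in unit steps; the first one is large compared with \<open>K\<close> and \<open>\<kappa>\<close>.\<close>
  define a where "a k = 4 * K + 4 + real \<kappa> + real k" for k :: nat
  have a: "4 * K + 4 + real \<kappa> \<le> a k" for k by (simp add: a_def)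
  define G where "G = (\<lambda>(k, e). a k *\<^sub>R e) ` ({..\<kappa>} \<times> N)"
  have G: "finite G" using N by (simp add: G_def)
  obtain \<epsilon> where eps: "\<epsilon> > 0" "\<epsilon> \<le> 1/2" "\<And>g g'. g \<in> G \<Longrightarrow> g' \<in> G \<Longrightarrow> g \<noteq> g' \<Longrightarrow> 2 * \<epsilon> < dist g g'"
    using finite_set_separated[OF G] by blast
  define A where "A = a \<kappa> + 1"
  have normG: "norm (a k *\<^sub>R e) = a k" if "e \<in> N" for k e
    using that N(2) a[of k] K by (auto simp: subset_iff)
  have ak: "0 < a k" for k unfolding a_def using K by (intro add_pos_nonneg) auto
  have inG: "a k *\<^sub>R e \<in> G" if "k \<le> \<kappa>" "e \<in> N" for k e using that by (force simp: G_def)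
  have add: "H (V \<union> B) = H V + H B"
    if V: "V \<in> configs Q" "card V = m" "\<forall>p\<in>V. dist y (fst p) \<le> K"
      and B: "B \<in> configs Q" "guarded A G \<epsilon> y B" for y V B
  proof -
    have fin: "finite V" "finite B" using V B configs_finite by auto
    have guard: "\<exists>p\<in>B. dist (y + g) (fst p) < \<epsilon>" if "g \<in> G" for g
      using B(2) that by (auto simp: guarded_def)
    have Bfar: "4 * K + 3 + real \<kappa> \<le> dist y (fst p)" if "p \<in> B" for p
    proof (cases "dist y (fst p) \<le> A")
      case True
      then obtain g where g: "g \<in> G" "dist (y + g) (fst p) < \<epsilon>" using B(2) \<open>p \<in> B\<close> by (auto simp: guarded_def)
      then have "4 * K + 4 + real \<kappa> \<le> norm g" using normG a by (auto simp: G_def)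
      moreover have "norm g \<le> dist y (fst p) + dist (y + g) (fst p)"
        using dist_triangle[of y "y + g" "fst p"] by (simp add: dist_commute dist_norm)
      ultimately show ?thesis using g eps by linarith
    next
      case False
      then show ?thesis using a[of \<kappa>] K unfolding A_def by linarith
    qed
    have disj: "V \<inter> B = {}"
    proof -
      have False if "p \<in> V" "p \<in> B" for p
        using V(3) Bfar[OF that(2)] that(1) K by force
      then show ?thesis by blast
    qed
    have xiV: "\<xi> p (V \<union> B) = \<xi> p V" if p: "p \<in> V" for p
    proof (rule nn_functional_local[OF nn configs_Un[OF V(1) B(1)] _ p, of "2 * K"])
      have "dist (fst p) (fst q) \<le> 2 * K" if "q \<in> V" for q
        using bspec[OF V(3) p] bspec[OF V(3) that] dist_triangle3[of "fst p" "fst q" y] by linarith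
      then have "{q \<in> V - {p}. dist (fst p) (fst q) \<le> 2 * K} = V - {p}" by auto
      then show "\<kappa> \<le> card {q \<in> V - {p}. dist (fst p) (fst q) \<le> 2 * K}"
        using V(2) m p fin by simp
      fix q assume "q \<in> V \<union> B - V"
      then have "4 * K + 3 + real \<kappa> \<le> dist y (fst q)" using Bfar[of q] by blast
      moreover have "dist y (fst p) \<le> K" using V(3) p by auto
      ultimately show "2 * K < dist (fst p) (fst q)"
        using dist_triangle[of y "fst q" "fst p"] K by linarith
    qed (use K in auto)
    have xiB: "\<xi> p (V \<union> B) = \<xi> p B" if p: "p \<in> B" for p
    proof -
      define D where "D = dist y (fst p)"
      have Vd: "D - K \<le> dist (fst p) (fst q)" if "q \<in> V" for q
        using bspec[OF V(3) that] dist_triangle[of y "fst p" "fst q"] by (simp add: D_def dist_commute)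
      \<comment> \<open>A point that is itself a guard uses its own ray. A point beyond distance \<open>A\<close> uses the ray closest to its own direction.\<close>
      have "\<exists>e\<in>N. \<forall>k\<le>\<kappa>. \<forall>q. dist (y + a k *\<^sub>R e) (fst q) < \<epsilon> \<longrightarrow> dist (fst p) (fst q) \<le> D - K - 1"
      proof (cases "D \<le> A")
        case True
        then obtain g where g: "g \<in> G" "dist (y + g) (fst p) < \<epsilon>"
          using B(2) p by (auto simp: guarded_def D_def)
        then obtain j e where je: "j \<le> \<kappa>" "e \<in> N" "g = a j *\<^sub>R e" by (auto simp: G_def)
        show ?thesis
        proof (intro bexI[of _ e] allI impI)
          fix k q assume k: "k \<le> \<kappa>" and q: "dist (y + a k *\<^sub>R e) (fst q) < \<epsilon>"
          have "dist (y + a k *\<^sub>R e) (y + a j *\<^sub>R e) = \<bar>a k - a j\<bar>"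
            using je N(2) by (auto simp: dist_norm subset_iff simp flip: scaleR_diff_left)
          also have "\<dots> \<le> real \<kappa>" using k je by (auto simp: a_def)
          finally have "dist (fst p) (fst q) \<le> \<epsilon> + real \<kappa> + \<epsilon>"
            using dist_triangle[of "fst p" "fst q" "y + a j *\<^sub>R e"] dist_triangle[of "y + a j *\<^sub>R e" "fst q" "y + a k *\<^sub>R e"]
              q g je by (simp add: dist_commute)
          moreover have "4 * K + 3 + real \<kappa> \<le> D" using Bfar[OF p] by (simp add: D_def)
          ultimately show "dist (fst p) (fst q) \<le> D - K - 1" using eps K by linarith
        qed (use je in auto)
      next
        case False
        then have D: "a k \<le> D" if "k \<le> \<kappa>" for k using that by (simp add: A_def a_def)
        have D0: "0 < D" using D[of 0] ak[of 0] by simp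
        define e0 where "e0 = (1 / D) *\<^sub>R (fst p - y)"
        have "norm e0 = 1" using D0 by (simp add: e0_def D_def dist_norm norm_minus_commute)
        then obtain e where e: "e \<in> N" "dist e e0 < 1/2" using N(3) by (auto simp: subset_iff)
        show ?thesis
        proof (intro bexI[of _ e] allI impI)
          fix k q assume k: "k \<le> \<kappa>" and q: "dist (y + a k *\<^sub>R e) (fst q) < \<epsilon>"
          have pe: "fst p = y + D *\<^sub>R e0" using D0 by (simp add: e0_def)
          have "dist (fst p) (y + a k *\<^sub>R e0) = D - a k"
            using \<open>norm e0 = 1\<close> D[OF k] by (simp add: pe dist_norm flip: scaleR_diff_left)
          moreover have "dist (y + a k *\<^sub>R e0) (y + a k *\<^sub>R e) \<le> a k * (1/2)"
            using e(2) ak[of k] by (simp add: dist_norm norm_minus_commute flip: scaleR_diff_right)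
          ultimately have "dist (fst p) (fst q) \<le> (D - a k) + a k / 2 + \<epsilon>"
            using dist_triangle[of "fst p" "fst q" "y + a k *\<^sub>R e"] dist_triangle[of "fst p" "y + a k *\<^sub>R e" "y + a k *\<^sub>R e0"] q
            by linarith
          then show "dist (fst p) (fst q) \<le> D - K - 1" using a[of k] K eps by (simp add: field_simps)
        qed (use e in auto)
      qed
      then obtain e where e: "e \<in> N" "\<And>k q. k \<le> \<kappa> \<Longrightarrow> dist (y + a k *\<^sub>R e) (fst q) < \<epsilon> \<Longrightarrow> dist (fst p) (fst q) \<le> D - K - 1"
        by blast
      have "\<forall>k. \<exists>q. k \<le> \<kappa> \<longrightarrow> q \<in> B \<and> dist (y + a k *\<^sub>R e) (fst q) < \<epsilon>"
        using guard inG e(1) by blast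
      then obtain w where w: "\<And>k. k \<le> \<kappa> \<Longrightarrow> w k \<in> B" "\<And>k. k \<le> \<kappa> \<Longrightarrow> dist (y + a k *\<^sub>R e) (fst (w k)) < \<epsilon>"
        by metis
      have "inj_on w {..\<kappa>}"
      proof (rule inj_onI, rule ccontr)
        fix j k assume jk: "j \<in> {..\<kappa>}" "k \<in> {..\<kappa>}" "w j = w k" "j \<noteq> k"
        have ne: "norm e = 1" using e N(2) by auto
        then have "a j *\<^sub>R e \<noteq> a k *\<^sub>R e" using jk by (auto simp: a_def)
        then have 1: "2 * \<epsilon> < dist (a j *\<^sub>R e) (a k *\<^sub>R e)" using jk e by (intro eps inG) auto
        have 2: "dist (a j *\<^sub>R e) (a k *\<^sub>R e) = dist (y + a j *\<^sub>R e) (y + a k *\<^sub>R e)" by simp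
        have 3: "dist (y + a j *\<^sub>R e) (y + a k *\<^sub>R e) \<le> dist (y + a j *\<^sub>R e) (fst (w j)) + dist (y + a k *\<^sub>R e) (fst (w k))"
          unfolding jk(3) by (rule dist_triangle2)
        have "dist (y + a j *\<^sub>R e) (fst (w j)) < \<epsilon>" "dist (y + a k *\<^sub>R e) (fst (w k)) < \<epsilon>"
          using w(2)[of j] w(2)[of k] jk(1,2) by simp_all
        with 1 2 3 show False by linarith
      qed
      then have cw: "card (w ` {..\<kappa>}) = Suc \<kappa>" by (simp add: card_image)
      have "w ` {..\<kappa>} - {p} \<subseteq> {q \<in> B - {p}. dist (fst p) (fst q) \<le> D - K - 1}"
        using w e(2) by auto
      then have "card (w ` {..\<kappa>} - {p}) \<le> card {q \<in> B - {p}. dist (fst p) (fst q) \<le> D - K - 1}"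
        using fin by (intro card_mono) auto
      moreover have "\<kappa> \<le> card (w ` {..\<kappa>} - {p})"
        using cw by (simp add: card_Diff_singleton_if)
      ultimately have near: "\<kappa> \<le> card {q \<in> B - {p}. dist (fst p) (fst q) \<le> D - K - 1}" by simp
      show ?thesis
      proof (rule nn_functional_local[OF nn configs_Un[OF V(1) B(1)] _ p _ near])
        show "0 \<le> D - K - 1" using Bfar[OF p] K by (simp add: D_def)
        fix q assume "q \<in> V \<union> B - B"
        then show "D - K - 1 < dist (fst p) (fst q)" using Vd[of q] by auto
      qed auto
    qed
    have "H (V \<union> B) = (\<Sum>p\<in>V. \<xi> p (V \<union> B)) + (\<Sum>p\<in>B. \<xi> p (V \<union> B))"
      using H[OF configs_Un[OF V(1) B(1)]] fin disj by (simp add: induced_functional_def sum.union_disjoint)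
    also have "\<dots> = H V + H B"
      using H[OF V(1)] H[OF B(1)] xiV xiB by (simp add: induced_functional_def)
    finally show ?thesis .
  qed
  have radii: "K + \<epsilon> < norm g \<and> norm g + \<epsilon> < A" if "g \<in> G" for g
  proof -
    from that obtain k e where ke: "k \<le> \<kappa>" "e \<in> N" "g = a k *\<^sub>R e" by (auto simp: G_def)
    have "a k \<le> a \<kappa>" using ke by (simp add: a_def)
    moreover have "norm g = a k" using normG[OF ke(2)] ke(3) by blast
    ultimately show ?thesis using a[of k] K eps(1,2) unfolding A_def by linarith
  qed
  have KA: "K < A" using a[of \<kappa>] K unfolding A_def by linarith
  have "isolation Q H m K A G \<epsilon>"
    unfolding isolation_def using eps(1) K KA G radii add by blast
  then show ?thesis by blast
qed

section \<open>Functionals of independent marked points\<close>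

text \<open>The functional of an indexed family of points. Families with coinciding locations form a null set
  for the laws below; the value \<open>0\<close> there makes the function measurable, since the counting maps that
  generate the measurable sets of configurations are sums of indicators only where the points are
  distinct.\<close>

definition config_value :: "(((real^'d) \<times> 'm) set \<Rightarrow> real) \<Rightarrow> 'i set \<Rightarrow> ('i \<Rightarrow> (real^'d) \<times> 'm) \<Rightarrow> real" where
  "config_value H I x = (if inj_on (\<lambda>i. fst (x i)) I then H (x ` I) else 0)"

lemma space_finite_config: "space (finite_config E) = finite_subsets E"
  unfolding finite_config_def by (rule space_measure_of) auto

lemma distinct_locations_measurable:
  assumes I: "finite I"
  shows "{x \<in> space (PiM I (\<lambda>_. marked_space Q)). inj_on (\<lambda>i. fst (x i) :: real^'d) I} \<in> sets (PiM I (\<lambda>_. marked_space Q))"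
proof -
  have "{x \<in> space (PiM I (\<lambda>_. marked_space Q)). inj_on (\<lambda>i. fst (x i) :: real^'d) I} =
     {x \<in> space (PiM I (\<lambda>_. marked_space Q)). \<forall>i\<in>I. \<forall>j\<in>I. (fst (x i) :: real^'d) = fst (x j) \<longrightarrow> i = j}"
    by (auto simp: inj_on_def)
  also have "\<dots> \<in> sets (PiM I (\<lambda>_. marked_space Q))"
  proof (intro sets.sets_Collect_finite_All I)
    fix i j assume "i \<in> I" "j \<in> I"
    then have [measurable]: "(\<lambda>x. fst (x i) :: real^'d) \<in> borel_measurable (PiM I (\<lambda>_. marked_space Q))"
      "(\<lambda>x. fst (x j) :: real^'d) \<in> borel_measurable (PiM I (\<lambda>_. marked_space Q))"
      by (auto intro!: measurable_compose[OF measurable_component_singleton])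
    have "{x \<in> space (PiM I (\<lambda>_. marked_space Q)). (fst (x i) :: real^'d) = fst (x j) \<longrightarrow> i = j}
      = {x \<in> space (PiM I (\<lambda>_. marked_space Q)). dist (fst (x i) :: real^'d) (fst (x j)) = 0 \<longrightarrow> i = j}" by simp
    also have "\<dots> \<in> sets (PiM I (\<lambda>_. marked_space Q))" by measurable
    finally show "{x \<in> space (PiM I (\<lambda>_. marked_space Q)). (fst (x i) :: real^'d) = fst (x j) \<longrightarrow> i = j} \<in> sets (PiM I (\<lambda>_. marked_space Q))" .
  qed
  finally show ?thesis .
qed

lemma config_value_measurable:
  fixes H :: "((real^'d) \<times> 'm) set \<Rightarrow> real"
  assumes I: "finite I" and H[measurable]: "H \<in> borel_measurable (finite_config (marked_space Q))"
  shows "config_value H I \<in> borel_measurable (PiM I (\<lambda>_. marked_space Q))"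
proof -
  let ?E = "marked_space Q :: ((real^'d) \<times> 'm) measure"
  let ?M = "PiM I (\<lambda>_. ?E)"
  let ?A = "{x. inj_on (\<lambda>i. fst (x i)) I}"
  have A: "{x \<in> space ?M. inj_on (\<lambda>i. fst (x i)) I} \<in> sets ?M" by (rule distinct_locations_measurable[OF I])
  then have A': "?A \<inter> space ?M \<in> sets ?M" by (simp add: Int_def conj_commute)
  have "(\<lambda>x. x ` I) \<in> measurable (restrict_space ?M ?A) (finite_config ?E)"
    unfolding finite_config_def
  proof (rule measurable_measure_of)
    show "(\<lambda>x. x ` I) \<in> space (restrict_space ?M ?A) \<rightarrow> finite_subsets ?E"
      using I by (auto simp: space_restrict_space finite_subsets_def space_PiM)
    fix Y assume "Y \<in> {{X \<in> finite_subsets ?E. card (X \<inter> B) = k} |B k. B \<in> sets ?E}"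
    then obtain B k where B[measurable]: "B \<in> sets ?E" and Y: "Y = {X \<in> finite_subsets ?E. card (X \<inter> B) = k}" by auto
    have "card (x ` I \<inter> B) = (\<Sum>i\<in>I. if x i \<in> B then 1 else 0)" if "inj_on (\<lambda>i. fst (x i)) I" for x
    proof -
      have "inj_on x I" using that by (auto simp: inj_on_def)
      then have "card (x ` {i\<in>I. x i \<in> B}) = card {i\<in>I. x i \<in> B}" by (intro card_image) (auto intro: inj_on_subset)
      moreover have "x ` I \<inter> B = x ` {i\<in>I. x i \<in> B}" by auto
      moreover have "card {i\<in>I. x i \<in> B} = (\<Sum>i\<in>I. if x i \<in> B then 1 else 0)"
        using I by (simp add: sum.If_cases Int_def)
      ultimately show ?thesis by simp
    qed
    then have "(\<lambda>x. x ` I) -` Y \<inter> space (restrict_space ?M ?A) = {x \<in> space ?M \<inter> ?A. (\<Sum>i\<in>I. if x i \<in> B then 1 else 0) = k}"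
      using I unfolding Y by (auto simp: space_restrict_space finite_subsets_def space_PiM)
    also have "\<dots> = (?A \<inter> space ?M) \<inter> {x \<in> space ?M. (\<Sum>i\<in>I. if x i \<in> B then 1 else 0) = k}" by auto
    also have "{x \<in> space ?M. (\<Sum>i\<in>I. if x i \<in> B then 1 else 0) = k} \<in> sets ?M"
      by measurable
    then have "(?A \<inter> space ?M) \<inter> {x \<in> space ?M. (\<Sum>i\<in>I. if x i \<in> B then 1 else 0) = k} \<in> sets (restrict_space ?M ?A)"
      using A' by (subst sets_restrict_space_iff[OF A']) blast
    finally show "(\<lambda>x. x ` I) -` Y \<inter> space (restrict_space ?M ?A) \<in> sets (restrict_space ?M ?A)" .
  qed auto
  then have "(\<lambda>x. H (x ` I)) \<in> borel_measurable (restrict_space ?M ?A)" by measurable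
  then have "(\<lambda>x. if inj_on (\<lambda>i. fst (x i)) I then H (x ` I) else 0) \<in> borel_measurable ?M"
    using A by (subst measurable_If_restrict_space_iff) auto
  then show ?thesis by (simp add: config_value_def[abs_def])
qed

text \<open>A comparison \<open>N \<le> C M\<close> of measures on \<open>S\<close> is inherited by powers, with constant \<open>C ^ card I\<close>.\<close>

lemma product_nn_integral_le:
  fixes N M :: "'a measure" and C :: ennreal and F :: "('i \<Rightarrow> 'a) \<Rightarrow> ennreal"
  assumes sf: "sigma_finite_measure N" "sigma_finite_measure M"
    and sets: "sets N = sets M" and S[measurable]: "S \<in> sets M"
    and le: "\<And>A. A \<in> sets M \<Longrightarrow> emeasure N (A \<inter> S) \<le> C * emeasure M A"
    and I: "finite I" and F: "F \<in> borel_measurable (PiM I (\<lambda>_. M))"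
  shows "(\<integral>\<^sup>+x. F x * (\<Prod>i\<in>I. indicator S (x i)) \<partial>PiM I (\<lambda>_. N)) \<le> C ^ card I * (\<integral>\<^sup>+x. F x \<partial>PiM I (\<lambda>_. M))"
proof -
  interpret N: sigma_finite_measure N by fact
  interpret M: sigma_finite_measure M by fact
  interpret PN: product_sigma_finite "\<lambda>_. N" ..
  interpret PM: product_sigma_finite "\<lambda>_. M" ..
  have sP: "sets (PiM J (\<lambda>_. N)) = sets (PiM J (\<lambda>_. M))" for J :: "'i set"
    by (rule sets_PiM_cong) (simp_all add: sets)
  have mP: "borel_measurable (PiM J (\<lambda>_. N)) = (borel_measurable (PiM J (\<lambda>_. M)) :: (('i \<Rightarrow> 'a) \<Rightarrow> ennreal) set)" for J :: "'i set"
    by (rule measurable_cong_sets) (simp_all add: sP)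
  have SN: "S \<in> sets N" using sets S by simp
  have one: "(\<integral>\<^sup>+x. f x * indicator S x \<partial>N) \<le> C * (\<integral>\<^sup>+x. f x \<partial>M)" if f: "f \<in> borel_measurable M" for f
  proof -
    have fN: "f \<in> borel_measurable N" using f measurable_cong_sets[OF sets refl] by auto
    have "(\<integral>\<^sup>+x. f x * indicator S x \<partial>N) = (\<integral>\<^sup>+x. f x \<partial>density N (indicator S))"
      using fN SN by (subst nn_integral_density) (auto simp: mult.commute)
    also have "\<dots> \<le> (\<integral>\<^sup>+x. f x \<partial>scale_measure C M)"
    proof (intro nn_integral_mono_measure)
      show "sets (density N (indicator S)) = sets (scale_measure C M)" by (simp add: sets)
      show "density N (indicator S) \<le> scale_measure C M"
        using le SN sets by (subst le_measure) (auto simp: emeasure_restricted Int_commute)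
    qed
    also have "\<dots> = C * (\<integral>\<^sup>+x. f x \<partial>M)" using f by (simp add: nn_integral_scale_measure)
    finally show ?thesis .
  qed
  have pm: "(\<lambda>x. \<Prod>i\<in>J. indicator S (x i) :: ennreal) \<in> borel_measurable (PiM J' (\<lambda>_. M))" if "J \<subseteq> J'" for J J' :: "'i set"
  proof (rule borel_measurable_prod_ennreal)
    fix i assume "i \<in> J"
    then have "(\<lambda>x. x i) \<in> measurable (PiM J' (\<lambda>_. M)) M" using that by (intro measurable_component_singleton) auto
    then show "(\<lambda>x. indicator S (x i) :: ennreal) \<in> borel_measurable (PiM J' (\<lambda>_. M))"
      by (rule measurable_compose) (rule borel_measurable_indicator[OF S])
  qed
  show ?thesis using I F
  proof (induction I arbitrary: F)
    case empty
    then show ?case by (simp add: PiM_empty nn_integral_count_space_finite)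
  next
    case (insert i I)
    have F: "F \<in> borel_measurable (PiM (insert i I) (\<lambda>_. M))"
      using insert.prems by auto
    have FN: "(\<lambda>x. F x * (\<Prod>i\<in>insert i I. indicator S (x i))) \<in> borel_measurable (PiM (insert i I) (\<lambda>_. N))"
      unfolding mP by (intro borel_measurable_times_ennreal F pm) auto
    have m2: "(\<lambda>y. F (x(i := y))) \<in> borel_measurable M" if "x \<in> space (PiM I (\<lambda>_. M))" for x
      using measurable_comp[OF measurable_component_update[OF that insert.hyps(2)] F(1)] by (simp add: comp_def)
    have m3: "(\<lambda>x. \<integral>\<^sup>+y. F (x(i := y)) \<partial>M) \<in> borel_measurable (PiM I (\<lambda>_. M))"
      using F(1) by measurable
    have upd: "(\<Prod>k\<in>I. indicator S ((x(i := y)) k)) = (\<Prod>k\<in>I. indicator S (x k) :: ennreal)" for x y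
      using insert.hyps by (intro prod.cong) auto
    have "(\<integral>\<^sup>+x. F x * (\<Prod>i\<in>insert i I. indicator S (x i)) \<partial>PiM (insert i I) (\<lambda>_. N))
       = (\<integral>\<^sup>+x. (\<integral>\<^sup>+y. F (x(i := y)) * (\<Prod>k\<in>insert i I. indicator S ((x(i := y)) k)) \<partial>N) \<partial>PiM I (\<lambda>_. N))"
      by (rule PN.product_nn_integral_insert[OF insert.hyps FN])
    also have "\<dots> = (\<integral>\<^sup>+x. (\<integral>\<^sup>+y. F (x(i := y)) * indicator S y * (\<Prod>k\<in>I. indicator S (x k)) \<partial>N) \<partial>PiM I (\<lambda>_. N))"
      unfolding prod.insert[OF insert.hyps] upd by (simp add: mult.assoc)
    also have "\<dots> \<le> (\<integral>\<^sup>+x. (C * (\<integral>\<^sup>+y. F (x(i := y)) \<partial>M)) * (\<Prod>k\<in>I. indicator S (x k)) \<partial>PiM I (\<lambda>_. N))"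
    proof (rule nn_integral_mono)
      fix x assume "x \<in> space (PiM I (\<lambda>_. N))"
      then have x: "x \<in> space (PiM I (\<lambda>_. M))" using sets_eq_imp_space_eq[OF sP] by auto
      have mN: "(\<lambda>y. F (x(i := y)) * indicator S y) \<in> borel_measurable N"
        unfolding measurable_cong_sets[OF sets refl]
        by (rule borel_measurable_times_ennreal[OF m2[OF x] borel_measurable_indicator[OF S]])
      show "(\<integral>\<^sup>+y. F (x(i := y)) * indicator S y * (\<Prod>k\<in>I. indicator S (x k)) \<partial>N)
         \<le> (C * (\<integral>\<^sup>+y. F (x(i := y)) \<partial>M)) * (\<Prod>k\<in>I. indicator S (x k))"
        unfolding nn_integral_multc[OF mN] by (intro mult_right_mono one m2 x) auto
    qed
    also have "\<dots> \<le> C ^ card I * (\<integral>\<^sup>+x. C * (\<integral>\<^sup>+y. F (x(i := y)) \<partial>M) \<partial>PiM I (\<lambda>_. M))"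
      by (rule insert.IH, rule borel_measurable_times_ennreal[OF borel_measurable_const m3])
    also have "\<dots> = C ^ card (insert i I) * (\<integral>\<^sup>+x. (\<integral>\<^sup>+y. F (x(i := y)) \<partial>M) \<partial>PiM I (\<lambda>_. M))"
      using m3 insert.hyps by (simp add: nn_integral_cmult mult_ac)
    also have "(\<integral>\<^sup>+x. (\<integral>\<^sup>+y. F (x(i := y)) \<partial>M) \<partial>PiM I (\<lambda>_. M)) = (\<integral>\<^sup>+x. F x \<partial>PiM (insert i I) (\<lambda>_. M))"
      by (rule PM.product_nn_integral_insert[OF insert.hyps F(1), symmetric])
    finally show ?case .
  qed
qed

lemma AE_distinct_locations:
  fixes M :: "((real^'d) \<times> 'm) measure"
  assumes M: "prob_space M" "sets M = sets (marked_space Q)" and na: "\<And>a. AE q in M. fst q \<noteq> a" and I: "finite I"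
  shows "AE x in PiM I (\<lambda>_. M). inj_on (\<lambda>i. fst (x i)) I"
proof -
  interpret prob_space M by fact
  interpret P: product_prob_space "\<lambda>_. M" I ..
  have ne: "AE x in PiM I (\<lambda>_. M). fst (x i) \<noteq> fst (x j)" if ij: "i \<in> I" "j \<in> I" "i \<noteq> j" for i j
  proof -
    have cm: "(\<lambda>x. fst (x k) :: real^'d) \<in> borel_measurable (PiM I (\<lambda>_. M))" if "k \<in> I" for k
      using that M(2) by (intro measurable_compose[OF measurable_component_singleton]) 
        (auto simp: measurable_cong_sets[OF M(2) refl])
    define J where "J = I - {i}"
    have J: "finite J" "i \<notin> J" "insert i J = I" "j \<in> J" using I ij by (auto simp: J_def)
    have "{x \<in> space (PiM I (\<lambda>_. M)). dist (fst (x i)) (fst (x j)) = 0} \<in> sets (PiM I (\<lambda>_. M))"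
      using cm[OF ij(1)] cm[OF ij(2)] by measurable
    then have m: "{x \<in> space (PiM I (\<lambda>_. M)). fst (x i) = fst (x j)} \<in> sets (PiM I (\<lambda>_. M))" by simp
    have "emeasure (PiM I (\<lambda>_. M)) {x \<in> space (PiM I (\<lambda>_. M)). fst (x i) = fst (x j)}
      = (\<integral>\<^sup>+x. indicator {x \<in> space (PiM I (\<lambda>_. M)). fst (x i) = fst (x j)} x \<partial>PiM (insert i J) (\<lambda>_. M))"
      unfolding J(3) by (rule nn_integral_indicator[OF m, symmetric])
    also have "\<dots> = (\<integral>\<^sup>+x. (\<integral>\<^sup>+y. indicator {x \<in> space (PiM I (\<lambda>_. M)). fst (x i) = fst (x j)} (x(i := y)) \<partial>M) \<partial>PiM J (\<lambda>_. M))"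
      by (rule P.product_nn_integral_insert[OF J(1,2)]) (unfold J(3), rule borel_measurable_indicator[OF m])
    also have "\<dots> = (\<integral>\<^sup>+x. 0 \<partial>PiM J (\<lambda>_. M))"
    proof (rule nn_integral_cong)
      fix x
      have "AE y in M. indicator {x \<in> space (PiM I (\<lambda>_. M)). fst (x i) = fst (x j)} (x(i := y)) = (0 :: ennreal)"
        using na[of "fst (x j)"] by eventually_elim (use ij in \<open>auto simp: indicator_def\<close>)
      from nn_integral_cong_AE[OF this]
      show "(\<integral>\<^sup>+y. indicator {x \<in> space (PiM I (\<lambda>_. M)). fst (x i) = fst (x j)} (x(i := y)) \<partial>M) = (0 :: ennreal)"
        unfolding nn_integral_const by simp
    qed
    finally have "emeasure (PiM I (\<lambda>_. M)) {x \<in> space (PiM I (\<lambda>_. M)). fst (x i) = fst (x j)} = 0"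
      by (simp only: nn_integral_const mult_zero_left)
    then show ?thesis using AE_iff_measurable[OF m, of "\<lambda>x. fst (x i) \<noteq> fst (x j)"] by (simp only: not_not)
  qed
  have "AE x in PiM I (\<lambda>_. M). \<forall>i\<in>I. \<forall>j\<in>I. i \<noteq> j \<longrightarrow> fst (x i) \<noteq> fst (x j)"
    using I ne by (intro AE_finite_allI) (auto intro: AE_impI)
  then show ?thesis by eventually_elim (auto simp: inj_on_def)
qed

text \<open>The quotient \<open>(1 - cos (t d)) / t\<^sup>2\<close> extends continuously to \<open>t = 0\<close> with value \<open>d\<^sup>2 / 2\<close>. If the bound
  failed for every \<open>k\<close>, then by compactness and Fatou's lemma the integral of the quotient without
  truncation would vanish at some limit point \<open>l\<close> with \<open>\<bar>l\<bar> \<le> T\<close>, which the two hypotheses on \<open>D\<close>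
  exclude for \<open>l = 0\<close> and \<open>l \<noteq> 0\<close>. The same truncation \<open>A k\<close> works for all \<open>t\<close>.\<close>

lemma quadratic_lower_bound:
  fixes D :: "'a \<Rightarrow> real" and A :: "nat \<Rightarrow> 'a set"
  assumes fin: "finite_measure \<nu>" and D[measurable]: "D \<in> borel_measurable \<nu>"
    and A[measurable]: "\<And>k. A k \<in> sets \<nu>"
    and ev: "\<And>x. x \<in> space \<nu> \<Longrightarrow> \<forall>\<^sub>F k in sequentially. x \<in> A k"
    and nz: "\<not> (AE x in \<nu>. D x = 0)"
    and pos: "\<And>t. 0 < \<bar>t\<bar> \<Longrightarrow> \<bar>t\<bar> \<le> T \<Longrightarrow> \<not> (AE x in \<nu>. cos (t * D x) = 1)"
  shows "\<exists>k. \<exists>c>0. \<forall>t. \<bar>t\<bar> \<le> T \<longrightarrow> c * t\<^sup>2 \<le> (\<integral>x. indicator (A k) x * (1 - cos (t * D x)) \<partial>\<nu>)"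
proof (rule ccontr)
  interpret finite_measure \<nu> by fact
  assume neg: "\<not> ?thesis"
  have "\<exists>t. \<bar>t\<bar> \<le> T \<and> (\<integral>x. indicator (A k) x * (1 - cos (t * D x)) \<partial>\<nu>) < 1 / (real k + 1) * t\<^sup>2" for k
  proof -
    have "\<not> (\<forall>t. \<bar>t\<bar> \<le> T \<longrightarrow> 1 / (real k + 1) * t\<^sup>2 \<le> (\<integral>x. indicator (A k) x * (1 - cos (t * D x)) \<partial>\<nu>))"
    proof
      assume "\<forall>t. \<bar>t\<bar> \<le> T \<longrightarrow> 1 / (real k + 1) * t\<^sup>2 \<le> (\<integral>x. indicator (A k) x * (1 - cos (t * D x)) \<partial>\<nu>)"
      moreover have "0 < 1 / (real k + 1)" by simp
      ultimately show False using neg by blast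
    qed
    then show ?thesis by (auto simp: not_le)
  qed
  then obtain t where t: "\<And>k. \<bar>t k\<bar> \<le> T"
      "\<And>k. (\<integral>x. indicator (A k) x * (1 - cos (t k * D x)) \<partial>\<nu>) < 1 / (real k + 1) * (t k)\<^sup>2"
    by metis
  have "bounded (range t)" using t(1) by (intro boundedI[of _ T]) auto
  then obtain l r where r: "strict_mono r" and l: "(t \<circ> r) \<longlonglongrightarrow> l"
    using bounded_imp_convergent_subsequence by blast
  have lT: "\<bar>l\<bar> \<le> T"
    using tendsto_rabs[OF l] t(1) by (intro LIMSEQ_le_const2) (auto intro!: exI[of _ 0])
  \<comment> \<open>The continuous extension of \<open>(1 - cos (t d)) / t\<^sup>2\<close>.\<close>
  define q where "q t d = d\<^sup>2 / 2 * (sinc (t * d / 2))\<^sup>2" for t d :: real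
  have q_cont: "isCont (\<lambda>t. q t d) s" for d s
    unfolding q_def by (intro continuous_intros continuous_within_compose3[OF isCont_sinc]) auto
  have q_eq: "q t d = (1 - cos (t * d)) / t\<^sup>2" if "t \<noteq> 0" for t d
  proof (cases "d = 0")
    case False
    have "1 - cos (t * d) = 2 * (sin (t * d / 2))\<^sup>2"
      using cos_double_sin[of "t * d / 2"] by simp
    with False that show ?thesis by (simp add: q_def power_divide field_simps)
  qed (simp add: q_def)
  have q0: "0 \<le> q t d" for t d by (simp add: q_def)
  have qm[measurable]: "(\<lambda>x. q s (D x)) \<in> borel_measurable \<nu>" for s unfolding q_def by measurable
  have small: "(\<integral>\<^sup>+x. ennreal (indicator (A k) x * q (t k) (D x)) \<partial>\<nu>) \<le> ennreal (1 / (real k + 1))" for k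
  proof -
    have "t k \<noteq> 0"
    proof
      assume "t k = 0"
      with t(2)[of k] show False by simp
    qed
    have i: "integrable \<nu> (\<lambda>x. indicator (A k) x * (1 - cos (t k * D x)) / (t k)\<^sup>2)"
    proof (rule integrable_const_bound[of _ "2 / (t k)\<^sup>2"])
      have "\<bar>indicator (A k) x * (1 - cos (t k * D x))\<bar> \<le> 2" for x
        using cos_ge_minus_one[of "t k * D x"] cos_le_one[of "t k * D x"] by (auto simp: indicator_def abs_le_iff)
      then show "AE x in \<nu>. norm (indicator (A k) x * (1 - cos (t k * D x)) / (t k)\<^sup>2) \<le> 2 / (t k)\<^sup>2"
        by (auto intro!: divide_right_mono)
    qed measurable
    have "(\<integral>\<^sup>+x. ennreal (indicator (A k) x * q (t k) (D x)) \<partial>\<nu>) = (\<integral>\<^sup>+x. ennreal (indicator (A k) x * (1 - cos (t k * D x)) / (t k)\<^sup>2) \<partial>\<nu>)"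
      using \<open>t k \<noteq> 0\<close> by (simp add: q_eq)
    also have "\<dots> = ennreal (\<integral>x. indicator (A k) x * (1 - cos (t k * D x)) / (t k)\<^sup>2 \<partial>\<nu>)"
      by (rule nn_integral_eq_integral[OF i]) auto
    also have "(\<integral>x. indicator (A k) x * (1 - cos (t k * D x)) / (t k)\<^sup>2 \<partial>\<nu>) = (\<integral>x. indicator (A k) x * (1 - cos (t k * D x)) \<partial>\<nu>) / (t k)\<^sup>2"
      by simp
    also have "\<dots> \<le> 1 / (real k + 1)"
      using t(2)[of k] \<open>t k \<noteq> 0\<close> by (simp add: divide_le_eq)
    finally show ?thesis by (simp add: ennreal_leI)
  qed
  have "(\<integral>\<^sup>+x. ennreal (q l (D x)) \<partial>\<nu>) = (\<integral>\<^sup>+x. liminf (\<lambda>n. ennreal (indicator (A (r n)) x * q (t (r n)) (D x))) \<partial>\<nu>)"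
  proof (rule nn_integral_cong)
    fix x assume x: "x \<in> space \<nu>"
    have "(\<lambda>n. q (t (r n)) (D x)) \<longlonglongrightarrow> q l (D x)"
      using isCont_tendsto_compose[OF q_cont l] by (simp add: o_def)
    moreover have "\<forall>\<^sub>F n in sequentially. x \<in> A (r n)"
      using ev[OF x] r by (rule eventually_subseq[rotated])
    then have "\<forall>\<^sub>F n in sequentially. q (t (r n)) (D x) = indicator (A (r n)) x * q (t (r n)) (D x)"
      by eventually_elim simp
    ultimately have "(\<lambda>n. indicator (A (r n)) x * q (t (r n)) (D x)) \<longlonglongrightarrow> q l (D x)"
      by (rule Lim_transform_eventually)
    then have "(\<lambda>n. ennreal (indicator (A (r n)) x * q (t (r n)) (D x))) \<longlonglongrightarrow> ennreal (q l (D x))"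
      by (intro tendsto_ennrealI)
    then show "ennreal (q l (D x)) = liminf (\<lambda>n. ennreal (indicator (A (r n)) x * q (t (r n)) (D x)))"
      by (intro lim_imp_Liminf[symmetric]) auto
  qed
  also have "\<dots> \<le> liminf (\<lambda>n. \<integral>\<^sup>+x. ennreal (indicator (A (r n)) x * q (t (r n)) (D x)) \<partial>\<nu>)"
    by (rule nn_integral_liminf) measurable
  also have "\<dots> \<le> liminf (\<lambda>n. ennreal (1 / (real (r n) + 1)))"
    by (intro Liminf_mono always_eventually allI small)
  also have "\<dots> = 0"
  proof -
    have "(\<lambda>k. 1 / (real k + 1)) \<longlonglongrightarrow> 0" by real_asymp
    from LIMSEQ_subseq_LIMSEQ[OF this r] have "(\<lambda>n. ennreal (1 / (real (r n) + 1))) \<longlonglongrightarrow> ennreal 0"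
      by (intro tendsto_ennrealI) (simp add: o_def)
    from lim_imp_Liminf[OF _ this] show ?thesis by simp
  qed
  finally have "AE x in \<nu>. ennreal (q l (D x)) = 0"
    by (subst nn_integral_0_iff_AE[symmetric]) auto
  then have q_zero: "AE x in \<nu>. q l (D x) = 0" by eventually_elim (use q0 in \<open>auto simp: antisym\<close>)
  show False
  proof (cases "l = 0")
    case True
    from q_zero have "AE x in \<nu>. D x = 0" by eventually_elim (auto simp: True q_def)
    with nz show False by simp
  next
    case False
    from q_zero have "AE x in \<nu>. cos (l * D x) = 1" by eventually_elim (use False in \<open>auto simp: q_eq\<close>)
    with pos[of l] False lT show False by simp
  qed
qed

text \<open>A variance bound of Efron-Stein type, by integrating out one coordinate at a time: averaging over
  a coordinate preserves the bounded differences and lowers the second moment by at most \<open>C\<^sup>2\<close>.\<close>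

lemma bounded_difference_second_moment:
  fixes f :: "('i \<Rightarrow> 'a) \<Rightarrow> real"
  assumes M: "prob_space M" and I: "finite I"
    and f: "f \<in> borel_measurable (PiM I (\<lambda>_. M))"
    and B: "\<And>x. x \<in> space (PiM I (\<lambda>_. M)) \<Longrightarrow> \<bar>f x\<bar> \<le> B"
    and diff: "\<And>x i y. x \<in> space (PiM I (\<lambda>_. M)) \<Longrightarrow> i \<in> I \<Longrightarrow> y \<in> space M \<Longrightarrow> \<bar>f (x(i := y)) - f x\<bar> \<le> C"
  shows "(\<integral>x. (f x)\<^sup>2 \<partial>PiM I (\<lambda>_. M)) \<le> (\<integral>x. f x \<partial>PiM I (\<lambda>_. M))\<^sup>2 + real (card I) * C\<^sup>2"
proof -
  interpret M: prob_space M by fact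
  interpret P: product_prob_space "\<lambda>_. M" UNIV ..
  show ?thesis using I f B diff
  proof (induction I arbitrary: f)
    case empty
    then show ?case by (simp add: PiM_empty lebesgue_integral_count_space_finite)
  next
    case (insert i I)
    let ?N = "PiM I (\<lambda>_. M)" and ?N' = "PiM (insert i I) (\<lambda>_. M)"
    interpret N: prob_space ?N by (intro prob_space_PiM) (rule M)
    interpret N': prob_space ?N' by (intro prob_space_PiM) (rule M)
    note [measurable] = insert.prems(1)
    have upd: "x(i := y) \<in> space ?N'" if "x \<in> space ?N" "y \<in> space M" for x y
      using that by (auto simp: space_PiM PiE_def extensional_def)
    have fm: "(\<lambda>y. f (x(i := y))) \<in> borel_measurable M" if "x \<in> space ?N" for x
      using measurable_comp[OF measurable_component_update[OF that insert.hyps(2)] insert.prems(1)] by (simp add: comp_def)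
    have intf: "integrable M (\<lambda>y. f (x(i := y)))" if "x \<in> space ?N" for x
      by (rule M.integrable_const_bound[of _ B]) (use fm[OF that] insert.prems(2) upd[OF that] in auto)
    have sqB: "(f x)\<^sup>2 \<le> B\<^sup>2" if "x \<in> space ?N'" for x
      using insert.prems(2)[OF that] by (metis abs_ge_zero power2_abs power_mono)
    have intf2: "integrable M (\<lambda>y. (f (x(i := y)))\<^sup>2)" if "x \<in> space ?N" for x
      by (rule M.integrable_const_bound[of _ "B\<^sup>2"]) (use fm[OF that] sqB upd[OF that] in auto)
    define g where "g x = (\<integral>y. f (x(i := y)) \<partial>M)" for x
    have gm[measurable]: "g \<in> borel_measurable ?N" unfolding g_def by measurable
    have gB: "\<bar>g x\<bar> \<le> B" if x: "x \<in> space ?N" for x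
    proof -
      have "\<bar>g x\<bar> \<le> (\<integral>y. \<bar>f (x(i := y))\<bar> \<partial>M)" unfolding g_def by (rule integral_abs_bound)
      also have "\<dots> \<le> (\<integral>y. B \<partial>M)"
        using intf[OF x] insert.prems(2) upd[OF x] by (intro integral_mono) auto
      finally show ?thesis by (simp add: M.prob_space)
    qed
    have gdiff: "\<bar>g (x(j := z)) - g x\<bar> \<le> C" if x: "x \<in> space ?N" "j \<in> I" "z \<in> space M" for x j z
    proof -
      have x': "x(j := z) \<in> space ?N" using x by (auto simp: space_PiM)
      have ij: "i \<noteq> j" using insert.hyps x by auto
      have "\<bar>g (x(j := z)) - g x\<bar> = \<bar>\<integral>y. f (x(j := z, i := y)) - f (x(i := y)) \<partial>M\<bar>"
        unfolding g_def using intf[OF x(1)] intf[OF x'] by simp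
      also have "\<dots> \<le> (\<integral>y. \<bar>f (x(j := z, i := y)) - f (x(i := y))\<bar> \<partial>M)" by (rule integral_abs_bound)
      also have "\<dots> \<le> (\<integral>y. C \<partial>M)"
      proof (rule integral_mono)
        fix y assume y: "y \<in> space M"
        show "\<bar>f (x(j := z, i := y)) - f (x(i := y))\<bar> \<le> C"
          unfolding fun_upd_twist[OF ij[symmetric]]
          by (rule insert.prems(3)[OF upd[OF x(1) y]]) (use x in auto)
      qed (use intf[OF x(1)] intf[OF x'] in auto)
      finally show ?thesis by (simp add: M.prob_space)
    qed
    have "(\<integral>x. (f x)\<^sup>2 \<partial>?N') = (\<integral>x. (\<integral>y. (f (x(i := y)))\<^sup>2 \<partial>M) \<partial>?N)"
      using sqB by (intro P.product_integral_insert insert.hyps N'.integrable_const_bound[of _ "B\<^sup>2"]) auto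
    also have "\<dots> \<le> (\<integral>x. (g x)\<^sup>2 + C\<^sup>2 \<partial>?N)"
    proof (rule integral_mono)
      have "\<bar>\<integral>y. (f (x(i := y)))\<^sup>2 \<partial>M\<bar> \<le> B\<^sup>2" if x: "x \<in> space ?N" for x
      proof -
        have "(\<integral>y. (f (x(i := y)))\<^sup>2 \<partial>M) \<le> (\<integral>y. B\<^sup>2 \<partial>M)"
          using intf2[OF x] sqB upd[OF x] by (intro integral_mono) auto
        then show ?thesis by (simp add: M.prob_space)
      qed
      then show "integrable ?N (\<lambda>x. \<integral>y. (f (x(i := y)))\<^sup>2 \<partial>M)"
        by (intro N.integrable_const_bound[of _ "B\<^sup>2"]) auto
      have "(g x)\<^sup>2 \<le> B\<^sup>2" if "x \<in> space ?N" for x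
        using gB[OF that] by (metis abs_ge_zero power2_abs power_mono)
      then have "integrable ?N (\<lambda>x. (g x)\<^sup>2)" by (intro N.integrable_const_bound[of _ "B\<^sup>2"]) auto
      then show "integrable ?N (\<lambda>x. (g x)\<^sup>2 + C\<^sup>2)" by simp
      fix x assume x: "x \<in> space ?N"
      have osc: "\<bar>f (x(i := y)) - g x\<bar> \<le> C" if y: "y \<in> space M" for y
      proof -
        have "\<bar>f (x(i := y)) - g x\<bar> = \<bar>\<integral>z. f (x(i := y)) - f (x(i := z)) \<partial>M\<bar>"
          unfolding g_def using intf[OF x] by (simp add: M.prob_space)
        also have "\<dots> \<le> (\<integral>z. \<bar>f (x(i := y)) - f (x(i := z))\<bar> \<partial>M)" by (rule integral_abs_bound)
        also have "\<dots> \<le> (\<integral>z. C \<partial>M)"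
        proof (rule integral_mono)
          fix z assume z: "z \<in> space M"
          have "\<bar>f ((x(i := z))(i := y)) - f (x(i := z))\<bar> \<le> C"
            by (rule insert.prems(3)[OF upd[OF x z]]) (use y in auto)
          then show "\<bar>f (x(i := y)) - f (x(i := z))\<bar> \<le> C" unfolding fun_upd_upd .
        qed (use intf[OF x] in auto)
        finally show ?thesis by (simp add: M.prob_space)
      qed
      have "(\<integral>y. (f (x(i := y)))\<^sup>2 \<partial>M) \<le> (\<integral>y. C\<^sup>2 + (2 * g x * f (x(i := y)) - (g x)\<^sup>2) \<partial>M)"
      proof (rule integral_mono)
        fix y assume y: "y \<in> space M"
        have "(f (x(i := y)) - g x)\<^sup>2 \<le> C\<^sup>2" using osc[OF y] by (metis abs_ge_zero power2_abs power_mono)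
        then show "(f (x(i := y)))\<^sup>2 \<le> C\<^sup>2 + (2 * g x * f (x(i := y)) - (g x)\<^sup>2)"
          by (simp add: power2_eq_square algebra_simps)
      qed (use intf[OF x] intf2[OF x] in auto)
      also have "\<dots> = (g x)\<^sup>2 + C\<^sup>2"
        using intf[OF x] by (simp add: M.prob_space g_def[symmetric] power2_eq_square)
      finally show "(\<integral>y. (f (x(i := y)))\<^sup>2 \<partial>M) \<le> (g x)\<^sup>2 + C\<^sup>2" .
    qed
    also have "\<dots> = (\<integral>x. (g x)\<^sup>2 \<partial>?N) + C\<^sup>2"
    proof -
      have "(g x)\<^sup>2 \<le> B\<^sup>2" if "x \<in> space ?N" for x
        using gB[OF that] by (metis abs_ge_zero power2_abs power_mono)
      then have "integrable ?N (\<lambda>x. (g x)\<^sup>2)" by (intro N.integrable_const_bound[of _ "B\<^sup>2"]) auto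
      then show ?thesis by (simp add: N.prob_space)
    qed
    also have "(\<integral>x. (g x)\<^sup>2 \<partial>?N) \<le> (\<integral>x. g x \<partial>?N)\<^sup>2 + real (card I) * C\<^sup>2"
      by (rule insert.IH[OF gm gB gdiff])
    also have "(\<integral>x. g x \<partial>?N) = (\<integral>x. f x \<partial>?N')"
      unfolding g_def using insert.prems(2)
      by (intro P.product_integral_insert[symmetric] insert.hyps N'.integrable_const_bound[of _ B]) auto
    finally show ?case using insert.hyps by (simp add: algebra_simps)
  qed
qed

section \<open>Factorisation over good boxes\<close>

lemma config_value_reindex:
  assumes "bij_betw f J I"
  shows "config_value H J (\<lambda>n\<in>J. x (f n)) = config_value H I x"
proof -
  have "inj_on (\<lambda>n. fst ((\<lambda>n\<in>J. x (f n)) n)) J \<longleftrightarrow> inj_on ((\<lambda>i. fst (x i)) \<circ> f) J"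
    by (intro inj_on_cong) auto
  also have "\<dots> \<longleftrightarrow> inj_on (\<lambda>i. fst (x i)) I"
    using assms by (metis bij_betw_def comp_inj_on_iff)
  finally have 1: "inj_on (\<lambda>n. fst ((\<lambda>n\<in>J. x (f n)) n)) J \<longleftrightarrow> inj_on (\<lambda>i. fst (x i)) I" .
  have 2: "(\<lambda>n\<in>J. x (f n)) ` J = x ` I"
    using assms by (auto simp: bij_betw_def)
  show ?thesis unfolding config_value_def 1 2 ..
qed

lemma config_value_restrict: "config_value H J (restrict x J) = config_value H J x"
  unfolding config_value_def by (simp cong: inj_on_cong)

text \<open>With an independent copy \<open>x'\<close> of the block, the squared modulus of the restricted characteristic
  function equals \<open>w\<^sup>2 - J\<close>, where \<open>w\<close> is the mass of the restriction and \<open>J\<close> the integral of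
  \<open>1 - cos (\<theta> (h x - h x'))\<close>. The hypothesis bounds this integral from below for the reference law \<open>\<Gamma>\<close>;
  the bound passes to \<open>N\<close>, because \<open>\<Gamma> \<le> C N\<close> on \<open>S\<close>. The constant only involves \<open>C u\<close>: in the
  application \<open>C\<close> is of order \<open>n\<close> and \<open>u\<close> of order \<open>1/n\<close>.\<close>

lemma block_char_bound:
  fixes h :: "('i \<Rightarrow> 'a) \<Rightarrow> real" and \<Gamma> N :: "'a measure"
  assumes G: "prob_space \<Gamma>" and N: "prob_space N" and sets: "sets \<Gamma> = sets N" and S: "S \<in> sets N"
    and I: "finite I" and h: "h \<in> borel_measurable (PiM I (\<lambda>_. N))"
    and C: "0 < C" "\<And>A. A \<in> sets N \<Longrightarrow> emeasure \<Gamma> (A \<inter> S) \<le> ennreal C * emeasure N A"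
    and u: "measure N S \<le> u" "0 < u" and c: "0 < c"
    and base: "ennreal (c * \<theta>\<^sup>2) \<le> (\<integral>\<^sup>+x. (\<integral>\<^sup>+x'. ennreal (1 - cos (\<theta> * (h x - h x'))) * 
       (\<Prod>i\<in>I. indicator S (x' i)) \<partial>PiM I (\<lambda>_. \<Gamma>)) * (\<Prod>i\<in>I. indicator S (x i)) \<partial>PiM I (\<lambda>_. \<Gamma>))"
  shows "cmod (\<integral>x. iexp (\<theta> * h x) * (\<Prod>i\<in>I. indicator S (x i)) \<partial>PiM I (\<lambda>_. N))
    \<le> exp (- (c / (C * u) ^ (2 * card I) / 2) * \<theta>\<^sup>2) * measure N S ^ card I"
proof -
  interpret N: prob_space N by fact
  interpret G: prob_space \<Gamma> by fact
  let ?N = "PiM I (\<lambda>_. N)"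
  interpret NI: prob_space ?N by (intro prob_space_PiM N)
  interpret P: product_sigma_finite "\<lambda>_. N" ..
  note [measurable] = h
  define W where "W x = (\<Prod>i\<in>I. indicator S (x i) :: real)" for x :: "'i \<Rightarrow> 'a"
  have W01: "0 \<le> W x" "W x \<le> 1" for x by (auto simp: W_def intro!: prod_nonneg prod_le_1)
  have Wm[measurable]: "W \<in> borel_measurable ?N"
    unfolding W_def
  proof (rule borel_measurable_prod)
    fix i assume "i \<in> I"
    then have "(\<lambda>x. x i) \<in> measurable ?N N" by (intro measurable_component_singleton) auto
    then show "(\<lambda>x. indicator S (x i) :: real) \<in> borel_measurable ?N"
      by (rule measurable_compose) (rule borel_measurable_indicator[OF S])
  qed
  have We: "ennreal (W x) = (\<Prod>i\<in>I. indicator S (x i))" for x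
    unfolding W_def by (subst prod_ennreal[symmetric]) (auto simp: ennreal_indicator)
  have Wc: "complex_of_real (W x) = (\<Prod>i\<in>I. indicator S (x i))" for x
    unfolding W_def of_real_prod by (intro prod.cong) (auto simp: indicator_def)
  define w where "w = (\<integral>x. W x \<partial>?N)"
  have Wint: "integrable ?N W" by (rule NI.integrable_const_bound[of _ 1]) (use W01 in auto)
  have w: "w = measure N S ^ card I"
  proof -
    have "w = (\<Prod>i\<in>I. \<integral>x. indicator S x \<partial>N)"
      unfolding w_def W_def using S
      by (intro P.product_integral_prod I integrable_real_indicator) (auto simp: N.emeasure_eq_measure)
    then show ?thesis using S by simp
  qed
  define a where "a = (\<integral>x. cos (\<theta> * h x) * W x \<partial>?N)"
  define b where "b = (\<integral>x. sin (\<theta> * h x) * W x \<partial>?N)"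
  have bnd: "integrable ?N (\<lambda>x. f x * W x)" if "f \<in> borel_measurable ?N" "\<And>x. \<bar>f x\<bar> \<le> k" for f k
  proof (rule NI.integrable_const_bound[of _ k])
    have "\<bar>f x * W x\<bar> \<le> k" for x
      using mult_mono[OF that(2)[of x] W01(2)[of x]] W01(1)[of x] that(2)[of x] by (auto simp: abs_mult)
    then show "AE x in ?N. norm (f x * W x) \<le> k" by auto
  qed (use that in measurable)
  have ia: "integrable ?N (\<lambda>x. cos (\<theta> * h x) * W x)" by (rule bnd[of _ 1]) auto
  have ib: "integrable ?N (\<lambda>x. sin (\<theta> * h x) * W x)" by (rule bnd[of _ 1]) auto
  have char: "(\<integral>x. iexp (\<theta> * h x) * (\<Prod>i\<in>I. indicator S (x i)) \<partial>?N) = Complex a b"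
  proof -
    have ic: "integrable ?N (\<lambda>x. iexp (\<theta> * h x) * complex_of_real (W x))"
      by (rule NI.integrable_const_bound[of _ 1]) (use W01 in \<open>auto simp: norm_mult\<close>)
    have "Re (\<integral>x. iexp (\<theta> * h x) * complex_of_real (W x) \<partial>?N) = a"
      unfolding a_def by (subst integral_Re[OF ic, symmetric]) (simp add: Re_exp)
    moreover have "Im (\<integral>x. iexp (\<theta> * h x) * complex_of_real (W x) \<partial>?N) = b"
      unfolding b_def by (subst integral_Im[OF ic, symmetric]) (simp add: Im_exp)
    ultimately show ?thesis unfolding Wc by (simp add: complex_eq_iff)
  qed
  define j where "j x = (\<integral>x'. (1 - cos (\<theta> * (h x - h x'))) * W x' \<partial>?N)" for x
  have j: "j x = w - (cos (\<theta> * h x) * a + sin (\<theta> * h x) * b)" for x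
  proof -
    have "j x = (\<integral>x'. W x' - (cos (\<theta> * h x) * (cos (\<theta> * h x') * W x') + sin (\<theta> * h x) * (sin (\<theta> * h x') * W x')) \<partial>?N)"
      unfolding j_def by (intro Bochner_Integration.integral_cong) (auto simp: right_diff_distrib cos_diff algebra_simps)
    also have "\<dots> = w - (cos (\<theta> * h x) * a + sin (\<theta> * h x) * b)"
      using ia ib Wint by (simp add: w_def a_def b_def)
    finally show ?thesis .
  qed
  have c2: "0 \<le> 1 - cos t" "1 - cos t \<le> 2" for t :: real using cos_ge_minus_one[of t] cos_le_one[of t] by linarith+
  have j0: "0 \<le> j x" for x unfolding j_def using W01 c2 by (intro Bochner_Integration.integral_nonneg) auto
  have jm[measurable]: "j \<in> borel_measurable ?N" unfolding j by measurable
  define J where "J = (\<integral>x. j x * W x \<partial>?N)"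
  have iJ: "integrable ?N (\<lambda>x. j x * W x)"
  proof (rule bnd[of _ "\<bar>w\<bar> + \<bar>a\<bar> + \<bar>b\<bar>"])
    fix x
    have "\<bar>cos (\<theta> * h x) * a\<bar> \<le> \<bar>a\<bar>" "\<bar>sin (\<theta> * h x) * b\<bar> \<le> \<bar>b\<bar>"
      by (auto simp: abs_mult intro!: mult_left_le_one_le)
    then show "\<bar>j x\<bar> \<le> \<bar>w\<bar> + \<bar>a\<bar> + \<bar>b\<bar>" unfolding j by linarith
  qed measurable
  have Jab: "J = w\<^sup>2 - (a\<^sup>2 + b\<^sup>2)"
  proof -
    have "J = (\<integral>x. w * W x - (a * (cos (\<theta> * h x) * W x) + b * (sin (\<theta> * h x) * W x)) \<partial>?N)"
      unfolding J_def j by (intro Bochner_Integration.integral_cong) (auto simp: algebra_simps)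
    also have "\<dots> = w * w - (a * a + b * b)"
      using ia ib Wint by (simp add: w_def[symmetric] a_def[symmetric] b_def[symmetric])
    finally show ?thesis by (simp add: power2_eq_square)
  qed
  have nnj: "(\<integral>\<^sup>+x'. ennreal (1 - cos (\<theta> * (h x - h x'))) * ennreal (W x') \<partial>?N) = ennreal (j x)" for x
  proof -
    have "(\<integral>\<^sup>+x'. ennreal (1 - cos (\<theta> * (h x - h x'))) * ennreal (W x') \<partial>?N)
      = (\<integral>\<^sup>+x'. ennreal ((1 - cos (\<theta> * (h x - h x'))) * W x') \<partial>?N)"
      using c2 W01 by (simp add: ennreal_mult)
    also have "\<dots> = ennreal (j x)" unfolding j_def
    proof (rule nn_integral_eq_integral)
      show "integrable ?N (\<lambda>x'. (1 - cos (\<theta> * (h x - h x'))) * W x')"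
      proof (rule bnd[of _ 2])
        show "\<bar>1 - cos (\<theta> * (h x - h x'))\<bar> \<le> 2" for x' using c2[of "\<theta> * (h x - h x')"] by simp
      qed measurable
    qed (use c2 W01 in auto)
    finally show ?thesis .
  qed
  have nnJ: "(\<integral>\<^sup>+x. ennreal (j x) * ennreal (W x) \<partial>?N) = ennreal J"
    unfolding J_def ennreal_mult[OF j0 W01(1), symmetric]
    by (rule nn_integral_eq_integral[OF iJ]) (use j0 W01 in auto)
  have sG: "sigma_finite_measure \<Gamma>" "sigma_finite_measure N" by unfold_locales
  have Wb: "W x * W x = W x" for x unfolding W_def prod.distrib[symmetric] by (intro prod.cong) (auto simp: indicator_def)
  have Wb: "ennreal (W x) * ennreal (W x) = ennreal (W x)" for x using W01[of x] by (simp add: Wb flip: ennreal_mult)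
  have sP: "sets (PiM I (\<lambda>_. \<Gamma>)) = sets ?N" by (rule sets_PiM_cong) (simp_all add: sets)
  have "ennreal (c * \<theta>\<^sup>2) \<le> (\<integral>\<^sup>+x. (\<integral>\<^sup>+x'. ennreal (1 - cos (\<theta> * (h x - h x'))) * ennreal (W x') \<partial>PiM I (\<lambda>_. \<Gamma>)) * ennreal (W x) \<partial>PiM I (\<lambda>_. \<Gamma>))"
    using base by (simp add: We)
  also have "\<dots> \<le> (\<integral>\<^sup>+x. (ennreal C ^ card I * ennreal (j x)) * ennreal (W x) \<partial>PiM I (\<lambda>_. \<Gamma>))"
  proof (intro nn_integral_mono mult_right_mono)
    fix x assume "x \<in> space (PiM I (\<lambda>_. \<Gamma>))"
    have "(\<integral>\<^sup>+x'. ennreal (1 - cos (\<theta> * (h x - h x'))) * ennreal (W x') \<partial>PiM I (\<lambda>_. \<Gamma>))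
      = (\<integral>\<^sup>+x'. (ennreal (1 - cos (\<theta> * (h x - h x'))) * ennreal (W x')) * (\<Prod>i\<in>I. indicator S (x' i)) \<partial>PiM I (\<lambda>_. \<Gamma>))"
      unfolding We[symmetric] mult.assoc Wb ..
    also have "\<dots> \<le> ennreal C ^ card I * (\<integral>\<^sup>+x'. ennreal (1 - cos (\<theta> * (h x - h x'))) * ennreal (W x') \<partial>?N)"
      by (rule product_nn_integral_le[OF sG sets S C(2) I]) auto
    finally show "(\<integral>\<^sup>+x'. ennreal (1 - cos (\<theta> * (h x - h x'))) * ennreal (W x') \<partial>PiM I (\<lambda>_. \<Gamma>)) \<le> ennreal C ^ card I * ennreal (j x)"
      unfolding nnj .
  qed auto
  also have "\<dots> = (\<integral>\<^sup>+x. ((ennreal C ^ card I * ennreal (j x)) * ennreal (W x)) * (\<Prod>i\<in>I. indicator S (x i)) \<partial>PiM I (\<lambda>_. \<Gamma>))"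
    unfolding We[symmetric] mult.assoc Wb ..
  also have "\<dots> \<le> ennreal C ^ card I * (\<integral>\<^sup>+x. (ennreal C ^ card I * ennreal (j x)) * ennreal (W x) \<partial>?N)"
    by (rule product_nn_integral_le[OF sG sets S C(2) I]) auto
  also have "\<dots> = ennreal C ^ card I * (ennreal C ^ card I * ennreal J)"
    unfolding mult.assoc by (subst nn_integral_cmult) (auto simp: nnJ)
  also have "\<dots> = ennreal (C ^ (2 * card I) * J)"
  proof -
    have "0 \<le> J" unfolding J_def using j0 W01 by (intro Bochner_Integration.integral_nonneg) auto
    then show ?thesis using C(1) by (simp add: ennreal_power ennreal_mult mult_2 power_add mult.assoc)
  qed
  finally have "ennreal (c * \<theta>\<^sup>2) \<le> ennreal (C ^ (2 * card I) * J)" .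
  moreover have J0: "0 \<le> J" unfolding J_def using j0 W01 by (intro Bochner_Integration.integral_nonneg) auto
  ultimately have cJ: "c * \<theta>\<^sup>2 \<le> C ^ (2 * card I) * J"
    using C(1) by (subst (asm) ennreal_le_iff) auto
  have w0: "0 \<le> w" unfolding w by simp
  have wu: "w \<le> u ^ card I" unfolding w by (intro power_mono u) auto
  have "c / (C * u) ^ (2 * card I) * \<theta>\<^sup>2 * w\<^sup>2 \<le> J"
  proof -
    have "w\<^sup>2 \<le> (u ^ card I)\<^sup>2" using wu w0 by (rule power_mono)
    then have w2: "w\<^sup>2 \<le> u ^ (2 * card I)" by (simp add: power_mult mult.commute)
    have "c * \<theta>\<^sup>2 * w\<^sup>2 \<le> (C ^ (2 * card I) * J) * u ^ (2 * card I)"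
      by (rule mult_mono[OF cJ w2]) (use C J0 in auto)
    then show ?thesis using C u by (simp add: power_mult_distrib field_simps)
  qed
  then have "a\<^sup>2 + b\<^sup>2 \<le> w\<^sup>2 * (1 - c / (C * u) ^ (2 * card I) * \<theta>\<^sup>2)"
    unfolding Jab by (simp add: algebra_simps)
  also have "\<dots> \<le> w\<^sup>2 * exp (- (c / (C * u) ^ (2 * card I) * \<theta>\<^sup>2))"
  proof (intro mult_left_mono)
    show "1 - c / (C * u) ^ (2 * card I) * \<theta>\<^sup>2 \<le> exp (- (c / (C * u) ^ (2 * card I) * \<theta>\<^sup>2))"
      using exp_ge_add_one_self[of "- (c / (C * u) ^ (2 * card I) * \<theta>\<^sup>2)"] by simp
  qed simp
  also have "\<dots> = (w * exp (- (c / (C * u) ^ (2 * card I) / 2) * \<theta>\<^sup>2))\<^sup>2"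
    by (simp add: power_mult_distrib flip: exp_double)
  finally have "sqrt (a\<^sup>2 + b\<^sup>2) \<le> w * exp (- (c / (C * u) ^ (2 * card I) / 2) * \<theta>\<^sup>2)"
    using w0 by (intro real_le_lsqrt) auto
  then show ?thesis unfolding char complex_norm w by (simp add: mult.commute)
qed

text \<open>The box around \<open>y\<close> holds a block of exactly \<open>m\<close> points in its core, and the rest of the sample is
  guarded there.\<close>

definition good_box :: "nat set \<Rightarrow> nat \<Rightarrow> real \<Rightarrow> real \<Rightarrow> (real^'d) set \<Rightarrow> real \<Rightarrow>
    (nat \<Rightarrow> (real^'d) \<times> 'm) \<Rightarrow> real^'d \<Rightarrow> bool" where
  "good_box I m K A G \<epsilon> x y \<longleftrightarrow>
     card {i\<in>I. dist y (fst (x i)) \<le> K} = m \<and>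
     (\<forall>g\<in>G. \<exists>i\<in>I. dist (y + g) (fst (x i)) < \<epsilon>) \<and>
     (\<forall>i\<in>I. dist y (fst (x i)) \<le> A \<longrightarrow>
        dist y (fst (x i)) \<le> K \<or> (\<exists>g\<in>G. dist (y + g) (fst (x i)) < \<epsilon>))"

lemma guarded_far:
  assumes g: "guarded A G \<epsilon> y B"
    and far: "\<And>p. p \<in> B' \<Longrightarrow> A < dist y (fst p)"
  shows "guarded A G \<epsilon> y (B' \<union> B)"
  using g far unfolding guarded_def by (auto simp: not_le[symmetric])

text \<open>Blocks with separated centres can be split off one after the other: the other blocks lie outside
  the guarded zone of the one that is split off.\<close>

lemma isolation_add:
  fixes V :: "real^'d \<Rightarrow> ((real^'d) \<times> 'm) set"
  assumes iso: "isolation Q H m K A G \<epsilon>" and J: "finite J"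
    and sep: "\<And>y y'. y \<in> J \<Longrightarrow> y' \<in> J \<Longrightarrow> y \<noteq> y' \<Longrightarrow> 2 * A < dist y y'"
    and V: "\<And>y. y \<in> J \<Longrightarrow> V y \<in> configs Q" "\<And>y. y \<in> J \<Longrightarrow> card (V y) = m"
      "\<And>y p. y \<in> J \<Longrightarrow> p \<in> V y \<Longrightarrow> dist y (fst p) \<le> K"
    and B: "B \<in> configs Q" "\<And>y. y \<in> J \<Longrightarrow> guarded A G \<epsilon> y B"
  shows "H ((\<Union>y\<in>J. V y) \<union> B) = (\<Sum>y\<in>J. H (V y)) + H B"
  using J sep V B(2)
proof (induction J)
  case (insert y J)
  have KA: "K < A" using iso by (simp add: isolation_def)
  have C: "(\<Union>y\<in>J. V y) \<in> configs Q" using insert by (auto simp: finite_subsets_def)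
  have "guarded A G \<epsilon> y ((\<Union>y\<in>J. V y) \<union> B)"
  proof (rule guarded_far)
    fix p assume "p \<in> (\<Union>y\<in>J. V y)"
    then obtain y' where y': "y' \<in> J" "p \<in> V y'" by auto
    then have "2 * A < dist y y'" "dist y' (fst p) \<le> K" using insert by auto
    then show "A < dist y (fst p)" using dist_triangle[of y y' "fst p"] KA by (simp add: dist_commute)
  qed (use insert in auto)
  moreover have "H (V y \<union> D) = H (V y) + H D" if "D \<in> configs Q" "guarded A G \<epsilon> y D" for D
    using iso insert.prems(2,3,4)[of y] that unfolding isolation_def by blast
  ultimately have "H (V y \<union> ((\<Union>y\<in>J. V y) \<union> B)) = H (V y) + H ((\<Union>y\<in>J. V y) \<union> B)"
    using C B(1) by (simp add: configs_Un)
  then show ?case using insert by (simp add: Un_assoc)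
qed simp

lemma good_box_decomposition:
  fixes x :: "nat \<Rightarrow> (real^'d) \<times> 'm"
  assumes iso: "isolation Q H m K A G \<epsilon>" and J: "finite J" and I: "finite I"
    and sep: "\<And>y y'. y \<in> J \<Longrightarrow> y' \<in> J \<Longrightarrow> y \<noteq> y' \<Longrightarrow> 2 * A < dist y y'"
    and inj: "inj_on (\<lambda>i. fst (x i)) I" and sp: "\<And>i. i \<in> I \<Longrightarrow> x i \<in> space (marked_space Q)"
    and good: "\<And>y. y \<in> J \<Longrightarrow> good_box I m K A G \<epsilon> x y"
  defines "blk \<equiv> \<lambda>y. {i\<in>I. dist y (fst (x i)) \<le> K}"
  shows "config_value H I x = (\<Sum>y\<in>J. config_value H (blk y) x) + config_value H (I - (\<Union>y\<in>J. blk y)) x"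
proof -
  have inj': "inj_on (\<lambda>i. fst (x i)) I'" "inj_on x I'" if "I' \<subseteq> I" for I'
  proof -
    show "inj_on (\<lambda>i. fst (x i)) I'" using inj that by (rule inj_on_subset)
    then show "inj_on x I'" by (auto simp: inj_on_def)
  qed
  have blkI: "blk y \<subseteq> I" for y by (auto simp: blk_def)
  define R where "R = I - (\<Union>y\<in>J. blk y)"
  have KA: "K < A" and KG: "\<And>g. g \<in> G \<Longrightarrow> K + \<epsilon> < norm g \<and> norm g + \<epsilon> < A" using iso by (auto simp: isolation_def)
  have "H ((\<Union>y\<in>J. x ` blk y) \<union> x ` R) = (\<Sum>y\<in>J. H (x ` blk y)) + H (x ` R)"
  proof (rule isolation_add[OF iso J sep])
    fix y assume y: "y \<in> J"
    show "x ` blk y \<in> configs Q" using sp blkI I by (auto simp: finite_subsets_def blk_def)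
    have "card (x ` blk y) = card (blk y)" by (intro card_image inj' blkI)
    then show "card (x ` blk y) = m" using good[OF y] by (simp add: good_box_def blk_def)
    show "dist y (fst p) \<le> K" if "p \<in> x ` blk y" for p using that by (auto simp: blk_def)
    show "guarded A G \<epsilon> y (x ` R)"
      unfolding guarded_def
    proof (intro conjI ballI impI)
      fix g assume g: "g \<in> G"
      then obtain i where i: "i \<in> I" "dist (y + g) (fst (x i)) < \<epsilon>" using good[OF y] by (auto simp: good_box_def)
      have "i \<in> R"
      proof (rule ccontr)
        assume "i \<notin> R"
        then obtain y' where y': "y' \<in> J" "dist y' (fst (x i)) \<le> K" using i by (auto simp: R_def blk_def)
        have ng: "dist y (y + g) = norm g" by (simp add: dist_norm)
        show False
        proof (cases "y' = y")
          case True
          then have "dist y (y + g) \<le> K + dist (y + g) (fst (x i))"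
            using dist_triangle2[of y "y + g" "fst (x i)"] y' by simp
          then show False using KG[OF g] i ng by simp
        next
          case False
          then have "2 * A < dist y y'" using sep y y' by auto
          moreover have "dist y y' \<le> dist y (y + g) + dist (y + g) (fst (x i)) + dist y' (fst (x i))"
            using dist_triangle2[of "y + g" y' "fst (x i)"] dist_triangle[of y y' "y + g"] by linarith
          ultimately show False using KG[OF g] i ng y' KA by linarith
        qed
      qed
      then show "\<exists>p\<in>x ` R. dist (y + g) (fst p) < \<epsilon>" using i by blast
    next
      fix p assume p: "p \<in> x ` R" "dist y (fst p) \<le> A"
      then obtain i where i: "i \<in> R" "p = x i" by auto
      then have "\<not> dist y (fst (x i)) \<le> K" "i \<in> I" using y by (auto simp: R_def blk_def)
      then show "\<exists>g\<in>G. dist (y + g) (fst p) < \<epsilon>"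
        using good[OF y] p(2) unfolding good_box_def i(2) by blast
    qed
  next
    show "x ` R \<in> configs Q" using sp I by (auto simp: finite_subsets_def R_def)
  qed
  moreover have "(\<Union>y\<in>J. x ` blk y) \<union> x ` R = x ` I"
  proof -
    have "I = (\<Union>y\<in>J. blk y) \<union> R" using blkI by (auto simp: R_def)
    then show ?thesis by (metis image_Un image_UN)
  qed
  moreover have "config_value H I' x = H (x ` I')" if "I' \<subseteq> I" for I'
    using inj'(1)[OF that] by (simp add: config_value_def)
  ultimately show ?thesis using blkI unfolding R_def[symmetric] by (simp add: R_def)
qed

text \<open>The discrete information about a point that determines the good boxes and their blocks: the cores,
  the boxes and the guard positions to which it belongs.\<close>

definition region_label :: "(real^'d) set \<Rightarrow> real \<Rightarrow> real \<Rightarrow> (real^'d) set \<Rightarrow> real \<Rightarrow> (real^'d) \<times> 'm \<Rightarrow>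
    (real^'d) set \<times> (real^'d) set \<times> ((real^'d) \<times> (real^'d)) set" where
  "region_label Y K A G \<epsilon> p =
     ({y\<in>Y. dist y (fst p) \<le> K}, {y\<in>Y. dist y (fst p) \<le> A}, {(y, g) \<in> Y \<times> G. dist (y + g) (fst p) < \<epsilon>})"

lemma region_label_range: "region_label Y K A G \<epsilon> p \<in> Pow Y \<times> Pow Y \<times> Pow (Y \<times> G)"
  by (auto simp: region_label_def)

lemma region_label_measurable:
  assumes Y: "finite Y" "finite G"
  shows "{p \<in> space (marked_space Q). region_label Y K A G \<epsilon> p = l} \<in> sets (marked_space Q)"
proof (cases "l \<in> Pow Y \<times> Pow Y \<times> Pow (Y \<times> G)")
  case True
  obtain l1 l2 l3 where l: "l = (l1, l2, l3)" by (cases l)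
  have "{p \<in> space (marked_space Q). region_label Y K A G \<epsilon> p = l} =
    {p \<in> space (marked_space Q). (\<forall>y\<in>Y. dist y (fst p) \<le> K \<longleftrightarrow> y \<in> l1) \<and> (\<forall>y\<in>Y. dist y (fst p) \<le> A \<longleftrightarrow> y \<in> l2) \<and>
       (\<forall>y\<in>Y. \<forall>g\<in>G. dist (y + g) (fst p) < \<epsilon> \<longleftrightarrow> (y, g) \<in> l3)}"
    using True by (auto simp: region_label_def l)
  also have "\<dots> \<in> sets (marked_space Q)"
    by (intro sets.sets_Collect_conj sets.sets_Collect_finite_All Y) measurable
  finally show ?thesis .
next
  case False
  then have "{p \<in> space (marked_space Q). region_label Y K A G \<epsilon> p = l} = {}"
    using region_label_range by blast
  then show ?thesis by (simp only: sets.empty_sets)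
qed

lemma good_box_label_cong:
  assumes "\<And>i. i \<in> I \<Longrightarrow> region_label Y K A G \<epsilon> (x i) = region_label Y K A G \<epsilon> (x' i)" and y: "y \<in> Y"
  shows "{i\<in>I. dist y (fst (x i)) \<le> K} = {i\<in>I. dist y (fst (x' i)) \<le> K}"
    and "good_box I m K A G \<epsilon> x y \<longleftrightarrow> good_box I m K A G \<epsilon> x' y"
proof -
  have 1: "dist y (fst (x i)) \<le> K \<longleftrightarrow> dist y (fst (x' i)) \<le> K" if "i \<in> I" for i
    using assms(1)[OF that] y by (auto simp: region_label_def set_eq_iff)
  have 2: "dist y (fst (x i)) \<le> A \<longleftrightarrow> dist y (fst (x' i)) \<le> A" if "i \<in> I" for i
    using assms(1)[OF that] y by (auto simp: region_label_def set_eq_iff)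
  have 3: "dist (y + g) (fst (x i)) < \<epsilon> \<longleftrightarrow> dist (y + g) (fst (x' i)) < \<epsilon>" if "i \<in> I" "g \<in> G" for i g
    using assms(1)[OF that(1)] y that(2) by (auto simp: region_label_def set_eq_iff)
  show *: "{i\<in>I. dist y (fst (x i)) \<le> K} = {i\<in>I. dist y (fst (x' i)) \<le> K}" using 1 by auto
  show "good_box I m K A G \<epsilon> x y \<longleftrightarrow> good_box I m K A G \<epsilon> x' y"
    unfolding good_box_def * using 1 2 3 by (simp cong: ball_cong bex_cong conj_cong)
qed

text \<open>A core is a single label class, so that conditioning on the labels restricts the points of a block
  to the core and to nothing smaller.\<close>

lemma region_label_inner:
  assumes iso: "isolation Q H m K A G \<epsilon>"
    and sep: "\<And>y y'. y \<in> Y \<Longrightarrow> y' \<in> Y \<Longrightarrow> y \<noteq> y' \<Longrightarrow> 2 * A < dist y y'" and y: "y \<in> Y"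
  shows "region_label Y K A G \<epsilon> p = ({y}, {y}, {}) \<longleftrightarrow> dist y (fst p) \<le> K"
proof
  assume "region_label Y K A G \<epsilon> p = ({y}, {y}, {})"
  then show "dist y (fst p) \<le> K" by (auto simp: region_label_def)
next
  assume K: "dist y (fst p) \<le> K"
  have KA: "K < A" and KG: "\<And>g. g \<in> G \<Longrightarrow> K + \<epsilon> < norm g \<and> norm g + \<epsilon> < A" using iso by (auto simp: isolation_def)
  have far: "A < dist y' (fst p)" if "y' \<in> Y" "y' \<noteq> y" for y'
    using sep[OF that(1) y that(2)] dist_triangle2[of y' y "fst p"] K KA by linarith
  have near: "\<not> dist (y' + g) (fst p) < \<epsilon>" if "y' \<in> Y" "g \<in> G" for y' g
  proof
    assume e: "dist (y' + g) (fst p) < \<epsilon>"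
    have ng: "dist y' (y' + g) = norm g" by (simp add: dist_norm)
    show False
    proof (cases "y' = y")
      case True
      then show False using dist_triangle2[of y "y + g" "fst p"] K e ng KG[OF that(2)] by simp
    next
      case False
      then show False using far[OF that(1) False] dist_triangle[of y' "fst p" "y' + g"] e ng KG[OF that(2)] by simp
    qed
  qed
  show "region_label Y K A G \<epsilon> p = ({y}, {y}, {})"
    using y K KA far near by (fastforce simp: region_label_def)
qed

lemma good_box_measurable:
  fixes y :: "real^'d" and Q :: "'m measure"
  assumes I: "finite I" and G: "finite G"
  shows "{x \<in> space (PiM I (\<lambda>_. marked_space Q)). good_box I m K A G \<epsilon> x y} \<in> sets (PiM I (\<lambda>_. marked_space Q))"
proof -
  let ?M = "PiM I (\<lambda>_. marked_space Q :: ((real^'d) \<times> 'm) measure)"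
  have d[measurable]: "(\<lambda>x. dist z (fst (x i))) \<in> borel_measurable ?M" if "i \<in> I" for i and z :: "real^'d"
  proof -
    have "(\<lambda>x. x i) \<in> measurable ?M (marked_space Q)" using that by (rule measurable_component_singleton)
    then show ?thesis by measurable
  qed
  have c: "card {i\<in>I. dist y (fst (x i)) \<le> K} = (\<Sum>i\<in>I. if dist y (fst (x i)) \<le> K then 1 else 0)" for x :: "nat \<Rightarrow> (real^'d) \<times> 'm"
    using I by (simp add: sum.If_cases Int_def)
  have cm: "(\<lambda>x. \<Sum>i\<in>I. if dist y (fst (x i)) \<le> K then 1 else 0 :: nat) \<in> measurable ?M (count_space UNIV)"
    by (intro measurable_sum_nat measurable_If) (auto intro!: measurable_const borel_measurable_le d)
  show ?thesis
    unfolding good_box_def c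
    by (intro sets.sets_Collect_conj sets.sets_Collect_finite_All sets.sets_Collect_finite_Ex sets.sets_Collect_imp 
        sets.sets_Collect_disj I G) (use cm d in measurable)
qed

text \<open>Fix the labels of all points. The good boxes \<open>J\<close> and their blocks of indices are then known,
  and the integrand, restricted to this event, is a product of a function of the remaining points
  and of one function of each block, over disjoint sets of indices; hence the integral factorises.
  Every good box contributes a factor \<open>\<delta>\<close>, the remainder at most \<open>1\<close>. Summing over all labellings
  gives the expectation of \<open>\<delta>\<close> to the number of good boxes.

  The test function \<open>\<Psi>\<close> need only be multiplicative in increments from \<open>S\<close>. Characters correspond to
  \<open>S = UNIV\<close>; in the lattice case \<open>S = a \<int>\<close>, and the shift \<open>a\<close> of the coset is moved from the blocks
  into the remainder.\<close>

lemma (in prob_space) char_bound_good_boxes: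
  fixes \<xi> :: "nat \<Rightarrow> 'a \<Rightarrow> (real^'d) \<times> 'm" and Q :: "'m measure" and H :: "((real^'d) \<times> 'm) set \<Rightarrow> real"
    and \<Psi> :: "real \<Rightarrow> complex"
  assumes I: "finite I" and ind: "indep_vars (\<lambda>_. marked_space Q) \<xi> I"
    and H: "H \<in> borel_measurable (finite_config (marked_space Q))"
    and iso: "isolation Q H m K A G \<epsilon>" and Y: "finite Y"
    and sep: "\<And>y y'. y \<in> Y \<Longrightarrow> y' \<in> Y \<Longrightarrow> y \<noteq> y' \<Longrightarrow> 2 * A < dist y y'"
    and distinct: "AE \<omega> in M. inj_on (\<lambda>i. fst (\<xi> i \<omega>)) I"
    and \<Psi>[measurable]: "\<Psi> \<in> borel_measurable borel" and \<Psi>1: "\<And>x. cmod (\<Psi> x) \<le> 1"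
    and S: "0 \<in> S" "\<And>v w. v \<in> S \<Longrightarrow> w \<in> S \<Longrightarrow> v + w \<in> S"
    and \<Psi>S: "\<And>x v. v \<in> S \<Longrightarrow> \<Psi> (x + v) = \<Psi> x * iexp (\<theta> * v)"
    and \<delta>: "0 \<le> \<delta>"
    and block: "\<And>y J. y \<in> Y \<Longrightarrow> J \<subseteq> I \<Longrightarrow> card J = m \<Longrightarrow>
       cmod (CLINT \<omega>|M. iexp (\<theta> * config_value H J (\<lambda>i. \<xi> i \<omega>)) * (\<Prod>i\<in>J. indicator {p. dist y (fst p) \<le> K} (\<xi> i \<omega>)))
       \<le> \<delta> * (\<integral>\<omega>. (\<Prod>i\<in>J. indicator {p. dist y (fst p) \<le> K} (\<xi> i \<omega>)) \<partial>M)"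
    and coset: "\<And>y J. y \<in> Y \<Longrightarrow> J \<subseteq> I \<Longrightarrow> card J = m \<Longrightarrow>
       AE \<omega> in M. (\<forall>i\<in>J. dist y (fst (\<xi> i \<omega>)) \<le> K) \<longrightarrow> config_value H J (\<lambda>i. \<xi> i \<omega>) - a \<in> S"
  shows "cmod (CLINT \<omega>|M. \<Psi> (config_value H I (\<lambda>i. \<xi> i \<omega>)))
    \<le> (\<integral>\<omega>. \<delta> ^ card {y\<in>Y. good_box I m K A G \<epsilon> (\<lambda>i. \<xi> i \<omega>) y} \<partial>M)"
proof -
  let ?E = "marked_space Q :: ((real^'d) \<times> 'm) measure"
  have rv[measurable]: "\<xi> i \<in> measurable M ?E" if "i \<in> I" for i
    using ind that by (auto simp: indep_vars_def)
  have G: "finite G" using iso by (simp add: isolation_def)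
  define lab where "lab = (region_label Y K A G \<epsilon> :: (real^'d) \<times> 'm \<Rightarrow> _)"
  define Lab where "Lab = Pow Y \<times> Pow Y \<times> Pow (Y \<times> G)"
  have finLab: "finite Lab" using Y G by (simp add: Lab_def)
  define R where "R l = {p \<in> space ?E. lab p = l}" for l
  have Rm: "R l \<in> sets ?E" for l unfolding R_def lab_def by (rule region_label_measurable[OF Y G])
  define D where "D l \<omega> = (\<Prod>i\<in>I. indicator (R (l i)) (\<xi> i \<omega>) :: real)" for l \<omega>
  have xm: "(\<lambda>\<omega>. restrict (\<lambda>i. \<xi> i \<omega>) I') \<in> measurable M (PiM I' (\<lambda>_. ?E))" if "I' \<subseteq> I" for I'
    by (rule measurable_restrict) (use that rv in auto)
  have prodm: "(\<lambda>x. \<Prod>i\<in>I'. indicator (R (l i)) (x i) :: real) \<in> borel_measurable (PiM I' (\<lambda>_. ?E))" for l and I' :: "nat set"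
  proof (rule borel_measurable_prod)
    fix i assume "i \<in> I'"
    then have "(\<lambda>x. x i) \<in> measurable (PiM I' (\<lambda>_. ?E)) ?E" by (rule measurable_component_singleton)
    then show "(\<lambda>x. indicator (R (l i)) (x i) :: real) \<in> borel_measurable (PiM I' (\<lambda>_. ?E))"
      by (rule measurable_compose) (rule borel_measurable_indicator[OF Rm])
  qed
  have prodM: "(\<lambda>\<omega>. \<Prod>i\<in>I'. indicator (R (l i)) (\<xi> i \<omega>) :: real) \<in> borel_measurable M" if "I' \<subseteq> I" for l I'
    using measurable_compose[OF xm[OF that] prodm] by simp
  have prod01: "0 \<le> (\<Prod>i\<in>I'. indicator (R (l i)) (z i) :: real)" "(\<Prod>i\<in>I'. indicator (R (l i)) (z i) :: real) \<le> 1" for l and I' :: "nat set" and z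
    by (auto intro!: prod_nonneg prod_le_1)
  have sumD: "(\<Sum>l\<in>PiE I (\<lambda>_. Lab). D l \<omega>) = 1" if \<omega>: "\<omega> \<in> space M" for \<omega>
  proof -
    define l0 where "l0 = restrict (\<lambda>i. lab (\<xi> i \<omega>)) I"
    have l0: "l0 \<in> PiE I (\<lambda>_. Lab)"
      unfolding l0_def lab_def Lab_def restrict_PiE_iff using region_label_range by blast
    have "D l \<omega> = (if l0 = l then 1 else 0)" if l: "l \<in> PiE I (\<lambda>_. Lab)" for l
    proof (cases "l0 = l")
      case True
      have "indicator (R (l i)) (\<xi> i \<omega>) = (1::real)" if "i \<in> I" for i
        using measurable_space[OF rv[OF that] \<omega>] that by (auto simp: R_def True[symmetric] l0_def)
      with True show ?thesis by (simp add: D_def)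
    next
      case False
      then obtain i where "i \<in> I" "l0 i \<noteq> l i" using l0 l by (metis PiE_ext)
      then have "i \<in> I" "indicator (R (l i)) (\<xi> i \<omega>) = (0::real)" by (auto simp: R_def l0_def)
      then have "D l \<omega> = 0" unfolding D_def using I by (intro prod_zero) auto
      then show ?thesis using False by simp
    qed
    then have "(\<Sum>l\<in>PiE I (\<lambda>_. Lab). D l \<omega>) = (\<Sum>l\<in>PiE I (\<lambda>_. Lab). if l0 = l then 1 else 0)"
      by (intro sum.cong) auto
    also have "\<dots> = 1" using l0 finLab I by (subst sum.delta') (auto intro: finite_PiE)
    finally show ?thesis .
  qed
  have cvm: "config_value H I' \<in> borel_measurable (PiM I' (\<lambda>_. ?E))" if "I' \<subseteq> I" for I'
    using config_value_measurable[OF finite_subset[OF that I] H] .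
  have cvM: "(\<lambda>\<omega>. config_value H I' (\<lambda>i. \<xi> i \<omega>)) \<in> borel_measurable M" if "I' \<subseteq> I" for I'
    using measurable_compose[OF xm[OF that] cvm[OF that]] by (simp add: config_value_restrict)
  define F where "F \<omega> = \<Psi> (config_value H I (\<lambda>i. \<xi> i \<omega>))" for \<omega>
  have Fm[measurable]: "F \<in> borel_measurable M" unfolding F_def using cvM[OF order_refl] by measurable
  have Dm[measurable]: "D l \<in> borel_measurable M" for l unfolding D_def by (rule prodM) simp
  have D01: "0 \<le> D l \<omega>" "D l \<omega> \<le> 1" for l \<omega> unfolding D_def using prod01 by auto
  define N where "N \<omega> = card {y\<in>Y. good_box I m K A G \<epsilon> (\<lambda>i. \<xi> i \<omega>) y}" for \<omega>
  \<comment> \<open>The contribution of a single labelling \<open>l\<close>, with \<open>k\<close> good boxes.\<close>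
  have single: "\<exists>k. (\<forall>\<omega>. D l \<omega> \<noteq> 0 \<longrightarrow> N \<omega> = k) \<and> cmod (CLINT \<omega>|M. F \<omega> * D l \<omega>) \<le> \<delta> ^ k * (\<integral>\<omega>. D l \<omega> \<partial>M)" for l
  proof (cases "\<exists>\<omega>. D l \<omega> \<noteq> 0")
    case False
    then show ?thesis by auto
  next
    case True
    then obtain \<omega>0 where "D l \<omega>0 \<noteq> 0" by blast
    have lab_eq: "\<xi> i \<omega> \<in> space ?E \<and> lab (\<xi> i \<omega>) = l i" if "D l \<omega> \<noteq> 0" "i \<in> I" for i \<omega>
      using that I unfolding D_def R_def by (auto simp: indicator_def split: if_splits)
    define x0 where "x0 i = \<xi> i \<omega>0" for i
    have lab0: "lab (x0 i) = l i" if "i \<in> I" for i using lab_eq[OF \<open>D l \<omega>0 \<noteq> 0\<close> that] by (simp add: x0_def)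
    define J where "J = {y\<in>Y. good_box I m K A G \<epsilon> x0 y}"
    define blk where "blk y = {i\<in>I. dist y (fst (x0 i)) \<le> K}" for y
    have J: "finite J" "J \<subseteq> Y" using Y by (auto simp: J_def)
    have same: "good_box I m K A G \<epsilon> (\<lambda>i. \<xi> i \<omega>) y \<longleftrightarrow> y \<in> J" "{i\<in>I. dist y (fst (\<xi> i \<omega>)) \<le> K} = blk y"
      if \<omega>: "D l \<omega> \<noteq> 0" and y: "y \<in> Y" for \<omega> y
    proof -
      have "region_label Y K A G \<epsilon> (\<xi> i \<omega>) = region_label Y K A G \<epsilon> (x0 i)" if "i \<in> I" for i
        using lab_eq[OF \<omega> that] lab0[OF that] by (simp add: lab_def)
      from good_box_label_cong[OF this y] y
      show "good_box I m K A G \<epsilon> (\<lambda>i. \<xi> i \<omega>) y \<longleftrightarrow> y \<in> J" "{i\<in>I. dist y (fst (\<xi> i \<omega>)) \<le> K} = blk y"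
        by (auto simp: J_def blk_def)
    qed
    have NJ: "N \<omega> = card J" if "D l \<omega> \<noteq> 0" for \<omega>
      unfolding N_def using same(1)[OF that] J(2) by (intro arg_cong[where f=card]) auto
    have blkI: "blk y \<subseteq> I" for y by (auto simp: blk_def)
    have blkm: "card (blk y) = m" if "y \<in> J" for y using that by (simp add: J_def good_box_def blk_def)
    have inner: "lab p = ({y}, {y}, {}) \<longleftrightarrow> dist y (fst p) \<le> K" if "y \<in> Y" for y p
      unfolding lab_def by (rule region_label_inner[OF iso sep that])
    have lblk: "l i = ({y}, {y}, {})" if "y \<in> J" "i \<in> blk y" for i y
      using inner[of y "x0 i"] lab0[of i] that J(2) by (auto simp: blk_def)
    have disj: "blk y \<inter> blk y' = {}" if "y \<in> J" "y' \<in> J" "y \<noteq> y'" for y y'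
    proof -
      have False if i: "i \<in> blk y" "i \<in> blk y'" for i
        using lblk[OF \<open>y \<in> J\<close> i(1)] lblk[OF \<open>y' \<in> J\<close> i(2)] \<open>y \<noteq> y'\<close> by simp
      then show ?thesis by blast
    qed
    define R0 where "R0 = I - (\<Union>y\<in>J. blk y)"
    \<comment> \<open>Index sets of the independent factors: \<open>None\<close> stands for the remaining points, \<open>Some y\<close> for the block at \<open>y\<close>.\<close>
    define Ls where "Ls = case_option R0 blk"
    define K' where "K' = insert None (Some ` J)"
    have K': "finite K'" using J by (simp add: K'_def)
    have LsI: "Ls o' \<subseteq> I" for o' using blkI by (cases o') (auto simp: Ls_def R0_def)
    have Lsdisj: "disjoint_family_on Ls K'"
      using disj by (auto simp: disjoint_family_on_def K'_def Ls_def R0_def)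
    have LsU: "(\<Union>o'\<in>K'. Ls o') = I" using blkI by (auto simp: K'_def Ls_def R0_def)
    define g where "g o' x = (\<Prod>i\<in>Ls o'. indicator (R (l i)) (x i) :: real)" for o' x
    define f where "f o' x = (case o' of None \<Rightarrow> \<Psi> (config_value H R0 x + real (card J) * a)
        | Some y \<Rightarrow> iexp (\<theta> * (config_value H (blk y) x - a))) * complex_of_real (g o' x)" for o' x
    have gm: "g o' \<in> borel_measurable (PiM (Ls o') (\<lambda>_. ?E))" for o' unfolding g_def by (rule prodm)
    have fm: "f o' \<in> borel_measurable (PiM (Ls o') (\<lambda>_. ?E))" for o'
    proof (cases o')
      case None
      have "R0 \<subseteq> I" by (auto simp: R0_def)
      from cvm[OF this] gm[of None] show ?thesis unfolding f_def None by (simp add: Ls_def)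
    next
      case (Some y)
      from cvm[OF blkI, of y] gm[of "Some y"] show ?thesis unfolding f_def Some by (simp add: Ls_def)
    qed
    have rest: "g o' (restrict z (Ls o')) = g o' z" "f o' (restrict z (Ls o')) = f o' z" for o' z
    proof -
      show *: "g o' (restrict z (Ls o')) = g o' z" unfolding g_def by (intro prod.cong) auto
      show "f o' (restrict z (Ls o')) = f o' z"
        unfolding f_def * by (cases o') (simp_all add: Ls_def config_value_restrict)
    qed
    have indL: "indep_vars (\<lambda>o'. PiM (Ls o') (\<lambda>_. ?E)) (\<lambda>o' \<omega>. restrict (\<lambda>i. \<xi> i \<omega>) (Ls o')) K'"
      by (rule indep_vars_restrict[OF ind LsI Lsdisj])
    have indf: "indep_vars (\<lambda>_. borel) (\<lambda>o' \<omega>. f o' (\<lambda>i. \<xi> i \<omega>)) K'"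
      using indep_vars_compose2[OF indL fm] by (simp add: rest)
    have indg: "indep_vars (\<lambda>_. borel) (\<lambda>o' \<omega>. g o' (\<lambda>i. \<xi> i \<omega>)) K'"
      using indep_vars_compose2[OF indL gm] by (simp add: rest)
    have fM: "(\<lambda>\<omega>. f o' (\<lambda>i. \<xi> i \<omega>)) \<in> borel_measurable M" for o'
      using measurable_compose[OF xm[OF LsI] fm] by (simp add: rest)
    have gM: "(\<lambda>\<omega>. g o' (\<lambda>i. \<xi> i \<omega>)) \<in> borel_measurable M" for o'
      using measurable_compose[OF xm[OF LsI] gm] by (simp add: rest)
    have g01: "0 \<le> g o' z" "g o' z \<le> 1" for o' z unfolding g_def using prod01 by auto
    have fg: "cmod (f o' z) \<le> g o' z" for o' z
      using \<Psi>1 g01 by (cases o') (auto simp: f_def norm_mult intro!: mult_left_le_one_le)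
    have intg: "integrable M (\<lambda>\<omega>. g o' (\<lambda>i. \<xi> i \<omega>))" for o'
      by (rule integrable_const_bound[of _ 1]) (use g01 gM in auto)
    have intf: "integrable M (\<lambda>\<omega>. f o' (\<lambda>i. \<xi> i \<omega>))" for o'
      by (rule integrable_const_bound[of _ 1]) (auto intro!: fM AE_I2 order_trans[OF fg g01(2)])
    have Dprod: "D l \<omega> = (\<Prod>o'\<in>K'. g o' (\<lambda>i. \<xi> i \<omega>))" for \<omega>
    proof -
      have "finite (Ls o')" for o' using finite_subset[OF LsI I] .
      then show ?thesis
        unfolding D_def g_def LsU[symmetric]
        using Lsdisj K' by (intro prod.UNION_disjoint) (auto simp: disjoint_family_on_def)
    qed
    have coset': "AE \<omega> in M. \<forall>y\<in>J. (\<forall>i\<in>blk y. dist y (fst (\<xi> i \<omega>)) \<le> K) \<longrightarrow> config_value H (blk y) (\<lambda>i. \<xi> i \<omega>) - a \<in> S"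
      using J by (intro AE_finite_allI coset blkI blkm) auto
    have FD: "AE \<omega> in M. F \<omega> * D l \<omega> = (\<Prod>o'\<in>K'. f o' (\<lambda>i. \<xi> i \<omega>))"
      using distinct coset'
    proof eventually_elim
      case (elim \<omega>)
      let ?x = "\<lambda>i. \<xi> i \<omega>"
      show ?case
      proof (cases "D l \<omega> = 0")
        case True
        then obtain o' where o': "o' \<in> K'" "g o' ?x = 0" using Dprod[of \<omega>] K' by auto
        then have "f o' ?x = 0" using fg[of o' ?x] by simp
        then have "(\<Prod>o'\<in>K'. f o' ?x) = 0" using o' K' by (intro prod_zero) auto
        then show ?thesis using True by simp
      next
        case False
        define v where "v y = config_value H (blk y) ?x - a" for y
        have vS: "v y \<in> S" if "y \<in> J" for y
          using elim(2) same(2)[OF False] that J(2) unfolding v_def by blast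
        have blkeq: "{i\<in>I. dist y (fst (\<xi> i \<omega>)) \<le> K} = blk y" if "y \<in> J" for y
          using same(2)[OF False] that J(2) by auto
        have "config_value H I ?x = (\<Sum>y\<in>J. config_value H {i\<in>I. dist y (fst (\<xi> i \<omega>)) \<le> K} ?x)
            + config_value H (I - (\<Union>y\<in>J. {i\<in>I. dist y (fst (\<xi> i \<omega>)) \<le> K})) ?x"
        proof (rule good_box_decomposition[OF iso J(1) I])
          show "2 * A < dist y y'" if "y \<in> J" "y' \<in> J" "y \<noteq> y'" for y y' using sep that J(2) by auto
          show "\<xi> i \<omega> \<in> space ?E" if "i \<in> I" for i using lab_eq[OF False that] by simp
          show "good_box I m K A G \<epsilon> ?x y" if "y \<in> J" for y using same(1)[OF False] that J(2) by auto
        qed (use elim in auto)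
        also have "\<dots> = (\<Sum>y\<in>J. config_value H (blk y) ?x) + config_value H R0 ?x"
          by (simp add: R0_def blkeq cong: SUP_cong)
        also have "(\<Sum>y\<in>J. config_value H (blk y) ?x) = (\<Sum>y\<in>J. v y) + real (card J) * a"
          by (simp add: v_def sum_subtractf)
        finally have cv: "config_value H I ?x = (config_value H R0 ?x + real (card J) * a) + (\<Sum>y\<in>J. v y)" by simp
        have sumS: "(\<Sum>y\<in>J'. v y) \<in> S \<and> \<Psi> (z + (\<Sum>y\<in>J'. v y)) = \<Psi> z * (\<Prod>y\<in>J'. iexp (\<theta> * v y))" if "J' \<subseteq> J" for J' z
          using finite_subset[OF that J(1)] that
        proof (induction J')
          case empty
          then show ?case using S by simp
        next
          case (insert y J')
          then have IH: "(\<Sum>y\<in>J'. v y) \<in> S" "\<Psi> (z + (\<Sum>y\<in>J'. v y)) = \<Psi> z * (\<Prod>y\<in>J'. iexp (\<theta> * v y))" and y: "v y \<in> S"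
            using vS by auto
          have "\<Psi> (z + (\<Sum>y\<in>insert y J'. v y)) = \<Psi> ((z + (\<Sum>y\<in>J'. v y)) + v y)"
            using insert by (simp add: algebra_simps)
          also have "\<dots> = \<Psi> z * (\<Prod>y\<in>insert y J'. iexp (\<theta> * v y))"
            unfolding \<Psi>S[OF y] IH(2) using insert by (simp add: mult_ac)
          finally show ?case using IH y S insert by simp
        qed
        have "F \<omega> = \<Psi> (config_value H R0 ?x + real (card J) * a) * (\<Prod>y\<in>J. iexp (\<theta> * v y))"
          unfolding F_def cv using sumS[OF order_refl] by blast
        moreover have "complex_of_real (D l \<omega>) = g None ?x * (\<Prod>y\<in>J. complex_of_real (g (Some y) ?x))"
          unfolding Dprod K'_def using J by (simp add: prod.reindex)
        moreover have "(\<Prod>o'\<in>K'. f o' ?x) = f None ?x * (\<Prod>y\<in>J. f (Some y) ?x)"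
          unfolding K'_def using J by (simp add: prod.reindex)
        ultimately show ?thesis
          unfolding f_def v_def by (simp add: prod.distrib mult_ac)
      qed
    qed
    have bnd: "cmod (CLINT \<omega>|M. f o' (\<lambda>i. \<xi> i \<omega>)) \<le> (case o' of None \<Rightarrow> 1 | Some y \<Rightarrow> \<delta>) * (\<integral>\<omega>. g o' (\<lambda>i. \<xi> i \<omega>) \<partial>M)"
      if "o' \<in> K'" for o'
    proof (cases o')
      case None
      have "cmod (CLINT \<omega>|M. f o' (\<lambda>i. \<xi> i \<omega>)) \<le> (\<integral>\<omega>. cmod (f o' (\<lambda>i. \<xi> i \<omega>)) \<partial>M)" by (rule integral_norm_bound)
      also have "\<dots> \<le> (\<integral>\<omega>. g o' (\<lambda>i. \<xi> i \<omega>) \<partial>M)"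
        by (intro integral_mono intg integrable_norm intf fg)
      finally show ?thesis using None by simp
    next
      case (Some y)
      then have y: "y \<in> J" "y \<in> Y" using that J by (auto simp: K'_def)
      have "indicator (R (l i)) (\<xi> i \<omega>) = (indicator {p. dist y (fst p) \<le> K} (\<xi> i \<omega>) :: real)"
        if "i \<in> blk y" "\<omega> \<in> space M" for i \<omega>
        using lblk[OF y(1) that(1)] inner[OF y(2), of "\<xi> i \<omega>"] measurable_space[OF rv that(2), of i] that blkI[of y]
        by (auto simp: R_def indicator_def)
      then have geq: "g o' (\<lambda>i. \<xi> i \<omega>) = (\<Prod>i\<in>blk y. indicator {p. dist y (fst p) \<le> K} (\<xi> i \<omega>))" if "\<omega> \<in> space M" for \<omega>
        unfolding g_def Some using that by (auto simp: Ls_def intro!: prod.cong)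
      have "(CLINT \<omega>|M. f o' (\<lambda>i. \<xi> i \<omega>)) = (CLINT \<omega>|M. iexp (- (\<theta> * a)) * (iexp (\<theta> * config_value H (blk y) (\<lambda>i. \<xi> i \<omega>)) * (\<Prod>i\<in>blk y. indicator {p. dist y (fst p) \<le> K} (\<xi> i \<omega>))))"
      proof (intro Bochner_Integration.integral_cong refl)
        fix \<omega> assume \<omega>: "\<omega> \<in> space M"
        have "complex_of_real (\<Prod>i\<in>blk y. indicator {p. dist y (fst p) \<le> K} (\<xi> i \<omega>)) = (\<Prod>i\<in>blk y. indicator {p. dist y (fst p) \<le> K} (\<xi> i \<omega>))"
          unfolding of_real_prod by (intro prod.cong) (auto simp: indicator_def)
        moreover have "iexp (\<theta> * (config_value H (blk y) (\<lambda>i. \<xi> i \<omega>) - a)) = iexp (- (\<theta> * a)) * iexp (\<theta> * config_value H (blk y) (\<lambda>i. \<xi> i \<omega>))"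
          by (simp add: algebra_simps flip: exp_add)
        ultimately show "f o' (\<lambda>i. \<xi> i \<omega>) = iexp (- (\<theta> * a)) * (iexp (\<theta> * config_value H (blk y) (\<lambda>i. \<xi> i \<omega>)) * (\<Prod>i\<in>blk y. indicator {p. dist y (fst p) \<le> K} (\<xi> i \<omega>)))"
          unfolding f_def geq[OF \<omega>] by (simp add: Some mult.assoc)
      qed
      also have "cmod \<dots> = cmod (CLINT \<omega>|M. iexp (\<theta> * config_value H (blk y) (\<lambda>i. \<xi> i \<omega>)) * (\<Prod>i\<in>blk y. indicator {p. dist y (fst p) \<le> K} (\<xi> i \<omega>)))"
        by (simp only: integral_mult_right_zero norm_mult norm_exp_i_times mult_1_left)
      also have "\<dots> \<le> \<delta> * (\<integral>\<omega>. (\<Prod>i\<in>blk y. indicator {p. dist y (fst p) \<le> K} (\<xi> i \<omega>)) \<partial>M)"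
        by (rule block[OF y(2) blkI blkm[OF y(1)]])
      also have "(\<integral>\<omega>. (\<Prod>i\<in>blk y. indicator {p. dist y (fst p) \<le> K} (\<xi> i \<omega>)) \<partial>M) = (\<integral>\<omega>. g o' (\<lambda>i. \<xi> i \<omega>) \<partial>M)"
        by (intro Bochner_Integration.integral_cong refl geq[symmetric])
      finally show ?thesis using Some by simp
    qed
    have "(CLINT \<omega>|M. F \<omega> * D l \<omega>) = (CLINT \<omega>|M. (\<Prod>o'\<in>K'. f o' (\<lambda>i. \<xi> i \<omega>)))"
      using FD fM by (intro integral_cong_AE) (auto intro!: borel_measurable_prod)
    also have "\<dots> = (\<Prod>o'\<in>K'. CLINT \<omega>|M. f o' (\<lambda>i. \<xi> i \<omega>))"
      by (rule indep_vars_lebesgue_integral[OF K' indf intf])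
    also have "cmod \<dots> \<le> (\<Prod>o'\<in>K'. (case o' of None \<Rightarrow> 1 | Some y \<Rightarrow> \<delta>) * (\<integral>\<omega>. g o' (\<lambda>i. \<xi> i \<omega>) \<partial>M))"
      unfolding prod_norm[symmetric] using bnd by (intro prod_mono) auto
    also have "\<dots> = \<delta> ^ card J * (\<Prod>o'\<in>K'. \<integral>\<omega>. g o' (\<lambda>i. \<xi> i \<omega>) \<partial>M)"
      unfolding prod.distrib K'_def using J by (simp add: prod.reindex)
    also have "(\<Prod>o'\<in>K'. \<integral>\<omega>. g o' (\<lambda>i. \<xi> i \<omega>) \<partial>M) = (\<integral>\<omega>. D l \<omega> \<partial>M)"
      unfolding Dprod by (rule indep_vars_lebesgue_integral[OF K' indg intg, symmetric])
    finally show ?thesis using NJ by blast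
  qed
  then obtain k where k: "\<And>l \<omega>. D l \<omega> \<noteq> 0 \<Longrightarrow> N \<omega> = k l"
      "\<And>l. cmod (CLINT \<omega>|M. F \<omega> * D l \<omega>) \<le> \<delta> ^ k l * (\<integral>\<omega>. D l \<omega> \<partial>M)"
    by metis
  let ?L = "PiE I (\<lambda>_. Lab)"
  have finL: "finite ?L" using finLab I by (intro finite_PiE) auto
  have intD: "integrable M (D l)" for l by (rule integrable_const_bound[of _ 1]) (use D01 in auto)
  have intFD: "integrable M (\<lambda>\<omega>. F \<omega> * D l \<omega>)" for l
  proof (rule integrable_const_bound[of _ 1])
    have "cmod (F \<omega> * D l \<omega>) \<le> 1" for \<omega>
      using \<Psi>1 D01[of l \<omega>] by (simp add: norm_mult F_def mult_le_one)
    then show "AE \<omega> in M. cmod (F \<omega> * D l \<omega>) \<le> 1" by simp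
  qed measurable
  have "(CLINT \<omega>|M. F \<omega>) = (CLINT \<omega>|M. (\<Sum>l\<in>?L. F \<omega> * D l \<omega>))"
  proof (intro Bochner_Integration.integral_cong refl)
    fix \<omega> assume "\<omega> \<in> space M"
    then have "F \<omega> = F \<omega> * complex_of_real (\<Sum>l\<in>?L. D l \<omega>)" using sumD by simp
    then show "F \<omega> = (\<Sum>l\<in>?L. F \<omega> * D l \<omega>)" by (simp add: sum_distrib_left)
  qed
  also have "\<dots> = (\<Sum>l\<in>?L. CLINT \<omega>|M. F \<omega> * D l \<omega>)"
    by (rule Bochner_Integration.integral_sum[OF intFD])
  also have "cmod \<dots> \<le> (\<Sum>l\<in>?L. \<delta> ^ k l * (\<integral>\<omega>. D l \<omega> \<partial>M))"
    by (intro sum_norm_le k(2))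
  also have "\<dots> = (\<integral>\<omega>. (\<Sum>l\<in>?L. \<delta> ^ k l * D l \<omega>) \<partial>M)"
    using intD by (subst Bochner_Integration.integral_sum) auto
  also have "\<dots> = (\<integral>\<omega>. \<delta> ^ N \<omega> \<partial>M)"
  proof (intro Bochner_Integration.integral_cong refl)
    fix \<omega> assume "\<omega> \<in> space M"
    have "(\<Sum>l\<in>?L. \<delta> ^ k l * D l \<omega>) = (\<Sum>l\<in>?L. \<delta> ^ N \<omega> * D l \<omega>)"
      by (intro sum.cong refl) (metis k(1) mult_zero_right)
    also have "\<dots> = \<delta> ^ N \<omega>" using sumD[OF \<open>\<omega> \<in> space M\<close>] by (simp flip: sum_distrib_left)
    finally show "(\<Sum>l\<in>?L. \<delta> ^ k l * D l \<omega>) = \<delta> ^ N \<omega>" .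
  qed
  finally show ?thesis unfolding F_def N_def .
qed

section \<open>The number of good boxes\<close>

lemma one_minus_power_lower:
  assumes "0 \<le> C" "2 * C \<le> real n" "0 < n"
  shows "exp (- 2 * C) \<le> (1 - C / real n) ^ n"
proof -
  define x where "x = C / real n"
  have x: "0 \<le> x" "x \<le> 1/2" using assms by (auto simp: x_def field_simps)
  have "- 2 * x \<le> - x - 2 * x\<^sup>2"
  proof -
    have "x * x \<le> x * (1/2)" using x by (intro mult_left_mono) auto
    then show ?thesis by (simp add: power2_eq_square)
  qed
  also have "\<dots> \<le> ln (1 - x)" by (rule ln_one_minus_pos_lower_bound) (use x in auto)
  finally have "exp (- 2 * x) \<le> 1 - x" using x by (simp add: ln_ge_iff)
  then have "exp (- 2 * x) ^ n \<le> (1 - x) ^ n" by (intro power_mono) auto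
  also have "exp (- 2 * x) ^ n = exp (- 2 * C)"
    using assms by (simp add: x_def flip: exp_of_nat_mult)
  finally show ?thesis by (simp add: x_def)
qed

text \<open>Divide the indices into \<open>m + card G\<close> groups of about equal size. From each group choose one point
  and assign it to a role, being in the core or near a guard position; let all other points avoid the
  box. Different choices give disjoint events, each implying that the box is good. There are of order
  \<open>n ^ (m + card G)\<close> choices, and each has probability of order \<open>n\<close> to the power \<open>- (m + card G)\<close>. Taking
  groups makes the choices injective without counting falling factorials.\<close>

lemma (in prob_space) good_box_probability:
  fixes \<xi> :: "nat \<Rightarrow> 'a \<Rightarrow> (real^'d) \<times> 'm" and Q :: "'m measure"
  assumes ind: "indep_vars (\<lambda>_. marked_space Q) \<xi> {1..n}"
    and iso: "isolation Q H m K A G \<epsilon>" and m: "1 \<le> m"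
    and inner: "\<And>i. i \<in> {1..n} \<Longrightarrow> q / real n \<le> prob {\<omega> \<in> space M. dist y (fst (\<xi> i \<omega>)) \<le> K}"
    and guard: "\<And>i g. i \<in> {1..n} \<Longrightarrow> g \<in> G \<Longrightarrow> q / real n \<le> prob {\<omega> \<in> space M. dist (y + g) (fst (\<xi> i \<omega>)) < \<epsilon>}"
    and box: "\<And>i. i \<in> {1..n} \<Longrightarrow> prob {\<omega> \<in> space M. dist y (fst (\<xi> i \<omega>)) \<le> A} \<le> C / real n"
    and q: "0 < q" and C: "0 \<le> C" and n: "2 * (m + card G) \<le> n" "2 * C \<le> real n"
  shows "(q / (2 * real (m + card G))) ^ (m + card G) * exp (- 2 * C)
    \<le> prob {\<omega> \<in> space M. good_box {1..n} m K A G \<epsilon> (\<lambda>i. \<xi> i \<omega>) y}"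
proof -
  let ?E = "marked_space Q :: ((real^'d) \<times> 'm) measure"
  let ?I = "{1..n}"
  have G: "finite G" and KA: "K < A" and KG: "\<And>g. g \<in> G \<Longrightarrow> K + \<epsilon> < norm g \<and> norm g + \<epsilon> < A"
    using iso by (auto simp: isolation_def)
  define M' where "M' = m + card G"
  have M': "0 < M'" using m by (simp add: M'_def)
  define L where "L = n div M'"
  have LM: "L * M' \<le> n" by (simp add: L_def)
  have Lge: "real n / (2 * real M') \<le> real L"
  proof -
    have "n < L * M' + M'" unfolding L_def using M' by (metis add.commute div_mult_mod_eq mod_less_divisor nat_add_left_cancel_less)
    moreover have "2 * M' \<le> n" using n by (simp add: M'_def)
    ultimately have "n \<le> 2 * (L * M')" by linarith
    then have "real n \<le> real (2 * (L * M'))" by (simp only: of_nat_le_iff)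
    then show ?thesis using M' by (simp add: field_simps)
  qed
  have n0: "0 < n" using n(1) m by simp
  obtain e where e: "bij_betw e {..<card G} G" using G by (metis atLeast0LessThan ex_bij_betw_nat_finite)
  define S where "S k = (if k < m then {p :: (real^'d) \<times> 'm. dist y (fst p) \<le> K} else {p. dist (y + e (k - m)) (fst p) < \<epsilon>})" for k
  define Bx where "Bx = {p :: (real^'d) \<times> 'm. dist y (fst p) \<le> A}"
  have eG: "e (k - m) \<in> G" if "k < M'" "\<not> k < m" for k
    using e that by (auto simp: bij_betw_def M'_def)
  have SB: "S k \<subseteq> Bx" if "k < M'" for k
  proof (cases "k < m")
    case False
    have "dist y (fst p) \<le> A" if "dist (y + e (k - m)) (fst p) < \<epsilon>" for p :: "(real^'d) \<times> 'm"
      using dist_triangle[of y "fst p" "y + e (k - m)"] KG[OF eG[OF \<open>k < M'\<close> False]] that by (simp add: dist_norm)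
    then show ?thesis using False by (auto simp: S_def Bx_def)
  qed (use KA in \<open>auto simp: S_def Bx_def\<close>)
  have Sdisj: "\<not> dist y (fst p) \<le> K" if "k < M'" "\<not> k < m" "p \<in> S k" for k p
    using dist_triangle2[of y "y + e (k - m)" "fst p"] KG[OF eG[OF that(1,2)]] that by (auto simp: S_def dist_norm)
  define Blk where "Blk k = {k * L + 1..k * L + L}" for k
  have BlkI: "Blk k \<subseteq> ?I" if "k < M'" for k
  proof -
    have "(k + 1) * L \<le> M' * L" using that by (intro mult_right_mono) auto
    then have "k * L + L \<le> n" using LM by (simp add: algebra_simps)
    then show ?thesis by (auto simp: Blk_def)
  qed
  have Blkdisj: "k = k'" if "i \<in> Blk k" "i \<in> Blk k'" for i k k'
  proof (rule ccontr)
    have *: False if "i \<in> Blk k" "i \<in> Blk k'" "k < k'" for i k k'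
    proof -
      have "(k + 1) * L \<le> k' * L" using that by (intro mult_right_mono) auto
      then show False using that by (auto simp: Blk_def algebra_simps)
    qed
    assume "k \<noteq> k'"
    then show False using *[of i k k'] *[of i k' k] that by (cases "k < k'") auto
  qed
  define Tu where "Tu = PiE {..<M'} Blk"
  have finTu: "finite Tu" unfolding Tu_def by (intro finite_PiE) (auto simp: Blk_def)
  have cardTu: "card Tu = L ^ M'" unfolding Tu_def by (subst card_PiE) (auto simp: Blk_def)
  \<comment> \<open>The region prescribed for point \<open>i\<close> by the choice \<open>t\<close>.\<close>
  define T where "T t i = (if i \<in> t ` {..<M'} then S (the_inv_into {..<M'} t i) else - Bx)" for t :: "nat \<Rightarrow> nat" and i
  have tB: "t k \<in> Blk k" if "t \<in> Tu" "k < M'" for t k using that by (auto simp: Tu_def)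
  have tinj: "inj_on t {..<M'}" if "t \<in> Tu" for t
  proof (rule inj_onI)
    fix k k' assume "k \<in> {..<M'}" "k' \<in> {..<M'}" "t k = t k'"
    then show "k = k'" using tB[OF that, of k] tB[OF that, of k'] Blkdisj[of "t k" k k'] by simp
  qed
  have Tt: "T t (t k) = S k" if "t \<in> Tu" "k < M'" for t k
    using tinj[OF that(1)] that(2) by (simp add: T_def the_inv_into_f_f)
  have Tn: "T t i = - Bx" if "i \<notin> t ` {..<M'}" for t i using that by (simp add: T_def)
  have Sm: "S k \<inter> space ?E \<in> sets ?E" for k
  proof -
    have "S k \<inter> space ?E = (if k < m then {p \<in> space ?E. dist y (fst p) \<le> K} else {p \<in> space ?E. dist (y + e (k - m)) (fst p) < \<epsilon>})"
      by (auto simp: S_def)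
    also have "\<dots> \<in> sets ?E" by simp
    finally show ?thesis .
  qed
  have Bxm: "- Bx \<inter> space ?E \<in> sets ?E"
  proof -
    have "- Bx \<inter> space ?E = {p \<in> space ?E. \<not> dist y (fst p) \<le> A}" by (auto simp: Bx_def)
    also have "\<dots> \<in> sets ?E" by measurable
    finally show ?thesis .
  qed
  have Tm: "T t i \<inter> space ?E \<in> sets ?E" for t i using Sm Bxm by (auto simp: T_def)
  have rv: "\<xi> i \<in> measurable M ?E" if "i \<in> ?I" for i
    using ind that by (auto simp: indep_vars_def)
  have sp: "\<xi> i \<omega> \<in> space ?E" if "i \<in> ?I" "\<omega> \<in> space M" for i \<omega> using measurable_space[OF rv[OF that(1)] that(2)] .
  define Ev where "Ev t = (\<Inter>i\<in>?I. \<xi> i -` (T t i \<inter> space ?E) \<inter> space M)" for t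
  have Evmem: "\<xi> i \<omega> \<in> T t i" if "\<omega> \<in> Ev t" "i \<in> ?I" for \<omega> t i using that by (auto simp: Ev_def)
  have Evm: "Ev t \<in> events" for t
    unfolding Ev_def using n0 by (intro sets.finite_INT measurable_sets[OF rv Tm]) auto
  have Evsp: "\<omega> \<in> space M" if "\<omega> \<in> Ev t" for \<omega> t using sets.sets_into_space[OF Evm] that by blast
  have Evdisj: "disjoint_family_on Ev Tu"
    unfolding disjoint_family_on_def
  proof (intro ballI impI)
    fix t t' assume t: "t \<in> Tu" "t' \<in> Tu" "t \<noteq> t'"
    have False if \<omega>: "\<omega> \<in> Ev t" "\<omega> \<in> Ev t'" for \<omega>
    proof -
      have "t k = t' k" if k: "k \<in> {..<M'}" for k
      proof -
        have tk: "t k \<in> ?I" using subsetD[OF BlkI tB[OF t(1)], of k] k by simp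
        have "\<xi> (t k) \<omega> \<in> Bx" using Evmem[OF \<omega>(1) tk] Tt[OF t(1)] SB k by auto
        then have "t k \<in> t' ` {..<M'}" using Evmem[OF \<omega>(2) tk] Tn by blast
        then obtain k' where k': "k' < M'" "t k = t' k'" by auto
        then have "k = k'" using Blkdisj tB[OF t(1), of k] tB[OF t(2), of k'] k by auto
        then show ?thesis using k' by simp
      qed
      then have "t = t'" using t(1,2) unfolding Tu_def by (intro PiE_ext) auto
      then show False using t by simp
    qed
    then show "Ev t \<inter> Ev t' = {}" by blast
  qed
  have Evgood: "good_box ?I m K A G \<epsilon> (\<lambda>i. \<xi> i \<omega>) y" if t: "t \<in> Tu" and \<omega>: "\<omega> \<in> Ev t" for t \<omega>
  proof -
    have tI: "t k \<in> ?I" if "k < M'" for k by (rule subsetD[OF BlkI[OF that] tB[OF t that]])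
    have inS: "\<xi> (t k) \<omega> \<in> S k" if "k < M'" for k using Evmem[OF \<omega> tI[OF that]] Tt[OF t that] by simp
    have box_t: "\<exists>k<M'. i = t k" if "i \<in> ?I" "dist y (fst (\<xi> i \<omega>)) \<le> A" for i
    proof (rule ccontr)
      assume "\<not> (\<exists>k<M'. i = t k)"
      then have "i \<notin> t ` {..<M'}" by auto
      then have "\<xi> i \<omega> \<in> - Bx" using Evmem[OF \<omega> that(1)] Tn by simp
      then show False using that by (simp add: Bx_def)
    qed
    have f1: "{i\<in>?I. dist y (fst (\<xi> i \<omega>)) \<le> K} = t ` {..<m}"
    proof (intro set_eqI iffI)
      fix i assume i: "i \<in> {i\<in>?I. dist y (fst (\<xi> i \<omega>)) \<le> K}"
      then obtain k where k: "k < M'" "i = t k" using box_t[of i] KA by auto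
      then have "k < m" using Sdisj[OF k(1) _ inS[OF k(1)]] i by auto
      then show "i \<in> t ` {..<m}" using k by auto
    next
      fix i assume "i \<in> t ` {..<m}"
      then obtain k where k: "k < m" "i = t k" by auto
      then show "i \<in> {i\<in>?I. dist y (fst (\<xi> i \<omega>)) \<le> K}" using inS[of k] tI[of k] by (auto simp: S_def M'_def)
    qed
    have f2: "card (t ` {..<m}) = m"
      using inj_on_subset[OF tinj[OF t], of "{..<m}"] by (subst card_image) (auto simp: M'_def)
    have f3: "\<exists>i\<in>?I. dist (y + g) (fst (\<xi> i \<omega>)) < \<epsilon>" if "g \<in> G" for g
    proof -
      have "g \<in> e ` {..<card G}" using e that by (simp add: bij_betw_def)
      then obtain j where j: "j < card G" "g = e j" by auto
      then have "m + j < M'" by (simp add: M'_def)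
      then show ?thesis using inS[of "m + j"] tI[of "m + j"] j by (auto simp: S_def)
    qed
    have f4: "dist y (fst (\<xi> i \<omega>)) \<le> K \<or> (\<exists>g\<in>G. dist (y + g) (fst (\<xi> i \<omega>)) < \<epsilon>)"
      if i: "i \<in> ?I" "dist y (fst (\<xi> i \<omega>)) \<le> A" for i
    proof -
      obtain k where k: "k < M'" "i = t k" using box_t[OF i] by auto
      show ?thesis
      proof (cases "k < m")
        case True
        then show ?thesis using inS[OF k(1)] k(2) by (simp add: S_def)
      next
        case False
        then have "dist (y + e (k - m)) (fst (\<xi> i \<omega>)) < \<epsilon>" using inS[OF k(1)] k(2) by (simp add: S_def)
        then show ?thesis using eG[OF k(1) False] by blast
      qed
    qed
    show ?thesis unfolding good_box_def f1 by (intro conjI ballI impI f2 f3 f4)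
  qed
  have PS: "q / real n \<le> prob (\<xi> i -` (S k \<inter> space ?E) \<inter> space M)" if "i \<in> ?I" "k < M'" for i k
  proof (cases "k < m")
    case True
    then have "\<xi> i -` (S k \<inter> space ?E) \<inter> space M = {\<omega> \<in> space M. dist y (fst (\<xi> i \<omega>)) \<le> K}"
      using sp[OF that(1)] by (auto simp: S_def)
    then show ?thesis using inner[OF that(1)] by simp
  next
    case False
    then have "\<xi> i -` (S k \<inter> space ?E) \<inter> space M = {\<omega> \<in> space M. dist (y + e (k - m)) (fst (\<xi> i \<omega>)) < \<epsilon>}"
      using sp[OF that(1)] by (auto simp: S_def)
    then show ?thesis using guard[OF that(1) eG[OF that(2) False]] by simp
  qed
  have PB: "1 - C / real n \<le> prob (\<xi> i -` (- Bx \<inter> space ?E) \<inter> space M)" if "i \<in> ?I" for i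
  proof -
    have b: "{\<omega> \<in> space M. dist y (fst (\<xi> i \<omega>)) \<le> A} \<in> events" using rv[OF that] by measurable
    have "\<xi> i -` (- Bx \<inter> space ?E) \<inter> space M = space M - {\<omega> \<in> space M. dist y (fst (\<xi> i \<omega>)) \<le> A}"
      using sp[OF that] by (auto simp: Bx_def)
    then show ?thesis using prob_compl[OF b] box[OF that] by simp
  qed
  have Cn: "0 \<le> 1 - C / real n" "1 - C / real n \<le> 1" using n n0 C by (auto simp: field_simps)
  have PEv: "(q / real n) ^ M' * (1 - C / real n) ^ n \<le> prob (Ev t)" if t: "t \<in> Tu" for t
  proof -
    have tI: "t ` {..<M'} \<subseteq> ?I"
    proof
      fix i assume "i \<in> t ` {..<M'}"
      then obtain k where "k < M'" "i = t k" by auto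
      then show "i \<in> ?I" using subsetD[OF BlkI tB[OF t], of k] by simp
    qed
    have "(q / real n) ^ M' * (1 - C / real n) ^ n \<le> (q / real n) ^ M' * (1 - C / real n) ^ (n - M')"
      using Cn q by (intro mult_left_mono power_decreasing) auto
    also have "\<dots> = (\<Prod>i\<in>t ` {..<M'}. q / real n) * (\<Prod>i\<in>?I - t ` {..<M'}. 1 - C / real n)"
      using card_image[OF tinj[OF t]] tI by (simp add: card_Diff_subset finite_subset)
    also have "\<dots> \<le> (\<Prod>i\<in>t ` {..<M'}. prob (\<xi> i -` (T t i \<inter> space ?E) \<inter> space M)) * (\<Prod>i\<in>?I - t ` {..<M'}. prob (\<xi> i -` (T t i \<inter> space ?E) \<inter> space M))"
    proof (intro mult_mono prod_mono conjI prod_nonneg)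
      fix i assume "i \<in> t ` {..<M'}"
      then obtain k where "k < M'" "i = t k" by auto
      then show "q / real n \<le> prob (\<xi> i -` (T t i \<inter> space ?E) \<inter> space M)" using PS[of i k] Tt[OF t, of k] tI by auto
    next
      fix i assume "i \<in> ?I - t ` {..<M'}"
      then show "1 - C / real n \<le> prob (\<xi> i -` (T t i \<inter> space ?E) \<inter> space M)" using PB[of i] Tn[of i t] by auto
    qed (use q Cn in auto)
    also have "\<dots> = (\<Prod>i\<in>?I. prob (\<xi> i -` (T t i \<inter> space ?E) \<inter> space M))"
      using prod.subset_diff[OF tI, of "\<lambda>i. prob (\<xi> i -` (T t i \<inter> space ?E) \<inter> space M)"] by (simp add: mult.commute)
    also have "\<dots> = prob (Ev t)"
      unfolding Ev_def using n0 by (intro indep_varsD[OF ind, symmetric]) (auto intro: Tm)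
    finally show ?thesis .
  qed
  have "(q / (2 * real M')) ^ M' * exp (- 2 * C) \<le> (real L * (q / real n)) ^ M' * (1 - C / real n) ^ n"
  proof (intro mult_mono power_mono)
    have "q / (2 * real M') = (real n / (2 * real M')) * (q / real n)" using n0 by simp
    also have "\<dots> \<le> real L * (q / real n)" using q Lge by (intro mult_right_mono) auto
    finally show "q / (2 * real M') \<le> real L * (q / real n)" .
    show "exp (- 2 * C) \<le> (1 - C / real n) ^ n" by (rule one_minus_power_lower[OF C n(2) n0])
  qed (use q in auto)
  also have "\<dots> = (\<Sum>t\<in>Tu. (q / real n) ^ M' * (1 - C / real n) ^ n)"
    unfolding sum_constant cardTu power_mult_distrib by (simp only: of_nat_power mult.assoc)
  also have "\<dots> \<le> (\<Sum>t\<in>Tu. prob (Ev t))" by (intro sum_mono PEv)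
  also have "\<dots> = prob (\<Union>t\<in>Tu. Ev t)"
    using finTu Evm Evdisj by (intro finite_measure_finite_Union[symmetric]) auto
  also have "\<dots> \<le> prob {\<omega> \<in> space M. good_box ?I m K A G \<epsilon> (\<lambda>i. \<xi> i \<omega>) y}"
  proof (rule finite_measure_mono)
    have xm: "(\<lambda>\<omega>. restrict (\<lambda>i. \<xi> i \<omega>) ?I) \<in> measurable M (PiM ?I (\<lambda>_. ?E))"
      by (rule measurable_restrict) (rule rv)
    have gr: "good_box ?I m K A G \<epsilon> (restrict (\<lambda>i. \<xi> i \<omega>) ?I) y = good_box ?I m K A G \<epsilon> (\<lambda>i. \<xi> i \<omega>) y" for \<omega>
      unfolding good_box_def by (simp cong: conj_cong)
    have "{\<omega> \<in> space M. good_box ?I m K A G \<epsilon> (\<lambda>i. \<xi> i \<omega>) y} = (\<lambda>\<omega>. restrict (\<lambda>i. \<xi> i \<omega>) ?I) -` {x \<in> space (PiM ?I (\<lambda>_. ?E)). good_box ?I m K A G \<epsilon> x y} \<inter> space M"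
      using measurable_space[OF xm] by (auto simp: gr simp del: One_nat_def)
    also have "\<dots> \<in> events" by (rule measurable_sets[OF xm good_box_measurable[OF _ G]]) simp
    finally show "{\<omega> \<in> space M. good_box ?I m K A G \<epsilon> (\<lambda>i. \<xi> i \<omega>) y} \<in> events" .
  qed (use Evgood Evsp in blast)
  finally show ?thesis unfolding M'_def .
qed

lemma good_box_update_far:
  assumes iso: "isolation Q H m K A G \<epsilon>" and far: "A < dist y (fst (x i))" "A < dist y (fst p)"
  shows "good_box I m K A G \<epsilon> (x(i := p)) y \<longleftrightarrow> good_box I m K A G \<epsilon> x y"
proof -
  have KA: "K < A" and KG: "\<And>g. g \<in> G \<Longrightarrow> norm g + \<epsilon> < A" using iso by (auto simp: isolation_def)
  have ng: "\<not> dist (y + g) z < \<epsilon>" if "A < dist y z" "g \<in> G" for g z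
    using KG[OF that(2)] that(1) dist_triangle[of y z "y + g"] by (simp add: dist_norm)
  let ?x' = "x(i := p)"
  have 1: "dist y (fst (?x' j)) \<le> K \<longleftrightarrow> dist y (fst (x j)) \<le> K" for j using far KA by auto
  have 2: "dist y (fst (?x' j)) \<le> A \<longleftrightarrow> dist y (fst (x j)) \<le> A" for j using far by auto
  have 3: "dist (y + g) (fst (?x' j)) < \<epsilon> \<longleftrightarrow> dist (y + g) (fst (x j)) < \<epsilon>" if "g \<in> G" for j g
    using ng[OF far(1) that] ng[OF far(2) that] by auto
  show ?thesis unfolding good_box_def 1 2 using 3 by (simp cong: ball_cong bex_cong conj_cong)
qed

text \<open>Moving one point only affects the box that it leaves and the box that it enters.\<close>

lemma good_box_count_diff:
  assumes iso: "isolation Q H m K A G \<epsilon>" and Y: "finite Y"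
    and sep: "\<And>y y'. y \<in> Y \<Longrightarrow> y' \<in> Y \<Longrightarrow> y \<noteq> y' \<Longrightarrow> 2 * A < dist y y'"
  shows "\<bar>real (card {y\<in>Y. good_box I m K A G \<epsilon> (x(i := p)) y}) - real (card {y\<in>Y. good_box I m K A G \<epsilon> x y})\<bar> \<le> 2"
proof -
  define U where "U z = {y\<in>Y. dist y z \<le> A}" for z
  have U: "card (U z) \<le> 1" for z
  proof -
    have "y = y'" if "y \<in> U z" "y' \<in> U z" for y y'
      using sep[of y y'] that dist_triangle2[of y y' z] by (force simp: U_def)
    moreover have "finite (U z)" using Y by (simp add: U_def)
    ultimately show ?thesis using card_le_Suc0_iff_eq[of "U z"] by simp
  qed
  have *: "card {y\<in>Y. good_box I m K A G \<epsilon> x1 y} \<le> card {y\<in>Y. good_box I m K A G \<epsilon> x2 y} + 2"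
    if "\<And>y. A < dist y (fst (x i)) \<Longrightarrow> A < dist y (fst p) \<Longrightarrow> good_box I m K A G \<epsilon> x1 y \<Longrightarrow> good_box I m K A G \<epsilon> x2 y" for x1 x2
  proof -
    have "{y\<in>Y. good_box I m K A G \<epsilon> x1 y} \<subseteq> {y\<in>Y. good_box I m K A G \<epsilon> x2 y} \<union> (U (fst (x i)) \<union> U (fst p))"
    proof
      fix y assume "y \<in> {y\<in>Y. good_box I m K A G \<epsilon> x1 y}"
      then show "y \<in> {y\<in>Y. good_box I m K A G \<epsilon> x2 y} \<union> (U (fst (x i)) \<union> U (fst p))"
        using that[of y] by (cases "A < dist y (fst (x i))"; cases "A < dist y (fst p)") (auto simp: U_def not_less)
    qed
    then have "card {y\<in>Y. good_box I m K A G \<epsilon> x1 y} \<le> card ({y\<in>Y. good_box I m K A G \<epsilon> x2 y} \<union> (U (fst (x i)) \<union> U (fst p)))"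
      using Y by (intro card_mono) (auto simp: U_def)
    also have "\<dots> \<le> card {y\<in>Y. good_box I m K A G \<epsilon> x2 y} + (card (U (fst (x i))) + card (U (fst p)))"
      by (meson add_left_mono card_Un_le order_trans)
    finally show ?thesis using U[of "fst (x i)"] U[of "fst p"] by linarith
  qed
  have "card {y\<in>Y. good_box I m K A G \<epsilon> (x(i := p)) y} \<le> card {y\<in>Y. good_box I m K A G \<epsilon> x y} + 2"
    by (rule *) (simp add: good_box_update_far[OF iso])
  moreover have "card {y\<in>Y. good_box I m K A G \<epsilon> x y} \<le> card {y\<in>Y. good_box I m K A G \<epsilon> (x(i := p)) y} + 2"
    by (rule *) (simp add: good_box_update_far[OF iso])
  ultimately show ?thesis by linarith
qed

text \<open>The variance of the number of good boxes is at most \<open>4 n\<close>, and its mean \<open>\<mu>\<close> is at least \<open>p0 card Y\<close>.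
  By Chebyshev's inequality the number is at least half the mean up to a probability
  \<open>16 n / \<mu>\<^sup>2\<close>.\<close>

lemma (in prob_space) good_box_count_concentration:
  fixes \<xi> :: "nat \<Rightarrow> 'a \<Rightarrow> (real^'d) \<times> 'm" and Q :: "'m measure"
  assumes ind: "indep_vars (\<lambda>_. marked_space Q) \<xi> {1..n}" and n: "1 \<le> n"
    and law: "\<And>i. i \<in> {1..n} \<Longrightarrow> distr M (marked_space Q) (\<xi> i) = N"
    and iso: "isolation Q H m K A G \<epsilon>" and Y: "finite Y" "Y \<noteq> {}"
    and sep: "\<And>y y'. y \<in> Y \<Longrightarrow> y' \<in> Y \<Longrightarrow> y \<noteq> y' \<Longrightarrow> 2 * A < dist y y'"
    and p0: "0 < p0" "\<And>y. y \<in> Y \<Longrightarrow> p0 \<le> prob {\<omega> \<in> space M. good_box {1..n} m K A G \<epsilon> (\<lambda>i. \<xi> i \<omega>) y}"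
    and \<delta>: "0 \<le> \<delta>" "\<delta> \<le> 1"
  shows "(\<integral>\<omega>. \<delta> ^ card {y\<in>Y. good_box {1..n} m K A G \<epsilon> (\<lambda>i. \<xi> i \<omega>) y} \<partial>M)
     \<le> 16 * real n / (p0 * real (card Y))\<^sup>2 + \<delta> powr (p0 * real (card Y) / 2)"
proof -
  let ?E = "marked_space Q :: ((real^'d) \<times> 'm) measure"
  let ?I = "{1..n}"
  let ?P = "PiM ?I (\<lambda>_. N)"
  have G: "finite G" using iso by (simp add: isolation_def)
  have rv: "\<xi> i \<in> measurable M ?E" if "i \<in> ?I" for i
    using ind that by (auto simp: indep_vars_def)
  have setsN: "sets N = sets ?E" using law[of 1] n by (metis atLeastAtMost_iff order_refl sets_distr)
  have prN: "prob_space N" using prob_space_distr[OF rv[of 1]] law[of 1] n by simp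
  define X where "X \<omega> = restrict (\<lambda>i. \<xi> i \<omega>) ?I" for \<omega>
  have Xm: "X \<in> measurable M (PiM ?I (\<lambda>_. ?E))"
    unfolding X_def by (rule measurable_restrict) (rule rv)
  have lawX: "distr M (PiM ?I (\<lambda>_. ?E)) X = ?P"
  proof -
    have "distr M (PiM ?I (\<lambda>_. ?E)) X = PiM ?I (\<lambda>i. distr M ?E (\<xi> i))"
      unfolding X_def using n ind rv by (subst indep_vars_iff_distr_eq_PiM'[symmetric]) auto
    also have "\<dots> = ?P" by (rule PiM_cong) (auto simp: law)
    finally show ?thesis .
  qed
  have setsP: "sets ?P = sets (PiM ?I (\<lambda>_. ?E))" by (rule sets_PiM_cong) (simp_all add: setsN)
  interpret NP: prob_space ?P by (intro prob_space_PiM prN)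
  define gd where "gd x y = good_box ?I m K A G \<epsilon> x y" for x :: "nat \<Rightarrow> (real^'d) \<times> 'm" and y
  have gdX: "gd (X \<omega>) y = gd (\<lambda>i. \<xi> i \<omega>) y" for \<omega> y
    unfolding gd_def X_def good_box_def by (simp cong: conj_cong)
  have gdE: "{x \<in> space (PiM ?I (\<lambda>_. ?E)). gd x y} \<in> sets (PiM ?I (\<lambda>_. ?E))" for y
    unfolding gd_def by (rule good_box_measurable) (use G in auto)
  then have gdP: "{x \<in> space ?P. gd x y} \<in> sets ?P" for y
    using setsP sets_eq_imp_space_eq[OF setsP] by simp
  define f where "f x = real (card {y\<in>Y. gd x y})" for x
  have f_sum: "f x = (\<Sum>y\<in>Y. indicator {x. gd x y} x)" for x
    unfolding f_def using Y by (simp add: indicator_def sum.If_cases Int_def)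
  have fm: "f \<in> borel_measurable ?P"
    unfolding f_sum
  proof (rule borel_measurable_sum)
    fix y
    show "(\<lambda>x. indicator {x. gd x y} x :: real) \<in> borel_measurable ?P"
      using gdP[of y] by (simp add: borel_measurable_indicator_iff Int_def conj_commute)
  qed
  have fY: "0 \<le> f x" "f x \<le> real (card Y)" for x unfolding f_def using Y by (auto intro!: card_mono)
  have intf: "integrable ?P f" by (rule NP.integrable_const_bound[of _ "real (card Y)"]) (use fm fY in auto)
  define \<mu> where "\<mu> = (\<integral>x. f x \<partial>?P)"
  have prob_eq: "NP.prob {x \<in> space ?P. gd x y} = prob {\<omega> \<in> space M. gd (\<lambda>i. \<xi> i \<omega>) y}" for y
  proof -
    have "NP.prob {x \<in> space ?P. gd x y} = measure (distr M (PiM ?I (\<lambda>_. ?E)) X) {x \<in> space (PiM ?I (\<lambda>_. ?E)). gd x y}"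
      unfolding lawX using sets_eq_imp_space_eq[OF setsP] by simp
    also have "\<dots> = prob (X -` {x \<in> space (PiM ?I (\<lambda>_. ?E)). gd x y} \<inter> space M)"
      by (rule measure_distr[OF Xm gdE])
    also have "X -` {x \<in> space (PiM ?I (\<lambda>_. ?E)). gd x y} \<inter> space M = {\<omega> \<in> space M. gd (\<lambda>i. \<xi> i \<omega>) y}"
      using measurable_space[OF Xm] by (auto simp: gdX simp del: One_nat_def)
    finally show ?thesis .
  qed
  have mu_ge: "p0 * real (card Y) \<le> \<mu>"
  proof -
    have ii: "integrable ?P (\<lambda>x. indicator {x. gd x y} x :: real)" for y
    proof (rule NP.integrable_const_bound[of _ 1])
      show "(\<lambda>x. indicator {x. gd x y} x :: real) \<in> borel_measurable ?P"
        using gdP[of y] by (simp add: borel_measurable_indicator_iff Int_def conj_commute)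
    qed (auto simp: indicator_def)
    have "\<mu> = (\<Sum>y\<in>Y. \<integral>x. indicator {x. gd x y} x \<partial>?P)"
      unfolding \<mu>_def f_sum by (rule Bochner_Integration.integral_sum[OF ii])
    also have "\<dots> = (\<Sum>y\<in>Y. NP.prob {x \<in> space ?P. gd x y})"
      by (simp add: Int_def conj_commute)
    also have "\<dots> \<ge> (\<Sum>y\<in>Y. p0)"
      using p0(2) unfolding prob_eq by (intro sum_mono) (simp add: gd_def)
    finally show ?thesis by (simp add: mult.commute)
  qed
  have cY: "0 < real (card Y)" using Y by (simp add: card_gt_0_iff)
  have mu0: "0 < \<mu>" using mu_ge p0 cY by (meson mult_pos_pos order_less_le_trans)
  have second: "(\<integral>x. (f x)\<^sup>2 \<partial>?P) \<le> \<mu>\<^sup>2 + real n * 4"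
  proof -
    have "(\<integral>x. (f x)\<^sup>2 \<partial>?P) \<le> \<mu>\<^sup>2 + real (card ?I) * 2\<^sup>2"
      unfolding \<mu>_def
    proof (rule bounded_difference_second_moment[OF prN _ fm])
      show "\<bar>f x\<bar> \<le> real (card Y)" for x using fY[of x] by simp
      show "\<bar>f (x(i := p)) - f x\<bar> \<le> 2" for x i p
        unfolding f_def gd_def by (rule good_box_count_diff[OF iso Y(1) sep])
    qed auto
    then show ?thesis by simp
  qed
  have intf2: "integrable ?P (\<lambda>x. (f x)\<^sup>2)"
  proof (rule NP.integrable_const_bound[of _ "(real (card Y))\<^sup>2"])
    show "AE x in ?P. norm ((f x)\<^sup>2) \<le> (real (card Y))\<^sup>2" using fY by (auto intro!: power_mono)
  qed (use fm in measurable)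
  have i3: "integrable ?P (\<lambda>x. (f x - \<mu>)\<^sup>2)"
    unfolding power2_diff
    by (intro Bochner_Integration.integrable_add Bochner_Integration.integrable_diff integrable_mult_left
        integrable_mult_right intf intf2 NP.integrable_const)
  have pt: "\<delta> ^ card {y\<in>Y. gd x y} \<le> 4 / \<mu>\<^sup>2 * (f x - \<mu>)\<^sup>2 + \<delta> powr (p0 * real (card Y) / 2)" for x
  proof (cases "f x < \<mu> / 2")
    case True
    then have "(\<mu> / 2)\<^sup>2 \<le> (\<mu> - f x)\<^sup>2" using mu0 by (intro power_mono) auto
    then have "1 \<le> 4 / \<mu>\<^sup>2 * (f x - \<mu>)\<^sup>2" using mu0 by (simp add: field_simps power2_commute[of \<mu> "f x"] power_divide)
    moreover have "\<delta> ^ card {y\<in>Y. gd x y} \<le> 1" using \<delta> by (simp add: power_le_one)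
    moreover have "0 \<le> \<delta> powr (p0 * real (card Y) / 2)" by simp
    ultimately show ?thesis by linarith
  next
    case False
    then have le: "p0 * real (card Y) / 2 \<le> real (card {y\<in>Y. gd x y})" using mu_ge by (simp add: f_def)
    have pos: "0 < p0 * real (card Y) / 2" using p0 cY by simp
    have "\<delta> ^ card {y\<in>Y. gd x y} \<le> \<delta> powr (p0 * real (card Y) / 2)"
    proof (cases "\<delta> = 0")
      case True
      then show ?thesis using le pos by (simp add: power_0_left)
    next
      case False
      then have "\<delta> ^ card {y\<in>Y. gd x y} = \<delta> powr real (card {y\<in>Y. gd x y})" using \<delta> by (simp add: powr_realpow)
      also have "\<dots> \<le> \<delta> powr (p0 * real (card Y) / 2)" using le \<delta> False by (intro powr_mono') auto
      finally show ?thesis .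
    qed
    then show ?thesis by (simp add: add_increasing)
  qed
  have fmE: "f \<in> borel_measurable (PiM ?I (\<lambda>_. ?E))" using fm measurable_cong_sets[OF setsP refl] by auto
  have "(\<integral>\<omega>. \<delta> ^ card {y\<in>Y. gd (\<lambda>i. \<xi> i \<omega>) y} \<partial>M) \<le> (\<integral>\<omega>. 4 / \<mu>\<^sup>2 * (f (X \<omega>) - \<mu>)\<^sup>2 + \<delta> powr (p0 * real (card Y) / 2) \<partial>M)"
  proof (rule integral_mono')
    have "integrable ?P (\<lambda>x. 4 / \<mu>\<^sup>2 * (f x - \<mu>)\<^sup>2 + \<delta> powr (p0 * real (card Y) / 2))"
      by (intro Bochner_Integration.integrable_add integrable_mult_right NP.integrable_const)
         (rule i3)
    then show "integrable M (\<lambda>\<omega>. 4 / \<mu>\<^sup>2 * (f (X \<omega>) - \<mu>)\<^sup>2 + \<delta> powr (p0 * real (card Y) / 2))"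
      unfolding lawX[symmetric] by (subst (asm) integrable_distr_eq[OF Xm]) (use fmE in auto)
    show "\<delta> ^ card {y\<in>Y. gd (\<lambda>i. \<xi> i \<omega>) y} \<le> 4 / \<mu>\<^sup>2 * (f (X \<omega>) - \<mu>)\<^sup>2 + \<delta> powr (p0 * real (card Y) / 2)" for \<omega>
      using pt[of "X \<omega>"] by (simp add: gdX del: One_nat_def)
    show "0 \<le> 4 / \<mu>\<^sup>2 * (f (X \<omega>) - \<mu>)\<^sup>2 + \<delta> powr (p0 * real (card Y) / 2)" for \<omega> by simp
  qed
  also have "\<dots> = (\<integral>x. 4 / \<mu>\<^sup>2 * (f x - \<mu>)\<^sup>2 + \<delta> powr (p0 * real (card Y) / 2) \<partial>?P)"
    unfolding lawX[symmetric] by (subst integral_distr[OF Xm]) (use fmE in auto)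
  also have "\<dots> = 4 / \<mu>\<^sup>2 * ((\<integral>x. (f x)\<^sup>2 \<partial>?P) - \<mu>\<^sup>2) + \<delta> powr (p0 * real (card Y) / 2)"
  proof -
    have "(\<integral>x. (f x - \<mu>)\<^sup>2 \<partial>?P) = (\<integral>x. (f x)\<^sup>2 + \<mu>\<^sup>2 - 2 * \<mu> * f x \<partial>?P)"
      by (intro Bochner_Integration.integral_cong) (auto simp: power2_diff)
    also have "\<dots> = (\<integral>x. (f x)\<^sup>2 \<partial>?P) + \<mu>\<^sup>2 - 2 * \<mu> * \<mu>"
    proof -
      have "(\<integral>x. (f x)\<^sup>2 + \<mu>\<^sup>2 - 2 * \<mu> * f x \<partial>?P) = (\<integral>x. (f x)\<^sup>2 + \<mu>\<^sup>2 \<partial>?P) - (\<integral>x. 2 * \<mu> * f x \<partial>?P)"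
        by (intro Bochner_Integration.integral_diff Bochner_Integration.integrable_add integrable_mult_right
            intf intf2 NP.integrable_const)
      also have "(\<integral>x. (f x)\<^sup>2 + \<mu>\<^sup>2 \<partial>?P) = (\<integral>x. (f x)\<^sup>2 \<partial>?P) + \<mu>\<^sup>2"
        by (subst Bochner_Integration.integral_add[OF intf2 NP.integrable_const]) (simp del: One_nat_def add: NP.prob_space)
      finally show ?thesis by (simp del: One_nat_def add: \<mu>_def[symmetric])
    qed
    also have "\<dots> = (\<integral>x. (f x)\<^sup>2 \<partial>?P) - \<mu>\<^sup>2" by (simp add: power2_eq_square)
    finally have v: "(\<integral>x. (f x - \<mu>)\<^sup>2 \<partial>?P) = (\<integral>x. (f x)\<^sup>2 \<partial>?P) - \<mu>\<^sup>2" .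
    show ?thesis using i3 by (simp del: One_nat_def add: v NP.prob_space)
  qed
  also have "\<dots> \<le> 4 / \<mu>\<^sup>2 * (real n * 4) + \<delta> powr (p0 * real (card Y) / 2)"
    using second mu0 by (intro add_right_mono mult_left_mono) auto
  also have "4 / \<mu>\<^sup>2 * (real n * 4) \<le> 4 / (p0 * real (card Y))\<^sup>2 * (real n * 4)"
    using mu_ge p0 cY mu0 by (intro mult_right_mono divide_left_mono power_mono) auto
  finally show ?thesis by (simp add: gd_def)
qed

section \<open>Gaussian reference points\<close>

abbreviation point_law :: "(real^'d \<Rightarrow> ennreal) \<Rightarrow> 'm measure \<Rightarrow> ((real^'d) \<times> 'm) measure" where
  "point_law g Q \<equiv> density lborel g \<Otimes>\<^sub>M Q"

lemma sets_point_law: "sets (point_law g Q) = sets (marked_space Q)"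
  by (intro sets_pair_measure_cong) simp_all

lemma emeasure_point_law:
  assumes Q: "prob_space Q" and g: "g \<in> borel_measurable borel" and A: "A \<in> sets (marked_space Q)"
  shows "emeasure (point_law g Q) A = (\<integral>\<^sup>+x. g x * emeasure Q (Pair x -` A) \<partial>lborel)"
proof -
  interpret Q: prob_space Q by fact
  have m: "(\<lambda>x. emeasure Q (Pair x -` A)) \<in> borel_measurable borel"
    by (rule Q.measurable_emeasure_Pair[OF A])
  have "emeasure (point_law g Q) A = (\<integral>\<^sup>+x. emeasure Q (Pair x -` A) \<partial>density lborel g)"
    using A by (intro Q.emeasure_pair_measure_alt) (simp add: sets_point_law)
  also have "\<dots> = (\<integral>\<^sup>+x. g x * emeasure Q (Pair x -` A) \<partial>lborel)"
    using g m by (subst nn_integral_density) auto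
  finally show ?thesis .
qed

lemma emeasure_point_law_region:
  assumes Q: "prob_space Q" and g: "g \<in> borel_measurable borel" and B: "B \<in> sets borel"
  shows "emeasure (point_law g Q) (B \<times> space Q) = (\<integral>\<^sup>+x. g x * indicator B x \<partial>lborel)"
proof -
  interpret Q: prob_space Q by fact
  have "emeasure (point_law g Q) (B \<times> space Q) = (\<integral>\<^sup>+x. g x * emeasure Q (Pair x -` (B \<times> space Q)) \<partial>lborel)"
    by (rule emeasure_point_law[OF Q g]) (use B in auto)
  also have "\<dots> = (\<integral>\<^sup>+x. g x * indicator B x \<partial>lborel)"
    by (intro nn_integral_cong) (auto simp: indicator_def Q.emeasure_space_1)
  finally show ?thesis .
qed

lemma AE_point_law_location:
  fixes g :: "real^'d \<Rightarrow> ennreal"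
  assumes Q: "prob_space Q" and g: "g \<in> borel_measurable borel"
  shows "AE q in point_law g Q. fst q \<noteq> a"
proof -
  have "emeasure (point_law g Q) ({a} \<times> space Q) = (\<integral>\<^sup>+x. g x * indicator {a} x \<partial>lborel)"
    by (rule emeasure_point_law_region[OF Q g]) simp
  also have "\<dots> = (\<integral>\<^sup>+x. 0 \<partial>(lborel :: (real^'d) measure))"
  proof (rule nn_integral_cong_AE)
    show "AE x in lborel. g x * indicator {a} x = 0"
      using AE_lborel_singleton[of a] by eventually_elim auto
  qed
  finally have "emeasure (point_law g Q) ({a} \<times> space Q) = 0" by simp
  moreover have "{a} \<times> space Q \<in> sets (point_law g Q)" unfolding sets_point_law by auto
  ultimately show ?thesis
    by (intro AE_I[of _ _ "{a} \<times> space Q"]) (auto simp: space_pair_measure)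
qed

text \<open>Scaling by \<open>1/r\<close> multiplies densities by \<open>r ^ CARD('d)\<close>; this is what makes the density of a rescaled
  sample point of order \<open>1/n\<close>.\<close>

lemma distr_point_law_affine:
  fixes g :: "real^'d \<Rightarrow> ennreal"
  assumes Q: "prob_space Q" and g[measurable]: "g \<in> borel_measurable borel" and r: "0 < r"
  shows "distr (point_law g Q) (marked_space Q) (\<lambda>p. ((1 / r) *\<^sub>R fst p - y, snd p))
    = point_law (\<lambda>x. ennreal (r ^ CARD('d)) * g (r *\<^sub>R (x + y))) Q"
proof (rule measure_eqI)
  interpret Q: prob_space Q by fact
  let ?T = "\<lambda>p :: (real^'d) \<times> 'b. ((1 / r) *\<^sub>R fst p - y, snd p)"
  have Tm: "?T \<in> measurable (marked_space Q) (marked_space Q)" by measurable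
  then have Tm': "?T \<in> measurable (point_law g Q) (marked_space Q)"
    by (simp add: measurable_cong_sets[OF sets_point_law refl])
  show "sets (distr (point_law g Q) (marked_space Q) ?T) = sets (point_law (\<lambda>x. ennreal (r ^ CARD('d)) * g (r *\<^sub>R (x + y))) Q)"
    by (simp add: sets_point_law)
  fix A assume "A \<in> sets (distr (point_law g Q) (marked_space Q) ?T)"
  then have A: "A \<in> sets (marked_space Q)" by simp
  have m[measurable]: "(\<lambda>x. emeasure Q (Pair x -` A)) \<in> borel_measurable borel"
    by (rule Q.measurable_emeasure_Pair[OF A])
  have sp: "space (point_law g Q) = UNIV \<times> space Q" by (simp add: space_pair_measure)
  have "emeasure (distr (point_law g Q) (marked_space Q) ?T) A = emeasure (point_law g Q) (?T -` A \<inter> space (marked_space Q))"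
    by (subst emeasure_distr[OF Tm' A]) (simp add: sp space_pair_measure)
  also have "\<dots> = (\<integral>\<^sup>+x. g x * emeasure Q (Pair x -` (?T -` A \<inter> space (marked_space Q))) \<partial>lborel)"
    by (rule emeasure_point_law[OF Q g measurable_sets[OF Tm A]])
  also have "\<dots> = (\<integral>\<^sup>+x. g x * emeasure Q (Pair ((1 / r) *\<^sub>R x - y) -` A) \<partial>lborel)"
  proof (intro nn_integral_cong arg_cong2[where f="(*)"] refl arg_cong[where f="emeasure Q"])
    fix x show "Pair x -` (?T -` A \<inter> space (marked_space Q)) = Pair ((1 / r) *\<^sub>R x - y) -` A"
      using sets.sets_into_space[OF A] by (auto simp: space_pair_measure)
  qed
  also have "\<dots> = (\<integral>\<^sup>+x. g x * emeasure Q (Pair ((1 / r) *\<^sub>R x - y) -` A)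
       \<partial>density (distr lborel borel (\<lambda>x. r *\<^sub>R y + r *\<^sub>R x)) (\<lambda>_. ennreal (\<bar>r\<bar> ^ DIM(real^'d))))"
    using lborel_affine[of r "r *\<^sub>R y"] r by simp
  also have "\<dots> = (\<integral>\<^sup>+x. ennreal (r ^ CARD('d)) * (g (r *\<^sub>R y + r *\<^sub>R x) * emeasure Q (Pair ((1 / r) *\<^sub>R (r *\<^sub>R y + r *\<^sub>R x) - y) -` A)) \<partial>lborel)"
    using r by (subst nn_integral_density, simp, simp, subst nn_integral_distr) simp_all
  also have "\<dots> = (\<integral>\<^sup>+x. ennreal (r ^ CARD('d)) * g (r *\<^sub>R (x + y)) * emeasure Q (Pair x -` A) \<partial>lborel)"
    using r by (intro nn_integral_cong) (simp add: scaleR_add_right mult.assoc add.commute)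
  also have "\<dots> = emeasure (point_law (\<lambda>x. ennreal (r ^ CARD('d)) * g (r *\<^sub>R (x + y))) Q) A"
    by (rule emeasure_point_law[OF Q _ A, symmetric]) measurable
  finally show "emeasure (distr (point_law g Q) (marked_space Q) ?T) A = emeasure (point_law (\<lambda>x. ennreal (r ^ CARD('d)) * g (r *\<^sub>R (x + y))) Q) A" .
qed

lemma point_law_le:
  fixes f g :: "real^'d \<Rightarrow> ennreal"
  assumes Q: "prob_space Q" and f: "f \<in> borel_measurable borel" and g: "g \<in> borel_measurable borel"
    and B: "B \<in> sets borel" and le: "\<And>x. x \<in> B \<Longrightarrow> f x \<le> C * g x" and A: "A \<in> sets (marked_space Q)"
  shows "emeasure (point_law f Q) (A \<inter> (B \<times> space Q)) \<le> C * emeasure (point_law g Q) A"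
proof -
  interpret Q: prob_space Q by fact
  have [measurable]: "(\<lambda>x. emeasure Q (Pair x -` A)) \<in> borel_measurable borel"
    by (rule Q.measurable_emeasure_Pair[OF A])
  have BQ: "B \<times> space Q \<in> sets (marked_space Q)" using B by auto
  have "emeasure (point_law f Q) (A \<inter> (B \<times> space Q)) = (\<integral>\<^sup>+x. f x * emeasure Q (Pair x -` (A \<inter> (B \<times> space Q))) \<partial>lborel)"
    by (rule emeasure_point_law[OF Q f]) (use A BQ in auto)
  also have "\<dots> \<le> (\<integral>\<^sup>+x. C * (g x * emeasure Q (Pair x -` A)) \<partial>lborel)"
  proof (rule nn_integral_mono)
    fix x
    have s: "Pair x -` A \<in> sets Q" by (rule sets_Pair1[OF A])
    show "f x * emeasure Q (Pair x -` (A \<inter> (B \<times> space Q))) \<le> C * (g x * emeasure Q (Pair x -` A))"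
    proof (cases "x \<in> B")
      case True
      have "f x * emeasure Q (Pair x -` (A \<inter> (B \<times> space Q))) \<le> (C * g x) * emeasure Q (Pair x -` A)"
        using s by (intro mult_mono le True emeasure_mono) auto
      then show ?thesis by (simp add: mult.assoc)
    next
      case False
      then have "Pair x -` (A \<inter> (B \<times> space Q)) = {}" by auto
      then show ?thesis by simp
    qed
  qed
  also have "\<dots> = C * (\<integral>\<^sup>+x. g x * emeasure Q (Pair x -` A) \<partial>lborel)"
    using g by (intro nn_integral_cmult) auto
  also have "\<dots> = C * emeasure (point_law g Q) A" by (simp add: emeasure_point_law[OF Q g A])
  finally show ?thesis .
qed

definition std_vec_density :: "real^'d \<Rightarrow> real" where
  "std_vec_density z = (\<Prod>i\<in>UNIV. std_normal_density (z $ i))"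

lemma std_normal_vec_law: "std_normal_vec \<Otimes>\<^sub>M Q = point_law (\<lambda>z. ennreal (std_vec_density z)) Q"
  by (simp add: std_normal_vec_def std_vec_density_def)

lemma std_vec_density_measurable[measurable]: "std_vec_density \<in> borel_measurable borel"
  unfolding std_vec_density_def by measurable

lemma std_vec_density_pos: "0 < std_vec_density z"
  unfolding std_vec_density_def by (intro prod_pos normal_density_pos) auto

lemma std_vec_density_le: "std_vec_density z \<le> 1"
  unfolding std_vec_density_def by (intro prod_le_1) (auto simp: std_normal_density_le)

lemma std_vec_density_lower: "norm z \<le> K \<Longrightarrow> std_normal_density K ^ CARD('d) \<le> std_vec_density (z :: real^'d)"
proof -
  assume z: "norm z \<le> K"
  have "std_normal_density K \<le> std_normal_density (z $ i)" for i
  proof -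
    have "\<bar>z $ i\<bar> \<le> K" using component_le_norm_cart[of z i] z by linarith
    then have "(z $ i)\<^sup>2 \<le> K\<^sup>2" by (metis abs_ge_zero power2_abs power_mono)
    then show ?thesis by (simp add: std_normal_density_def divide_right_mono)
  qed
  then have "(\<Prod>i\<in>(UNIV :: 'd set). std_normal_density K) \<le> std_vec_density z"
    unfolding std_vec_density_def by (intro prod_mono) auto
  then show ?thesis by simp
qed

definition inner_region :: "'m measure \<Rightarrow> real \<Rightarrow> ((real^'d) \<times> 'm) set" where
  "inner_region Q K = cball 0 K \<times> space Q"

text \<open>The quantity \<open>E (1 - cos (\<theta> (h - h')))\<close> for two independent blocks of Gaussian points,
  restricted to the ball of radius \<open>K\<close>. It measures how far the block functional is from being
  concentrated on a coset of \<open>(2 \<pi> / \<theta>) \<int>\<close>.\<close>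

definition separated_pairs :: "'m measure \<Rightarrow> (((real^'d) \<times> 'm) set \<Rightarrow> real) \<Rightarrow> 'i set \<Rightarrow> real \<Rightarrow> real \<Rightarrow> ennreal" where
  "separated_pairs Q H I K \<theta> = (\<integral>\<^sup>+x. (\<integral>\<^sup>+x'. ennreal (1 - cos (\<theta> * (config_value H I x - config_value H I x'))) *
       (\<Prod>i\<in>I. indicator (inner_region Q K) (x' i)) \<partial>PiM I (\<lambda>_. std_normal_vec \<Otimes>\<^sub>M Q)) *
       (\<Prod>i\<in>I. indicator (inner_region Q K) (x i)) \<partial>PiM I (\<lambda>_. std_normal_vec \<Otimes>\<^sub>M Q))"

lemma inner_region_sets: "inner_region Q K \<in> sets (marked_space Q)"
  unfolding inner_region_def by auto

lemma separated_pairs_reindex: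
  fixes I :: "'i set" and J :: "'j set" and H :: "((real^'d) \<times> 'm) set \<Rightarrow> real"
  assumes G: "prob_space (std_normal_vec \<Otimes>\<^sub>M Q :: ((real^'d) \<times> 'm) measure)"
    and H: "H \<in> borel_measurable (finite_config (marked_space Q))"
    and f: "bij_betw f I J" and I: "finite I"
  shows "separated_pairs Q H J K \<theta> = separated_pairs Q H I K \<theta>"
proof -
  let ?\<Gamma> = "std_normal_vec \<Otimes>\<^sub>M Q :: ((real^'d) \<times> 'm) measure"
  let ?S = "inner_region Q K :: ((real^'d) \<times> 'm) set"
  have sets\<Gamma>: "sets ?\<Gamma> = sets (marked_space Q)" unfolding std_normal_vec_law by (rule sets_point_law)
  have fI: "inj_on f I" "f \<in> I \<rightarrow> J" using f by (auto simp: bij_betw_def)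
  let ?r = "\<lambda>\<omega>. \<lambda>n\<in>I. \<omega> (f n)"
  have D: "distr (PiM J (\<lambda>_. ?\<Gamma>)) (PiM I (\<lambda>_. ?\<Gamma>)) ?r = PiM I (\<lambda>_. ?\<Gamma>)"
    by (rule distr_PiM_reindex[OF G fI])
  have rm: "?r \<in> measurable (PiM J (\<lambda>_. ?\<Gamma>)) (PiM I (\<lambda>_. ?\<Gamma>))"
    using fI(2) by (intro measurable_restrict measurable_component_singleton) auto
  have sP: "sets (PiM I (\<lambda>_. ?\<Gamma>)) = sets (PiM I (\<lambda>_. marked_space Q))" by (rule sets_PiM_cong) (simp_all add: sets\<Gamma>)
  have hm[measurable]: "config_value H I \<in> borel_measurable (PiM I (\<lambda>_. ?\<Gamma>))"
    using config_value_measurable[OF I H] by (simp add: measurable_cong_sets[OF sP refl])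
  have Wm[measurable]: "(\<lambda>x. \<Prod>i\<in>I. indicator ?S (x i) :: ennreal) \<in> borel_measurable (PiM I (\<lambda>_. ?\<Gamma>))"
  proof (rule borel_measurable_prod_ennreal)
    fix i assume "i \<in> I"
    then have "(\<lambda>x. x i) \<in> measurable (PiM I (\<lambda>_. ?\<Gamma>)) ?\<Gamma>" by (rule measurable_component_singleton)
    then show "(\<lambda>x. indicator ?S (x i) :: ennreal) \<in> borel_measurable (PiM I (\<lambda>_. ?\<Gamma>))"
      by (rule measurable_compose) (rule borel_measurable_indicator, simp only: sets\<Gamma> inner_region_sets)
  qed
  have hr: "config_value H I (?r x) = config_value H J x" for x
    by (rule config_value_reindex[OF f])
  have Wr: "(\<Prod>i\<in>I. indicator ?S (?r x i) :: ennreal) = (\<Prod>i\<in>J. indicator ?S (x i))" for x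
    using prod.reindex_bij_betw[OF f, of "\<lambda>i. indicator ?S (x i) :: ennreal"] by simp
  define W where "W x = (\<Prod>i\<in>I. indicator ?S (x i) :: ennreal)" for x
  note Wm' = Wm[folded W_def]
  interpret \<Gamma>: prob_space ?\<Gamma> by fact
  interpret \<Gamma>I: prob_space "PiM I (\<lambda>_. ?\<Gamma>)" by (intro prob_space_PiM G)
  have inner: "(\<integral>\<^sup>+x'. ennreal (1 - cos (\<theta> * (v - config_value H I x'))) * W x' \<partial>PiM I (\<lambda>_. ?\<Gamma>))
     = (\<integral>\<^sup>+x'. ennreal (1 - cos (\<theta> * (v - config_value H J x'))) * (\<Prod>i\<in>J. indicator ?S (x' i)) \<partial>PiM J (\<lambda>_. ?\<Gamma>))" for v
  proof -
    let ?F = "\<lambda>x'. ennreal (1 - cos (\<theta> * (v - config_value H I x'))) * W x'"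
    have "(\<integral>\<^sup>+x'. ?F x' \<partial>PiM I (\<lambda>_. ?\<Gamma>)) = (\<integral>\<^sup>+x'. ?F x' \<partial>distr (PiM J (\<lambda>_. ?\<Gamma>)) (PiM I (\<lambda>_. ?\<Gamma>)) ?r)"
      by (simp only: D)
    also have "\<dots> = (\<integral>\<^sup>+x'. ?F (?r x') \<partial>PiM J (\<lambda>_. ?\<Gamma>))"
      by (rule nn_integral_distr[OF rm]) (use Wm' in measurable)
    finally show ?thesis by (simp only: hr W_def Wr)
  qed
  have m2: "(\<lambda>v. \<integral>\<^sup>+x'. ennreal (1 - cos (\<theta> * (v - config_value H I x'))) * W x' \<partial>PiM I (\<lambda>_. ?\<Gamma>)) \<in> borel_measurable borel"
  proof -
    note [measurable] = Wm'
    show ?thesis by measurable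
  qed
  define k where "k v = (\<integral>\<^sup>+x'. ennreal (1 - cos (\<theta> * (v - config_value H I x'))) * W x' \<partial>PiM I (\<lambda>_. ?\<Gamma>))" for v
  have km[measurable]: "k \<in> borel_measurable borel" unfolding k_def by (rule m2)
  have "separated_pairs Q H I K \<theta> = (\<integral>\<^sup>+x. k (config_value H I x) * W x \<partial>PiM I (\<lambda>_. ?\<Gamma>))"
    unfolding separated_pairs_def k_def W_def ..
  also have "\<dots> = (\<integral>\<^sup>+x. k (config_value H I x) * W x \<partial>distr (PiM J (\<lambda>_. ?\<Gamma>)) (PiM I (\<lambda>_. ?\<Gamma>)) ?r)" by (simp only: D)
  also have "\<dots> = (\<integral>\<^sup>+x. k (config_value H I (?r x)) * W (?r x) \<partial>PiM J (\<lambda>_. ?\<Gamma>))"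
    by (rule nn_integral_distr[OF rm]) (use Wm' in measurable)
  also have "\<dots> = (\<integral>\<^sup>+x. k (config_value H J x) * (\<Prod>i\<in>J. indicator ?S (x i)) \<partial>PiM J (\<lambda>_. ?\<Gamma>))"
    by (simp only: hr W_def Wr)
  also have "\<dots> = separated_pairs Q H J K \<theta>"
    unfolding separated_pairs_def k_def inner ..
  finally show ?thesis ..
qed

text \<open>By \<open>quadratic_lower_bound\<close>, applied to the difference of two independent copies. If this difference
  were concentrated on \<open>(2 \<pi> / t) \<int>\<close>, then freezing one copy would exhibit \<open>2 \<pi> / t\<close> as a span.\<close>

lemma separated_pairs_lower_bound:
  fixes H :: "((real^'d) \<times> 'm) set \<Rightarrow> real" and I :: "'i set"
  assumes G: "prob_space (std_normal_vec \<Otimes>\<^sub>M Q :: ((real^'d) \<times> 'm) measure)"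
    and H: "H \<in> borel_measurable (finite_config (marked_space Q))" and I: "finite I"
    and nd: "\<And>a. \<not> (AE x in PiM I (\<lambda>_. std_normal_vec \<Otimes>\<^sub>M Q). config_value H I x = a)"
    and nl: "\<And>t a. 0 < t \<Longrightarrow> t \<le> T \<Longrightarrow> \<not> (AE x in PiM I (\<lambda>_. std_normal_vec \<Otimes>\<^sub>M Q). (config_value H I x - a) / (2 * pi / t) \<in> \<int>)"
  shows "\<exists>K>0. \<exists>c>0. \<forall>\<theta>. \<bar>\<theta>\<bar> \<le> T \<longrightarrow> ennreal (c * \<theta>\<^sup>2) \<le> separated_pairs Q H I K \<theta>"
proof -
  let ?\<Gamma> = "std_normal_vec \<Otimes>\<^sub>M Q :: ((real^'d) \<times> 'm) measure"
  let ?\<Gamma>I = "PiM I (\<lambda>_. ?\<Gamma>)"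
  have sets\<Gamma>: "sets ?\<Gamma> = sets (marked_space Q)" unfolding std_normal_vec_law by (rule sets_point_law)
  have sP: "sets ?\<Gamma>I = sets (PiM I (\<lambda>_. marked_space Q))" by (rule sets_PiM_cong) (simp_all add: sets\<Gamma>)
  have hm[measurable]: "config_value H I \<in> borel_measurable ?\<Gamma>I"
    using config_value_measurable[OF I H] by (simp add: measurable_cong_sets[OF sP refl])
  interpret \<Gamma>I: prob_space ?\<Gamma>I by (intro prob_space_PiM G)
  interpret PP: pair_prob_space ?\<Gamma>I ?\<Gamma>I ..
  let ?S = "\<lambda>k. inner_region Q (real k + 1) :: ((real^'d) \<times> 'm) set"
  define W where "W k x = (\<Prod>i\<in>I. indicator (?S k) (x i) :: real)" for k x
  have Wm[measurable]: "W k \<in> borel_measurable ?\<Gamma>I" for k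
    unfolding W_def
  proof (rule borel_measurable_prod)
    fix i assume "i \<in> I"
    then have "(\<lambda>x. x i) \<in> measurable ?\<Gamma>I ?\<Gamma>" by (rule measurable_component_singleton)
    then show "(\<lambda>x. indicator (?S k) (x i) :: real) \<in> borel_measurable ?\<Gamma>I"
      by (rule measurable_compose) (rule borel_measurable_indicator, simp only: sets\<Gamma> inner_region_sets)
  qed
  have W01: "W k x = 0 \<or> W k x = 1" for k x
    unfolding W_def by (induction I rule: infinite_finite_induct) (auto simp: indicator_def)
  define A where "A k = {z \<in> space (?\<Gamma>I \<Otimes>\<^sub>M ?\<Gamma>I). W k (fst z) = 1 \<and> W k (snd z) = 1}" for k
  have Am: "A k \<in> sets (?\<Gamma>I \<Otimes>\<^sub>M ?\<Gamma>I)" for k unfolding A_def by measurable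
  define D where "D z = config_value H I (fst z) - config_value H I (snd z)" for z
  have Dm: "D \<in> borel_measurable (?\<Gamma>I \<Otimes>\<^sub>M ?\<Gamma>I)" unfolding D_def by measurable
  have Wev: "\<forall>\<^sub>F k in sequentially. W k x = 1" if x: "x \<in> space ?\<Gamma>I" for x
  proof -
    have "\<forall>\<^sub>F k in sequentially. \<forall>i\<in>I. norm (fst (x i)) \<le> real k + 1"
    proof (intro eventually_ball_finite I ballI)
      fix i show "\<forall>\<^sub>F k in sequentially. norm (fst (x i)) \<le> real k + 1" by real_asymp
    qed
    then show ?thesis
    proof eventually_elim
      case (elim k)
      have "x i \<in> ?S k" if "i \<in> I" for i
        using x that elim[rule_format, OF that] 
        by (auto simp: space_PiM inner_region_def space_pair_measure mem_Times_iff dest: PiE_mem)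
      then show ?case by (simp add: W_def)
    qed
  qed
  have "\<exists>k. \<exists>c>0. \<forall>t. \<bar>t\<bar> \<le> T \<longrightarrow> c * t\<^sup>2 \<le> (\<integral>z. indicator (A k) z * (1 - cos (t * D z)) \<partial>(?\<Gamma>I \<Otimes>\<^sub>M ?\<Gamma>I))"
  proof (rule quadratic_lower_bound[OF _ Dm Am])
    show "finite_measure (?\<Gamma>I \<Otimes>\<^sub>M ?\<Gamma>I)" by unfold_locales
    fix z assume z: "z \<in> space (?\<Gamma>I \<Otimes>\<^sub>M ?\<Gamma>I)"
    then have "fst z \<in> space ?\<Gamma>I" "snd z \<in> space ?\<Gamma>I" by (auto simp: space_pair_measure)
    from Wev[OF this(1)] Wev[OF this(2)] show "\<forall>\<^sub>F k in sequentially. z \<in> A k"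
      by eventually_elim (use z in \<open>simp add: A_def\<close>)
  next
    show "\<not> (AE z in ?\<Gamma>I \<Otimes>\<^sub>M ?\<Gamma>I. D z = 0)"
    proof
      assume "AE z in ?\<Gamma>I \<Otimes>\<^sub>M ?\<Gamma>I. D z = 0"
      from PP.AE_pair[OF this] have "AE x in ?\<Gamma>I. AE y in ?\<Gamma>I. config_value H I x = config_value H I y"
        by (simp add: D_def)
      then obtain x where "AE y in ?\<Gamma>I. config_value H I x = config_value H I y"
        using \<Gamma>I.AE_contr by (metis (mono_tags, lifting) eventually_mono)
      then have "AE y in ?\<Gamma>I. config_value H I y = config_value H I x" by eventually_elim simp
      with nd show False by blast
    qed
  next
    fix t :: real assume t: "0 < \<bar>t\<bar>" "\<bar>t\<bar> \<le> T"
    show "\<not> (AE z in ?\<Gamma>I \<Otimes>\<^sub>M ?\<Gamma>I. cos (t * D z) = 1)"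
    proof
      assume "AE z in ?\<Gamma>I \<Otimes>\<^sub>M ?\<Gamma>I. cos (t * D z) = 1"
      from PP.AE_pair[OF this] have "AE x in ?\<Gamma>I. AE y in ?\<Gamma>I. cos (t * (config_value H I x - config_value H I y)) = 1"
        by (simp add: D_def)
      then obtain x where x: "AE y in ?\<Gamma>I. cos (t * (config_value H I x - config_value H I y)) = 1"
        using \<Gamma>I.AE_contr by (metis (mono_tags, lifting) eventually_mono)
      have "AE y in ?\<Gamma>I. (config_value H I y - config_value H I x) / (2 * pi / \<bar>t\<bar>) \<in> \<int>"
        using x
      proof eventually_elim
        case (elim y)
        have "cos (\<bar>t\<bar> * (config_value H I y - config_value H I x)) = cos (t * (config_value H I x - config_value H I y))"
        proof (cases "0 < t")
          case True
          have "cos (\<bar>t\<bar> * (config_value H I y - config_value H I x)) = cos (- (t * (config_value H I x - config_value H I y)))"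
            using True by (simp add: algebra_simps)
          then show ?thesis by simp
        next
          case False
          then show ?thesis by (simp add: algebra_simps)
        qed
        then obtain k :: int where "\<bar>t\<bar> * (config_value H I y - config_value H I x) = k * 2 * pi"
          using elim by (auto simp: cos_one_2pi_int)
        then have "(config_value H I y - config_value H I x) / (2 * pi / \<bar>t\<bar>) = of_int k"
          using t by (simp add: field_simps)
        then show ?case by simp
      qed
      with nl[of "\<bar>t\<bar>" "config_value H I x"] t show False by simp
    qed
  qed
  then obtain k c where kc: "c > 0" "\<And>t. \<bar>t\<bar> \<le> T \<Longrightarrow> c * t\<^sup>2 \<le> (\<integral>z. indicator (A k) z * (1 - cos (t * D z)) \<partial>(?\<Gamma>I \<Otimes>\<^sub>M ?\<Gamma>I))"
    by blast
  have "ennreal (c * t\<^sup>2) \<le> separated_pairs Q H I (real k + 1) t" if t: "\<bar>t\<bar> \<le> T" for t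
  proof -
    note [measurable] = Am Dm
    have c2: "0 \<le> 1 - cos s" "1 - cos s \<le> 2" for s :: real using cos_ge_minus_one[of s] cos_le_one[of s] by linarith+
    have i: "integrable (?\<Gamma>I \<Otimes>\<^sub>M ?\<Gamma>I) (\<lambda>z. indicator (A k) z * (1 - cos (t * D z)))"
      by (rule PP.integrable_const_bound[of _ 2]) (use c2 in \<open>auto simp: indicator_def\<close>)
    have We: "ennreal (W k x) = (\<Prod>i\<in>I. indicator (?S k) (x i))" for x
      unfolding W_def by (subst prod_ennreal[symmetric]) (auto simp: ennreal_indicator)
    have "ennreal (c * t\<^sup>2) \<le> ennreal (\<integral>z. indicator (A k) z * (1 - cos (t * D z)) \<partial>(?\<Gamma>I \<Otimes>\<^sub>M ?\<Gamma>I))"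
      using kc(2)[OF t] by (rule ennreal_leI)
    also have "\<dots> = (\<integral>\<^sup>+z. ennreal (indicator (A k) z * (1 - cos (t * D z))) \<partial>(?\<Gamma>I \<Otimes>\<^sub>M ?\<Gamma>I))"
      by (rule nn_integral_eq_integral[OF i, symmetric]) (use c2 in auto)
    also have "\<dots> = (\<integral>\<^sup>+x. \<integral>\<^sup>+x'. ennreal (indicator (A k) (x, x') * (1 - cos (t * D (x, x')))) \<partial>?\<Gamma>I \<partial>?\<Gamma>I)"
      using Am Dm by (intro \<Gamma>I.nn_integral_fst[symmetric]) measurable
    also have "\<dots> = (\<integral>\<^sup>+x. (\<integral>\<^sup>+x'. ennreal (1 - cos (t * (config_value H I x - config_value H I x'))) * ennreal (W k x') \<partial>?\<Gamma>I) * ennreal (W k x) \<partial>?\<Gamma>I)"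
    proof (rule nn_integral_cong)
      fix x assume x: "x \<in> space ?\<Gamma>I"
      have "(\<integral>\<^sup>+x'. ennreal (indicator (A k) (x, x') * (1 - cos (t * D (x, x')))) \<partial>?\<Gamma>I)
        = (\<integral>\<^sup>+x'. (ennreal (1 - cos (t * (config_value H I x - config_value H I x'))) * ennreal (W k x')) * ennreal (W k x) \<partial>?\<Gamma>I)"
      proof (rule nn_integral_cong)
        fix x' assume x': "x' \<in> space ?\<Gamma>I"
        have "indicator (A k) (x, x') = W k x * W k x'"
          using W01[of k x] W01[of k x'] x x' by (auto simp: A_def space_pair_measure indicator_def)
        then show "ennreal (indicator (A k) (x, x') * (1 - cos (t * D (x, x'))))
          = (ennreal (1 - cos (t * (config_value H I x - config_value H I x'))) * ennreal (W k x')) * ennreal (W k x)"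
          using W01[of k x] W01[of k x'] by (auto simp: D_def)
      qed
      also have "\<dots> = (\<integral>\<^sup>+x'. ennreal (1 - cos (t * (config_value H I x - config_value H I x'))) * ennreal (W k x') \<partial>?\<Gamma>I) * ennreal (W k x)"
        by (rule nn_integral_multc) measurable
      finally show "(\<integral>\<^sup>+x'. ennreal (indicator (A k) (x, x') * (1 - cos (t * D (x, x')))) \<partial>?\<Gamma>I)
        = (\<integral>\<^sup>+x'. ennreal (1 - cos (t * (config_value H I x - config_value H I x'))) * ennreal (W k x') \<partial>?\<Gamma>I) * ennreal (W k x)" .
    qed
    also have "\<dots> = separated_pairs Q H I (real k + 1) t"
      unfolding separated_pairs_def We ..
    finally show ?thesis .
  qed
  then show ?thesis using kc(1) by (intro exI[of _ "real k + 1"]) auto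
qed

section \<open>Decay of the characteristic function of a rescaled sample\<close>

lemma AE_config_value_reindex:
  fixes I :: "'i set" and J :: "'j set" and H :: "((real^'d) \<times> 'm) set \<Rightarrow> real"
  assumes G: "prob_space \<Gamma>" and f: "bij_betw f I J"
    and ae: "AE x in PiM I (\<lambda>_. \<Gamma>). \<phi> (config_value H I x)"
  shows "AE x in PiM J (\<lambda>_. \<Gamma>). \<phi> (config_value H J x)"
proof -
  have fI: "inj_on f I" "f \<in> I \<rightarrow> J" using f by (auto simp: bij_betw_def)
  let ?r = "\<lambda>\<omega>. \<lambda>n\<in>I. \<omega> (f n)"
  have D: "distr (PiM J (\<lambda>_. \<Gamma>)) (PiM I (\<lambda>_. \<Gamma>)) ?r = PiM I (\<lambda>_. \<Gamma>)"
    by (rule distr_PiM_reindex[OF G fI])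
  have rm: "?r \<in> measurable (PiM J (\<lambda>_. \<Gamma>)) (PiM I (\<lambda>_. \<Gamma>))"
    using fI(2) by (intro measurable_restrict measurable_component_singleton) auto
  have "AE x in distr (PiM J (\<lambda>_. \<Gamma>)) (PiM I (\<lambda>_. \<Gamma>)) ?r. \<phi> (config_value H I x)"
    using ae by (simp only: D)
  from AE_distrD[OF rm this] show ?thesis
    by eventually_elim (simp only: config_value_reindex[OF f])
qed

lemma config_value_translate:
  assumes H: "translation_invariant Q H" and I: "finite I"
    and x: "\<And>i. i \<in> I \<Longrightarrow> x i \<in> space (marked_space Q)"
  shows "config_value H I (\<lambda>i. translate_pt y (x i)) = config_value H I x"
proof -
  have "inj_on (\<lambda>i. fst (translate_pt y (x i))) I \<longleftrightarrow> inj_on (\<lambda>i. fst (x i)) I"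
    by (auto simp: inj_on_def translate_pt_def)
  moreover have "H ((\<lambda>i. translate_pt y (x i)) ` I) = H (x ` I)"
  proof -
    have "x ` I \<in> configs Q" using x I by (auto simp: finite_subsets_def)
    then have "H (translate_pt y ` x ` I) = H (x ` I)" using H by (simp add: translation_invariant_def)
    then show ?thesis by (simp add: image_image)
  qed
  ultimately show ?thesis by (simp add: config_value_def)
qed

lemma measure_point_law_region:
  fixes g :: "real^'d \<Rightarrow> real"
  assumes Q: "prob_space Q" and P: "prob_space (point_law (\<lambda>x. ennreal (g x)) Q)"
    and g[measurable]: "g \<in> borel_measurable borel" and B[measurable]: "B \<in> sets borel" "emeasure lborel B < \<infinity>"
  shows "(\<And>x. x \<in> B \<Longrightarrow> k \<le> g x) \<Longrightarrow> 0 \<le> k \<Longrightarrow> k * measure lborel B \<le> measure (point_law (\<lambda>x. ennreal (g x)) Q) (B \<times> space Q)"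
    and "(\<And>x. x \<in> B \<Longrightarrow> g x \<le> k) \<Longrightarrow> 0 \<le> k \<Longrightarrow> measure (point_law (\<lambda>x. ennreal (g x)) Q) (B \<times> space Q) \<le> k * measure lborel B"
proof -
  interpret P: prob_space "point_law (\<lambda>x. ennreal (g x)) Q" by fact
  have e: "ennreal (measure (point_law (\<lambda>x. ennreal (g x)) Q) (B \<times> space Q)) = (\<integral>\<^sup>+x. ennreal (g x) * indicator B x \<partial>lborel)"
    unfolding P.emeasure_eq_measure[symmetric] by (rule emeasure_point_law_region[OF Q _ B(1)]) measurable
  have k: "ennreal (k * measure lborel B) = (\<integral>\<^sup>+x. ennreal k * indicator B x \<partial>lborel)" if "0 \<le> k"
    using B that by (simp add: nn_integral_cmult ennreal_mult emeasure_eq_ennreal_measure less_top[symmetric])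
  show "k * measure lborel B \<le> measure (point_law (\<lambda>x. ennreal (g x)) Q) (B \<times> space Q)"
    if "\<And>x. x \<in> B \<Longrightarrow> k \<le> g x" "0 \<le> k"
  proof -
    have "ennreal (k * measure lborel B) \<le> ennreal (measure (point_law (\<lambda>x. ennreal (g x)) Q) (B \<times> space Q))"
      unfolding e k[OF that(2)] using that by (intro nn_integral_mono) (auto simp: indicator_def intro: ennreal_leI)
    then show ?thesis by (subst (asm) ennreal_le_iff) auto
  qed
  show "measure (point_law (\<lambda>x. ennreal (g x)) Q) (B \<times> space Q) \<le> k * measure lborel B"
    if "\<And>x. x \<in> B \<Longrightarrow> g x \<le> k" "0 \<le> k"
  proof -
    have "ennreal (measure (point_law (\<lambda>x. ennreal (g x)) Q) (B \<times> space Q)) \<le> ennreal (k * measure lborel B)"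
      unfolding e k[OF that(2)] using that by (intro nn_integral_mono) (auto simp: indicator_def intro: ennreal_leI)
    then show ?thesis using that by (subst (asm) ennreal_le_iff) auto
  qed
qed

text \<open>Assembles the estimate for one fixed sample size. By translation invariance a block at \<open>y\<close> may be moved
  to the origin. There the law of a point and the Gaussian law bound each other on the core ball up to
  constants: the bound of the Gaussian law, with constant of order \<open>n\<close>, transfers the lower bound for
  separated pairs, and the reverse bound transfers null sets, hence the coset condition. The constants
  are spelled out to show that they do not depend on \<open>n\<close>.\<close>

lemma (in prob_space) scaled_char_bound:
  fixes \<xi> :: "nat \<Rightarrow> 'a \<Rightarrow> (real^'d) \<times> 'm" and Q :: "'m measure" and H :: "((real^'d) \<times> 'm) set \<Rightarrow> real"
    and g :: "real^'d \<Rightarrow> real" and \<Psi> :: "real \<Rightarrow> complex" and Y :: "(real^'d) set"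
  assumes Q: "prob_space Q" and G\<Gamma>: "prob_space (std_normal_vec \<Otimes>\<^sub>M Q :: ((real^'d) \<times> 'm) measure)"
    and H: "H \<in> borel_measurable (finite_config (marked_space Q))" and Ht: "translation_invariant Q H"
    and ind: "indep_vars (\<lambda>_. marked_space Q) \<xi> {1..n}" and n: "1 \<le> n"
    and law: "\<And>i. i \<in> {1..n} \<Longrightarrow> distr M (marked_space Q) (\<xi> i) = point_law (\<lambda>x. ennreal (g x)) Q"
    and g[measurable]: "g \<in> borel_measurable borel" and g0: "\<And>x. 0 \<le> g x" and gup: "\<And>x. g x \<le> c2 / real n"
    and glo: "\<And>x y. y \<in> Y \<Longrightarrow> dist y x \<le> A \<Longrightarrow> c1 / real n \<le> g x" and c12: "0 < c1" "0 < c2"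
    and iso: "isolation Q H m K A G \<epsilon>" and m: "1 \<le> m" and Y: "finite Y"
    and sep: "\<And>y y'. y \<in> Y \<Longrightarrow> y' \<in> Y \<Longrightarrow> y \<noteq> y' \<Longrightarrow> 2 * A < dist y y'"
    and c4: "0 < c4" "c4 * real n \<le> real (card Y)"
    and c: "0 < c" and base: "ennreal (c * \<theta>\<^sup>2) \<le> separated_pairs Q H {1..m} K \<theta>"
    and coset: "AE x in PiM {1..m} (\<lambda>_. std_normal_vec \<Otimes>\<^sub>M Q). config_value H {1..m} x - a \<in> S"
    and S: "S \<in> sets borel" "0 \<in> S" "\<And>v w. v \<in> S \<Longrightarrow> w \<in> S \<Longrightarrow> v + w \<in> S"
    and \<Psi>: "\<Psi> \<in> borel_measurable borel" and \<Psi>1: "\<And>x. cmod (\<Psi> x) \<le> 1"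
    and \<Psi>S: "\<And>x v. v \<in> S \<Longrightarrow> \<Psi> (x + v) = \<Psi> x * iexp (\<theta> * v)"
    and q: "q = c1 * min (measure lborel (cball (0 :: real^'d) K)) (measure lborel (ball (0 :: real^'d) \<epsilon>))"
    and C: "C = c2 * measure lborel (cball (0 :: real^'d) A)"
    and p0: "p0 = (q / (2 * real (m + card G))) ^ (m + card G) * exp (- 2 * C)"
    and \<kappa>: "\<kappa> = c / (c2 * measure lborel (cball (0 :: real^'d) K) / c1) ^ (2 * m) / 2"
    and nn: "2 * (m + card G) \<le> n" "2 * C \<le> real n"
  shows "cmod (CLINT \<omega>|M. \<Psi> (config_value H {1..n} (\<lambda>i. \<xi> i \<omega>)))
    \<le> 16 / (p0 * c4)\<^sup>2 / real n + exp (- (\<kappa> * (p0 * c4 / 2)) * real n * \<theta>\<^sup>2)" and "0 < \<kappa> * (p0 * c4 / 2)"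
proof -
  let ?E = "marked_space Q :: ((real^'d) \<times> 'm) measure"
  let ?\<Gamma> = "std_normal_vec \<Otimes>\<^sub>M Q :: ((real^'d) \<times> 'm) measure"
  let ?N0 = "point_law (\<lambda>x. ennreal (g x)) Q"
  let ?S = "inner_region Q K :: ((real^'d) \<times> 'm) set"
  have n0: "0 < real n" using n by simp
  have isoD: "0 < \<epsilon>" "0 < K" "K < A" "finite G" "\<And>g. g \<in> G \<Longrightarrow> K + \<epsilon> < norm g \<and> norm g + \<epsilon> < A"
    using iso by (auto simp: isolation_def)
  have rv: "\<xi> i \<in> measurable M ?E" if "i \<in> {1..n}" for i using ind that by (auto simp: indep_vars_def)
  have sp: "\<xi> i \<omega> \<in> space ?E" if "i \<in> {1..n}" "\<omega> \<in> space M" for i \<omega> using measurable_space[OF rv[OF that(1)] that(2)] .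
  have prN0: "prob_space ?N0" using prob_space_distr[OF rv[of 1]] law[of 1] n by simp
  interpret N0: prob_space ?N0 by (rule prN0)
  interpret \<Gamma>: prob_space ?\<Gamma> by (rule G\<Gamma>)
  have sets\<Gamma>: "sets ?\<Gamma> = sets ?E" unfolding std_normal_vec_law by (rule sets_point_law)
  define v1 where "v1 = measure lborel (cball (0 :: real^'d) K)"
  have v1: "0 < v1" unfolding v1_def using isoD by (simp add: content_cball)
  have fin: "emeasure lborel (cball z k) < \<infinity>" "emeasure lborel (ball z k) < \<infinity>" for z :: "real^'d" and k
    by (rule emeasure_bounded_finite, simp)+
  note fin = this[unfolded infinity_ennreal_def]
  have ve: "0 < measure lborel (ball (0 :: real^'d) \<epsilon>)" using isoD by (simp add: content_ball)
  have q0: "0 < q" using v1 ve c12 unfolding q v1_def by simp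
  have C0: "0 \<le> C" unfolding C using c12 by simp
  have mG: "0 < real (m + card G)" using m by simp
  have p00: "0 < p0" unfolding p0 using q0 mG by simp
  have \<kappa>0: "0 < \<kappa>" unfolding \<kappa> using c c12 v1 by (simp add: v1_def)
  show pos: "0 < \<kappa> * (p0 * c4 / 2)" using \<kappa>0 p00 c4 by simp
  have prob_region: "prob {\<omega> \<in> space M. fst (\<xi> i \<omega>) \<in> B} = measure ?N0 (B \<times> space Q)"
    if i: "i \<in> {1..n}" and B: "B \<in> sets borel" for i B
  proof -
    have "measure ?N0 (B \<times> space Q) = measure (distr M ?E (\<xi> i)) (B \<times> space Q)" by (simp only: law[OF i])
    also have "\<dots> = prob (\<xi> i -` (B \<times> space Q) \<inter> space M)"
      using B by (intro measure_distr[OF rv[OF i]]) auto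
    also have "\<xi> i -` (B \<times> space Q) \<inter> space M = {\<omega> \<in> space M. fst (\<xi> i \<omega>) \<in> B}"
      using sp[OF i] by (auto simp: space_pair_measure mem_Times_iff)
    finally show ?thesis ..
  qed
  have cY: "0 < real (card Y)" using c4 n0 by (meson mult_pos_pos order_less_le_trans)
  have good: "p0 \<le> prob {\<omega> \<in> space M. good_box {1..n} m K A G \<epsilon> (\<lambda>i. \<xi> i \<omega>) y}" if y: "y \<in> Y" for y
    unfolding p0
  proof (rule good_box_probability[OF ind iso m _ _ _ q0 C0 nn])
    fix i assume i: "i \<in> {1..n}"
    have "q / real n \<le> c1 / real n * measure lborel (cball y K)"
      unfolding q using c12 n0 isoD by (simp add: content_cball divide_right_mono mult_left_mono)
    also have "\<dots> \<le> measure ?N0 (cball y K \<times> space Q)"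
      using glo[OF y] isoD c12 n0 by (intro measure_point_law_region(1)[OF Q prN0 g]) (auto simp: fin)
    also have "\<dots> = prob {\<omega> \<in> space M. fst (\<xi> i \<omega>) \<in> cball y K}" by (rule prob_region[OF i, symmetric]) simp
    finally show "q / real n \<le> prob {\<omega> \<in> space M. dist y (fst (\<xi> i \<omega>)) \<le> K}" by simp
  next
    fix i assume i: "i \<in> {1..n}"
    have "prob {\<omega> \<in> space M. fst (\<xi> i \<omega>) \<in> cball y A} = measure ?N0 (cball y A \<times> space Q)" by (rule prob_region[OF i]) simp
    also have "\<dots> \<le> c2 / real n * measure lborel (cball y A)"
      using gup c12 n0 by (intro measure_point_law_region(2)[OF Q prN0 g]) (auto simp: fin)
    also have "\<dots> = C / real n" unfolding C using isoD by (simp add: content_cball)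
    finally show "prob {\<omega> \<in> space M. dist y (fst (\<xi> i \<omega>)) \<le> A} \<le> C / real n" by simp
  next
    fix i z assume i: "i \<in> {1..n}" and z: "z \<in> G"
    have "q / real n \<le> c1 / real n * measure lborel (ball (y + z) \<epsilon>)"
      unfolding q using c12 n0 isoD by (simp add: content_ball divide_right_mono mult_left_mono)
    also have "\<dots> \<le> measure ?N0 (ball (y + z) \<epsilon> \<times> space Q)"
    proof (intro measure_point_law_region(1)[OF Q prN0 g])
      fix x assume x: "x \<in> ball (y + z) \<epsilon>"
      have "dist y x \<le> dist y (y + z) + dist (y + z) x" by (rule dist_triangle)
      also have "dist y (y + z) = norm z" by (simp add: dist_norm)
      finally show "c1 / real n \<le> g x" using x isoD(5)[OF z] by (intro glo[OF y]) auto
    qed (use c12 n0 in \<open>auto simp: fin\<close>)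
    also have "\<dots> = prob {\<omega> \<in> space M. fst (\<xi> i \<omega>) \<in> ball (y + z) \<epsilon>}" by (rule prob_region[OF i, symmetric]) simp
    finally show "q / real n \<le> prob {\<omega> \<in> space M. dist (y + z) (fst (\<xi> i \<omega>)) < \<epsilon>}" by simp
  qed
  define \<delta> where "\<delta> = exp (- \<kappa> * \<theta>\<^sup>2)"
  have \<delta>: "0 \<le> \<delta>" "\<delta> \<le> 1" using \<kappa>0 by (auto simp: \<delta>_def)
  have distinct: "AE \<omega> in M. inj_on (\<lambda>i. fst (\<xi> i \<omega>)) {1..n}"
  proof -
    have Xm: "(\<lambda>\<omega>. restrict (\<lambda>i. \<xi> i \<omega>) {1..n}) \<in> measurable M (PiM {1..n} (\<lambda>_. ?E))"
      by (rule measurable_restrict) (rule rv)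
    have "distr M (PiM {1..n} (\<lambda>_. ?E)) (\<lambda>\<omega>. restrict (\<lambda>i. \<xi> i \<omega>) {1..n}) = PiM {1..n} (\<lambda>i. distr M ?E (\<xi> i))"
      using n ind rv by (subst indep_vars_iff_distr_eq_PiM'[symmetric]) auto
    also have "\<dots> = PiM {1..n} (\<lambda>_. ?N0)" by (rule PiM_cong) (auto simp: law)
    finally have D: "distr M (PiM {1..n} (\<lambda>_. ?E)) (\<lambda>\<omega>. restrict (\<lambda>i. \<xi> i \<omega>) {1..n}) = PiM {1..n} (\<lambda>_. ?N0)" .
    have "AE x in PiM {1..n} (\<lambda>_. ?N0). inj_on (\<lambda>i. fst (x i)) {1..n}"
      by (rule AE_distinct_locations[OF prN0 sets_point_law AE_point_law_location[OF Q]]) auto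
    then have ae: "AE x in distr M (PiM {1..n} (\<lambda>_. ?E)) (\<lambda>\<omega>. restrict (\<lambda>i. \<xi> i \<omega>) {1..n}). inj_on (\<lambda>i. fst (x i)) {1..n}"
      by (simp only: D)
    have "inj_on (\<lambda>i. fst (restrict (\<lambda>i. \<xi> i \<omega>) {1..n} i)) {1..n} \<longleftrightarrow> inj_on (\<lambda>i. fst (\<xi> i \<omega>)) {1..n}" for \<omega>
      by (rule inj_on_cong) (simp only: restrict_apply')
    with AE_distrD[OF Xm ae] show ?thesis by (simp only:)
  qed
  \<comment> \<open>All that is needed about the law \<open>N\<close> of a sample point seen from \<open>y\<close>.\<close>
  define box_law where "box_law y N \<longleftrightarrow> prob_space N \<and> sets N = sets ?E \<and>
      (\<forall>A\<in>sets ?E. emeasure ?\<Gamma> (A \<inter> ?S) \<le> ennreal (real n / c1) * emeasure N A) \<and>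
      (\<exists>k. \<forall>A\<in>sets ?E. emeasure N (A \<inter> ?S) \<le> ennreal k * emeasure ?\<Gamma> A) \<and>
      measure N ?S \<le> c2 / real n * v1 \<and>
      (\<forall>J\<subseteq>{1..n}. J \<noteq> {} \<longrightarrow> distr M (PiM J (\<lambda>_. ?E)) (\<lambda>\<omega>. \<lambda>i\<in>J. translate_pt (- y) (\<xi> i \<omega>)) = PiM J (\<lambda>_. N))" for y N
  have trans: "\<exists>N. box_law y N" if y: "y \<in> Y" for y
  proof -
    define N where "N = point_law (\<lambda>x. ennreal (g (x + y))) Q"
    have gy[measurable]: "(\<lambda>x. g (x + y)) \<in> borel_measurable borel" by measurable
    have tm: "translate_pt (- y) \<in> measurable ?E ?E"
      unfolding translate_pt_def[abs_def] by measurable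
    have lawN: "distr M ?E (\<lambda>\<omega>. translate_pt (- y) (\<xi> i \<omega>)) = N" if i: "i \<in> {1..n}" for i
    proof -
      have "distr M ?E (\<lambda>\<omega>. translate_pt (- y) (\<xi> i \<omega>)) = distr (distr M ?E (\<xi> i)) ?E (translate_pt (- y))"
        using distr_distr[OF tm rv[OF i]] by (simp add: comp_def)
      also have "\<dots> = distr ?N0 ?E (\<lambda>p. ((1 / 1) *\<^sub>R fst p - y, snd p))"
        unfolding law[OF i] by (rule distr_cong) (auto simp: translate_pt_def)
      also have "\<dots> = N" unfolding N_def
        by (subst distr_point_law_affine[OF Q]) auto
      finally show ?thesis .
    qed
    have prN: "prob_space N" 
      using prob_space_distr[OF measurable_compose[OF rv[of 1] tm]] lawN[of 1] n by simp
    have le1: "emeasure ?\<Gamma> (A' \<inter> ?S) \<le> ennreal (real n / c1) * emeasure N A'" if "A' \<in> sets ?E" for A'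
      unfolding std_normal_vec_law inner_region_def N_def
    proof (rule point_law_le[OF Q _ _ _ _ that])
      fix x :: "real^'d" assume "x \<in> cball 0 K"
      then have "c1 / real n \<le> g (x + y)" using isoD by (intro glo[OF y]) (auto simp: dist_norm)
      then have "1 \<le> real n / c1 * g (x + y)" using n0 c12 by (simp add: field_simps)
      then have "std_vec_density x \<le> real n / c1 * g (x + y)" using std_vec_density_le[of x] by linarith
      then show "ennreal (std_vec_density x) \<le> ennreal (real n / c1) * ennreal (g (x + y))"
        using n0 c12 g0 by (simp add: ennreal_leI flip: ennreal_mult)
    qed (auto intro!: measurable_compose[OF _ measurable_ennreal])
    define k where "k = c2 / real n / std_normal_density K ^ CARD('d)"
    have sK: "0 < std_normal_density K ^ CARD('d)" by (intro zero_less_power normal_density_pos) auto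
    have k0: "0 \<le> k" using c12 n0 sK unfolding k_def by (intro divide_nonneg_pos) auto
    have le2: "emeasure N (A' \<inter> ?S) \<le> ennreal k * emeasure ?\<Gamma> A'" if "A' \<in> sets ?E" for A'
      unfolding std_normal_vec_law inner_region_def N_def
    proof (rule point_law_le[OF Q _ _ _ _ that])
      fix x :: "real^'d" assume "x \<in> cball 0 K"
      then have "std_normal_density K ^ CARD('d) \<le> std_vec_density x" by (intro std_vec_density_lower) simp
      then have "k * std_normal_density K ^ CARD('d) \<le> k * std_vec_density x"
        using c12 n0 sK by (intro mult_left_mono) (auto simp: k_def)
      moreover have "k * std_normal_density K ^ CARD('d) = c2 / real n"
      proof -
        have "z / w * w = z" if "w \<noteq> 0" for z w :: real using that by simp
        then show ?thesis unfolding k_def using sK by (metis less_irrefl)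
      qed
      ultimately have "g (x + y) \<le> k * std_vec_density x" using gup[of "x + y"] by linarith
      then show "ennreal (g (x + y)) \<le> ennreal k * ennreal (std_vec_density x)"
        using k0 std_vec_density_pos[of x] by (simp add: ennreal_leI less_imp_le flip: ennreal_mult)
    qed (auto intro!: measurable_compose[OF _ measurable_ennreal])
    have le3: "measure N ?S \<le> c2 / real n * v1"
      unfolding N_def inner_region_def v1_def using gup c12 n0
      by (intro measure_point_law_region(2)[OF Q prN[unfolded N_def] gy]) (auto simp: fin)
    have dist: "distr M (PiM J (\<lambda>_. ?E)) (\<lambda>\<omega>. \<lambda>i\<in>J. translate_pt (- y) (\<xi> i \<omega>)) = PiM J (\<lambda>_. N)" if J: "J \<subseteq> {1..n}" "J \<noteq> {}" for J
    proof -
      have rvJ: "(\<lambda>\<omega>. translate_pt (- y) (\<xi> i \<omega>)) \<in> measurable M ?E" if "i \<in> J" for i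
        using measurable_compose[OF rv tm] that J by auto
      have "indep_vars (\<lambda>_. ?E) (\<lambda>i \<omega>. translate_pt (- y) (\<xi> i \<omega>)) J"
        using indep_vars_subset[OF ind J(1)] tm by (rule indep_vars_compose2)
      then have "distr M (PiM J (\<lambda>_. ?E)) (\<lambda>\<omega>. \<lambda>i\<in>J. translate_pt (- y) (\<xi> i \<omega>)) = PiM J (\<lambda>i. distr M ?E (\<lambda>\<omega>. translate_pt (- y) (\<xi> i \<omega>)))"
        using indep_vars_iff_distr_eq_PiM'[OF J(2), where X="\<lambda>i \<omega>. translate_pt (- y) (\<xi> i \<omega>)" and M'="\<lambda>_. ?E"] rvJ by blast
      also have "\<dots> = PiM J (\<lambda>_. N)" by (rule PiM_cong) (use J lawN in auto)
      finally show ?thesis .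
    qed
    have "sets N = sets ?E" unfolding N_def by (rule sets_point_law)
    then have "box_law y N" unfolding box_law_def using prN le1 le2 le3 dist by (intro conjI exI[of _ k]) simp_all
    then show ?thesis by blast
  qed
  have setsPJ: "sets (PiM J (\<lambda>_. N)) = sets (PiM J (\<lambda>_. ?E))" if "sets N = sets ?E" for N and J :: "nat set"
    by (rule sets_PiM_cong) (simp_all add: that)
  have cvE: "config_value H J \<in> borel_measurable (PiM J (\<lambda>_. ?E))" if "J \<subseteq> {1..n}" for J
    using config_value_measurable[OF finite_subset[OF that] H] by simp
  have transJ: "config_value H J (\<lambda>i. \<xi> i \<omega>) = config_value H J (\<lambda>i\<in>J. translate_pt (- y) (\<xi> i \<omega>))"
    if "J \<subseteq> {1..n}" "\<omega> \<in> space M" for J \<omega> y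
    unfolding config_value_restrict
    using sp that by (intro config_value_translate[OF Ht, symmetric] finite_subset[OF that(1)]) auto
  have inS: "translate_pt (- y) (\<xi> i \<omega>) \<in> ?S \<longleftrightarrow> dist y (fst (\<xi> i \<omega>)) \<le> K" if "i \<in> {1..n}" "\<omega> \<in> space M" for i \<omega> y
    using sp[OF that] by (auto simp: inner_region_def translate_pt_def space_pair_measure mem_Times_iff dist_norm norm_minus_commute)
  have bijJ: "\<exists>f. bij_betw f {1..m} J" if "J \<subseteq> {1..n}" "card J = m" for J
    using that by (metis card_atLeastAtMost diff_Suc_1 finite_atLeastAtMost finite_same_card_bij finite_subset)
  have XmJ: "(\<lambda>\<omega>. \<lambda>i\<in>J. translate_pt (- y) (\<xi> i \<omega>)) \<in> measurable M (PiM J (\<lambda>_. ?E))" if "J \<subseteq> {1..n}" for J y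
  proof (rule measurable_restrict)
    have tm: "translate_pt (- y) \<in> measurable ?E ?E"
      unfolding translate_pt_def[abs_def] by measurable
    fix i assume "i \<in> J"
    then show "(\<lambda>\<omega>. translate_pt (- y) (\<xi> i \<omega>)) \<in> measurable M ?E"
      using that by (intro measurable_compose[OF rv tm]) auto
  qed
  have main: "cmod (CLINT \<omega>|M. \<Psi> (config_value H {1..n} (\<lambda>i. \<xi> i \<omega>)))
    \<le> (\<integral>\<omega>. \<delta> ^ card {y\<in>Y. good_box {1..n} m K A G \<epsilon> (\<lambda>i. \<xi> i \<omega>) y} \<partial>M)"
  proof (rule char_bound_good_boxes[OF _ ind H iso Y sep distinct \<Psi> \<Psi>1 S(2,3) \<Psi>S \<delta>(1), where a=a])
    fix y J assume y: "y \<in> Y" and J: "J \<subseteq> {1..n}" "card J = m"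
    have Jne: "J \<noteq> {}" and finJ: "finite J" using J m finite_subset[OF J(1)] by auto
    obtain N where "box_law y N" using trans[OF y] by blast
    note bl = this[unfolded box_law_def]
    have N: "prob_space N" "sets N = sets ?E"
      "\<And>A. A \<in> sets ?E \<Longrightarrow> emeasure ?\<Gamma> (A \<inter> ?S) \<le> ennreal (real n / c1) * emeasure N A"
      "measure N ?S \<le> c2 / real n * v1"
      "distr M (PiM J (\<lambda>_. ?E)) (\<lambda>\<omega>. \<lambda>i\<in>J. translate_pt (- y) (\<xi> i \<omega>)) = PiM J (\<lambda>_. N)"
      using bl J(1) Jne by simp_all
    interpret N: prob_space N by (rule N(1))
    interpret NJ: product_sigma_finite "\<lambda>_. N" ..
    obtain f where f: "bij_betw f {1..m} J" using bijJ[OF J] by blast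
    have hN: "config_value H J \<in> borel_measurable (PiM J (\<lambda>_. N))"
      using cvE[OF J(1)] measurable_cong_sets[OF setsPJ[OF N(2), of J] refl] by auto
    have SE: "?S \<in> sets ?E" by (rule inner_region_sets)
    have SN: "?S \<in> sets N" using N(2) SE by simp
    define W where "W x = (\<Prod>i\<in>J. indicator ?S (x i) :: real)" for x
    have Wm: "W \<in> borel_measurable (PiM J (\<lambda>_. ?E))"
      unfolding W_def
    proof (rule borel_measurable_prod)
      fix i assume "i \<in> J"
      then have "(\<lambda>x. x i) \<in> measurable (PiM J (\<lambda>_. ?E)) ?E" by (rule measurable_component_singleton)
      then show "(\<lambda>x. indicator ?S (x i) :: real) \<in> borel_measurable (PiM J (\<lambda>_. ?E))"
        by (rule measurable_compose) (rule borel_measurable_indicator[OF SE])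
    qed
    have Weq: "W (\<lambda>i\<in>J. translate_pt (- y) (\<xi> i \<omega>)) = (\<Prod>i\<in>J. indicator {p. dist y (fst p) \<le> K} (\<xi> i \<omega>))" if "\<omega> \<in> space M" for \<omega>
      unfolding W_def using inS[OF _ that] J(1) by (intro prod.cong) (auto simp: indicator_def)
    have Wc: "complex_of_real (W x) = (\<Prod>i\<in>J. indicator ?S (x i))" for x
      unfolding W_def of_real_prod by (intro prod.cong) (auto simp: indicator_def)
    have "(CLINT \<omega>|M. iexp (\<theta> * config_value H J (\<lambda>i. \<xi> i \<omega>)) * (\<Prod>i\<in>J. indicator {p. dist y (fst p) \<le> K} (\<xi> i \<omega>)))
      = (CLINT \<omega>|M. iexp (\<theta> * config_value H J (\<lambda>i\<in>J. translate_pt (- y) (\<xi> i \<omega>))) * complex_of_real (W (\<lambda>i\<in>J. translate_pt (- y) (\<xi> i \<omega>))))"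
    proof (intro Bochner_Integration.integral_cong refl)
      fix \<omega> assume \<omega>: "\<omega> \<in> space M"
      have "(\<Prod>i\<in>J. indicator {p. dist y (fst p) \<le> K} (\<xi> i \<omega>)) = complex_of_real (\<Prod>i\<in>J. indicator {p. dist y (fst p) \<le> K} (\<xi> i \<omega>))"
        unfolding of_real_prod by (intro prod.cong) (auto simp: indicator_def)
      then show "iexp (\<theta> * config_value H J (\<lambda>i. \<xi> i \<omega>)) * (\<Prod>i\<in>J. indicator {p. dist y (fst p) \<le> K} (\<xi> i \<omega>))
        = iexp (\<theta> * config_value H J (\<lambda>i\<in>J. translate_pt (- y) (\<xi> i \<omega>))) * complex_of_real (W (\<lambda>i\<in>J. translate_pt (- y) (\<xi> i \<omega>)))"
        unfolding Weq[OF \<omega>] transJ[OF J(1) \<omega>, of y] by simp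
    qed
    also have "\<dots> = (CLINT x|PiM J (\<lambda>_. N). iexp (\<theta> * config_value H J x) * complex_of_real (W x))"
    proof -
      have "(\<lambda>x. iexp (\<theta> * config_value H J x) * complex_of_real (W x)) \<in> borel_measurable (PiM J (\<lambda>_. ?E))"
        using cvE[OF J(1)] Wm by measurable
      from integral_distr[OF XmJ[OF J(1)] this, of y] show ?thesis unfolding N(5) by simp
    qed
    also have "cmod \<dots> \<le> exp (- (c / ((real n / c1) * (c2 / real n * v1)) ^ (2 * card J) / 2) * \<theta>\<^sup>2) * measure N ?S ^ card J"
      unfolding Wc
    proof (rule block_char_bound[OF G\<Gamma> N(1) _ SN finJ hN _ _ N(4) _ c])
      show "sets ?\<Gamma> = sets N" using sets\<Gamma> N(2) by simp
      show "0 < real n / c1" using n0 c12 by simp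
      show "0 < c2 / real n * v1" using n0 c12 v1 by simp
      show "emeasure ?\<Gamma> (A \<inter> ?S) \<le> ennreal (real n / c1) * emeasure N A" if "A \<in> sets N" for A
        using N(3)[of A] that N(2) by simp
      show "ennreal (c * \<theta>\<^sup>2) \<le> (\<integral>\<^sup>+x. (\<integral>\<^sup>+x'. ennreal (1 - cos (\<theta> * (config_value H J x - config_value H J x'))) * 
         (\<Prod>i\<in>J. indicator ?S (x' i)) \<partial>PiM J (\<lambda>_. ?\<Gamma>)) * (\<Prod>i\<in>J. indicator ?S (x i)) \<partial>PiM J (\<lambda>_. ?\<Gamma>))"
        using base separated_pairs_reindex[OF G\<Gamma> H f, of K \<theta>] unfolding separated_pairs_def by simp
    qed
    also have "exp (- (c / ((real n / c1) * (c2 / real n * v1)) ^ (2 * card J) / 2) * \<theta>\<^sup>2) = \<delta>"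
    proof -
      have "(real n / c1) * (c2 / real n * v1) = c2 * v1 / c1" using n0 by simp
      then show ?thesis unfolding \<delta>_def \<kappa> J(2) v1_def[symmetric] by simp
    qed
    also have "measure N ?S ^ card J = (\<integral>x. W x \<partial>PiM J (\<lambda>_. N))"
    proof -
      have "(\<integral>x. W x \<partial>PiM J (\<lambda>_. N)) = (\<Prod>i\<in>J. \<integral>x. indicator ?S x \<partial>N)"
        unfolding W_def using SN by (intro NJ.product_integral_prod finJ integrable_real_indicator) (auto simp: N.emeasure_eq_measure)
      then show ?thesis using SN by simp
    qed
    also have "\<dots> = (\<integral>\<omega>. W (\<lambda>i\<in>J. translate_pt (- y) (\<xi> i \<omega>)) \<partial>M)"
      unfolding N(5)[symmetric] by (rule integral_distr[OF XmJ[OF J(1)] Wm])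
    also have "\<dots> = (\<integral>\<omega>. (\<Prod>i\<in>J. indicator {p. dist y (fst p) \<le> K} (\<xi> i \<omega>)) \<partial>M)"
      by (intro Bochner_Integration.integral_cong refl Weq)
    finally show "cmod (CLINT \<omega>|M. iexp (\<theta> * config_value H J (\<lambda>i. \<xi> i \<omega>)) * (\<Prod>i\<in>J. indicator {p. dist y (fst p) \<le> K} (\<xi> i \<omega>)))
       \<le> \<delta> * (\<integral>\<omega>. (\<Prod>i\<in>J. indicator {p. dist y (fst p) \<le> K} (\<xi> i \<omega>)) \<partial>M)" .
  next
    fix y J assume y: "y \<in> Y" and J: "J \<subseteq> {1..n}" "card J = m"
    have Jne: "J \<noteq> {}" and finJ: "finite J" using J m finite_subset[OF J(1)] by auto
    obtain N where "box_law y N" using trans[OF y] by blast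
    note bl = this[unfolded box_law_def]
    then obtain k where k: "\<forall>A\<in>sets ?E. emeasure N (A \<inter> ?S) \<le> ennreal k * emeasure ?\<Gamma> A" by (elim conjE exE)
    have N: "prob_space N" "sets N = sets ?E"
      "\<And>A. A \<in> sets ?E \<Longrightarrow> emeasure N (A \<inter> ?S) \<le> ennreal k * emeasure ?\<Gamma> A"
      "distr M (PiM J (\<lambda>_. ?E)) (\<lambda>\<omega>. \<lambda>i\<in>J. translate_pt (- y) (\<xi> i \<omega>)) = PiM J (\<lambda>_. N)"
      using bl k J(1) Jne by simp_all
    interpret N: prob_space N by (rule N(1))
    obtain f where f: "bij_betw f {1..m} J" using bijJ[OF J] by blast
    have SE: "?S \<in> sets ?E" by (rule inner_region_sets)
    have hG: "config_value H J \<in> borel_measurable (PiM J (\<lambda>_. ?\<Gamma>))"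
      using cvE[OF J(1)] measurable_cong_sets[OF setsPJ[OF sets\<Gamma>, of J] refl] by auto
    have hN: "config_value H J \<in> borel_measurable (PiM J (\<lambda>_. N))"
      using cvE[OF J(1)] measurable_cong_sets[OF setsPJ[OF N(2), of J] refl] by auto
    define F where "F x = (indicator (- S) (config_value H J x - a) :: ennreal)" for x
    have S': "- S \<in> sets borel" using S(1) by auto
    have Fm: "F \<in> borel_measurable (PiM J (\<lambda>_. ?\<Gamma>))" "F \<in> borel_measurable (PiM J (\<lambda>_. N))"
      unfolding F_def using hG hN S' by measurable
    have "AE x in PiM J (\<lambda>_. ?\<Gamma>). config_value H J x - a \<in> S"
      by (rule AE_config_value_reindex[OF G\<Gamma> f coset])
    then have "AE x in PiM J (\<lambda>_. ?\<Gamma>). F x = 0" by eventually_elim (simp add: F_def)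
    then have F0: "(\<integral>\<^sup>+x. F x \<partial>PiM J (\<lambda>_. ?\<Gamma>)) = 0" using nn_integral_0_iff_AE[OF Fm(1)] by simp
    have sf: "sigma_finite_measure N" "sigma_finite_measure ?\<Gamma>" by unfold_locales
    have "(\<integral>\<^sup>+x. F x * (\<Prod>i\<in>J. indicator ?S (x i)) \<partial>PiM J (\<lambda>_. N)) \<le> ennreal k ^ card J * (\<integral>\<^sup>+x. F x \<partial>PiM J (\<lambda>_. ?\<Gamma>))"
      using N(2,3) sets\<Gamma> SE by (intro product_nn_integral_le[OF sf _ _ _ finJ Fm(1)]) auto
    then have z: "(\<integral>\<^sup>+x. F x * (\<Prod>i\<in>J. indicator ?S (x i)) \<partial>PiM J (\<lambda>_. N)) = 0" using F0 by simp
    have Wm: "(\<lambda>x. \<Prod>i\<in>J. indicator ?S (x i) :: ennreal) \<in> borel_measurable (PiM J (\<lambda>_. N))"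
    proof (rule borel_measurable_prod_ennreal)
      fix i assume "i \<in> J"
      then have "(\<lambda>x. x i) \<in> measurable (PiM J (\<lambda>_. N)) N" by (rule measurable_component_singleton)
      then show "(\<lambda>x. indicator ?S (x i) :: ennreal) \<in> borel_measurable (PiM J (\<lambda>_. N))"
        by (rule measurable_compose) (rule borel_measurable_indicator, simp only: N(2) SE)
    qed
    have "AE x in PiM J (\<lambda>_. N). F x * (\<Prod>i\<in>J. indicator ?S (x i)) = 0"
      using z nn_integral_0_iff_AE[OF borel_measurable_times_ennreal[OF Fm(2) Wm]] by simp
    then have "AE x in distr M (PiM J (\<lambda>_. ?E)) (\<lambda>\<omega>. \<lambda>i\<in>J. translate_pt (- y) (\<xi> i \<omega>)). F x * (\<Prod>i\<in>J. indicator ?S (x i)) = 0"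
      by (simp only: N(4))
    from AE_distrD[OF XmJ[OF J(1)] this] AE_space
    show "AE \<omega> in M. (\<forall>i\<in>J. dist y (fst (\<xi> i \<omega>)) \<le> K) \<longrightarrow> config_value H J (\<lambda>i. \<xi> i \<omega>) - a \<in> S"
    proof eventually_elim
      case (elim \<omega>)
      show ?case
      proof
        assume inn: "\<forall>i\<in>J. dist y (fst (\<xi> i \<omega>)) \<le> K"
        have "(\<Prod>i\<in>J. indicator ?S ((\<lambda>i\<in>J. translate_pt (- y) (\<xi> i \<omega>)) i)) = (1 :: ennreal)"
          using inn inS[OF _ elim(2)] J(1) by (intro prod.neutral) (auto simp: indicator_def)
        then have "F (\<lambda>i\<in>J. translate_pt (- y) (\<xi> i \<omega>)) = 0" using elim(1) by simp
        then show "config_value H J (\<lambda>i. \<xi> i \<omega>) - a \<in> S"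
          unfolding F_def transJ[OF J(1) elim(2), of y, symmetric] by (simp add: indicator_def split: if_splits)
      qed
    qed
  qed simp
  also have "\<dots> \<le> 16 * real n / (p0 * real (card Y))\<^sup>2 + \<delta> powr (p0 * real (card Y) / 2)"
    by (rule good_box_count_concentration[OF ind n law iso Y _ sep p00 good \<delta>]) (use cY in auto)
  also have "16 * real n / (p0 * real (card Y))\<^sup>2 \<le> 16 * real n / (p0 * (c4 * real n))\<^sup>2"
    using p00 c4 n0 cY by (intro divide_left_mono power_mono mult_left_mono) auto
  also have "\<dots> = 16 / (p0 * c4)\<^sup>2 / real n"
    using n0 by (simp add: power2_eq_square)
  also have "\<delta> powr (p0 * real (card Y) / 2) \<le> \<delta> powr (p0 * (c4 * real n) / 2)"
    using \<delta> p00 c4 by (intro powr_mono') auto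
  also have "\<dots> = exp (- (\<kappa> * (p0 * c4 / 2)) * real n * \<theta>\<^sup>2)"
    by (simp add: \<delta>_def powr_def algebra_simps)
  finally show "cmod (CLINT \<omega>|M. \<Psi> (config_value H {1..n} (\<lambda>i. \<xi> i \<omega>)))
    \<le> 16 / (p0 * c4)\<^sup>2 / real n + exp (- (\<kappa> * (p0 * c4 / 2)) * real n * \<theta>\<^sup>2)"
    by simp
qed

text \<open>The centres of the boxes form a cubic grid.\<close>

lemma lattice_centres:
  fixes x0 :: "real^'d" and s :: real and q :: nat
  assumes s: "0 < s"
  shows "\<exists>Y. finite Y \<and> card Y = q ^ CARD('d) \<and> (\<forall>y\<in>Y. dist x0 y \<le> s * real CARD('d) * real q) \<and>
     (\<forall>y\<in>Y. \<forall>y'\<in>Y. y \<noteq> y' \<longrightarrow> s \<le> dist y y')"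
proof -
  define c where "c z = x0 + s *\<^sub>R (\<chi> i. real (z i))" for z :: "'d \<Rightarrow> nat"
  define Z where "Z = PiE (UNIV :: 'd set) (\<lambda>_. {..<q})"
  have Z: "finite Z" "card Z = q ^ CARD('d)" unfolding Z_def by (auto simp: card_PiE intro!: finite_PiE)
  have far: "s \<le> dist (c z) (c z')" if "z \<noteq> z'" for z z'
  proof -
    have "\<exists>i. z i \<noteq> z' i" using that by (metis ext)
    then obtain i where i: "z i \<noteq> z' i" by blast
    then have "1 \<le> \<bar>real (z i) - real (z' i)\<bar>" by linarith
    then have "s * 1 \<le> s * \<bar>real (z i) - real (z' i)\<bar>" using s by (intro mult_left_mono) auto
    also have "\<dots> = \<bar>(c z - c z') $ i\<bar>" using s by (simp add: c_def abs_mult flip: right_diff_distrib)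
    also have "\<dots> \<le> dist (c z) (c z')" unfolding dist_norm by (rule component_le_norm_cart)
    finally show ?thesis by simp
  qed
  have far': "s \<le> dist (c z) (c z')" if "c z \<noteq> c z'" for z z'
    by (rule far) (use that in auto)
  have inj: "inj_on c Z"
  proof (rule inj_onI, rule ccontr)
    fix z z' assume "c z = c z'" "z \<noteq> z'"
    then show False using far[of z z'] s by simp
  qed
  have near: "dist x0 (c z) \<le> s * real CARD('d) * real q" if "z \<in> Z" for z
  proof -
    have "norm (\<chi> i. real (z i)) \<le> (\<Sum>i\<in>(UNIV :: 'd set). \<bar>real (z i)\<bar>)"
      using norm_le_l1_cart[of "\<chi> i. real (z i)"] by simp
    also have "\<dots> \<le> (\<Sum>i\<in>(UNIV :: 'd set). real q)"
      using that by (intro sum_mono) (auto simp: Z_def PiE_iff less_imp_le)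
    finally have "norm (\<chi> i. real (z i)) \<le> real CARD('d) * real q" by simp
    then have "s * norm (\<chi> i. real (z i)) \<le> s * (real CARD('d) * real q)" using s by (intro mult_left_mono) auto
    then show ?thesis using s by (simp add: c_def dist_norm mult.assoc)
  qed
  show ?thesis
    using Z inj near far' by (intro exI[of _ "c ` Z"]) (auto simp: card_image)
qed

lemma (in prob_space) iid_marked_scaled:
  fixes X :: "nat \<Rightarrow> 'a \<Rightarrow> real^'d" and T :: "nat \<Rightarrow> 'a \<Rightarrow> 'm" and f :: "real^'d \<Rightarrow> ennreal"
  assumes Q: "prob_space Q" and f[measurable]: "f \<in> borel_measurable borel"
    and iid: "iid_marked M (density lborel f) Q X T" and r: "0 < r"
  defines "\<xi> \<equiv> \<lambda>i \<omega>. scale_pt (inverse r) (X i \<omega>, T i \<omega>)"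
  shows "indep_vars (\<lambda>_. marked_space Q) \<xi> {1..n}"
    and "\<And>i. 1 \<le> i \<Longrightarrow> distr M (marked_space Q) (\<xi> i) = point_law (\<lambda>x. ennreal (r ^ CARD('d)) * f (r *\<^sub>R x)) Q"
proof -
  have ind: "indep_vars (\<lambda>_. marked_space Q) (\<lambda>i \<omega>. (X i \<omega>, T i \<omega>)) {1..}"
    and law: "\<And>i. 1 \<le> i \<Longrightarrow> distr M (marked_space Q) (\<lambda>\<omega>. (X i \<omega>, T i \<omega>)) = point_law f Q"
    using iid by (auto simp: iid_marked_def)
  have sm: "scale_pt (inverse r) \<in> measurable (marked_space Q) (marked_space Q :: ((real^'d) \<times> 'm) measure)"
    unfolding scale_pt_def[abs_def] by measurable
  have "indep_vars (\<lambda>_. marked_space Q) (\<lambda>i \<omega>. (X i \<omega>, T i \<omega>)) {1..n}"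
    by (rule indep_vars_subset[OF ind]) auto
  then show "indep_vars (\<lambda>_. marked_space Q) \<xi> {1..n}"
    unfolding \<xi>_def using sm by (rule indep_vars_compose2)
  fix i :: nat assume i: "1 \<le> i"
  have rv: "(\<lambda>\<omega>. (X i \<omega>, T i \<omega>)) \<in> measurable M (marked_space Q)"
    using ind i by (auto simp: indep_vars_def)
  have "distr M (marked_space Q) (\<xi> i) = distr (distr M (marked_space Q) (\<lambda>\<omega>. (X i \<omega>, T i \<omega>))) (marked_space Q) (scale_pt (inverse r))"
    unfolding \<xi>_def using distr_distr[OF sm rv] by (simp add: comp_def)
  also have "\<dots> = distr (point_law f Q) (marked_space Q) (\<lambda>p. ((1 / r) *\<^sub>R fst p - 0, snd p))"
    unfolding law[OF i] by (rule distr_cong) (auto simp: scale_pt_def divide_inverse)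
  also have "\<dots> = point_law (\<lambda>x. ennreal (r ^ CARD('d)) * f (r *\<^sub>R x)) Q"
    by (subst distr_point_law_affine[OF Q f r]) simp
  finally show "distr M (marked_space Q) (\<xi> i) = point_law (\<lambda>x. ennreal (r ^ CARD('d)) * f (r *\<^sub>R x)) Q" .
qed

lemma (in prob_space) sample_AE:
  fixes \<xi> :: "nat \<Rightarrow> 'a \<Rightarrow> (real^'d) \<times> 'm" and g :: "real^'d \<Rightarrow> ennreal"
  assumes Q: "prob_space Q" and g: "g \<in> borel_measurable borel" and n: "1 \<le> n"
    and ind: "indep_vars (\<lambda>_. marked_space Q) \<xi> {1..n}"
    and law: "\<And>i. 1 \<le> i \<Longrightarrow> distr M (marked_space Q) (\<xi> i) = point_law g Q"
  shows "distr M (PiM {1..n} (\<lambda>_. marked_space Q)) (\<lambda>\<omega>. restrict (\<lambda>i. \<xi> i \<omega>) {1..n}) = PiM {1..n} (\<lambda>_. point_law g Q)"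
    and "(\<lambda>\<omega>. restrict (\<lambda>i. \<xi> i \<omega>) {1..n}) \<in> measurable M (PiM {1..n} (\<lambda>_. marked_space Q))"
    and "AE \<omega> in M. H ((\<lambda>i. \<xi> i \<omega>) ` {1..n}) = config_value H {1..n} (\<lambda>i. \<xi> i \<omega>)"
proof -
  have rv: "\<xi> i \<in> measurable M (marked_space Q)" if "i \<in> {1..n}" for i using ind that by (auto simp: indep_vars_def)
  show Xm: "(\<lambda>\<omega>. restrict (\<lambda>i. \<xi> i \<omega>) {1..n}) \<in> measurable M (PiM {1..n} (\<lambda>_. marked_space Q))"
    by (rule measurable_restrict) (rule rv)
  have "distr M (PiM {1..n} (\<lambda>_. marked_space Q)) (\<lambda>\<omega>. restrict (\<lambda>i. \<xi> i \<omega>) {1..n}) = PiM {1..n} (\<lambda>i. distr M (marked_space Q) (\<xi> i))"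
    using n ind rv by (subst indep_vars_iff_distr_eq_PiM'[symmetric]) auto
  also have "\<dots> = PiM {1..n} (\<lambda>_. point_law g Q)" by (rule PiM_cong) (auto simp: law)
  finally show D: "distr M (PiM {1..n} (\<lambda>_. marked_space Q)) (\<lambda>\<omega>. restrict (\<lambda>i. \<xi> i \<omega>) {1..n}) = PiM {1..n} (\<lambda>_. point_law g Q)" .
  have pr: "prob_space (point_law g Q)" using prob_space_distr[OF rv[of 1]] law[of 1] n by simp
  have "AE x in PiM {1..n} (\<lambda>_. point_law g Q). inj_on (\<lambda>i. fst (x i)) {1..n}"
    by (rule AE_distinct_locations[OF pr sets_point_law AE_point_law_location[OF Q g]]) auto
  then have ae: "AE x in distr M (PiM {1..n} (\<lambda>_. marked_space Q)) (\<lambda>\<omega>. restrict (\<lambda>i. \<xi> i \<omega>) {1..n}). inj_on (\<lambda>i. fst (x i)) {1..n}"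
    by (simp only: D)
  have "inj_on (\<lambda>i. fst (restrict (\<lambda>i. \<xi> i \<omega>) {1..n} i)) {1..n} \<longleftrightarrow> inj_on (\<lambda>i. fst (\<xi> i \<omega>)) {1..n}" for \<omega>
    by (rule inj_on_cong) (simp only: restrict_apply')
  with AE_distrD[OF Xm ae] have "AE \<omega> in M. inj_on (\<lambda>i. fst (\<xi> i \<omega>)) {1..n}" by (simp only:)
  then show "AE \<omega> in M. H ((\<lambda>i. \<xi> i \<omega>) ` {1..n}) = config_value H {1..n} (\<lambda>i. \<xi> i \<omega>)"
    by eventually_elim (simp only: config_value_def if_True)
qed

text \<open>A continuity point \<open>x0\<close> of \<open>f\<close> with \<open>f x0 > 0\<close> exists, since \<open>f\<close> is continuous almost everywhere and is
  not almost everywhere zero. Near it the density of the rescaled points is of exact order \<open>1/n\<close>, because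
  \<open>n (r n) ^ CARD('d)\<close> converges to a positive limit, and a grid of step \<open>s > 2 A\<close> in the rescaled
  neighbourhood has of order \<open>n\<close> centres.\<close>

lemma (in prob_space) sample_char_bound:
  fixes Q :: "'m measure" and X :: "nat \<Rightarrow> 'a \<Rightarrow> real^'d" and T :: "nat \<Rightarrow> 'a \<Rightarrow> 'm"
    and f :: "real^'d \<Rightarrow> real" and r :: "nat \<Rightarrow> real" and H :: "((real^'d) \<times> 'm) set \<Rightarrow> real"
  assumes Q: "prob_space Q" and f_meas[measurable]: "f \<in> borel_measurable borel"
    and f_nonneg: "\<And>x. 0 \<le> f x" and f_bdd: "bdd_above (range f)" and f_cont: "AE x in lborel. isCont f x"
    and X_iid: "iid_marked M (density lborel (\<lambda>x. ennreal (f x))) Q X T"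
    and r_pos: "\<And>n. n \<ge> 1 \<Longrightarrow> r n > 0"
    and r_lim: "(\<lambda>n. real n * r n ^ CARD('d)) \<longlonglongrightarrow> \<rho>" and rho_pos: "\<rho> > 0"
    and H_meas: "H \<in> borel_measurable (finite_config (marked_space Q))" and Ht: "translation_invariant Q H"
    and G\<Gamma>: "prob_space (std_normal_vec \<Otimes>\<^sub>M Q :: ((real^'d) \<times> 'm) measure)"
    and iso: "isolation Q H m K A G \<epsilon>" and m: "1 \<le> m"
    and c: "0 < c" and base: "\<And>\<theta>. \<bar>\<theta>\<bar> \<le> T0 \<Longrightarrow> ennreal (c * \<theta>\<^sup>2) \<le> separated_pairs Q H {1..m} K \<theta>"
    and coset: "AE x in PiM {1..m} (\<lambda>_. std_normal_vec \<Otimes>\<^sub>M Q). config_value H {1..m} x - a \<in> S"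
    and S: "S \<in> sets borel" "0 \<in> S" "\<And>v w. v \<in> S \<Longrightarrow> w \<in> S \<Longrightarrow> v + w \<in> S"
  shows "\<exists>c'>0. \<exists>B\<ge>0. \<forall>\<^sub>F n in sequentially. \<forall>\<theta> \<Psi>. \<bar>\<theta>\<bar> \<le> T0 \<longrightarrow> \<Psi> \<in> borel_measurable borel \<longrightarrow>
     (\<forall>x. cmod (\<Psi> x) \<le> 1) \<longrightarrow> (\<forall>x v. v \<in> S \<longrightarrow> \<Psi> (x + v) = \<Psi> x * iexp (\<theta> * v)) \<longrightarrow>
     cmod (CLINT \<omega>|M. \<Psi> (rescaled r H n (marked_sample X T n \<omega>))) \<le> B / real n + exp (- c' * real n * \<theta>\<^sup>2)"
proof -
  let ?d = "CARD('d)"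
  have d: "0 < ?d" by simp
  have isoD: "0 < \<epsilon>" "0 < K" "K < A" using iso by (auto simp: isolation_def)
  have fe: "(\<lambda>x. ennreal (f x)) \<in> borel_measurable borel" by measurable
  have prob_f: "prob_space (point_law (\<lambda>x. ennreal (f x)) Q)"
  proof -
    have "(\<lambda>\<omega>. (X 1 \<omega>, T 1 \<omega>)) \<in> measurable M (marked_space Q)" using X_iid by (auto simp: iid_marked_def indep_vars_def)
    from prob_space_distr[OF this] show ?thesis using X_iid by (auto simp: iid_marked_def)
  qed
  have "\<not> (AE x in lborel. f x = 0)"
  proof
    assume z: "AE x in lborel. f x = 0"
    interpret F: prob_space "point_law (\<lambda>x. ennreal (f x)) Q" by (rule prob_f)
    have "emeasure (point_law (\<lambda>x. ennreal (f x)) Q) (UNIV \<times> space Q) = (\<integral>\<^sup>+x. ennreal (f x) * indicator UNIV x \<partial>lborel)"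
      by (rule emeasure_point_law_region[OF Q fe]) simp
    also have "\<dots> = (\<integral>\<^sup>+x. 0 \<partial>(lborel :: (real^'d) measure))"
      using z by (intro nn_integral_cong_AE) (auto elim: eventually_mono)
    finally have "emeasure (point_law (\<lambda>x. ennreal (f x)) Q) (UNIV \<times> space Q) = 0" by simp
    moreover have "space (point_law (\<lambda>x. ennreal (f x)) Q) = UNIV \<times> space Q" by (simp add: space_pair_measure)
    ultimately show False using F.emeasure_space_1 by simp
  qed
  then have "\<exists>x0. isCont f x0 \<and> f x0 \<noteq> 0"
    using f_cont by (metis (mono_tags, lifting) eventually_mono)
  then obtain x0 where x0: "isCont f x0" "f x0 \<noteq> 0" by blast
  define f0 where "f0 = f x0 / 2"
  have f0: "0 < f0" using x0 f_nonneg[of x0] by (simp add: f0_def)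
  obtain \<eta> where eta: "0 < \<eta>" "\<And>x. dist x x0 < \<eta> \<Longrightarrow> f0 \<le> f x"
  proof -
    from x0(1) f0 obtain \<eta> where "\<eta> > 0" "\<And>x. dist x x0 < \<eta> \<Longrightarrow> dist (f x) (f x0) < f0"
      unfolding continuous_at_eps_delta by meson
    show ?thesis
    proof (rule that[OF \<open>\<eta> > 0\<close>])
      fix x assume "dist x x0 < \<eta>"
      then have "\<bar>f x - f x0\<bar> < f0" using \<open>\<And>x. dist x x0 < \<eta> \<Longrightarrow> dist (f x) (f x0) < f0\<close> by (simp add: dist_real_def)
      moreover have "f x0 = 2 * f0" by (simp add: f0_def)
      ultimately show "f0 \<le> f x" by linarith
    qed
  qed
  obtain F where F: "\<And>x. f x \<le> F" "0 < F"
  proof -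
    from f_bdd obtain F where "\<And>x. f x \<le> F" by (auto simp: bdd_above_def)
    then show ?thesis by (intro that[of "max F 1"]) (auto simp: le_max_iff_disj)
  qed
  define c1 c2 where "c1 = f0 * (\<rho> / 2)" and "c2 = F * (2 * \<rho>)"
  have c12: "0 < c1" "0 < c2" using f0 F rho_pos by (auto simp: c1_def c2_def)
  \<comment> \<open>The step of the grid of centres.\<close>
  define s where "s = 2 * A + 1"
  have s: "0 < s" using isoD by (simp add: s_def)
  define c4 where "c4 = (\<eta> / (4 * s * real ?d)) ^ ?d / (2 * \<rho>)"
  have c4: "0 < c4" using eta s rho_pos by (simp add: c4_def)
  define q where "q = c1 * min (measure lborel (cball (0 :: real^'d) K)) (measure lborel (ball (0 :: real^'d) \<epsilon>))"
  define C where "C = c2 * measure lborel (cball (0 :: real^'d) A)"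
  define p0 where "p0 = (q / (2 * real (m + card G))) ^ (m + card G) * exp (- 2 * C)"
  define \<kappa> where "\<kappa> = c / (c2 * measure lborel (cball (0 :: real^'d) K) / c1) ^ (2 * m) / 2"
  define c' where "c' = \<kappa> * (p0 * c4 / 2)"
  define B where "B = 16 / (p0 * c4)\<^sup>2"
  have ev1: "\<forall>\<^sub>F n in sequentially. \<rho> / 2 < real n * r n ^ ?d"
    using r_lim rho_pos by (intro order_tendstoD(1)) auto
  have ev2: "\<forall>\<^sub>F n in sequentially. real n * r n ^ ?d < 2 * \<rho>"
    using r_lim rho_pos by (intro order_tendstoD(2)) auto
  define \<gamma> where "\<gamma> = min (\<eta> / (2 * A)) (\<eta> / (4 * s * real ?d))"
  have \<gamma>: "0 < \<gamma>" using eta s isoD by (simp add: \<gamma>_def)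
  have ev3: "\<forall>\<^sub>F n in sequentially. 2 * \<rho> < real n * \<gamma> ^ ?d"
    using \<gamma> by real_asymp
  have ev4: "\<forall>\<^sub>F n in sequentially. 2 * C \<le> real n" by real_asymp
  have ev: "\<forall>\<^sub>F n in sequentially. (\<forall>\<theta> \<Psi>. \<bar>\<theta>\<bar> \<le> T0 \<longrightarrow> \<Psi> \<in> borel_measurable borel \<longrightarrow>
     (\<forall>x. cmod (\<Psi> x) \<le> 1) \<longrightarrow> (\<forall>x v. v \<in> S \<longrightarrow> \<Psi> (x + v) = \<Psi> x * iexp (\<theta> * v)) \<longrightarrow>
     cmod (CLINT \<omega>|M. \<Psi> (rescaled r H n (marked_sample X T n \<omega>))) \<le> B / real n + exp (- c' * real n * \<theta>\<^sup>2)) \<and> 0 < c'"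
    using ev1 ev2 ev3 ev4 eventually_ge_at_top[of "2 * (m + card G)"] eventually_ge_at_top[of 1]
  proof eventually_elim
    case (elim n)
    have n: "1 \<le> n" and n0: "0 < real n" using elim by auto
    have r0: "0 < r n" using r_pos n by simp
    have rg: "r n < \<gamma>"
    proof (rule power_less_imp_less_base)
      have "real n * r n ^ ?d < real n * \<gamma> ^ ?d" using elim by linarith
      then show "r n ^ ?d < \<gamma> ^ ?d" using n0 by simp
    qed (use \<gamma> in simp)
    have rA: "r n * A < \<eta> / 2"
    proof -
      have "r n * A < \<eta> / (2 * A) * A" using rg isoD by (intro mult_strict_right_mono) (auto simp: \<gamma>_def)
      then show ?thesis using isoD by simp
    qed
    define z where "z = \<eta> / (2 * r n * s * real ?d)"
    have z2: "2 \<le> z"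
    proof -
      have "r n < \<eta> / (4 * s * real ?d)" using rg by (simp add: \<gamma>_def)
      then show ?thesis using s r0 d by (simp add: z_def field_simps)
    qed
    \<comment> \<open>The number of grid points per axis that fit into the rescaled neighbourhood of \<open>x0\<close>; it is of order \<open>1 / r n\<close>.\<close>
    define qn where "qn = nat \<lfloor>z\<rfloor>"
    have qn: "real qn \<le> z" "z / 2 \<le> real qn" using z2 by (auto simp: qn_def) linarith+
    define y0 where "y0 = (1 / r n) *\<^sub>R x0"
    obtain Y where Y: "finite Y" "card Y = qn ^ ?d" "\<And>y. y \<in> Y \<Longrightarrow> dist y0 y \<le> s * real ?d * real qn"
        "\<And>y y'. y \<in> Y \<Longrightarrow> y' \<in> Y \<Longrightarrow> y \<noteq> y' \<Longrightarrow> s \<le> dist y y'"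
      using lattice_centres[OF s, of qn y0] by auto
    define g where "g x = r n ^ ?d * f (r n *\<^sub>R x)" for x
    have gm[measurable]: "g \<in> borel_measurable borel" unfolding g_def by measurable
    have g0: "0 \<le> g x" for x using f_nonneg r0 by (simp add: g_def)
    have gup: "g x \<le> c2 / real n" for x
    proof -
      have "g x * real n = f (r n *\<^sub>R x) * (real n * r n ^ ?d)" by (simp add: g_def)
      also have "\<dots> \<le> F * (2 * \<rho>)" by (rule mult_mono) (use F elim(2) f_nonneg r0 in auto)
      finally show ?thesis using n0 by (simp add: c2_def field_simps)
    qed
    have glo: "c1 / real n \<le> g x" if y: "y \<in> Y" "dist y x \<le> A" for x y
    proof -
      have "dist y0 x \<le> s * real ?d * real qn + A" using Y(3)[OF y(1)] y(2) dist_triangle[of y0 x y] by linarith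
      then have "r n * dist y0 x \<le> r n * (s * real ?d * real qn + A)" using r0 by (intro mult_left_mono) auto
      also have "\<dots> = r n * s * real ?d * real qn + r n * A" by (simp add: algebra_simps)
      also have "r n * s * real ?d * real qn \<le> r n * s * real ?d * z" using qn r0 s by (intro mult_left_mono) auto
      also have "r n * s * real ?d * z = \<eta> / 2" using r0 s d by (simp add: z_def)
      finally have "r n * dist y0 x < \<eta>" using rA by linarith
      moreover have "dist (r n *\<^sub>R x) x0 = r n * dist y0 x"
      proof -
        have "x0 = r n *\<^sub>R y0" using r0 by (simp add: y0_def)
        then have "dist (r n *\<^sub>R x) x0 = norm (r n *\<^sub>R (x - y0))" by (simp add: dist_norm scaleR_diff_right)
        then show ?thesis using r0 by (simp add: dist_norm norm_minus_commute)
      qed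
      ultimately have "f0 \<le> f (r n *\<^sub>R x)" by (intro eta(2)) simp
      then have "f0 * (\<rho> / 2) \<le> f (r n *\<^sub>R x) * (real n * r n ^ ?d)"
        by (rule mult_mono) (use elim(1) f0 rho_pos f_nonneg in auto)
      also have "\<dots> = g x * real n" by (simp add: g_def)
      finally show ?thesis using n0 by (simp add: c1_def field_simps)
    qed
    have cY: "c4 * real n \<le> real (card Y)"
    proof -
      have "c4 * real n = (\<eta> / (4 * s * real ?d)) ^ ?d * (real n / (2 * \<rho>))" by (simp add: c4_def)
      also have "\<dots> \<le> (\<eta> / (4 * s * real ?d)) ^ ?d * (1 / r n ^ ?d)"
        using elim(2) rho_pos r0 eta s by (intro mult_left_mono) (auto simp: field_simps)
      also have "\<dots> = (z / 2) ^ ?d" using r0 by (simp add: z_def power_divide power_mult_distrib field_simps)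
      also have "\<dots> \<le> real qn ^ ?d" using qn z2 by (intro power_mono) auto
      finally show ?thesis using Y(2) by simp
    qed
    have sep: "2 * A < dist y y'" if "y \<in> Y" "y' \<in> Y" "y \<noteq> y'" for y y'
      using Y(4)[OF that] by (simp add: s_def)
    define \<xi> where "\<xi> i \<omega> = scale_pt (inverse (r n)) (X i \<omega>, T i \<omega>)" for i \<omega>
    note sc = iid_marked_scaled[OF Q fe X_iid r0, folded \<xi>_def]
    have geq: "(\<lambda>x. ennreal (r n ^ ?d) * ennreal (f (r n *\<^sub>R x))) = (\<lambda>x. ennreal (g x))"
      using r0 f_nonneg by (auto simp: g_def ennreal_mult)
    have law: "distr M (marked_space Q) (\<xi> i) = point_law (\<lambda>x. ennreal (g x)) Q" if "1 \<le> i" for i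
      using sc(2)[OF that] unfolding geq .
    have im: "scale_pt (inverse (r n)) ` marked_sample X T n \<omega> = (\<lambda>i. \<xi> i \<omega>) ` {1..n}" for \<omega>
      by (simp add: marked_sample_def image_image \<xi>_def)
    have ge: "(\<lambda>x. ennreal (g x)) \<in> borel_measurable borel" by measurable
    have Xm: "(\<lambda>\<omega>. restrict (\<lambda>i. \<xi> i \<omega>) {1..n}) \<in> measurable M (PiM {1..n} (\<lambda>_. marked_space Q))"
      by (rule sample_AE(2)[OF Q ge n sc(1)]) (rule law)
    have Xae: "AE \<omega> in M. H ((\<lambda>i. \<xi> i \<omega>) ` {1..n}) = config_value H {1..n} (\<lambda>i. \<xi> i \<omega>)"
      by (rule sample_AE(3)[OF Q ge n sc(1)]) (rule law)
    have cvM: "(\<lambda>\<omega>. config_value H {1..n} (\<lambda>i. \<xi> i \<omega>)) \<in> borel_measurable M"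
      using measurable_compose[OF Xm config_value_measurable[OF _ H_meas, of "{1..n}"]] by (simp add: config_value_restrict)
    have lawI: "distr M (marked_space Q) (\<xi> i) = point_law (\<lambda>x. ennreal (g x)) Q" if "i \<in> {1..n}" for i
      using law[of i] that by simp
    have bd: "cmod (CLINT \<omega>|M. \<Psi> (config_value H {1..n} (\<lambda>i. \<xi> i \<omega>))) \<le> B / real n + exp (- c' * real n * \<theta>\<^sup>2)" "0 < c'"
      if "\<bar>\<theta>\<bar> \<le> T0" "\<Psi> \<in> borel_measurable borel" "\<And>x. cmod (\<Psi> x) \<le> 1" "\<And>x v. v \<in> S \<Longrightarrow> \<Psi> (x + v) = \<Psi> x * iexp (\<theta> * v)" for \<theta> \<Psi>
      unfolding B_def c'_def
      by (rule scaled_char_bound[OF Q G\<Gamma> H_meas Ht sc(1) n lawI gm g0 gup glo c12 iso m Y(1) sep c4 cY c base[OF that(1)]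
          coset S that(2,3,4) q_def C_def p0_def \<kappa>_def elim(5) elim(4)]; assumption)+
    show ?case
    proof (intro conjI allI impI)
      fix \<theta> \<Psi>
      assume \<Psi>: "\<bar>\<theta>\<bar> \<le> T0" "\<Psi> \<in> borel_measurable borel" "\<forall>x. cmod (\<Psi> x) \<le> 1" "\<forall>x v. v \<in> S \<longrightarrow> \<Psi> (x + v) = \<Psi> x * iexp (\<theta> * v)"
      have eq: "AE \<omega> in M. \<Psi> (rescaled r H n (marked_sample X T n \<omega>)) = \<Psi> (config_value H {1..n} (\<lambda>i. \<xi> i \<omega>))"
        using Xae by eventually_elim (simp only: rescaled_def im)
      show "cmod (CLINT \<omega>|M. \<Psi> (rescaled r H n (marked_sample X T n \<omega>))) \<le> B / real n + exp (- c' * real n * \<theta>\<^sup>2)"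
      proof (cases "(\<lambda>\<omega>. \<Psi> (rescaled r H n (marked_sample X T n \<omega>))) \<in> borel_measurable M")
        case True
        have "(CLINT \<omega>|M. \<Psi> (rescaled r H n (marked_sample X T n \<omega>))) = (CLINT \<omega>|M. \<Psi> (config_value H {1..n} (\<lambda>i. \<xi> i \<omega>)))"
          by (rule integral_cong_AE[OF True measurable_compose[OF cvM \<Psi>(2)] eq])
        then show ?thesis using bd(1)[of \<theta> \<Psi>] \<Psi> by simp
      next
        case False
        then have "(CLINT \<omega>|M. \<Psi> (rescaled r H n (marked_sample X T n \<omega>))) = 0"
          by (intro not_integrable_integral_eq) (auto dest: borel_measurable_integrable)
        moreover have "0 \<le> B" by (simp add: B_def)
        ultimately show ?thesis by (simp add: add_nonneg_nonneg)
      qed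
    next
      show "0 < c'"
      proof -
        have isoD': "0 < q" unfolding q_def using c12 isoD by (simp add: content_cball content_ball)
        have "0 < p0" unfolding p0_def using isoD' m by simp
        moreover have "0 < \<kappa>" unfolding \<kappa>_def using c c12 isoD by (simp add: content_cball)
        ultimately show ?thesis using c4 by (simp add: c'_def)
      qed
    qed
  qed
  have "0 < c'"
  proof -
    from ev have "\<forall>\<^sub>F n::nat in sequentially. 0 < c'" by eventually_elim simp
    then show ?thesis by simp
  qed
  moreover have "0 \<le> B" by (simp add: B_def)
  ultimately show ?thesis using ev by (intro exI[of _ c'] conjI exI[of _ B]) (auto elim: eventually_mono)
qed

section \<open>Spans of Gaussian samples\<close>

text \<open>Gaussian points put guards at all guard positions and the remaining points far away with positive
  probability. Freezing such positions \<open>w\<close> of the points \<open>k + 1, \<dots>, n\<close>, chosen so that the coset condition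
  still holds for almost all positions of the first \<open>k\<close> points, splits off the constant \<open>H B\<close>, which is absorbed
  into the shift of the coset.\<close>

lemma span_transfer:
  fixes H :: "((real^'d) \<times> 'm) set \<Rightarrow> real" and Q :: "'m measure"
  defines "\<Gamma> \<equiv> std_normal_vec \<Otimes>\<^sub>M Q :: ((real^'d) \<times> 'm) measure"
  assumes Q: "prob_space Q" and G\<Gamma>: "prob_space \<Gamma>"
    and iso: "isolation Q H k K A G \<epsilon>" and n: "k + card G \<le> n"
    and ae: "AE x in PiM {1..n} (\<lambda>_. \<Gamma>). config_value H {1..n} x - a \<in> S"
  shows "\<exists>a'. AE v in PiM {1..k} (\<lambda>_. \<Gamma>). (\<forall>i\<in>{1..k}. v i \<in> inner_region Q K) \<longrightarrow> config_value H {1..k} v - a' \<in> S"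
proof -
  interpret \<Gamma>: prob_space \<Gamma> by fact
  interpret PS: product_sigma_finite "\<lambda>_. \<Gamma>" ..
  let ?I = "{1..k}" and ?J = "{k+1..n}"
  let ?E = "marked_space Q :: ((real^'d) \<times> 'm) measure"
  interpret GI: prob_space "PiM ?I (\<lambda>_. \<Gamma>)" by (intro prob_space_PiM G\<Gamma>)
  interpret GJ: prob_space "PiM ?J (\<lambda>_. \<Gamma>)" by (intro prob_space_PiM G\<Gamma>)
  interpret PP: pair_prob_space "PiM ?J (\<lambda>_. \<Gamma>)" "PiM ?I (\<lambda>_. \<Gamma>)" ..
  have sets\<Gamma>: "sets \<Gamma> = sets ?E" unfolding \<Gamma>_def std_normal_vec_law by (rule sets_point_law)
  have sp\<Gamma>: "space \<Gamma> = space ?E" using sets_eq_imp_space_eq[OF sets\<Gamma>] .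
  have dens: "(\<lambda>z. ennreal (std_vec_density z)) \<in> borel_measurable borel" by measurable
  have G\<Gamma>': "prob_space (point_law (\<lambda>z. ennreal (std_vec_density z)) Q :: ((real^'d) \<times> 'm) measure)"
    using G\<Gamma> unfolding \<Gamma>_def std_normal_vec_law .
  have distinct: "AE x in PiM L (\<lambda>_. \<Gamma>). inj_on (\<lambda>i. fst (x i)) L" if "finite L" for L :: "nat set"
    unfolding \<Gamma>_def std_normal_vec_law
    by (rule AE_distinct_locations[OF G\<Gamma>' sets_point_law AE_point_law_location[OF Q dens] that])
  have isoD: "0 < \<epsilon>" "0 < K" "K < A" "finite G" "\<And>g. g \<in> G \<Longrightarrow> K + \<epsilon> < norm g \<and> norm g + \<epsilon> < A"
    using iso by (auto simp: isolation_def)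
  have add: "H (V \<union> B) = H V + H B"
    if "V \<in> configs Q" "B \<in> configs Q" "card V = k" "\<forall>p\<in>V. dist 0 (fst p) \<le> K" "guarded A G \<epsilon> 0 B" for V B
    using iso that unfolding isolation_def by blast
  have IJ: "?J \<union> ?I = {1..n}" "?J \<inter> ?I = {}" using n by auto
  have mm: "merge ?J ?I \<in> measurable (PiM ?J (\<lambda>_. \<Gamma>) \<Otimes>\<^sub>M PiM ?I (\<lambda>_. \<Gamma>)) (PiM {1..n} (\<lambda>_. \<Gamma>))"
    using measurable_merge[of ?J ?I "\<lambda>_. \<Gamma>"] unfolding IJ .
  have "distr (PiM ?J (\<lambda>_. \<Gamma>) \<Otimes>\<^sub>M PiM ?I (\<lambda>_. \<Gamma>)) (PiM {1..n} (\<lambda>_. \<Gamma>)) (merge ?J ?I) = PiM {1..n} (\<lambda>_. \<Gamma>)"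
    using PS.distr_merge[OF IJ(2)] unfolding IJ by simp
  then have "AE x in distr (PiM ?J (\<lambda>_. \<Gamma>) \<Otimes>\<^sub>M PiM ?I (\<lambda>_. \<Gamma>)) (PiM {1..n} (\<lambda>_. \<Gamma>)) (merge ?J ?I). config_value H {1..n} x - a \<in> S"
    using ae by (simp only:)
  from AE_distrD[OF mm this] have "AE z in PiM ?J (\<lambda>_. \<Gamma>) \<Otimes>\<^sub>M PiM ?I (\<lambda>_. \<Gamma>). config_value H {1..n} (merge ?J ?I z) - a \<in> S" .
  from PP.AE_pair[OF this] have aeW: "AE w in PiM ?J (\<lambda>_. \<Gamma>). AE v in PiM ?I (\<lambda>_. \<Gamma>). config_value H {1..n} (merge ?J ?I (w, v)) - a \<in> S" .
  obtain e where e: "bij_betw e {..<card G} G" using isoD(4) by (metis atLeast0LessThan ex_bij_betw_nat_finite)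
  \<comment> \<open>Superfluous points are parked near a location outside the ball of radius \<open>A\<close>.\<close>
  define far where "far = (A + 2) *\<^sub>R (axis undefined 1 :: real^'d)"
  have far: "norm far = A + 2" using isoD by (simp add: far_def norm_axis_1)
  define cell where "cell j = (if j \<le> k + card G then ball (e (j - k - 1)) \<epsilon> else ball far 1)" for j
  have cellpos: "0 < measure \<Gamma> (cell j \<times> space Q)" for j
  proof -
    have "0 < measure (point_law (\<lambda>z. ennreal (std_vec_density z)) Q) (ball (z :: real^'d) t \<times> space Q)" if t: "0 < t" for z t
    proof -
      have "0 < std_normal_density (norm z + t) ^ CARD('d) * measure lborel (ball z t)"
        using t by (intro mult_pos_pos zero_less_power normal_density_pos) (auto simp: content_ball)
      also have "\<dots> \<le> measure (point_law (\<lambda>z. ennreal (std_vec_density z)) Q) (ball z t \<times> space Q)"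
      proof (rule measure_point_law_region(1)[OF Q G\<Gamma>'])
        fix x assume "x \<in> ball z t"
        then have "norm x \<le> norm z + t" using norm_triangle_sub[of x z] by (simp add: dist_norm norm_minus_commute)
        then show "std_normal_density (norm z + t) ^ CARD('d) \<le> std_vec_density x" by (rule std_vec_density_lower)
      next
        show "emeasure lborel (ball z t) < \<infinity>" by (rule emeasure_bounded_finite) simp
      qed auto
      finally show ?thesis .
    qed
    then show ?thesis using isoD unfolding \<Gamma>_def std_normal_vec_law cell_def by simp
  qed
  define Wset where "Wset = PiE ?J (\<lambda>j. cell j \<times> space Q)"
  have cellE: "cell j \<times> space Q \<in> sets \<Gamma>" for j unfolding sets\<Gamma> by (auto simp: cell_def)
  have Wm: "Wset \<in> sets (PiM ?J (\<lambda>_. \<Gamma>))" unfolding Wset_def by (rule sets_PiM_I_finite) (auto simp: cellE)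
  have "emeasure (PiM ?J (\<lambda>_. \<Gamma>)) Wset = (\<Prod>j\<in>?J. emeasure \<Gamma> (cell j \<times> space Q))"
    unfolding Wset_def by (rule PS.emeasure_PiM) (auto simp: cellE)
  also have "\<dots> \<noteq> 0" using cellpos by (auto simp: \<Gamma>.emeasure_eq_measure less_le)
  finally have Wpos: "emeasure (PiM ?J (\<lambda>_. \<Gamma>)) Wset \<noteq> 0" .
  have "\<not> (AE w in PiM ?J (\<lambda>_. \<Gamma>). w \<notin> Wset)"
  proof
    assume "AE w in PiM ?J (\<lambda>_. \<Gamma>). w \<notin> Wset"
    moreover have "{w \<in> space (PiM ?J (\<lambda>_. \<Gamma>)). \<not> w \<notin> Wset} = Wset" using sets.sets_into_space[OF Wm] by auto
    ultimately show False using Wpos AE_iff_measurable[OF Wm, of "\<lambda>w. w \<notin> Wset"] by simp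
  qed
  moreover have "AE w in PiM ?J (\<lambda>_. \<Gamma>). inj_on (\<lambda>i. fst (w i)) ?J \<and> (AE v in PiM ?I (\<lambda>_. \<Gamma>). config_value H {1..n} (merge ?J ?I (w, v)) - a \<in> S)"
    using aeW distinct[of ?J] by auto
  ultimately have "\<exists>w. w \<in> Wset \<and> inj_on (\<lambda>i. fst (w i)) ?J \<and> (AE v in PiM ?I (\<lambda>_. \<Gamma>). config_value H {1..n} (merge ?J ?I (w, v)) - a \<in> S)"
  proof -
    assume no: "\<not> (AE w in PiM ?J (\<lambda>_. \<Gamma>). w \<notin> Wset)"
      and good: "AE w in PiM ?J (\<lambda>_. \<Gamma>). inj_on (\<lambda>i. fst (w i)) ?J \<and> (AE v in PiM ?I (\<lambda>_. \<Gamma>). config_value H {1..n} (merge ?J ?I (w, v)) - a \<in> S)"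
    show ?thesis
    proof (rule ccontr)
      assume none: "\<not> ?thesis"
      from good have "AE w in PiM ?J (\<lambda>_. \<Gamma>). w \<notin> Wset"
        by eventually_elim (use none in blast)
      with no show False by contradiction
    qed
  qed
  then obtain w where w: "w \<in> Wset" "inj_on (\<lambda>i. fst (w i)) ?J"
    "AE v in PiM ?I (\<lambda>_. \<Gamma>). config_value H {1..n} (merge ?J ?I (w, v)) - a \<in> S" by blast
  define B where "B = w ` ?J"
  have wc: "fst (w j) \<in> cell j" "snd (w j) \<in> space Q" if "j \<in> ?J" for j
    using w(1) that by (auto simp: Wset_def PiE_iff mem_Times_iff)
  have wE: "w j \<in> space ?E" if "j \<in> ?J" for j
    using wc[OF that] by (simp add: space_pair_measure mem_Times_iff)
  have BC: "B \<in> configs Q" using wE by (auto simp: B_def finite_subsets_def)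
  have eG: "e (j - k - 1) \<in> G" if "j \<in> ?J" "j \<le> k + card G" for j
    using e that by (auto simp: bij_betw_def)
  have outer: "K < dist 0 (fst (w j))" if j: "j \<in> ?J" for j
  proof (cases "j \<le> k + card G")
    case True
    have "norm (e (j - k - 1)) \<le> norm (fst (w j)) + dist (e (j - k - 1)) (fst (w j))"
      using norm_triangle_sub[of "e (j - k - 1)" "fst (w j)"] by (simp add: dist_norm)
    then show ?thesis using isoD(5)[OF eG[OF j True]] wc(1)[OF j] True by (simp add: cell_def)
  next
    case False
    have "norm far \<le> norm (fst (w j)) + dist far (fst (w j))"
      using norm_triangle_sub[of far "fst (w j)"] by (simp add: dist_norm)
    then show ?thesis using far wc(1)[OF j] False isoD by (simp add: cell_def)
  qed
  have gd: "guarded A G \<epsilon> 0 B"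
    unfolding guarded_def
  proof (intro conjI ballI impI)
    fix g assume "g \<in> G"
    then have "g \<in> e ` {..<card G}" using e by (simp add: bij_betw_def)
    then obtain l where l: "l < card G" "g = e l" by auto
    have j: "k + 1 + l \<in> ?J" using l n by auto
    have "fst (w (k + 1 + l)) \<in> ball g \<epsilon>" using wc(1)[OF j] l by (simp add: cell_def)
    then show "\<exists>p\<in>B. dist (0 + g) (fst p) < \<epsilon>" using j unfolding B_def by auto
  next
    fix p assume "p \<in> B" "dist 0 (fst p) \<le> A"
    then obtain j where j: "j \<in> ?J" "p = w j" by (auto simp: B_def)
    have "j \<le> k + card G"
    proof (rule ccontr)
      assume "\<not> j \<le> k + card G"
      then have "dist far (fst p) < 1" using wc(1)[OF j(1)] j by (simp add: cell_def)
      moreover have "norm far \<le> norm (fst p) + dist far (fst p)"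
        using norm_triangle_sub[of far "fst p"] by (simp add: dist_norm)
      ultimately show False using far \<open>dist 0 (fst p) \<le> A\<close> by simp
    qed
    then show "\<exists>g\<in>G. dist (0 + g) (fst p) < \<epsilon>"
      using wc(1)[OF j(1)] eG[OF j(1)] j(2) by (intro bexI[of _ "e (j - k - 1)"]) (auto simp: cell_def)
  qed
  have "AE v in PiM ?I (\<lambda>_. \<Gamma>). (\<forall>i\<in>?I. v i \<in> inner_region Q K) \<longrightarrow> config_value H ?I v - (a - H B) \<in> S"
    using w(3) distinct[of ?I, OF finite_atLeastAtMost]
  proof eventually_elim
    case (elim v)
    show ?case
    proof
      assume inn: "\<forall>i\<in>?I. v i \<in> inner_region Q K"
      let ?x = "merge ?J ?I (w, v)"
      have xI: "?x i = v i" if "i \<in> ?I" for i using that by (auto simp: merge_def)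
      have xJ: "?x j = w j" if "j \<in> ?J" for j using that by (auto simp: merge_def)
      have vE: "v i \<in> space ?E" if "i \<in> ?I" for i
        using inn that by (auto simp: inner_region_def space_pair_measure mem_Times_iff)
      have VC: "v ` ?I \<in> configs Q" using vE by (auto simp: finite_subsets_def)
      have vi: "dist 0 (fst (v i)) \<le> K" if "i \<in> ?I" for i using inn that by (auto simp: inner_region_def mem_Times_iff)
      have "inj_on v ?I" by (rule inj_onI, rule inj_onD[OF elim(2)]) simp_all
      then have cV: "card (v ` ?I) = k" by (simp add: card_image)
      have "inj_on (\<lambda>i. fst (?x i)) {1..n}"
      proof (rule inj_onI)
        fix i j assume ij: "i \<in> {1..n}" "j \<in> {1..n}" "fst (?x i) = fst (?x j)"
        consider "i \<in> ?I" "j \<in> ?I" | "i \<in> ?J" "j \<in> ?J" | "i \<in> ?I" "j \<in> ?J" | "i \<in> ?J" "j \<in> ?I" using ij n by (metis IJ(1) UnE)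
        then show "i = j"
        proof cases
          case 1
          then have "fst (v i) = fst (v j)" using ij(3) xI by simp
          then show ?thesis using 1 inj_onD[OF elim(2)] by blast
        next
          case 2
          then have "fst (w i) = fst (w j)" using ij(3) xJ by simp
          then show ?thesis using 2 inj_onD[OF w(2)] by blast
        next
          case 3
          then have "fst (v i) = fst (w j)" using ij(3) xI xJ by simp
          then show ?thesis using vi[OF 3(1)] outer[OF 3(2)] by simp
        next
          case 4
          then have "fst (w i) = fst (v j)" using ij(3) xI xJ by simp
          then show ?thesis using vi[OF 4(2)] outer[OF 4(1)] by simp
        qed
      qed
      then have "config_value H {1..n} ?x = H (?x ` {1..n})" by (simp add: config_value_def)
      also have "?x ` {1..n} = v ` ?I \<union> B"
      proof -
        have "?x ` {1..n} = ?x ` ?J \<union> ?x ` ?I" by (simp only: IJ(1) flip: image_Un)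
        also have "?x ` ?J = B" unfolding B_def by (rule image_cong[OF refl xJ])
        also have "?x ` ?I = v ` ?I" by (rule image_cong[OF refl xI])
        finally show ?thesis by (simp only: Un_commute)
      qed
      also have "H \<dots> = H (v ` ?I) + H B"
        by (rule add[OF VC BC cV _ gd]) (use vi in auto)
      also have "H (v ` ?I) = config_value H ?I v" using elim(2) by (simp add: config_value_def)
      finally show "config_value H ?I v - (a - H B) \<in> S" using elim(1) by (simp add: algebra_simps)
    qed
  qed
  then show ?thesis by blast
qed

text \<open>A strictly increasing sequence of spans would give a strictly decreasing sequence of positive
  integers \<open>\<bar>d\<bar> / h i\<close>.\<close>

lemma Greatest_lattice_span:
  assumes dv: "\<And>h. (\<And>i :: nat. has_lattice_span P V (h i)) \<Longrightarrow> \<exists>d. d \<noteq> 0 \<and> (\<forall>i. d / h i \<in> \<int>)"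
    and lat: "lattice_rv P V"
  shows "has_lattice_span P V (GREATEST h. has_lattice_span P V h)"
    and "has_lattice_span P V h' \<Longrightarrow> h' \<le> (GREATEST h. has_lattice_span P V h)"
proof -
  have "\<exists>h. has_lattice_span P V h \<and> (\<forall>h'. has_lattice_span P V h' \<longrightarrow> h' \<le> h)"
  proof (rule ccontr)
    assume "\<not> ?thesis"
    then have step: "\<exists>h'. has_lattice_span P V h' \<and> h < h'" if "has_lattice_span P V h" for h
      using that by (meson not_le)
    obtain h0 where "has_lattice_span P V h0" using lat by (auto simp: lattice_rv_def)
    then obtain h where h: "\<And>i. has_lattice_span P V (h i)" "\<And>i :: nat. h i < h (Suc i)"
      using dependent_nat_choice[of "\<lambda>_ h. has_lattice_span P V h" "\<lambda>_ h h'. h < h'"] step by metis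
    obtain d where d: "d \<noteq> 0" "\<And>i. d / h i \<in> \<int>" using dv[of h] h by blast
    have hpos: "0 < h i" for i using h(1)[of i] by (simp add: has_lattice_span_def)
    have "\<exists>k :: nat. \<bar>d\<bar> / h i = real k" for i
    proof -
      obtain z :: int where "d / h i = of_int z" using d(2)[of i] by (auto elim: Ints_cases)
      then have "\<bar>d\<bar> / h i = real (nat \<bar>z\<bar>)" using hpos[of i]
        by (metis abs_div_pos of_int_abs of_nat_nat abs_ge_zero of_int_of_nat_eq)
      then show ?thesis by blast
    qed
    then obtain k :: "nat \<Rightarrow> nat" where k: "\<And>i. \<bar>d\<bar> / h i = real (k i)" by metis
    have "k (Suc i) < k i" for i
    proof -
      have "\<bar>d\<bar> / h (Suc i) < \<bar>d\<bar> / h i" using h(2)[of i] hpos d(1) by (intro divide_strict_left_mono) auto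
      then show ?thesis unfolding k by simp
    qed
    then have "\<exists>f :: nat \<Rightarrow> nat. \<forall>i. (f (Suc i), f i) \<in> less_than" by auto
    then show False using wf_less_than wf_iff_no_infinite_down_chain by blast
  qed
  then obtain h where h: "has_lattice_span P V h" "\<And>h'. has_lattice_span P V h' \<Longrightarrow> h' \<le> h" by blast
  have "(GREATEST h. has_lattice_span P V h) = h" by (rule Greatest_equality) (use h in auto)
  with h show "has_lattice_span P V (GREATEST h. has_lattice_span P V h)"
    and "has_lattice_span P V h' \<Longrightarrow> h' \<le> (GREATEST h. has_lattice_span P V h)" by auto
qed

text \<open>All values are \<open>0\<close> or of the form \<open>\<bar>d\<bar> / k\<close>, a set which is bounded and accumulates only at \<open>0\<close>.
  A positive limit inferior is therefore attained.\<close>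

lemma liminf_of_commensurable_spans:
  fixes h :: "nat \<Rightarrow> ereal" and d :: real
  assumes d: "d \<noteq> 0" and h: "\<And>n. n1 \<le> n \<Longrightarrow> h n = 0 \<or> (\<exists>x>0. h n = ereal x \<and> d / x \<in> \<int>)"
  shows "0 \<le> liminf h" and "liminf h < \<infinity>"
    and "liminf h = 0 \<Longrightarrow> 0 < \<epsilon> \<Longrightarrow> \<exists>n\<ge>n1. h n < ereal \<epsilon>"
    and "liminf h = ereal a \<Longrightarrow> 0 < a \<Longrightarrow> \<exists>n\<ge>n1. h n = ereal a"
proof -
  have kx: "\<exists>k :: nat. 0 < k \<and> x = \<bar>d\<bar> / real k" if x: "0 < x" "d / x \<in> \<int>" for x
  proof -
    obtain z :: int where z: "d / x = of_int z" using x(2) by (auto elim: Ints_cases)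
    then have "\<bar>d\<bar> / x = \<bar>real_of_int z\<bar>" using x(1) by (metis abs_div_pos)
    then have z': "\<bar>d\<bar> / x = real (nat \<bar>z\<bar>)" by simp
    have "0 < \<bar>d\<bar> / x" using d x(1) by simp
    then have "0 < nat \<bar>z\<bar>" unfolding z' by simp
    then show ?thesis using z' x(1) by (intro exI[of _ "nat \<bar>z\<bar>"]) (auto simp: field_simps)
  qed
  have h0: "0 \<le> h n" if "n1 \<le> n" for n using h[OF that] by auto
  have hle: "h n \<le> ereal \<bar>d\<bar>" if n: "n1 \<le> n" for n
    using h[OF n]
  proof
    assume "\<exists>x>0. h n = ereal x \<and> d / x \<in> \<int>"
    then obtain x where x: "0 < x" "h n = ereal x" "d / x \<in> \<int>" by blast
    then obtain k :: nat where "0 < k" "x = \<bar>d\<bar> / real k" using kx by blast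
    moreover have "\<bar>d\<bar> / real k \<le> \<bar>d\<bar> / 1" using \<open>0 < k\<close> by (intro divide_left_mono) auto
    ultimately show ?thesis using x by simp
  qed simp
  show "0 \<le> liminf h"
    by (intro Liminf_bounded eventually_sequentiallyI[of n1] h0)
  have "liminf h \<le> liminf (\<lambda>n :: nat. ereal \<bar>d\<bar>)"
    by (intro Liminf_mono eventually_sequentiallyI[of n1] hle)
  then have "liminf h \<le> ereal \<bar>d\<bar>" by (simp add: Liminf_const)
  then show "liminf h < \<infinity>" using order_le_less_trans by fastforce
  show "\<exists>n\<ge>n1. h n < ereal \<epsilon>" if "liminf h = 0" "0 < \<epsilon>"
  proof (rule ccontr)
    assume "\<not> ?thesis"
    then have "ereal \<epsilon> \<le> h n" if "n1 \<le> n" for n using that by (auto simp: not_less)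
    then have "ereal \<epsilon> \<le> liminf h"
      by (intro Liminf_bounded eventually_sequentiallyI[of n1])
    then show False using \<open>liminf h = 0\<close> \<open>0 < \<epsilon>\<close> by simp
  qed
  show "\<exists>n\<ge>n1. h n = ereal a" if L: "liminf h = ereal a" and a: "0 < a"
  proof (rule ccontr)
    assume no: "\<not> ?thesis"
    define M where "M = nat \<lceil>2 * \<bar>d\<bar> / a\<rceil>"
    \<comment> \<open>The possible values above \<open>a / 2\<close>; they keep a distance \<open>\<delta>\<close> from \<open>a\<close> unless they equal it.\<close>
    define F where "F = (\<lambda>k :: nat. \<bar>d\<bar> / real k) ` {1..M}"
    have "finite F" by (simp add: F_def)
    then obtain \<delta> where \<delta>: "\<delta> > 0" "\<And>x. x \<in> F \<Longrightarrow> x \<noteq> a \<Longrightarrow> \<delta> \<le> dist a x"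
      using finite_set_avoid[of F a] by auto
    define b where "b = max (a / 2) (a - \<delta>)"
    have b: "b < a" "a / 2 \<le> b" "a - \<delta> \<le> b" using a \<delta> by (auto simp: b_def)
    have "\<forall>\<^sub>F n in sequentially. ereal b < h n"
      using less_LiminfD[of "ereal b" sequentially h] L b by simp
    then have "\<forall>\<^sub>F n in sequentially. ereal (a + \<delta>) \<le> h n"
      using eventually_ge_at_top[of n1]
    proof eventually_elim
      case (elim n)
      have "0 \<le> ereal b" using b a by simp
      then have "0 < h n" using elim(1) by (rule order_le_less_trans)
      then obtain x where x: "0 < x" "h n = ereal x" "d / x \<in> \<int>" using h[OF elim(2)] by auto
      obtain k :: nat where k: "0 < k" "x = \<bar>d\<bar> / real k" using kx[OF x(1,3)] by blast
      have bx: "b < x" using elim(1) x by simp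
      then have "a / 2 < \<bar>d\<bar> / real k" using b k by linarith
      then have "real k < 2 * \<bar>d\<bar> / a" using k a by (simp add: field_simps)
      then have "k \<le> M" unfolding M_def by linarith
      then have "x \<in> F" using k unfolding F_def by auto
      moreover have "x \<noteq> a" using no elim(2) x by auto
      ultimately have "\<delta> \<le> \<bar>a - x\<bar>" using \<delta>(2)[of x] by (simp add: dist_real_def)
      then show ?case using bx b x by auto
    qed
    then have "ereal (a + \<delta>) \<le> liminf h" by (rule Liminf_bounded)
    then show False using L \<delta> by simp
  qed
qed

text \<open>Spans depend on the law only, so that from here on it suffices to study the product space.\<close>

lemma (in prob_space) rv_span_normal_sample:
  fixes H :: "((real^'d) \<times> 'm) set \<Rightarrow> real" and Q :: "'m measure"
  assumes Q: "prob_space Q" and H: "H \<in> borel_measurable (finite_config (marked_space Q))"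
    and Z: "iid_marked M std_normal_vec Q Z T" and n: "1 \<le> n"
  shows "rv_span M (\<lambda>\<omega>. H (marked_sample Z T n \<omega>)) =
    rv_span (PiM {1..n} (\<lambda>_. std_normal_vec \<Otimes>\<^sub>M Q)) (config_value H {1..n})"
proof -
  let ?g = "\<lambda>z :: real^'d. ennreal (std_vec_density z)"
  let ?E = "marked_space Q :: ((real^'d) \<times> 'm) measure"
  define \<xi> where "\<xi> i \<omega> = (Z i \<omega>, T i \<omega>)" for i \<omega>
  have ge: "?g \<in> borel_measurable borel" by measurable
  have "indep_vars (\<lambda>_. ?E) \<xi> {1..}" using Z unfolding \<xi>_def iid_marked_def by simp
  then have ind: "indep_vars (\<lambda>_. ?E) \<xi> {1..n}" by (rule indep_vars_subset) auto
  have law: "distr M ?E (\<xi> i) = point_law ?g Q" if "1 \<le> i" for i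
    using Z that unfolding \<xi>_def iid_marked_def std_normal_vec_law by simp
  let ?R = "\<lambda>\<omega>. restrict (\<lambda>i. \<xi> i \<omega>) {1..n}"
  have D: "distr M (PiM {1..n} (\<lambda>_. ?E)) ?R = PiM {1..n} (\<lambda>_. point_law ?g Q)"
    by (rule sample_AE(1)[OF Q ge n ind]) (rule law)
  have Rm: "?R \<in> measurable M (PiM {1..n} (\<lambda>_. ?E))"
    by (rule sample_AE(2)[OF Q ge n ind]) (rule law)
  have ae: "AE \<omega> in M. H (marked_sample Z T n \<omega>) = config_value H {1..n} (?R \<omega>)"
    unfolding config_value_restrict
    using sample_AE(3)[where H = H, OF Q ge n ind law] by (simp only: marked_sample_def \<xi>_def)
  have cv: "config_value H {1..n} \<in> borel_measurable (PiM {1..n} (\<lambda>_. ?E))"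
    by (rule config_value_measurable[OF _ H]) simp
  have tr: "(AE \<omega> in M. H (marked_sample Z T n \<omega>) \<in> S) \<longleftrightarrow>
      (AE x in PiM {1..n} (\<lambda>_. std_normal_vec \<Otimes>\<^sub>M Q). config_value H {1..n} x \<in> S)"
    if S: "S \<in> sets borel" for S
  proof -
    have "(AE \<omega> in M. H (marked_sample Z T n \<omega>) \<in> S) \<longleftrightarrow> (AE \<omega> in M. config_value H {1..n} (?R \<omega>) \<in> S)"
      using ae by (auto elim: eventually_elim2)
    also have "\<dots> \<longleftrightarrow> (AE x in distr M (PiM {1..n} (\<lambda>_. ?E)) ?R. config_value H {1..n} x \<in> S)"
      by (rule AE_distr_iff[OF Rm, symmetric]) (use measurable_sets[OF cv S] in \<open>simp add: vimage_def Int_def conj_commute\<close>)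
    finally show ?thesis unfolding std_normal_vec_law D .
  qed
  have "has_lattice_span M (\<lambda>\<omega>. H (marked_sample Z T n \<omega>)) =
      has_lattice_span (PiM {1..n} (\<lambda>_. std_normal_vec \<Otimes>\<^sub>M Q)) (config_value H {1..n})"
  proof
    fix h :: real
    have "{y. (y - a) / h \<in> \<int>} \<in> sets borel" for a
    proof -
      have "(\<lambda>y :: real. (y - a) / h) -` \<int> \<inter> space borel \<in> sets borel"
        by (rule measurable_sets[of _ _ borel]) (auto intro!: closed_Ints)
      then show ?thesis by (simp add: vimage_def)
    qed
    from tr[OF this] show "has_lattice_span M (\<lambda>\<omega>. H (marked_sample Z T n \<omega>)) h =
      has_lattice_span (PiM {1..n} (\<lambda>_. std_normal_vec \<Otimes>\<^sub>M Q)) (config_value H {1..n}) h"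
      unfolding has_lattice_span_def by simp
  qed
  moreover have "degenerate_rv M (\<lambda>\<omega>. H (marked_sample Z T n \<omega>)) \<longleftrightarrow>
      degenerate_rv (PiM {1..n} (\<lambda>_. std_normal_vec \<Otimes>\<^sub>M Q)) (config_value H {1..n})"
    using tr[of "{c}" for c] unfolding degenerate_rv_def by simp
  ultimately show ?thesis unfolding rv_span_def lattice_rv_def by (simp only:)
qed

text \<open>A functional of \<open>k\<close> points that is not almost surely constant is not almost surely constant on some ball
  of radius \<open>K\<close> either. By \<open>span_transfer\<close> every span for \<open>n \<ge> n1\<close> points is a span for \<open>k\<close> points in this
  ball. Two typical configurations in the ball with different values then give a difference \<open>d\<close> that all
  of these spans divide. The spans are quantified over sequences, since only countably many null sets
  can be avoided simultaneously.\<close>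

lemma normal_spans_commensurable:
  fixes H :: "((real^'d) \<times> 'm) set \<Rightarrow> real" and Q :: "'m measure"
  defines "\<Gamma> \<equiv> std_normal_vec \<Otimes>\<^sub>M Q :: ((real^'d) \<times> 'm) measure"
  assumes Q: "prob_space Q" and G\<Gamma>: "prob_space \<Gamma>"
    and nd: "\<not> degenerate_rv (PiM {1..k} (\<lambda>_. \<Gamma>)) (config_value H {1..k})"
    and iso: "\<And>K. 0 < K \<Longrightarrow> \<exists>A G \<epsilon>. isolation Q H k K A G \<epsilon>"
  shows "\<exists>n1\<ge>k. (\<forall>n\<ge>n1. \<not> degenerate_rv (PiM {1..n} (\<lambda>_. \<Gamma>)) (config_value H {1..n})) \<and>
    (\<forall>N h. (\<forall>i :: nat. n1 \<le> N i \<and> has_lattice_span (PiM {1..N i} (\<lambda>_. \<Gamma>)) (config_value H {1..N i}) (h i)) \<longrightarrow>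
      (\<exists>d. d \<noteq> 0 \<and> (\<forall>i. d / h i \<in> \<int>)))"
proof -
  let ?P = "PiM {1..k} (\<lambda>_. \<Gamma>)" and ?V = "config_value H {1..k}"
  interpret P: prob_space ?P by (intro prob_space_PiM G\<Gamma>)
  define inner where "inner K v \<longleftrightarrow> (\<forall>i\<in>{1..k}. v i \<in> inner_region Q K)" for K and v :: "nat \<Rightarrow> (real^'d) \<times> 'm"
  have ex: "\<exists>v. R v" if "AE v in ?P. R v" for R
  proof (rule ccontr)
    assume none: "\<not> (\<exists>v. R v)"
    from that have "AE v in ?P. False" by eventually_elim (use none in blast)
    then show False by simp
  qed
  have sp\<Gamma>: "space \<Gamma> = UNIV \<times> space Q" by (simp add: \<Gamma>_def space_pair_measure std_normal_vec_def)
  have "\<exists>K>0. \<forall>a. \<not> (AE v in ?P. inner K v \<longrightarrow> ?V v = a)"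
  proof (rule ccontr)
    assume "\<not> ?thesis"
    then have const: "\<exists>a. AE v in ?P. inner K v \<longrightarrow> ?V v = a" if "0 < K" for K using that by blast
    have "\<forall>j :: nat. \<exists>a. AE v in ?P. inner (real j + 1) v \<longrightarrow> ?V v = a" by (intro allI const) simp
    from choice[OF this]
    obtain a where "\<And>j :: nat. AE v in ?P. inner (real j + 1) v \<longrightarrow> ?V v = a j" by blast
    then have "AE v in ?P. \<forall>j :: nat. inner (real j + 1) v \<longrightarrow> ?V v = a j" by (simp add: AE_all_countable)
    then have ae: "AE v in ?P. v \<in> space ?P \<and> (\<forall>j :: nat. inner (real j + 1) v \<longrightarrow> ?V v = a j)"
      using AE_space by eventually_elim blast
    have big: "\<exists>j0. \<forall>j\<ge>j0. ?V v = a j" if v: "v \<in> space ?P" "\<forall>j :: nat. inner (real j + 1) v \<longrightarrow> ?V v = a j" for v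
    proof -
      have "inner (real j + 1) v" if j: "nat \<lceil>\<Sum>i\<in>{1..k}. norm (fst (v i))\<rceil> \<le> j" for j
        unfolding inner_def
      proof
        fix i assume i: "i \<in> {1..k}"
        have "norm (fst (v i)) \<le> (\<Sum>i\<in>{1..k}. norm (fst (v i)))" by (rule member_le_sum) (use i in auto)
        also have "\<dots> \<le> real j" using j by linarith
        finally show "v i \<in> inner_region Q (real j + 1)"
          using v(1) i by (auto simp: inner_region_def space_PiM PiE_iff sp\<Gamma> mem_Times_iff)
      qed
      with v(2) show ?thesis by blast
    qed
    obtain v0 where v0: "v0 \<in> space ?P" "\<forall>j :: nat. inner (real j + 1) v0 \<longrightarrow> ?V v0 = a j" using ex[OF ae] by blast
    obtain j0 where j0: "\<And>j. j0 \<le> j \<Longrightarrow> ?V v0 = a j" using big[OF v0] by blast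
    from ae have "AE v in ?P. ?V v = ?V v0"
    proof eventually_elim
      case (elim v)
      then obtain j1 where "\<And>j. j1 \<le> j \<Longrightarrow> ?V v = a j" using big[of v] by blast
      from this[of "max j0 j1"] j0[of "max j0 j1"] show ?case by simp
    qed
    with nd show False unfolding degenerate_rv_def by blast
  qed
  then obtain K where K: "0 < K" "\<And>a. \<not> (AE v in ?P. inner K v \<longrightarrow> ?V v = a)" by blast
  obtain A G \<epsilon> where isol: "isolation Q H k K A G \<epsilon>" using iso[OF K(1)] by blast
  note tr = span_transfer[OF Q G\<Gamma>[unfolded \<Gamma>_def] isol, folded \<Gamma>_def inner_def]
  show ?thesis
  proof (intro exI[of _ "k + card G"] conjI allI impI)
    fix n assume n: "k + card G \<le> n"
    show "\<not> degenerate_rv (PiM {1..n} (\<lambda>_. \<Gamma>)) (config_value H {1..n})"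
    proof
      assume "degenerate_rv (PiM {1..n} (\<lambda>_. \<Gamma>)) (config_value H {1..n})"
      then obtain c where "AE x in PiM {1..n} (\<lambda>_. \<Gamma>). config_value H {1..n} x = c"
        unfolding degenerate_rv_def by blast
      then have "AE x in PiM {1..n} (\<lambda>_. \<Gamma>). config_value H {1..n} x - c \<in> {0}" by eventually_elim simp
      from tr[OF n this] show False using K(2) by auto
    qed
  next
    fix N :: "nat \<Rightarrow> nat" and h :: "nat \<Rightarrow> real"
    assume Nh: "\<forall>i :: nat. k + card G \<le> N i \<and> has_lattice_span (PiM {1..N i} (\<lambda>_. \<Gamma>)) (config_value H {1..N i}) (h i)"
    have "\<forall>i. \<exists>a'. AE v in ?P. inner K v \<longrightarrow> ?V v - a' \<in> {y. y / h i \<in> \<int>}"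
    proof
      fix i
      obtain a where "AE x in PiM {1..N i} (\<lambda>_. \<Gamma>). config_value H {1..N i} x - a \<in> {y. y / h i \<in> \<int>}"
        using spec[OF Nh, of i] unfolding has_lattice_span_def mem_Collect_eq by blast
      from tr[OF _ this] Nh show "\<exists>a'. AE v in ?P. inner K v \<longrightarrow> ?V v - a' \<in> {y. y / h i \<in> \<int>}" by blast
    qed
    from choice[OF this]
    obtain a' where "\<And>i. AE v in ?P. inner K v \<longrightarrow> ?V v - a' i \<in> {y. y / h i \<in> \<int>}" by blast
    then have ae: "AE v in ?P. \<forall>i. inner K v \<longrightarrow> (?V v - a' i) / h i \<in> \<int>"
      unfolding AE_all_countable mem_Collect_eq by blast
    have pick: "\<exists>v. inner K v \<and> ?V v \<noteq> b \<and> (\<forall>i. (?V v - a' i) / h i \<in> \<int>)" for b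
    proof (rule ccontr)
      assume none: "\<not> ?thesis"
      from ae have "AE v in ?P. inner K v \<longrightarrow> ?V v = b" by eventually_elim (use none in blast)
      with K(2) show False by blast
    qed
    from pick[of 0] obtain v0 where v0: "\<And>i. (?V v0 - a' i) / h i \<in> \<int>" by blast
    from pick[of "?V v0"] obtain v where v: "?V v \<noteq> ?V v0" "\<And>i. (?V v - a' i) / h i \<in> \<int>" by blast
    have "(?V v - ?V v0) / h i \<in> \<int>" for i
    proof -
      have "(?V v - ?V v0) / h i = (?V v - a' i) / h i - (?V v0 - a' i) / h i" by (simp flip: diff_divide_distrib)
      then show ?thesis using v(2)[of i] v0[of i] by simp
    qed
    with v(1) show "\<exists>d. d \<noteq> 0 \<and> (\<forall>i. d / h i \<in> \<int>)" by (intro exI[of _ "?V v - ?V v0"]) auto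
  qed simp
qed

text \<open>The dichotomy that drives the main argument: it selects a block size \<open>m\<close> whose own span is
  either as small as desired or equal to the limiting span.\<close>

lemma limiting_span_cases:
  fixes P :: "nat \<Rightarrow> 'a measure" and V :: "nat \<Rightarrow> 'a \<Rightarrow> real"
  assumes nd: "\<And>n. n1 \<le> n \<Longrightarrow> \<not> degenerate_rv (P n) (V n)"
    and dv: "\<And>N h. (\<And>i :: nat. n1 \<le> N i \<and> has_lattice_span (P (N i)) (V (N i)) (h i)) \<Longrightarrow> \<exists>d. d \<noteq> 0 \<and> (\<forall>i. d / h i \<in> \<int>)"
  defines "L \<equiv> liminf (\<lambda>n. rv_span (P n) (V n))"
  shows "L < \<infinity> \<and> (L = 0 \<and> (\<forall>T>0. \<exists>m\<ge>n1. \<forall>t. 0 < t \<and> t \<le> T \<longrightarrow> \<not> has_lattice_span (P m) (V m) (2 * pi / t)) \<or>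
    (\<exists>a>0. L = ereal a \<and> (\<exists>m\<ge>n1. has_lattice_span (P m) (V m) a \<and> (\<forall>h. has_lattice_span (P m) (V m) h \<longrightarrow> h \<le> a))))"
proof -
  define W where "W n h \<longleftrightarrow> has_lattice_span (P n) (V n) h" for n h
  define g where "g n = (GREATEST h. W n h)" for n
  have g: "W n (g n)" "\<And>h. W n h \<Longrightarrow> h \<le> g n" if n: "n1 \<le> n" and l: "lattice_rv (P n) (V n)" for n
  proof -
    have "\<exists>d. d \<noteq> 0 \<and> (\<forall>i. d / h i \<in> \<int>)" if "\<And>i :: nat. has_lattice_span (P n) (V n) (h i)" for h
      by (rule dv[of "\<lambda>_. n"]) (use n that in auto)
    note gr = Greatest_lattice_span[OF this l]
    show "W n (g n)" unfolding g_def W_def by (rule gr(1))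
    show "h \<le> g n" if "W n h" for h  using gr(2)[of h] that by (simp add: g_def W_def)
  qed
  have val: "rv_span (P n) (V n) = (if lattice_rv (P n) (V n) then ereal (g n) else 0)" if "n1 \<le> n" for n
    using nd[OF that] by (simp add: rv_span_def g_def W_def)
  have Wpos: "0 < h" if "W n h" for n h using that by (simp add: W_def has_lattice_span_def)
  have "\<exists>d. d \<noteq> 0 \<and> (\<forall>n\<ge>n1. lattice_rv (P n) (V n) \<longrightarrow> d / g n \<in> \<int>)"
  proof (cases "\<exists>l\<ge>n1. lattice_rv (P l) (V l)")
    case True
    then obtain l where l: "n1 \<le> l" "lattice_rv (P l) (V l)" by blast
    define N where "N i = (if n1 \<le> i \<and> lattice_rv (P i) (V i) then i else l)" for i
    have "n1 \<le> N i \<and> has_lattice_span (P (N i)) (V (N i)) (g (N i))" for i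
      using l g(1)[of "N i"] by (auto simp: N_def W_def)
    from dv[of N "\<lambda>i. g (N i)", OF this] obtain d where d: "d \<noteq> 0" "\<forall>i. d / g (N i) \<in> \<int>" by (elim exE conjE)
    have "d / g n \<in> \<int>" if "n1 \<le> n" "lattice_rv (P n) (V n)" for n
      using spec[OF d(2), of n] that by (simp add: N_def)
    with d(1) show ?thesis by blast
  qed (auto intro: exI[of _ 1])
  then obtain d where d: "d \<noteq> 0" "\<And>n. n1 \<le> n \<Longrightarrow> lattice_rv (P n) (V n) \<Longrightarrow> d / g n \<in> \<int>" by blast
  have com: "rv_span (P n) (V n) = 0 \<or> (\<exists>x>0. rv_span (P n) (V n) = ereal x \<and> d / x \<in> \<int>)" if n: "n1 \<le> n" for n
    using val[OF n] d(2)[OF n] g(1)[OF n] Wpos[of n "g n"] by auto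
  note lim = liminf_of_commensurable_spans[where h = "\<lambda>n. rv_span (P n) (V n)", OF d(1) com, folded L_def]
  have nonneg: "0 \<le> L" and fin: "L < \<infinity>" using lim(1,2) by auto
  show ?thesis
  proof (cases "L = 0")
    case True
    have "\<exists>m\<ge>n1. \<forall>t. 0 < t \<and> t \<le> T \<longrightarrow> \<not> has_lattice_span (P m) (V m) (2 * pi / t)" if T: "0 < T" for T
    proof -
      have "0 < 2 * pi / T" using T by simp
      then obtain m where m: "n1 \<le> m" "rv_span (P m) (V m) < ereal (2 * pi / T)"
        using lim(3)[OF _ True] by blast
      have "\<not> W m (2 * pi / t)" if t: "0 < t" "t \<le> T" for t
      proof
        assume W: "W m (2 * pi / t)"
        then have l: "lattice_rv (P m) (V m)" by (auto simp: lattice_rv_def W_def)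
        have "2 * pi / t \<le> g m" using g(2)[OF m(1) l W] .
        also have "g m < 2 * pi / T" using m(2) val[OF m(1)] l by simp
        also have "\<dots> \<le> 2 * pi / t" using t by (intro divide_left_mono) auto
        finally show False by simp
      qed
      with m(1) show ?thesis unfolding W_def by blast
    qed
    with True fin show ?thesis by blast
  next
    case False
    with nonneg have "0 < L" by simp
    with fin obtain a where a: "L = ereal a" "0 < a" by (cases L) auto
    obtain m where m: "n1 \<le> m" "rv_span (P m) (V m) = ereal a" using lim(4)[OF _ a] by blast
    have l: "lattice_rv (P m) (V m)" using val[OF m(1)] m(2) a by (auto split: if_splits)
    then have "g m = a" using val[OF m(1)] m(2) by simp
    then show ?thesis using g[OF m(1) l] m(1) a fin unfolding W_def by blast
  qed
qed

section \<open>The local limit theorem for functionals of samples\<close>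

lemma real_distribution_centred_normal:
  assumes "0 \<le> \<sigma>"
  shows "real_distribution (centred_normal \<sigma>)"
proof (cases "\<sigma> = 0")
  case True
  then show ?thesis
    by (simp add: centred_normal_def real_distribution_def real_distribution_axioms_def prob_space_return)
next
  case False
  then have "prob_space (density lborel (\<lambda>x. ennreal (normal_density 0 \<sigma> x)))"
    using assms by (intro prob_space_normal_density) simp
  then show ?thesis using False
    by (simp add: centred_normal_def real_distribution_def real_distribution_axioms_def)
qed

lemma char_centred_normal:
  assumes "0 \<le> \<sigma>"
  shows "char (centred_normal \<sigma>) w = complex_of_real (exp (- (\<sigma> * w)\<^sup>2 / 2))"
proof (cases "\<sigma> = 0")
  case True
  then show ?thesis by (simp add: centred_normal_def char_def integral_return)
next
  case False
  with assms have s: "0 < \<sigma>" by simp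
  define N where "N = density lborel (\<lambda>x. ennreal (normal_density 0 \<sigma> x))"
  interpret prob_space N unfolding N_def by (rule prob_space_normal_density[OF s])
  have "distributed N lborel (\<lambda>x. x) (normal_density 0 \<sigma>)"
    unfolding distributed_def N_def by (auto intro!: distr_id2)
  then have "distributed N lborel (\<lambda>x. (x - 0) / \<sigma>) std_normal_density"
    by (rule normal_standard_normal_convert[OF s, where X = "\<lambda>x. x" and \<mu> = 0, THEN iffD1])
  then have D: "distr N lborel (\<lambda>x. x / \<sigma>) = std_normal_distribution"
    by (simp add: distributed_def)
  have "char std_normal_distribution (\<sigma> * w) = (CLINT x|N. iexp (\<sigma> * w * (x / \<sigma>)))"
    unfolding D[symmetric] char_def by (rule integral_distr) (auto simp: N_def)
  also have "\<dots> = (CLINT x|N. iexp (w * x))" using s by (intro Bochner_Integration.integral_cong) auto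
  also have "\<dots> = char (centred_normal \<sigma>) w" using False by (simp add: char_def centred_normal_def N_def)
  finally show ?thesis by (simp add: char_std_normal_distribution)
qed

lemma (in prob_space) clt_char_limit:
  assumes Y[measurable]: "\<And>n. Y n \<in> borel_measurable M" and s: "0 \<le> \<sigma>"
    and clt: "weak_conv_m (\<lambda>n. distr M borel (\<lambda>\<omega>. (Y n \<omega> - \<mu> n) / sqrt (real n))) (centred_normal \<sigma>)"
  shows "(\<lambda>n. CLINT \<omega>|M. iexp (w * ((Y n \<omega> - \<mu> n) / sqrt (real n)))) \<longlonglongrightarrow> complex_of_real (exp (- (\<sigma> * w)\<^sup>2 / 2))"
proof -
  have "(\<lambda>n. char (distr M borel (\<lambda>\<omega>. (Y n \<omega> - \<mu> n) / sqrt (real n))) w) \<longlonglongrightarrow> char (centred_normal \<sigma>) w"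
    by (rule levy_continuity1[OF _ real_distribution_centred_normal[OF s] clt]) (intro real_distribution_distr, measurable)
  moreover have "char (distr M borel (\<lambda>\<omega>. (Y n \<omega> - \<mu> n) / sqrt (real n))) w = (CLINT \<omega>|M. iexp (w * ((Y n \<omega> - \<mu> n) / sqrt (real n))))" for n
    unfolding char_def by (rule integral_distr) auto
  ultimately show ?thesis by (simp add: char_centred_normal[OF s])
qed

text \<open>At \<open>t = 1 / sqrt n\<close> the bound tends to \<open>exp (- c) < 1\<close>, whereas a degenerate limit would make the
  modulus of the characteristic function tend to \<open>1\<close>.\<close>

lemma (in prob_space) clt_variance_positive:
  assumes Y: "\<And>n. Y n \<in> borel_measurable M" and s: "0 \<le> \<sigma>"
    and clt: "weak_conv_m (\<lambda>n. distr M borel (\<lambda>\<omega>. (Y n \<omega> - \<mu> n) / sqrt (real n))) (centred_normal \<sigma>)"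
    and c: "0 < c" and T: "0 < T"
    and bound: "\<forall>\<^sub>F n in sequentially. \<forall>t. \<bar>t\<bar> \<le> T \<longrightarrow> cmod (CLINT \<omega>|M. iexp (t * Y n \<omega>)) \<le> B / real n + exp (- c * real n * t\<^sup>2)"
  shows "0 < \<sigma>"
proof (rule ccontr)
  assume "\<not> 0 < \<sigma>"
  with s have "\<sigma> = 0" by simp
  with clt_char_limit[OF Y s clt, of 1]
  have "(\<lambda>n. CLINT \<omega>|M. iexp (1 * ((Y n \<omega> - \<mu> n) / sqrt (real n)))) \<longlonglongrightarrow> 1" by simp
  then have lim: "(\<lambda>n. cmod (CLINT \<omega>|M. iexp ((Y n \<omega> - \<mu> n) / sqrt (real n)))) \<longlonglongrightarrow> 1"
    using tendsto_norm by fastforce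
  have up: "(\<lambda>n. B / real n + exp (- c)) \<longlonglongrightarrow> exp (- c)" by real_asymp
  have "\<forall>\<^sub>F n in sequentially. 1 / sqrt (real n) < T" using T by real_asymp
  then have "\<forall>\<^sub>F n in sequentially. cmod (CLINT \<omega>|M. iexp ((Y n \<omega> - \<mu> n) / sqrt (real n))) \<le> B / real n + exp (- c)"
    using bound eventually_ge_at_top[of 1]
  proof eventually_elim
    case (elim n)
    have n: "0 < real n" using elim by simp
    have "(CLINT \<omega>|M. iexp ((Y n \<omega> - \<mu> n) / sqrt (real n))) =
        (CLINT \<omega>|M. iexp (1 / sqrt (real n) * Y n \<omega>) * iexp (- (\<mu> n / sqrt (real n))))"
      by (intro Bochner_Integration.integral_cong refl) (simp add: field_simps diff_divide_distrib flip: exp_add)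
    also have "\<dots> = (CLINT \<omega>|M. iexp (1 / sqrt (real n) * Y n \<omega>)) * iexp (- (\<mu> n / sqrt (real n)))"
      by (rule Bochner_Integration.integral_mult_left_zero)
    finally have "cmod (CLINT \<omega>|M. iexp ((Y n \<omega> - \<mu> n) / sqrt (real n))) =
        cmod (CLINT \<omega>|M. iexp (1 / sqrt (real n) * Y n \<omega>))" by (simp only: norm_mult norm_exp_i_times mult_1_right)
    also have "\<dots> \<le> B / real n + exp (- c * real n * (1 / sqrt (real n))\<^sup>2)"
      using elim(1) n by (intro elim(2)[rule_format]) auto
    also have "- c * real n * (1 / sqrt (real n))\<^sup>2 = - c" using n by (simp add: power_divide)
    finally show ?case .
  qed
  from tendsto_le[OF _ up lim this] have "1 \<le> exp (- c)" by simp
  with c show False by simp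
qed

lemma tendsto_SUP_zero:
  fixes F :: "nat \<Rightarrow> real \<Rightarrow> real"
  assumes "\<And>e. 0 < e \<Longrightarrow> \<forall>\<^sub>F n in sequentially. \<forall>u. \<bar>F n u\<bar> < e"
  shows "(\<lambda>n. SUP u\<in>UNIV. \<bar>F n u\<bar>) \<longlonglongrightarrow> 0"
proof (rule tendstoI)
  fix e :: real assume "0 < e"
  then have "\<forall>\<^sub>F n in sequentially. \<forall>u. \<bar>F n u\<bar> < e / 2" by (intro assms) simp
  then show "\<forall>\<^sub>F n in sequentially. dist (SUP u\<in>UNIV. \<bar>F n u\<bar>) 0 < e"
  proof eventually_elim
    case (elim n)
    have "(SUP u\<in>UNIV. \<bar>F n u\<bar>) \<le> e / 2" using elim by (intro cSUP_least) (auto intro: less_imp_le)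
    moreover have "\<bar>F n 0\<bar> \<le> (SUP u\<in>UNIV. \<bar>F n u\<bar>)"
      using elim by (intro cSUP_upper bdd_aboveI2[of _ _ "e / 2"]) (auto intro: less_imp_le)
    ultimately show ?case using \<open>0 < e\<close> by (simp add: dist_real_def)
  qed
qed

text \<open>The two structural hypotheses on the functional enter through \<open>isolation\<close> only. The block size is
  taken from \<open>limiting_span_cases\<close>: if the limiting span is \<open>0\<close>, blocks without spans \<open>2 \<pi> / t\<close> for
  \<open>t \<le> T\<close> exist for every \<open>T\<close>. If it is \<open>a > 0\<close>, a block with greatest span \<open>a\<close> has no span
  \<open>2 \<pi> / t \<ge> 2 a\<close> with \<open>t \<le> \<pi> / a\<close>, which is precisely the range needed for inverting integer-valued
  variables.\<close>

lemma (in prob_space) sample_llt: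
  fixes Q :: "'m measure" and X :: "nat \<Rightarrow> 'a \<Rightarrow> real^'d" and T :: "nat \<Rightarrow> 'a \<Rightarrow> 'm"
    and f :: "real^'d \<Rightarrow> real" and r :: "nat \<Rightarrow> real" and H :: "((real^'d) \<times> 'm) set \<Rightarrow> real"
  defines "\<Gamma> \<equiv> std_normal_vec \<Otimes>\<^sub>M Q :: ((real^'d) \<times> 'm) measure"
  assumes Q: "prob_space Q" and f_meas: "f \<in> borel_measurable borel"
    and f_nonneg: "\<And>x. 0 \<le> f x" and f_bdd: "bdd_above (range f)" and f_cont: "AE x in lborel. isCont f x"
    and X_iid: "iid_marked M (density lborel (\<lambda>x. ennreal (f x))) Q X T"
    and r_pos: "\<And>n. n \<ge> 1 \<Longrightarrow> r n > 0"
    and r_lim: "(\<lambda>n. real n * r n ^ CARD('d)) \<longlonglongrightarrow> \<rho>" and rho_pos: "\<rho> > 0"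
    and H_meas: "H \<in> borel_measurable (finite_config (marked_space Q))" and Ht: "translation_invariant Q H"
    and G\<Gamma>: "prob_space \<Gamma>"
    and k: "1 \<le> k" and nd: "\<not> degenerate_rv (PiM {1..k} (\<lambda>_. \<Gamma>)) (config_value H {1..k})"
    and iso: "\<And>m K. k \<le> m \<Longrightarrow> 0 < K \<Longrightarrow> \<exists>A G \<epsilon>. isolation Q H m K A G \<epsilon>"
    and Y_meas: "\<And>n. Y n \<in> borel_measurable M"
    and Y: "\<And>n. 1 \<le> n \<Longrightarrow> Y n = (\<lambda>\<omega>. rescaled r H n (marked_sample X T n \<omega>))"
    and s: "0 \<le> \<sigma>"
    and clt: "weak_conv_m (\<lambda>n. distr M borel (\<lambda>\<omega>. (Y n \<omega> - \<mu> n) / sqrt (real n))) (centred_normal \<sigma>)"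
  defines "L \<equiv> liminf (\<lambda>n. rv_span (PiM {1..n} (\<lambda>_. \<Gamma>)) (config_value H {1..n}))"
  shows "0 < \<sigma> \<and> L < \<infinity> \<and> (\<forall>b>0. span_dvd L b \<longrightarrow>
     (\<lambda>n. SUP u\<in>(UNIV::real set). \<bar>sqrt (real n) * measure M {\<omega> \<in> space M. Y n \<omega> \<in> {u..<u + b}}
            - b / \<sigma> * std_normal_density ((u - \<mu> n) / (sqrt (real n) * \<sigma>))\<bar>) \<longlonglongrightarrow> 0)"
proof -
  let ?W = "\<lambda>n. has_lattice_span (PiM {1..n} (\<lambda>_. \<Gamma>)) (config_value H {1..n})"
  obtain n1 where n1: "k \<le> n1"
    and nd1: "\<And>n. n1 \<le> n \<Longrightarrow> \<not> degenerate_rv (PiM {1..n} (\<lambda>_. \<Gamma>)) (config_value H {1..n})"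
    and dv: "\<And>N h. (\<And>i :: nat. n1 \<le> N i \<and> ?W (N i) (h i)) \<Longrightarrow> \<exists>d. d \<noteq> 0 \<and> (\<forall>i. d / h i \<in> \<int>)"
    using normal_spans_commensurable[OF Q G\<Gamma>[unfolded \<Gamma>_def] nd[unfolded \<Gamma>_def] iso[OF order_refl]] unfolding \<Gamma>_def by blast
  have cs: "L < \<infinity> \<and> (L = 0 \<and> (\<forall>T>0. \<exists>m\<ge>n1. \<forall>t. 0 < t \<and> t \<le> T \<longrightarrow> \<not> ?W m (2 * pi / t)) \<or>
    (\<exists>a>0. L = ereal a \<and> (\<exists>m\<ge>n1. ?W m a \<and> (\<forall>h. ?W m h \<longrightarrow> h \<le> a))))"
    unfolding L_def
    by (rule limiting_span_cases[where P = "\<lambda>n. PiM {1..n} (\<lambda>_. \<Gamma>)" and V = "\<lambda>n. config_value H {1..n}"])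
      (erule nd1, rule dv, assumption)
  have charb: "\<exists>c>0. \<exists>B\<ge>0. \<forall>\<^sub>F n in sequentially. \<forall>\<theta> \<Psi>. \<bar>\<theta>\<bar> \<le> \<tau> \<longrightarrow> \<Psi> \<in> borel_measurable borel \<longrightarrow>
     (\<forall>x. cmod (\<Psi> x) \<le> 1) \<longrightarrow> (\<forall>x v. v \<in> S \<longrightarrow> \<Psi> (x + v) = \<Psi> x * iexp (\<theta> * v)) \<longrightarrow>
     cmod (CLINT \<omega>|M. \<Psi> (Y n \<omega>)) \<le> B / real n + exp (- c * real n * \<theta>\<^sup>2)"
    if m: "n1 \<le> m" and nl: "\<And>t. 0 < t \<Longrightarrow> t \<le> \<tau> \<Longrightarrow> \<not> ?W m (2 * pi / t)"
      and coset: "AE x in PiM {1..m} (\<lambda>_. \<Gamma>). config_value H {1..m} x - a \<in> S"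
      and S: "S \<in> sets borel" "0 \<in> S" "\<And>v w. v \<in> S \<Longrightarrow> w \<in> S \<Longrightarrow> v + w \<in> S" for m \<tau> a S
  proof -
    have nd': "\<not> (AE x in PiM {1..m} (\<lambda>_. \<Gamma>). config_value H {1..m} x = a)" for a
      using nd1[OF m] unfolding degenerate_rv_def by blast
    have nl': "\<not> (AE x in PiM {1..m} (\<lambda>_. \<Gamma>). (config_value H {1..m} x - a) / (2 * pi / t) \<in> \<int>)" if "0 < t" "t \<le> \<tau>" for t a
      using nl[OF that] that pi_gt_zero unfolding has_lattice_span_def by simp
    from separated_pairs_lower_bound[OF G\<Gamma>[unfolded \<Gamma>_def] H_meas finite_atLeastAtMost nd'[unfolded \<Gamma>_def] nl'[unfolded \<Gamma>_def]]
    obtain K c where K: "0 < K" and c: "0 < c"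
      and base: "\<And>\<theta>. \<bar>\<theta>\<bar> \<le> \<tau> \<Longrightarrow> ennreal (c * \<theta>\<^sup>2) \<le> separated_pairs Q H {1..m} K \<theta>" by blast
    obtain A G \<epsilon> where isol: "isolation Q H m K A G \<epsilon>" using iso[of m K] K m n1 by auto
    have m1: "1 \<le> m" using m n1 k by simp
    obtain c' B where cB: "0 < c'" "0 \<le> B" and ev: "\<forall>\<^sub>F n in sequentially. \<forall>\<theta> \<Psi>. \<bar>\<theta>\<bar> \<le> \<tau> \<longrightarrow> \<Psi> \<in> borel_measurable borel \<longrightarrow>
       (\<forall>x. cmod (\<Psi> x) \<le> 1) \<longrightarrow> (\<forall>x v. v \<in> S \<longrightarrow> \<Psi> (x + v) = \<Psi> x * iexp (\<theta> * v)) \<longrightarrow>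
       cmod (CLINT \<omega>|M. \<Psi> (rescaled r H n (marked_sample X T n \<omega>))) \<le> B / real n + exp (- c' * real n * \<theta>\<^sup>2)"
      using sample_char_bound[OF Q f_meas f_nonneg f_bdd f_cont X_iid r_pos r_lim rho_pos H_meas Ht G\<Gamma>[unfolded \<Gamma>_def] isol m1 c base
          coset[unfolded \<Gamma>_def] S] by blast
    from ev eventually_ge_at_top[of 1] have "\<forall>\<^sub>F n in sequentially. \<forall>\<theta> \<Psi>. \<bar>\<theta>\<bar> \<le> \<tau> \<longrightarrow> \<Psi> \<in> borel_measurable borel \<longrightarrow>
       (\<forall>x. cmod (\<Psi> x) \<le> 1) \<longrightarrow> (\<forall>x v. v \<in> S \<longrightarrow> \<Psi> (x + v) = \<Psi> x * iexp (\<theta> * v)) \<longrightarrow>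
       cmod (CLINT \<omega>|M. \<Psi> (Y n \<omega>)) \<le> B / real n + exp (- c' * real n * \<theta>\<^sup>2)"
      by eventually_elim (simp only: Y)
    with cB show ?thesis by blast
  qed
  have fluct: "gaussian_fluctuations M Y \<mu> \<sigma>" if "0 < \<sigma>"
    by unfold_locales (use Y_meas that clt_char_limit[OF Y_meas s clt] in auto)
  have sq: "(\<lambda>n. sqrt (real n) * (B / real n)) \<longlonglongrightarrow> 0" for B :: real by real_asymp
  have iexp_char: "(\<lambda>x. iexp (\<theta> * x)) \<in> borel_measurable borel" "\<forall>x. cmod (iexp (\<theta> * x)) \<le> 1"
      "\<forall>x v. iexp (\<theta> * (x + v)) = iexp (\<theta> * x) * iexp (\<theta> * v)" for \<theta> :: real
    by (simp_all add: distrib_left exp_add)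
  from cs have fin: "L < \<infinity>" by blast
  from cs consider (dense) "L = 0" "\<And>T. 0 < T \<Longrightarrow> \<exists>m\<ge>n1. \<forall>t. 0 < t \<and> t \<le> T \<longrightarrow> \<not> ?W m (2 * pi / t)"
    | (lattice) a m where "0 < a" "L = ereal a" "n1 \<le> m" "?W m a" "\<And>h. ?W m h \<Longrightarrow> h \<le> a" by blast
  then show ?thesis
  proof cases
    case dense
    have bd: "\<exists>c>0. \<exists>B\<ge>0. \<forall>\<^sub>F n in sequentially. \<forall>t. \<bar>t\<bar> \<le> T \<longrightarrow>
        cmod (CLINT \<omega>|M. iexp (t * Y n \<omega>)) \<le> B / real n + exp (- c * real n * t\<^sup>2)" if T: "0 < T" for T
    proof -
      obtain m where m: "n1 \<le> m" "\<And>t. 0 < t \<Longrightarrow> t \<le> T \<Longrightarrow> \<not> ?W m (2 * pi / t)" using dense(2)[OF T] by blast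
      have triv: "AE x in PiM {1..m} (\<lambda>_. \<Gamma>). config_value H {1..m} x - 0 \<in> (UNIV :: real set)" by simp
      obtain c B where cB: "0 < c" "0 \<le> B" and ev: "\<forall>\<^sub>F n in sequentially. \<forall>\<theta> \<Psi>. \<bar>\<theta>\<bar> \<le> T \<longrightarrow> \<Psi> \<in> borel_measurable borel \<longrightarrow>
         (\<forall>x. cmod (\<Psi> x) \<le> 1) \<longrightarrow> (\<forall>x v. v \<in> UNIV \<longrightarrow> \<Psi> (x + v) = \<Psi> x * iexp (\<theta> * v)) \<longrightarrow>
         cmod (CLINT \<omega>|M. \<Psi> (Y n \<omega>)) \<le> B / real n + exp (- c * real n * \<theta>\<^sup>2)"
        using charb[of m T, OF m(1) m(2) triv] by auto
      from ev have "\<forall>\<^sub>F n in sequentially. \<forall>t. \<bar>t\<bar> \<le> T \<longrightarrow>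
        cmod (CLINT \<omega>|M. iexp (t * Y n \<omega>)) \<le> B / real n + exp (- c * real n * t\<^sup>2)"
      proof eventually_elim
        case (elim n)
        show ?case
        proof (intro allI impI)
          fix t :: real assume t: "\<bar>t\<bar> \<le> T"
          show "cmod (CLINT \<omega>|M. iexp (t * Y n \<omega>)) \<le> B / real n + exp (- c * real n * t\<^sup>2)"
            by (rule elim[rule_format, OF t iexp_char(1)]) (use iexp_char[of t] in blast)+
        qed
      qed
      with cB show ?thesis by blast
    qed
    have sp: "0 < \<sigma>"
    proof -
      obtain c B where c: "0 < c" and ev: "\<forall>\<^sub>F n in sequentially. \<forall>t. \<bar>t\<bar> \<le> 1 \<longrightarrow>
        cmod (CLINT \<omega>|M. iexp (t * Y n \<omega>)) \<le> B / real n + exp (- c * real n * t\<^sup>2)" using bd[of 1] by auto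
      show ?thesis by (rule clt_variance_positive[OF Y_meas s clt c _ ev]) simp
    qed
    interpret Fl: gaussian_fluctuations M Y \<mu> \<sigma> by (rule fluct[OF sp])
    have pr: "\<exists>c>0. \<exists>p. (\<lambda>n. sqrt (real n) * p n) \<longlonglongrightarrow> 0 \<and> (\<forall>n. 0 \<le> p n) \<and>
      (\<forall>\<^sub>F n in sequentially. \<forall>t. \<bar>t\<bar> \<le> T \<longrightarrow> cmod (CLINT \<omega>|M. iexp (t * Y n \<omega>)) \<le> p n + exp (- c * real n * t\<^sup>2))" if T: "0 < T" for T
    proof -
      obtain c B where "0 < c" "0 \<le> B" "\<forall>\<^sub>F n in sequentially. \<forall>t. \<bar>t\<bar> \<le> T \<longrightarrow>
        cmod (CLINT \<omega>|M. iexp (t * Y n \<omega>)) \<le> B / real n + exp (- c * real n * t\<^sup>2)" using bd[OF T] by blast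
      then show ?thesis using sq[of B] by (intro exI[of _ c] conjI exI[of _ "\<lambda>n. B / real n"]) auto
    qed
    show ?thesis
    proof (intro conjI allI impI sp fin tendsto_SUP_zero)
      fix b e :: real assume "0 < b" "0 < e"
      then show "\<forall>\<^sub>F n in sequentially. \<forall>u. \<bar>sqrt (real n) * measure M {\<omega> \<in> space M. Y n \<omega> \<in> {u..<u + b}}
            - b / \<sigma> * std_normal_density ((u - \<mu> n) / (sqrt (real n) * \<sigma>))\<bar> < e"
        by (intro Fl.nonlattice_llt pr)
    qed
  next
    case lattice
    define S where "S = {v. v / a \<in> \<int>}"
    have S: "S \<in> sets borel" "0 \<in> S" "\<And>v w. v \<in> S \<Longrightarrow> w \<in> S \<Longrightarrow> v + w \<in> S"
    proof -
      have "(\<lambda>y :: real. y / a) -` \<int> \<inter> space borel \<in> sets borel"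
        by (rule measurable_sets[of _ _ borel]) (auto intro!: closed_Ints)
      then show "S \<in> sets borel" by (simp add: S_def vimage_def)
    qed (auto simp: S_def add_divide_distrib)
    obtain a' where coset: "AE x in PiM {1..m} (\<lambda>_. \<Gamma>). config_value H {1..m} x - a' \<in> S"
      using lattice(4) unfolding has_lattice_span_def S_def mem_Collect_eq by blast
    have nl: "\<not> ?W m (2 * pi / t)" if t: "0 < t" "t \<le> pi / a" for t
    proof
      assume "?W m (2 * pi / t)"
      then have "2 * pi / t \<le> a" by (rule lattice(5))
      then have "2 * pi \<le> a * t" using t by (simp add: field_simps)
      also have "a * t \<le> pi" using t lattice(1) by (simp add: field_simps)
      finally show False using pi_gt_zero by linarith
    qed
    obtain c B where cB: "0 < c" "0 \<le> B" and ev: "\<forall>\<^sub>F n in sequentially. \<forall>\<theta> \<Psi>. \<bar>\<theta>\<bar> \<le> pi / a \<longrightarrow> \<Psi> \<in> borel_measurable borel \<longrightarrow>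
         (\<forall>x. cmod (\<Psi> x) \<le> 1) \<longrightarrow> (\<forall>x v. v \<in> S \<longrightarrow> \<Psi> (x + v) = \<Psi> x * iexp (\<theta> * v)) \<longrightarrow>
         cmod (CLINT \<omega>|M. \<Psi> (Y n \<omega>)) \<le> B / real n + exp (- c * real n * \<theta>\<^sup>2)"
      using charb[OF lattice(3) nl coset S] by blast
    have sp: "0 < \<sigma>"
    proof (rule clt_variance_positive[OF Y_meas s clt cB(1)])
      show "0 < pi / a" using lattice(1) by simp
      from ev show "\<forall>\<^sub>F n in sequentially. \<forall>t. \<bar>t\<bar> \<le> pi / a \<longrightarrow>
        cmod (CLINT \<omega>|M. iexp (t * Y n \<omega>)) \<le> B / real n + exp (- c * real n * t\<^sup>2)"
      proof eventually_elim
        case (elim n)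
        show ?case
        proof (intro allI impI)
          fix t :: real assume t: "\<bar>t\<bar> \<le> pi / a"
          show "cmod (CLINT \<omega>|M. iexp (t * Y n \<omega>)) \<le> B / real n + exp (- c * real n * t\<^sup>2)"
            by (rule elim[rule_format, OF t iexp_char(1)]) (use iexp_char[of t] in blast)+
        qed
      qed
    qed
    interpret Fl: gaussian_fluctuations M Y \<mu> \<sigma> by (rule fluct[OF sp])
    have evl: "\<forall>\<^sub>F n in sequentially. \<forall>u s. \<bar>s\<bar> \<le> pi \<longrightarrow>
      cmod (CLINT \<omega>|M. iexp (s * of_int \<lfloor>(Y n \<omega> - u) / a\<rfloor>)) \<le> B / real n + exp (- (c / a\<^sup>2) * real n * s\<^sup>2)"
      using ev
    proof eventually_elim
      case (elim n)
      show ?case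
      proof (intro allI impI)
        fix u s :: real assume "\<bar>s\<bar> \<le> pi"
        then have t: "\<bar>s / a\<bar> \<le> pi / a" using lattice(1) by (simp add: divide_right_mono)
        have "cmod (CLINT \<omega>|M. iexp (s * of_int \<lfloor>(Y n \<omega> - u) / a\<rfloor>)) \<le> B / real n + exp (- c * real n * (s / a)\<^sup>2)"
        proof (rule elim[rule_format, OF t])
          show "(\<lambda>x. iexp (s * of_int \<lfloor>(x - u) / a\<rfloor>)) \<in> borel_measurable borel" by measurable
          show "cmod (iexp (s * of_int \<lfloor>(x - u) / a\<rfloor>)) \<le> 1" for x by simp
          fix x v assume "v \<in> S"
          then obtain z :: int where z: "v / a = of_int z" by (auto simp: S_def elim: Ints_cases)
          then have v: "v = of_int z * a" using lattice(1) by (simp add: field_simps)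
          have "(x + v - u) / a = (x - u) / a + of_int z" using lattice(1) by (simp add: v field_simps)
          then have fl: "\<lfloor>(x + v - u) / a\<rfloor> = \<lfloor>(x - u) / a\<rfloor> + z" by simp
          have sv: "s / a * v = s * of_int z" using lattice(1) by (simp add: v)
          show "iexp (s * of_int \<lfloor>(x + v - u) / a\<rfloor>) = iexp (s * of_int \<lfloor>(x - u) / a\<rfloor>) * iexp (s / a * v)"
            unfolding fl sv by (simp add: distrib_left exp_add)
        qed
        also have "- c * real n * (s / a)\<^sup>2 = - (c / a\<^sup>2) * real n * s\<^sup>2" by (simp add: power_divide)
        finally show "cmod (CLINT \<omega>|M. iexp (s * of_int \<lfloor>(Y n \<omega> - u) / a\<rfloor>)) \<le> B / real n + exp (- (c / a\<^sup>2) * real n * s\<^sup>2)" .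
      qed
    qed
    show ?thesis
    proof (intro conjI allI impI sp fin tendsto_SUP_zero)
      fix b e :: real assume b: "0 < b" "span_dvd L b" and e: "0 < e"
      then obtain z :: int where z: "b = of_int z * a" using lattice(1,2) by (auto simp: span_dvd_def)
      then have "0 < z" using b(1) lattice(1) by (simp add: zero_less_mult_iff)
      then have z': "b = real (nat z) * a" using z by simp
      have "0 < c / a\<^sup>2" using cB lattice(1) by simp
      then show "\<forall>\<^sub>F n in sequentially. \<forall>u. \<bar>sqrt (real n) * measure M {\<omega> \<in> space M. Y n \<omega> \<in> {u..<u + b}}
            - b / \<sigma> * std_normal_density ((u - \<mu> n) / (sqrt (real n) * \<sigma>))\<bar> < e"
        by (rule Fl.lattice_llt_multiple[OF lattice(1) _ z' sq _ evl e]) (use cB in auto)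
    qed
  qed
qed

lemma prob_space_std_normal_mark_law:
  assumes "prob_space P" and Z: "iid_marked P (std_normal_vec :: (real^'d) measure) Q Z T"
  shows "prob_space (std_normal_vec \<Otimes>\<^sub>M Q :: ((real^'d) \<times> 'm) measure)"
proof -
  interpret prob_space P by fact
  have "(\<lambda>\<omega>. (Z 1 \<omega>, T 1 \<omega>)) \<in> measurable P (marked_space Q)"
    using Z by (auto simp: iid_marked_def indep_vars_def)
  from prob_space_distr[OF this] show ?thesis using Z by (auto simp: iid_marked_def)
qed

lemma empty_config_measurable: "{X \<in> finite_subsets E. X = {}} \<in> sets (finite_config E)"
proof -
  have eq: "{X \<in> finite_subsets E. X = {}} = {X \<in> finite_subsets E. card (X \<inter> space E) = 0}"
    by (auto simp: finite_subsets_def Int_absorb2)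
  have "sets (finite_config E) = sigma_sets (finite_subsets E)
      {{X \<in> finite_subsets E. card (X \<inter> A) = k} | A k. A \<in> sets E}"
    unfolding finite_config_def by (rule sets_measure_of) auto
  moreover have "{X \<in> finite_subsets E. card (X \<inter> space E) = 0} \<in> {{X \<in> finite_subsets E. card (X \<inter> A) = k} | A k. A \<in> sets E}"
    by blast
  ultimately show ?thesis unfolding eq by (simp only: sigma_sets.Basic)
qed

text \<open>It remains to produce the isolation property and a non-degenerate block size from the two
  alternative hypotheses. The sample size with finite span that they provide serves as \<open>k\<close>; in the
  nearest neighbour case it exceeds \<open>\<kappa>\<close>, as \<open>nearest_neighbour_isolation\<close> requires.\<close>

theorem theorem5p1:
  fixes P :: "'w measure" and Q :: "'m measure"
    and X Z :: "nat \<Rightarrow> 'w \<Rightarrow> real^'d" and U :: "real \<Rightarrow> nat \<Rightarrow> 'w \<Rightarrow> real^'d"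
    and T :: "nat \<Rightarrow> 'w \<Rightarrow> 'm"
    and f :: "real^'d \<Rightarrow> real" and r :: "nat \<Rightarrow> real" and \<rho> \<sigma> :: real
    and H :: "((real^'d) \<times> 'm) set \<Rightarrow> real"
  defines "HX \<equiv> \<lambda>n \<omega>. rescaled r H n (marked_sample X T n \<omega>)"
  assumes "prob_space P" and "prob_space Q"
    and f_meas: "f \<in> borel_measurable borel"
    and f_nonneg: "\<And>x. 0 \<le> f x"
    and f_bdd: "bdd_above (range f)"
    and f_cont: "AE x in lborel. isCont f x"
    and X_iid: "iid_marked P (density lborel (\<lambda>x. ennreal (f x))) Q X T"
    and U_iid: "\<And>K. K > 0 \<Longrightarrow> iid_marked P (uniform_measure lborel (cball 0 K)) Q (U K) T"
    and Z_iid: "iid_marked P std_normal_vec Q Z T"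
    and r_pos: "\<And>n. n \<ge> 1 \<Longrightarrow> r n > 0"
    and r_lim: "(\<lambda>n. real n * r n ^ CARD('d)) \<longlonglongrightarrow> \<rho>"
    and rho_pos: "\<rho> > 0"
    and H_meas: "H \<in> borel_measurable (finite_config (marked_space Q))"
    and H_transl: "translation_invariant Q H"
    and cases_i_ii:
      "(finite_range_interactions Q H \<and>
          (\<exists>n\<ge>1. rv_span P (\<lambda>\<omega>. H (marked_sample Z T n \<omega>)) < \<infinity>))
       \<or> (\<exists>\<kappa>\<ge>1. (\<exists>\<xi>. translation_invariant_functional Q \<xi> \<and>
               depends_on_nearest_neighbours Q \<kappa> \<xi> \<and>
               (\<forall>A \<in> configs Q. H A = induced_functional \<xi> A)) \<and>
             (\<exists>n>\<kappa>. rv_span P (\<lambda>\<omega>. H (marked_sample Z T n \<omega>)) < \<infinity>))"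
    and HX_int: "\<And>n. n \<ge> 1 \<Longrightarrow> integrable P (HX n)"
    and HU_int: "\<And>n K. n \<ge> 1 \<Longrightarrow> K > 0 \<Longrightarrow>
                   integrable P (\<lambda>\<omega>. H (marked_sample (U K) T n \<omega>))"
    and sigma_nonneg: "\<sigma> \<ge> 0"
    and CLT: "weak_conv_m
        (\<lambda>n. distr P borel (\<lambda>\<omega>. (HX n \<omega> - (\<integral>\<omega>'. HX n \<omega>' \<partial>P)) / sqrt (real n)))
        (centred_normal \<sigma>)"
  shows "\<sigma> > 0 \<and> limiting_span P H Z T < \<infinity> \<and>
    (\<forall>b>0. span_dvd (limiting_span P H Z T) b \<longrightarrow>
       (\<lambda>n. SUP u\<in>(UNIV::real set).
          \<bar>sqrt (real n) * measure P {\<omega> \<in> space P. HX n \<omega> \<in> {u..<u + b}}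
            - b / \<sigma> * std_normal_density ((u - (\<integral>\<omega>. HX n \<omega> \<partial>P)) / (sqrt (real n) * \<sigma>))\<bar>)
       \<longlonglongrightarrow> 0)"
proof -
  interpret prob_space P by fact
  note Q = \<open>prob_space Q\<close>
  \<comment> \<open>Additivity over isolated parts requires the value \<open>0\<close> on the empty configuration; nonempty samples do
    not see this change.\<close>
  define H0 where "H0 A = (if A = {} then 0 else H A)" for A
  have G\<Gamma>: "prob_space (std_normal_vec \<Otimes>\<^sub>M Q :: ((real^'d) \<times> 'm) measure)"
    by (rule prob_space_std_normal_mark_law[OF \<open>prob_space P\<close> Z_iid])
  have H0_meas: "H0 \<in> borel_measurable (finite_config (marked_space Q))"
    unfolding H0_def
    by (rule measurable_If[OF measurable_const H_meas]) (simp_all only: space_finite_config empty_config_measurable space_borel UNIV_I)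
  have H0_transl: "translation_invariant Q H0"
    using H_transl by (auto simp: translation_invariant_def H0_def)
  have sample_ne: "marked_sample V T n \<omega> \<noteq> {}" if "1 \<le> n" for V :: "nat \<Rightarrow> 'w \<Rightarrow> real^'d" and n \<omega>
    using that by (auto simp: marked_sample_def)
  have span: "rv_span P (\<lambda>\<omega>. H (marked_sample Z T n \<omega>)) =
      rv_span (PiM {1..n} (\<lambda>_. std_normal_vec \<Otimes>\<^sub>M Q)) (config_value H0 {1..n})" if n: "1 \<le> n" for n
  proof -
    have "(\<lambda>\<omega>. H (marked_sample Z T n \<omega>)) = (\<lambda>\<omega>. H0 (marked_sample Z T n \<omega>))"
      using sample_ne[OF n] by (simp add: H0_def)
    then show ?thesis using rv_span_normal_sample[OF Q H0_meas Z_iid n] by (simp only:)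
  qed
  have limiting: "limiting_span P H Z T =
      liminf (\<lambda>n. rv_span (PiM {1..n} (\<lambda>_. std_normal_vec \<Otimes>\<^sub>M Q)) (config_value H0 {1..n}))"
    unfolding limiting_span_def
    by (intro Liminf_eq eventually_sequentiallyI[of 1] span)
  have nondeg: "\<not> degenerate_rv (PiM {1..n} (\<lambda>_. std_normal_vec \<Otimes>\<^sub>M Q)) (config_value H0 {1..n})"
    if "1 \<le> n" "rv_span P (\<lambda>\<omega>. H (marked_sample Z T n \<omega>)) < \<infinity>" for n
    using that(2)[unfolded span[OF that(1)]] unfolding rv_span_def by (rule contrapos_pn) (simp only: if_True less_irrefl not_False_eq_True)
  have "\<exists>k\<ge>1. \<not> degenerate_rv (PiM {1..k} (\<lambda>_. std_normal_vec \<Otimes>\<^sub>M Q)) (config_value H0 {1..k}) \<and>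
      (\<forall>m K. k \<le> m \<longrightarrow> 0 < K \<longrightarrow> (\<exists>A G \<epsilon>. isolation Q H0 m K A G \<epsilon>))"
    using cases_i_ii
  proof (elim disjE conjE exE)
    fix n
    assume fr: "finite_range_interactions Q H" and n: "1 \<le> n" "rv_span P (\<lambda>\<omega>. H (marked_sample Z T n \<omega>)) < \<infinity>"
    have "finite_range_interactions Q H0" using fr by (simp add: finite_range_interactions_def H0_def)
    moreover have "H0 {} = 0" by (simp add: H0_def)
    ultimately show ?thesis using n(1) nondeg[OF n] by (blast intro: finite_range_isolation)
  next
    fix \<kappa> \<xi> n
    assume k: "1 \<le> \<kappa>" and nn: "depends_on_nearest_neighbours Q \<kappa> \<xi>"
      and ind: "\<forall>A\<in>configs Q. H A = induced_functional \<xi> A"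
      and n: "\<kappa> < n" "rv_span P (\<lambda>\<omega>. H (marked_sample Z T n \<omega>)) < \<infinity>"
    have "H0 A = induced_functional \<xi> A" if "A \<in> configs Q" for A
      using ind that by (simp add: H0_def induced_functional_def)
    from nearest_neighbour_isolation[OF nn this]
    have "\<exists>A G \<epsilon>. isolation Q H0 m K A G \<epsilon>" if "n \<le> m" "0 < K" for m K using n that by simp
    moreover have "1 \<le> n" using k n by simp
    ultimately show ?thesis using nondeg[OF _ n(2)] by blast
  qed
  then obtain k where k: "1 \<le> k" "\<not> degenerate_rv (PiM {1..k} (\<lambda>_. std_normal_vec \<Otimes>\<^sub>M Q)) (config_value H0 {1..k})"
    and iso: "\<And>m K. k \<le> m \<Longrightarrow> 0 < K \<Longrightarrow> \<exists>A G \<epsilon>. isolation Q H0 m K A G \<epsilon>" by blast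
  have HX_meas: "HX n \<in> borel_measurable P" for n
  proof (cases "1 \<le> n")
    case True
    then show ?thesis using HX_int by blast
  next
    case False
    then have "HX n = (\<lambda>\<omega>. H {})" by (simp add: HX_def rescaled_def marked_sample_def)
    then show ?thesis by simp
  qed
  have HX0: "HX n = (\<lambda>\<omega>. rescaled r H0 n (marked_sample X T n \<omega>))" if "1 \<le> n" for n
    using sample_ne[OF that] by (simp add: HX_def rescaled_def H0_def)
  show ?thesis
    unfolding limiting
    by (rule sample_llt[OF Q f_meas f_nonneg f_bdd f_cont X_iid r_pos r_lim rho_pos H0_meas H0_transl G\<Gamma> k iso
        HX_meas HX0 sigma_nonneg CLT])
qed

end
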